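(* Let $k\ge 1$, $\mathbf n=(n_1,\dots,n_k)$, $n=n_1+\dots+n_k\ge1$ and let $\delta=(\delta_{ij})$ be an $n\times k$ matrix. If there are nonnegative integers $d_1,\dots,d_n$ and $e_1,\dots,e_k$ such that $\delta_{ij}=d_i\cdot e_j$ for all $i,j$, then $$E(\mathbf n,\delta)=\frac{\Gamma(\frac{n+1}2)}{\Gamma(\frac12)}\cdot\Bigl(\prod_{j=1}^k\frac{\Gamma(\frac12)}{\Gamma(\frac{n_j+1}2)}\Bigr)\cdot\sqrt{\prod_{i=1}^nd_i}\cdot\sqrt{\prod_{j=1}^ke_j^{n_j}},$$ where $E(\mathbf n,\delta)$ is the expected number of real roots defined in the context.
   Context: Setting. $k\ge1$ is an integer, $\mathbf n=(n_1,\dots,n_k)$ are nonnegative integers, $n=n_1+\dots+n_k\ge1$, and $\delta=(\delta_{ij})_{1\le i\le n,\,1\le j\le k}$ is a matrix of nonnegative integers. Variables are $\mathbf x=(\mathbf y_1,\dots,\mathbf y_k)$ with $\mathbf y_j=(y_{j0},y_{j1},\dots,y_{jn_j})$. For each $i$ let $\mathcal A_i=\mathcal A_{i1}\times\dots\times\mathcal A_{ik}$ where $\mathcal A_{ij}=\{\alpha\in\mathbb N^{n_j+1}:\alpha_0+\dots+\alpha_{n_j}=\delta_{ij}\}$ ($0\in\mathbb N$). A coefficient vector $f_i=(f_{ia})_{a\in\mathcal A_i}\in\mathbb R^{\mathcal A_i}$ is identified with the polynomial $f_i(\mathbf x)=\sum_{a\in\mathcal A_i}f_{ia}\mathbf x^a$,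 which is homogeneous of degree $\delta_{ij}$ in $\mathbf y_j$ for each $j$. For $a\in\mathcal A_i$, with components $a_{jh}$ ($1\le j\le k$, $0\le h\le n_j$), let $\eta(a)=\prod_{j=1}^k\frac{a_{j0}!\cdots a_{jn_j}!}{(a_{j0}+\dots+a_{jn_j})!}$. Random system: $\tilde f=(\tilde f_1,\dots,\tilde f_n)$, where all coefficients $\tilde f_{ia}$ are independent normal random variables with mean $0$ and variance $\eta(a)^{-1}$. Root space: $P=\mathbf P^{n_1}(\mathbb R)\times\dots\times\mathbf P^{n_k}(\mathbb R)$; the condition $f_i(\zeta)=0$ is well defined for $\zeta\in P$ by multihomogeneity. $E(\mathbf n,\delta)=\mathbb E\bigl(\#\{\zeta\in P:\tilde f(\zeta)=0\}\bigr)$. $\Gamma$ is Euler's Gamma function, and $0^0=1$. *)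

theory Defs
  imports "HOL-Probability.Probability"
begin

(* The dimensions n_j vary with j, so vectors y_j = (y_{j0}, ..., y_{j n_j}) are extensional
   functions on {..ns j} and families indexed by j are extensional functions on {1..k}.
   Extensionality makes equality of functions the same as equality of tuples, which matters
   because exponents index random coefficients and because roots are counted. *)

definition nonzero_vectors :: "nat \<Rightarrow> (nat \<Rightarrow> real) set" where
  "nonzero_vectors m = {u \<in> {..m} \<rightarrow>\<^sub>E (UNIV :: real set). \<exists>h\<le>m. u h \<noteq> 0}"

definition proj_rel :: "nat \<Rightarrow> ((nat \<Rightarrow> real) \<times> (nat \<Rightarrow> real)) set" where
  "proj_rel m = {(u, v). u \<in> nonzero_vectors m \<and> v \<in> nonzero_vectors m \<and>
     (\<exists>c::real. c \<noteq> 0 \<and> (\<forall>h\<le>m. v h = c * u h))}"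

definition real_proj_space :: "nat \<Rightarrow> (nat \<Rightarrow> real) set set" where
  "real_proj_space m = nonzero_vectors m // proj_rel m"

definition root_space :: "nat \<Rightarrow> (nat \<Rightarrow> nat) \<Rightarrow> (nat \<Rightarrow> (nat \<Rightarrow> real) set) set" where
  "root_space k ns = (\<Pi>\<^sub>E j\<in>{1..k}. real_proj_space (ns j))"

(* The index set A_i is multi_exps k ns (\<delta> i). *)
definition multi_exps :: "nat \<Rightarrow> (nat \<Rightarrow> nat) \<Rightarrow> (nat \<Rightarrow> nat) \<Rightarrow> (nat \<Rightarrow> nat \<Rightarrow> nat) set" where
  "multi_exps k ns D =
     (\<Pi>\<^sub>E j\<in>{1..k}. {\<alpha> \<in> {..ns j} \<rightarrow>\<^sub>E (UNIV :: nat set). (\<Sum>h\<le>ns j. \<alpha> h) = D j})"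

definition mpoly_eval ::
  "nat \<Rightarrow> (nat \<Rightarrow> nat) \<Rightarrow> (nat \<Rightarrow> nat) \<Rightarrow> ((nat \<Rightarrow> nat \<Rightarrow> nat) \<Rightarrow> real) \<Rightarrow> (nat \<Rightarrow> nat \<Rightarrow> real) \<Rightarrow> real" where
  "mpoly_eval k ns D f x = (\<Sum>a\<in>multi_exps k ns D. f a * (\<Prod>j\<in>{1..k}. \<Prod>h\<le>ns j. x j h ^ a j h))"

(* Vanishing at a point of the product of projective spaces: all representatives are zeros.
   By multihomogeneity it suffices to test one, see vanishes_at_iff below. *)
definition vanishes_at ::
  "nat \<Rightarrow> (nat \<Rightarrow> nat) \<Rightarrow> (nat \<Rightarrow> nat) \<Rightarrow> ((nat \<Rightarrow> nat \<Rightarrow> nat) \<Rightarrow> real) \<Rightarrow> (nat \<Rightarrow> (nat \<Rightarrow> real) set) \<Rightarrow> bool" where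
  "vanishes_at k ns D f \<zeta> \<longleftrightarrow> (\<forall>x \<in> (\<Pi>\<^sub>E j\<in>{1..k}. \<zeta> j). mpoly_eval k ns D f x = 0)"

definition root_set ::
  "nat \<Rightarrow> (nat \<Rightarrow> nat) \<Rightarrow> nat \<Rightarrow> (nat \<Rightarrow> nat \<Rightarrow> nat) \<Rightarrow> (nat \<Rightarrow> (nat \<Rightarrow> nat \<Rightarrow> nat) \<Rightarrow> real)
     \<Rightarrow> (nat \<Rightarrow> (nat \<Rightarrow> real) set) set" where
  "root_set k ns n \<delta> f = {\<zeta> \<in> root_space k ns. \<forall>i\<in>{1..n}. vanishes_at k ns (\<delta> i) (f i) \<zeta>}"

definition eta :: "nat \<Rightarrow> (nat \<Rightarrow> nat) \<Rightarrow> (nat \<Rightarrow> nat \<Rightarrow> nat) \<Rightarrow> real" where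
  "eta k ns a = (\<Prod>j\<in>{1..k}. (\<Prod>h\<le>ns j. fact (a j h)) / fact (\<Sum>h\<le>ns j. a j h))"

(* normal_density takes the standard deviation, hence the square root of the variance. *)
definition random_system ::
  "'w measure \<Rightarrow> nat \<Rightarrow> (nat \<Rightarrow> nat) \<Rightarrow> nat \<Rightarrow> (nat \<Rightarrow> nat \<Rightarrow> nat)
     \<Rightarrow> (nat \<Rightarrow> (nat \<Rightarrow> nat \<Rightarrow> nat) \<Rightarrow> 'w \<Rightarrow> real) \<Rightarrow> bool" where
  "random_system M k ns n \<delta> F \<longleftrightarrow>
     prob_space M \<and>
     prob_space.indep_vars M (\<lambda>_. borel) (\<lambda>(i, a). F i a)
       (SIGMA i:{1..n}. multi_exps k ns (\<delta> i)) \<and>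
     (\<forall>i\<in>{1..n}. \<forall>a\<in>multi_exps k ns (\<delta> i).
        distributed M lborel (F i a) (normal_density 0 (sqrt (inverse (eta k ns a)))))"

(* The number of roots may be infinite for some outcomes, so roots are counted by the counting
   measure (card would give 0 there) and the expectation is a nonnegative integral.
   For each m, the systems with at least m roots form an F_sigma set (a projection of a
   sigma-compact one), so the integrand is measurable. *)
definition expected_roots ::
  "'w measure \<Rightarrow> nat \<Rightarrow> (nat \<Rightarrow> nat) \<Rightarrow> nat \<Rightarrow> (nat \<Rightarrow> nat \<Rightarrow> nat)
     \<Rightarrow> (nat \<Rightarrow> (nat \<Rightarrow> nat \<Rightarrow> nat) \<Rightarrow> 'w \<Rightarrow> real) \<Rightarrow> ennreal" where
  "expected_roots M k ns n \<delta> F =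
     (\<integral>\<^sup>+ w. emeasure (count_space UNIV) (root_set k ns n \<delta> (\<lambda>i a. F i a w)) \<partial>M)"

lemma finite_multi_exps: "finite (multi_exps k ns D)"
proof -
  have "finite {\<alpha> \<in> {..m} \<rightarrow>\<^sub>E (UNIV :: nat set). (\<Sum>h\<le>m. \<alpha> h) = d}" for m d :: nat
  proof (rule finite_subset)
    show "{\<alpha> \<in> {..m} \<rightarrow>\<^sub>E (UNIV :: nat set). (\<Sum>h\<le>m. \<alpha> h) = d} \<subseteq> {..m} \<rightarrow>\<^sub>E {..d}"
    proof
      fix \<alpha> assume \<alpha>: "\<alpha> \<in> {\<alpha> \<in> {..m} \<rightarrow>\<^sub>E (UNIV :: nat set). (\<Sum>h\<le>m. \<alpha> h) = d}"
      then have "\<alpha> h \<le> d" if "h \<le> m" for h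
        using member_le_sum[of h "{..m}" \<alpha>] that by auto
      then show "\<alpha> \<in> {..m} \<rightarrow>\<^sub>E {..d}"
        using \<alpha> by (simp add: PiE_iff)
    qed
    show "finite ({..m} \<rightarrow>\<^sub>E {..d})"
      by (intro finite_PiE) auto
  qed
  then show ?thesis
    unfolding multi_exps_def by (intro finite_PiE) auto
qed

lemma equiv_proj_rel: "equiv (nonzero_vectors m) (proj_rel m)"
proof (rule equivI)
  show "proj_rel m \<subseteq> nonzero_vectors m \<times> nonzero_vectors m"
    by (auto simp: proj_rel_def)
  show "refl_on (nonzero_vectors m) (proj_rel m)"
    by (auto simp: refl_on_def proj_rel_def intro: exI[of _ 1])
  show "sym (proj_rel m)"
  proof (rule symI)
    fix u v assume "(u, v) \<in> proj_rel m"
    then obtain c where "c \<noteq> 0" "\<forall>h\<le>m. v h = c * u h"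
      and "u \<in> nonzero_vectors m" "v \<in> nonzero_vectors m"
      by (auto simp: proj_rel_def)
    then show "(v, u) \<in> proj_rel m"
      by (auto simp: proj_rel_def intro!: exI[of _ "inverse c"])
  qed
  show "trans (proj_rel m)"
  proof (rule transI)
    fix u v w assume "(u, v) \<in> proj_rel m" "(v, w) \<in> proj_rel m"
    then obtain c d where "c \<noteq> 0" "\<forall>h\<le>m. v h = c * u h" "d \<noteq> 0" "\<forall>h\<le>m. w h = d * v h"
      and "u \<in> nonzero_vectors m" "w \<in> nonzero_vectors m"
      by (auto simp: proj_rel_def)
    then show "(u, w) \<in> proj_rel m"
      by (auto simp: proj_rel_def intro!: exI[of _ "d * c"])
  qed
qed

lemma mpoly_eval_scale:
  assumes "\<And>j h. j \<in> {1..k} \<Longrightarrow> h \<le> ns j \<Longrightarrow> y j h = c j * x j h"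
  shows "mpoly_eval k ns D f y = (\<Prod>j\<in>{1..k}. c j ^ D j) * mpoly_eval k ns D f x"
proof -
  have "(\<Prod>j\<in>{1..k}. \<Prod>h\<le>ns j. y j h ^ a j h) =
      (\<Prod>j\<in>{1..k}. c j ^ D j) * (\<Prod>j\<in>{1..k}. \<Prod>h\<le>ns j. x j h ^ a j h)"
    if a: "a \<in> multi_exps k ns D" for a
  proof -
    have "(\<Prod>h\<le>ns j. y j h ^ a j h) = c j ^ D j * (\<Prod>h\<le>ns j. x j h ^ a j h)"
      if j: "j \<in> {1..k}" for j
    proof -
      have D: "(\<Sum>h\<le>ns j. a j h) = D j"
        using a j by (auto simp: multi_exps_def PiE_iff)
      have "(\<Prod>h\<le>ns j. y j h ^ a j h) = (\<Prod>h\<le>ns j. c j ^ a j h * x j h ^ a j h)"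
        by (intro prod.cong refl) (simp add: assms[OF j] power_mult_distrib)
      also have "\<dots> = c j ^ (\<Sum>h\<le>ns j. a j h) * (\<Prod>h\<le>ns j. x j h ^ a j h)"
        by (simp add: prod.distrib power_sum)
      finally show ?thesis
        by (simp add: D)
    qed
    then have "(\<Prod>j\<in>{1..k}. \<Prod>h\<le>ns j. y j h ^ a j h) =
        (\<Prod>j\<in>{1..k}. c j ^ D j * (\<Prod>h\<le>ns j. x j h ^ a j h))"
      by (intro prod.cong refl)
    then show ?thesis
      by (simp add: prod.distrib)
  qed
  then show ?thesis
    unfolding mpoly_eval_def sum_distrib_left
    by (intro sum.cong refl) (simp add: mult_ac)
qed

lemma vanishes_at_iff:
  assumes "\<zeta> \<in> root_space k ns" and x: "x \<in> (\<Pi>\<^sub>E j\<in>{1..k}. \<zeta> j)"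
  shows "vanishes_at k ns D f \<zeta> \<longleftrightarrow> mpoly_eval k ns D f x = 0"
proof
  assume "vanishes_at k ns D f \<zeta>"
  then show "mpoly_eval k ns D f x = 0"
    using x by (auto simp: vanishes_at_def)
next
  assume zero: "mpoly_eval k ns D f x = 0"
  show "vanishes_at k ns D f \<zeta>"
    unfolding vanishes_at_def
  proof
    fix y assume y: "y \<in> (\<Pi>\<^sub>E j\<in>{1..k}. \<zeta> j)"
    have "\<exists>c::real. \<forall>h\<le>ns j. y j h = c * x j h" if "j \<in> {1..k}" for j
    proof -
      have "\<zeta> j \<in> nonzero_vectors (ns j) // proj_rel (ns j)" "x j \<in> \<zeta> j" "y j \<in> \<zeta> j"
        using assms y that by (auto simp: root_space_def real_proj_space_def PiE_iff)
      then have "(x j, y j) \<in> proj_rel (ns j)"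
        using quotient_eq_iff[OF equiv_proj_rel] by metis
      then show ?thesis
        by (auto simp: proj_rel_def)
    qed
    then obtain c where "\<And>j h. j \<in> {1..k} \<Longrightarrow> h \<le> ns j \<Longrightarrow> y j h = c j * x j h"
      by metis
    from mpoly_eval_scale[where c = c, OF this] show "mpoly_eval k ns D f y = 0"
      using zero by simp
  qed
qed

end

theory Submission
  imports Defs
begin

text \<open>Realise the random coefficients as sums of independent standard normals indexed by words, so that the
  \<open>i\<close>-th polynomial is a Gaussian tensor applied to the variables. The law of the system is then
  invariant under the orthogonal groups of the factors. The number of roots is the limit, for \<open>s \<rightarrow> 0\<close>,
  of the Gaussian measure of the set of points within angle \<open>arctan s\<close> of some root, divided by the
  measure \<open>v(s)\<close> of one such neighbourhood. By Tonelli and invariance, the expectation of this quotient is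
  \<open>p(s) / v(s)\<close>, where \<open>p(s)\<close> is the probability of a root within angle \<open>arctan s\<close> of one fixed
  point. In the affine chart around this point the system is a small perturbation of a linear one, and
  after scaling by \<open>s\<close> the limit of \<open>p(s) / v(s)\<close> is the mean volume of the image of the unit cube under
  the linear part, divided by absolute moments of the normal distribution. The linear part is a Gaussian matrix with rows scaled
  by \<open>sqrt (d i)\<close> and columns by \<open>sqrt (e j)\<close>. The mean volume for an unscaled Gaussian matrix is read off
  from the case of linear equations, where the number of roots is almost surely 1.\<close>

section \<open>Linear systems over finite index sets\<close>

text \<open>The dimensions \<open>ns j\<close> vary with the block, so matrices are functions on
  finite sets of index pairs, and the volume of the image of the unit cube takes the place of the
  absolute determinant. Fatou's lemma and monotonicity then give the two inequalities for the
  expectation, and degenerate roots never require attention. Up to that point the degrees are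
  arbitrary. The factorisation \<open>\<delta> i j = d i * e j\<close> enters only through the
  variances of the linear part: they form a matrix of rank one, so scalings of rows and columns can
  be taken out of the mean volume. The mean absolute determinant of a Gaussian matrix then depends
  on the size alone, which is why a single solvable case of each size fixes it.\<close>

lemma homogeneous_system_nontrivial:
  fixes a :: "'e \<Rightarrow> 'v \<Rightarrow> real"
  assumes "finite E" "finite V" "card E < card V"
  shows "\<exists>x. (\<exists>v\<in>V. x v \<noteq> 0) \<and> (\<forall>e\<in>E. (\<Sum>v\<in>V. a e v * x v) = 0)"
  using assms
proof (induction E arbitrary: V a rule: finite_induct)
  case empty
  then have "V \<noteq> {}" by auto
  then show ?case by (intro exI[of _ "\<lambda>_. 1"]) auto
next
  case (insert e E)
  show ?case
  proof (cases "\<forall>v\<in>V. a e v = 0")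
    case True
    have "card E < card V" using insert by simp
    then obtain x where "\<exists>v\<in>V. x v \<noteq> 0" "\<forall>e\<in>E. (\<Sum>v\<in>V. a e v * x v) = 0"
      using insert.IH[OF \<open>finite V\<close>] by blast
    with True show ?thesis by (intro exI[of _ x]) auto
  next
    case False
    then obtain p where p: "p \<in> V" "a e p \<noteq> 0" by auto
    define V' where "V' = V - {p}"
    have V: "V = insert p V'" "p \<notin> V'" "finite V'" using p insert.prems by (auto simp: V'_def)
    have "card E < card V'" using insert V by simp
    \<comment> \<open>In this smaller system the equation \<open>e\<close> has been used to
      eliminate the unknown \<open>p\<close>, whose value is recovered from \<open>e\<close>
      afterwards.\<close>
    then obtain x where x: "\<exists>v\<in>V'. x v \<noteq> 0"
      "\<forall>f\<in>E. (\<Sum>v\<in>V'. (a f v - a f p * a e v / a e p) * x v) = 0"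
      using insert.IH[OF \<open>finite V'\<close>, of "\<lambda>f v. a f v - a f p * a e v / a e p"] by blast
    define y where "y v = (if v = p then - (\<Sum>v\<in>V'. a e v * x v) / a e p else x v)" for v
    have y: "(\<Sum>v\<in>V. a f v * y v) = a f p * y p + (\<Sum>v\<in>V'. a f v * x v)" for f
    proof -
      have "(\<Sum>v\<in>V. a f v * y v) = a f p * y p + (\<Sum>v\<in>V'. a f v * y v)"
        using V by simp
      also have "(\<Sum>v\<in>V'. a f v * y v) = (\<Sum>v\<in>V'. a f v * x v)"
        using V by (intro sum.cong) (auto simp: y_def)
      finally show ?thesis .
    qed
    have "(\<Sum>v\<in>V. a f v * y v) = 0" if "f \<in> insert e E" for f
    proof (cases "f = e")
      case True
      have "a e p * y p + (\<Sum>v\<in>V'. a e v * x v) = 0" using p by (simp add: y_def)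
      then show ?thesis using True y[of e] by simp
    next
      case False
      with that have "(\<Sum>v\<in>V'. (a f v - a f p * a e v / a e p) * x v) = 0" using x by auto
      moreover have "(\<Sum>v\<in>V'. (a f v - a f p * a e v / a e p) * x v) =
         (\<Sum>v\<in>V'. a f v * x v) - a f p / a e p * (\<Sum>v\<in>V'. a e v * x v)"
        by (simp add: algebra_simps sum_subtractf sum_distrib_left sum_divide_distrib)
      ultimately have "a f p * y p + (\<Sum>v\<in>V'. a f v * x v) = 0" using p by (simp add: y_def)
      then show ?thesis using y[of f] by simp
    qed
    moreover have "\<exists>v\<in>V. y v \<noteq> 0" using x V by (auto simp: y_def)
    ultimately show ?thesis by blast
  qed
qed

text \<open>Takes the place of a nonvanishing determinant for matrices whose rows and columns have
  different index types. Only the values of \<open>t\<close> on \<open>J\<close> count.\<close>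

definition injective_system :: "'i set \<Rightarrow> 'j set \<Rightarrow> ('i \<Rightarrow> 'j \<Rightarrow> real) \<Rightarrow> bool" where
  "injective_system I J L \<longleftrightarrow> (\<forall>t. (\<forall>i\<in>I. (\<Sum>j\<in>J. L i j * t j) = 0) \<longrightarrow> (\<forall>j\<in>J. t j = 0))"

text \<open>A right inverse is found column by column. Each inhomogeneous system becomes homogeneous
  by an additional unknown \<open>None\<close> for the right-hand side, so a dimension count gives a
  nontrivial solution. That the result is also a left inverse follows from injectivity, since
  \<open>L\<close> maps the difference of the two sides to zero.\<close>

lemma injective_system_inverse:
  assumes fin: "finite I" "finite J" and card: "card I = card J" and inj: "injective_system I J L"
  obtains B where
    "\<And>z i. i \<in> I \<Longrightarrow> (\<Sum>j\<in>J. L i j * (\<Sum>l\<in>I. B j l * z l)) = z i"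
    "\<And>t j. j \<in> J \<Longrightarrow> (\<Sum>l\<in>I. B j l * (\<Sum>j'\<in>J. L l j' * t j')) = t j"
proof -
  have ex: "\<exists>b. \<forall>i\<in>I. (\<Sum>j\<in>J. L i j * b j) = (if i = l then 1 else 0)" if l: "l \<in> I" for l
  proof -
    define V where "V = insert None (Some ` J)"
    define a where "a i v = (case v of None \<Rightarrow> (if i = l then - 1 else 0) | Some j \<Rightarrow> L i j)" for i v
    have sumV: "(\<Sum>v\<in>V. a i v * x v) = a i None * x None + (\<Sum>j\<in>J. L i j * x (Some j))" for i x
      unfolding V_def using fin by (subst sum.insert) (auto simp: sum.reindex a_def)
    have "card I < card V" using fin card by (simp add: V_def card_image)
    then obtain x where x: "\<exists>v\<in>V. x v \<noteq> 0" "\<forall>i\<in>I. (\<Sum>v\<in>V. a i v * x v) = 0"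
      using homogeneous_system_nontrivial[of I V a] fin by (auto simp: V_def)
    have eq: "(\<Sum>j\<in>J. L i j * x (Some j)) = (if i = l then x None else 0)" if "i \<in> I" for i
    proof -
      have "a i None * x None + (\<Sum>j\<in>J. L i j * x (Some j)) = 0" using x(2) that sumV[of i x] by auto
      then show ?thesis by (auto simp: a_def split: if_splits)
    qed
    \<comment> \<open>Otherwise the solution would be a nontrivial kernel vector of
      \<open>L\<close>. Dividing by \<open>x None\<close> normalises the right-hand side to a unit
      vector.\<close>
    have "x None \<noteq> 0"
    proof
      assume 0: "x None = 0"
      then have "\<forall>j\<in>J. x (Some j) = 0"
        using inj[unfolded injective_system_def, rule_format, of "\<lambda>j. x (Some j)"] eq by auto
      with 0 x(1) show False by (auto simp: V_def)
    qed
    then show ?thesis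
      using eq by (intro exI[of _ "\<lambda>j. x (Some j) / x None"])
        (simp only: times_divide_eq_right sum_divide_distrib[symmetric], auto)
  qed
  then obtain b where b: "\<And>l i. l \<in> I \<Longrightarrow> i \<in> I \<Longrightarrow> (\<Sum>j\<in>J. L i j * b l j) = (if i = l then 1 else 0)"
    by metis
  have 1: "(\<Sum>j\<in>J. L i j * (\<Sum>l\<in>I. b l j * z l)) = z i" if "i \<in> I" for z i
  proof -
    have "(\<Sum>j\<in>J. L i j * (\<Sum>l\<in>I. b l j * z l)) = (\<Sum>l\<in>I. (\<Sum>j\<in>J. L i j * b l j) * z l)"
      unfolding sum_distrib_left sum_distrib_right by (subst sum.swap) (simp add: mult_ac)
    also have "\<dots> = (\<Sum>l\<in>I. if i = l then z l else 0)"
      using b that by (intro sum.cong) auto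
    also have "\<dots> = z i" using fin that by simp
    finally show ?thesis .
  qed
  have 2: "(\<Sum>l\<in>I. b l j * (\<Sum>j'\<in>J. L l j' * t j')) = t j" if "j \<in> J" for t j
  proof -
    define z where "z l = (\<Sum>j'\<in>J. L l j' * t j')" for l
    have "(\<Sum>j\<in>J. L i j * ((\<Sum>l\<in>I. b l j * z l) - t j)) = 0" if "i \<in> I" for i
      using 1[OF that, of z] by (simp add: right_diff_distrib sum_subtractf z_def)
    then have "\<forall>j\<in>J. (\<Sum>l\<in>I. b l j * z l) - t j = 0"
      using inj[unfolded injective_system_def, rule_format, of "\<lambda>j. (\<Sum>l\<in>I. b l j * z l) - t j"] by blast
    with that show ?thesis by (simp add: z_def)
  qed
  show thesis by (rule that[of "\<lambda>j l. b l j"]) (use 1 2 in auto)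
qed

text \<open>Row rank equals column rank, in the form required. A kernel vector is nonzero at some
  column \<open>p\<close>; the other columns are fewer than the rows, so a nonzero \<open>u\<close>
  annihilates all of them, and the kernel relation expresses column \<open>p\<close> through
  them.\<close>

lemma singular_system_left_kernel:
  assumes fin: "finite I" "finite J" and card: "card I = card J" and sing: "\<not> injective_system I J L"
  obtains u where "\<exists>i\<in>I. u i \<noteq> 0" "\<And>t. (\<Sum>i\<in>I. u i * (\<Sum>j\<in>J. L i j * t j)) = 0"
proof -
  obtain t p where t: "\<forall>i\<in>I. (\<Sum>j\<in>J. L i j * t j) = 0" and p: "p \<in> J" "t p \<noteq> 0"
    using sing by (auto simp: injective_system_def)
  have "card (J - {p}) < card I" using p fin card by (metis card_Diff1_less)
  then obtain u where u: "\<exists>i\<in>I. u i \<noteq> 0" "\<forall>j\<in>J-{p}. (\<Sum>i\<in>I. L i j * u i) = 0"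
    using homogeneous_system_nontrivial[of "J - {p}" I "\<lambda>j i. L i j"] fin by auto
  have "0 = (\<Sum>i\<in>I. u i * (\<Sum>j\<in>J. L i j * t j))" using t by simp
  also have "\<dots> = (\<Sum>j\<in>J. (\<Sum>i\<in>I. L i j * u i) * t j)"
    unfolding sum_distrib_left sum_distrib_right by (subst sum.swap) (simp add: mult_ac)
  also have "\<dots> = (\<Sum>i\<in>I. L i p * u i) * t p"
    using u fin p by (subst sum.remove[OF _ p(1)]) auto
  finally have "(\<Sum>i\<in>I. L i p * u i) = 0" using p by simp
  with u have all: "\<forall>j\<in>J. (\<Sum>i\<in>I. L i j * u i) = 0" by auto
  have "(\<Sum>i\<in>I. u i * (\<Sum>j\<in>J. L i j * t j)) = 0" for t
  proof -
    have "(\<Sum>i\<in>I. u i * (\<Sum>j\<in>J. L i j * t j)) = (\<Sum>j\<in>J. (\<Sum>i\<in>I. L i j * u i) * t j)"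
      unfolding sum_distrib_left sum_distrib_right by (subst sum.swap) (simp add: mult_ac)
    with all show ?thesis by simp
  qed
  with u show thesis using that by blast
qed

section \<open>Lebesgue measure on finite products\<close>

definition leb :: "'i set \<Rightarrow> ('i \<Rightarrow> real) measure" where
  "leb I = PiM I (\<lambda>_. lborel)"

interpretation lborel_prod: product_sigma_finite "\<lambda>_. lborel :: real measure"
  by standard

lemma sets_leb [measurable_cong]: "sets (leb I) = sets (PiM I (\<lambda>_. borel))"
  unfolding leb_def by (intro sets_PiM_cong) auto

lemma space_leb: "space (leb I) = PiE I (\<lambda>_. UNIV)"
  by (simp add: leb_def space_PiM)

lemma sigma_finite_leb: "finite I \<Longrightarrow> sigma_finite_measure (leb I)"
  unfolding leb_def by (rule lborel_prod.sigma_finite)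

text \<open>Product measures are determined on boxes, where the claim is the one-dimensional affine
  substitution in each coordinate. The factors \<open>c i\<close> may be negative, so reflections
  are included.\<close>

lemma leb_affine:
  fixes c t :: "'i \<Rightarrow> real"
  assumes [simp]: "finite I" and c: "\<And>i. i \<in> I \<Longrightarrow> c i \<noteq> 0"
  shows "leb I = density (distr (leb I) (leb I) (\<lambda>x. \<lambda>i\<in>I. t i + c i * x i)) (\<lambda>_. ennreal (\<Prod>i\<in>I. \<bar>c i\<bar>))"
  unfolding leb_def
proof (rule lborel_prod.PiM_eqI[symmetric])
  let ?L = "PiM I (\<lambda>_. lborel)"
  let ?T = "\<lambda>x. \<lambda>i\<in>I. t i + c i * x i"
  show "sets (density (distr ?L ?L ?T) (\<lambda>_. ennreal (\<Prod>i\<in>I. \<bar>c i\<bar>))) = sets ?L" by simp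
  fix A :: "'i \<Rightarrow> real set" assume A: "\<And>i. i \<in> I \<Longrightarrow> A i \<in> sets lborel"
  have T[measurable]: "?T \<in> measurable ?L ?L" by measurable
  have PA[measurable]: "PiE I A \<in> sets ?L" using A by (intro sets_PiM_I_finite) auto
  have vim: "?T -` PiE I A \<inter> space ?L = PiE I (\<lambda>i. (\<lambda>x. t i + c i * x) -` A i)"
    by (auto simp: space_PiM PiE_iff extensional_def)
  have m: "(\<lambda>x. t i + c i * x) -` A i \<in> sets lborel" if "i \<in> I" for i
    using measurable_sets[of "\<lambda>x. t i + c i * x" borel borel "A i"] A[OF that] by simp
  have 1: "emeasure lborel (A i) = ennreal \<bar>c i\<bar> * emeasure lborel ((\<lambda>x. t i + c i * x) -` A i)" if "i \<in> I" for i
  proof -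
    have [measurable]: "A i \<in> sets borel" using A[OF that] by simp
    show ?thesis
      by (subst lborel_real_affine[OF c[OF that], of "t i"])
         (simp add: emeasure_density nn_integral_cmult emeasure_distr nn_integral_distr)
  qed
  have "emeasure (density (distr ?L ?L ?T) (\<lambda>_. ennreal (\<Prod>i\<in>I. \<bar>c i\<bar>))) (PiE I A)
      = ennreal (\<Prod>i\<in>I. \<bar>c i\<bar>) * emeasure ?L (?T -` PiE I A \<inter> space ?L)"
    by (simp add: emeasure_density nn_integral_cmult_indicator emeasure_distr)
  also have "\<dots> = (\<Prod>i\<in>I. ennreal \<bar>c i\<bar>) * (\<Prod>i\<in>I. emeasure lborel ((\<lambda>x. t i + c i * x) -` A i))"
    unfolding vim using m by (subst lborel_prod.emeasure_PiM) (auto simp: prod_ennreal)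
  also have "\<dots> = (\<Prod>i\<in>I. emeasure lborel (A i))"
    unfolding prod.distrib[symmetric] using 1 by (intro prod.cong) auto
  finally show "emeasure (density (distr ?L ?L ?T) (\<lambda>_. ennreal (\<Prod>i\<in>I. \<bar>c i\<bar>))) (PiE I A) = (\<Prod>i\<in>I. emeasure lborel (A i))" .
qed simp

lemma nn_integral_leb_affine:
  fixes c t :: "'i \<Rightarrow> real"
  assumes [simp]: "finite I" and c: "\<And>i. i \<in> I \<Longrightarrow> c i \<noteq> 0" and [measurable]: "f \<in> borel_measurable (leb I)"
  shows "(\<integral>\<^sup>+x. f x \<partial>leb I) = (\<Prod>i\<in>I. \<bar>c i\<bar>) * (\<integral>\<^sup>+x. f (\<lambda>i\<in>I. t i + c i * x i) \<partial>leb I)"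
proof -
  have [measurable]: "(\<lambda>x. \<lambda>i\<in>I. t i + c i * x i) \<in> measurable (leb I) (leb I)"
    unfolding leb_def by measurable
  have "(\<integral>\<^sup>+x. f x \<partial>leb I) =
    (\<integral>\<^sup>+x. f x \<partial>density (distr (leb I) (leb I) (\<lambda>x. \<lambda>i\<in>I. t i + c i * x i)) (\<lambda>_. ennreal (\<Prod>i\<in>I. \<bar>c i\<bar>)))"
    by (subst leb_affine[of I c t]) (use c in auto)
  also have "\<dots> = (\<Prod>i\<in>I. \<bar>c i\<bar>) * (\<integral>\<^sup>+x. f (\<lambda>i\<in>I. t i + c i * x i) \<partial>leb I)"
    by (simp add: nn_integral_density nn_integral_cmult nn_integral_distr)
  finally show ?thesis .
qed

lemma nn_integral_leb_translate:
  assumes "finite I" "f \<in> borel_measurable (leb I)"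
  shows "(\<integral>\<^sup>+x. f (\<lambda>i\<in>I. a i + x i) \<partial>leb I) = (\<integral>\<^sup>+x. f x \<partial>leb I)"
  using nn_integral_leb_affine[of I "\<lambda>_. 1" f a] assms by simp

lemma nn_integral_leb_reflect:
  assumes "finite I" "f \<in> borel_measurable (leb I)"
  shows "(\<integral>\<^sup>+x. f (\<lambda>i\<in>I. a i - x i) \<partial>leb I) = (\<integral>\<^sup>+x. f x \<partial>leb I)"
  using nn_integral_leb_affine[of I "\<lambda>_. - 1" f a] assms by simp

text \<open>Uniqueness of Haar measure: both sides equal the integral of \<open>1\<^sub>A(x) 1\<^sub>B(x + y)\<close>.\<close>

lemma translation_invariant_unique:
  fixes I :: "'i set"
  assumes [simp]: "finite I" and \<nu>: "sigma_finite_measure \<nu>" and sets[measurable_cong]: "sets \<nu> = sets (leb I)"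
    and inv: "\<And>a f. f \<in> borel_measurable (leb I) \<Longrightarrow>
        (\<integral>\<^sup>+x. f (\<lambda>i\<in>I. a i + x i) \<partial>\<nu>) = (\<integral>\<^sup>+x. f x \<partial>\<nu>)"
    and A[measurable]: "A \<in> sets (leb I)" and B[measurable]: "B \<in> sets (leb I)"
  shows "emeasure \<nu> A * emeasure (leb I) B = emeasure \<nu> B * emeasure (leb I) A"
proof -
  let ?a = "indicator A :: _ \<Rightarrow> ennreal" and ?b = "indicator B :: _ \<Rightarrow> ennreal"
  interpret N: sigma_finite_measure \<nu> by fact
  interpret L: sigma_finite_measure "leb I" by (simp add: sigma_finite_leb)
  interpret P: pair_sigma_finite \<nu> "leb I" ..
  have space: "space \<nu> = space (leb I)" by (rule sets_eq_imp_space_eq[OF sets])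
  have plus[measurable]: "(\<lambda>(x, y). \<lambda>i\<in>I. x i + y i) \<in> measurable (\<nu> \<Otimes>\<^sub>M leb I) (leb I)"
    unfolding leb_def by measurable
  have minus[measurable]: "(\<lambda>(x, y). \<lambda>i\<in>I. x i - y i) \<in> measurable (\<nu> \<Otimes>\<^sub>M leb I) (leb I)"
    unfolding leb_def by measurable
  have [measurable]: "?a \<in> borel_measurable (leb I)" "?b \<in> borel_measurable (leb I)"
    by measurable
  have add[measurable]: "(\<lambda>x. \<lambda>i\<in>I. a i + x i) \<in> measurable (leb I) (leb I)" 
       "(\<lambda>x. \<lambda>i\<in>I. x i + a i) \<in> measurable (leb I) (leb I)" 
       "(\<lambda>x. \<lambda>i\<in>I. a i - x i) \<in> measurable (leb I) (leb I)" for a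
    unfolding leb_def by measurable
  have "emeasure \<nu> A * emeasure (leb I) B = (\<integral>\<^sup>+x. ?a x * emeasure (leb I) B \<partial>\<nu>)"
    by (simp add: nn_integral_multc)
  also have "\<dots> = (\<integral>\<^sup>+x. \<integral>\<^sup>+y. ?a x * ?b (\<lambda>i\<in>I. x i + y i) \<partial>leb I \<partial>\<nu>)"
    by (intro nn_integral_cong) (simp add: nn_integral_cmult nn_integral_leb_translate[of I "?b"])
  also have "\<dots> = (\<integral>\<^sup>+y. \<integral>\<^sup>+x. ?a x * ?b (\<lambda>i\<in>I. x i + y i) \<partial>\<nu> \<partial>leb I)"
    by (rule P.Fubini'[symmetric]) measurable
  \<comment> \<open>Translation by \<open>- y\<close> under \<open>\<nu>\<close> moves the shift
    from \<open>B\<close> to \<open>A\<close>. After the next exchange of integrals the shift is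
    removed by invariance of \<open>leb I\<close>.\<close>
  also have "\<dots> = (\<integral>\<^sup>+y. \<integral>\<^sup>+x. ?a (\<lambda>i\<in>I. x i - y i) * ?b x \<partial>\<nu> \<partial>leb I)"
  proof (rule nn_integral_cong)
    fix y :: "'i \<Rightarrow> real"
    have "(\<integral>\<^sup>+x. ?a x * ?b (\<lambda>i\<in>I. x i + y i) \<partial>\<nu>) =
       (\<integral>\<^sup>+x. ?a (\<lambda>i\<in>I. - y i + x i) * ?b (\<lambda>i\<in>I. (\<lambda>i\<in>I. - y i + x i) i + y i) \<partial>\<nu>)"
      by (rule inv[symmetric]) measurable
    also have "\<dots> = (\<integral>\<^sup>+x. ?a (\<lambda>i\<in>I. x i - y i) * ?b x \<partial>\<nu>)"
    proof (intro nn_integral_cong)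
      fix x assume "x \<in> space \<nu>"
      then have "(\<lambda>i\<in>I. (\<lambda>i\<in>I. - y i + x i) i + y i) = x"
        by (auto simp: space space_leb PiE_iff extensional_def)
      then show "?a (\<lambda>i\<in>I. - y i + x i) * ?b (\<lambda>i\<in>I. (\<lambda>i\<in>I. - y i + x i) i + y i)
         = (?a (\<lambda>i\<in>I. x i - y i) * ?b x)" by simp
    qed
    finally show "(\<integral>\<^sup>+x. ?a x * ?b (\<lambda>i\<in>I. x i + y i) \<partial>\<nu>) =
      (\<integral>\<^sup>+x. ?a (\<lambda>i\<in>I. x i - y i) * ?b x \<partial>\<nu>)" .
  qed
  also have "\<dots> = (\<integral>\<^sup>+x. \<integral>\<^sup>+y. ?a (\<lambda>i\<in>I. x i - y i) * ?b x \<partial>leb I \<partial>\<nu>)"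
    by (rule P.Fubini') measurable
  also have "\<dots> = (\<integral>\<^sup>+x. emeasure (leb I) A * ?b x \<partial>\<nu>)"
    by (intro nn_integral_cong) (simp add: nn_integral_multc nn_integral_leb_reflect[of I "?a"])
  also have "\<dots> = emeasure \<nu> B * emeasure (leb I) A"
    by (simp add: nn_integral_cmult nn_integral_multc mult.commute)
  finally show ?thesis .
qed

section \<open>Volumes of linear images\<close>

text \<open>The image consists of functions extensional on \<open>I\<close>, because
  \<open>leb I\<close> lives on these. If \<open>I\<close> and \<open>J\<close> have the same size,
  the measure of the image of \<open>unit_cube J\<close> is the absolute determinant of
  \<open>L\<close>.\<close>

definition lin_image :: "'i set \<Rightarrow> 'j set \<Rightarrow> ('i \<Rightarrow> 'j \<Rightarrow> real) \<Rightarrow> ('j \<Rightarrow> real) set \<Rightarrow> ('i \<Rightarrow> real) set" where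
  "lin_image I J L A = {z \<in> space (leb I). \<exists>t\<in>A. \<forall>i\<in>I. z i = (\<Sum>j\<in>J. L i j * t j)}"

definition unit_cube :: "'i set \<Rightarrow> ('i \<Rightarrow> real) set" where
  "unit_cube I = PiE I (\<lambda>_. {0..1})"

lemma measurable_leb_coord: "(\<lambda>x. x i) \<in> borel_measurable (leb I)" if "i \<in> I"
  using that unfolding leb_def by measurable

lemma measurable_lebI:
  "(\<And>i. i \<in> I \<Longrightarrow> f i \<in> borel_measurable M) \<Longrightarrow> (\<lambda>x. \<lambda>i\<in>I. f i x) \<in> measurable M (leb I)"
  unfolding leb_def by (intro measurable_restrict) auto

lemma box_in_sets_leb:
  "finite I \<Longrightarrow> (\<And>i. i \<in> I \<Longrightarrow> A i \<in> sets borel) \<Longrightarrow> PiE I A \<in> sets (leb I)"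
  unfolding leb_def by (intro sets_PiM_I_finite) auto

lemma emeasure_leb_box:
  "finite I \<Longrightarrow> (\<And>i. i \<in> I \<Longrightarrow> A i \<in> sets borel) \<Longrightarrow> emeasure (leb I) (PiE I A) = (\<Prod>i\<in>I. emeasure lborel (A i))"
  unfolding leb_def by (intro lborel_prod.emeasure_PiM) auto

lemma unit_cube_sets [measurable]: "finite I \<Longrightarrow> unit_cube I \<in> sets (leb I)"
  unfolding unit_cube_def by (intro box_in_sets_leb) auto

lemma emeasure_unit_cube: "finite I \<Longrightarrow> emeasure (leb I) (unit_cube I) = 1"
  unfolding unit_cube_def by (subst emeasure_leb_box) auto

lemma emeasure_leb_bounded_finite:
  assumes "finite I" "A \<subseteq> PiE I (\<lambda>_. {-c..c})"
  shows "emeasure (leb I) A < \<infinity>"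
proof -
  have "emeasure (leb I) A \<le> emeasure (leb I) (PiE I (\<lambda>_. {-c..c}))"
    using assms by (intro emeasure_mono box_in_sets_leb) auto
  also have "\<dots> < \<infinity>"
    using assms(1) by (subst emeasure_leb_box) (auto simp: power_less_top_ennreal emeasure_lborel_Icc_eq)
  finally show ?thesis .
qed

text \<open>Fubini along a coordinate \<open>p\<close> with nonzero coefficient: every line in this
  direction meets the hyperplane in at most one point.\<close>

lemma leb_hyperplane_null:
  assumes [simp]: "finite I" and u: "\<exists>i\<in>I. u i \<noteq> 0"
  shows "{z \<in> space (leb I). (\<Sum>i\<in>I. u i * z i) = 0} \<in> null_sets (leb I)"
proof -
  obtain p where p: "p \<in> I" "u p \<noteq> 0" using u by auto
  define I' where "I' = I - {p}"
  have I: "I = insert p I'" "p \<notin> I'" "finite I'" using p by (auto simp: I'_def)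
  let ?H = "{z \<in> space (leb I). (\<Sum>i\<in>I. u i * z i) = 0}"
  have H[measurable]: "?H \<in> sets (leb I)" by measurable
  have leb_eq: "leb I = PiM (insert p I') (\<lambda>_. lborel)" unfolding leb_def by (simp only: I(1)[symmetric])
  have "emeasure (leb I) ?H = (\<integral>\<^sup>+z. indicator ?H z \<partial>PiM (insert p I') (\<lambda>_. lborel))"
    using H by (simp add: leb_eq[symmetric])
  also have "\<dots> = (\<integral>\<^sup>+x. \<integral>\<^sup>+y. indicator ?H (x(p := y)) \<partial>lborel \<partial>PiM I' (\<lambda>_. lborel))"
    using H I(2,3) by (intro lborel_prod.product_nn_integral_insert) (auto simp: leb_eq[symmetric])
  also have "\<dots> \<le> (\<integral>\<^sup>+x. \<integral>\<^sup>+y. indicator {- (\<Sum>i\<in>I'. u i * x i) / u p} y \<partial>lborel \<partial>PiM I' (\<lambda>_. lborel))"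
  proof (intro nn_integral_mono)
    fix x :: "'a \<Rightarrow> real" and y :: real
    have "y = - (\<Sum>i\<in>I'. u i * x i) / u p" if "(\<Sum>i\<in>I. u i * (x(p := y)) i) = 0"
    proof -
      have "(\<Sum>i\<in>I. u i * (x(p := y)) i) = u p * y + (\<Sum>i\<in>I'. u i * x i)"
        using I by (simp add: sum.insert) (intro sum.cong, auto)
      with that p show ?thesis by (simp add: field_simps)
    qed
    then show "indicator ?H (x(p := y)) \<le> (indicator {- (\<Sum>i\<in>I'. u i * x i) / u p} y :: ennreal)"
      by (auto simp: indicator_def)
  qed
  also have "\<dots> = 0" by simp
  finally show ?thesis using H by (intro null_setsI) auto
qed

text \<open>The image under \<open>L\<close> is a preimage under the inverse \<open>B\<close>, hence
  measurable. The measure \<open>leb I\<close> transported by \<open>B\<close> is invariant under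
  translations, so it is a multiple of \<open>leb J\<close>, and the unit cube determines the
  factor.\<close>

lemma linear_iso_image:
  fixes L :: "'i \<Rightarrow> 'j \<Rightarrow> real" and B :: "'j \<Rightarrow> 'i \<Rightarrow> real"
  assumes fin[simp]: "finite I" "finite J"
    and LB: "\<And>z i. i \<in> I \<Longrightarrow> (\<Sum>j\<in>J. L i j * (\<Sum>l\<in>I. B j l * z l)) = z i"
    and BL: "\<And>t j. j \<in> J \<Longrightarrow> (\<Sum>l\<in>I. B j l * (\<Sum>j'\<in>J. L l j' * t j')) = t j"
    and A: "A \<in> sets (leb J)"
  shows "lin_image I J L A = (\<lambda>z. \<lambda>j\<in>J. \<Sum>l\<in>I. B j l * z l) -` A \<inter> space (leb I)"
    and "lin_image I J L A \<in> sets (leb I)"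
    and "emeasure (leb I) (lin_image I J L A) = emeasure (leb J) A * emeasure (leb I) (lin_image I J L (unit_cube J))"
proof -
  let ?T = "\<lambda>z. \<lambda>j\<in>J. \<Sum>l\<in>I. B j l * z l"
  have T[measurable]: "?T \<in> measurable (leb I) (leb J)"
    by (intro measurable_lebI borel_measurable_sum borel_measurable_times) auto
  have im: "lin_image I J L A = ?T -` A \<inter> space (leb I)" if A: "A \<in> sets (leb J)" for A
  proof (intro set_eqI iffI)
    fix z assume "z \<in> lin_image I J L A"
    then obtain t where z: "z \<in> space (leb I)" and t: "t \<in> A" and eq: "\<forall>i\<in>I. z i = (\<Sum>j\<in>J. L i j * t j)"
      by (auto simp: lin_image_def)
    have "t \<in> space (leb J)" using A t sets.sets_into_space by blast
    moreover have "(\<Sum>l\<in>I. B j l * z l) = t j" if "j \<in> J" for j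
      using BL[OF that, of t] eq by simp
    ultimately have "?T z = t" by (auto simp: space_leb PiE_iff extensional_def)
    with t z show "z \<in> ?T -` A \<inter> space (leb I)" by simp
  next
    fix z assume z: "z \<in> ?T -` A \<inter> space (leb I)"
    then show "z \<in> lin_image I J L A"
      using LB by (auto simp: lin_image_def intro!: bexI[of _ "?T z"])
  qed
  show "lin_image I J L A = ?T -` A \<inter> space (leb I)" by (rule im[OF A])
  show "lin_image I J L A \<in> sets (leb I)" unfolding im[OF A] using A by measurable
  let ?\<nu> = "distr (leb I) (leb J) ?T"
  have \<nu>: "emeasure ?\<nu> A = emeasure (leb I) (lin_image I J L A)" if "A \<in> sets (leb J)" for A
    using that by (simp add: emeasure_distr im)
  have "emeasure ?\<nu> A * emeasure (leb J) (unit_cube J) = emeasure ?\<nu> (unit_cube J) * emeasure (leb J) A"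
  proof (rule translation_invariant_unique)
    show "sigma_finite_measure ?\<nu>"
    proof
      let ?Q = "\<lambda>m::nat. PiE J (\<lambda>_. {-real m..real m})"
      have Q: "?Q m \<in> sets (leb J)" for m by (intro box_in_sets_leb) auto
      have "emeasure ?\<nu> (?Q m) \<noteq> \<infinity>" for m
      proof -
        \<comment> \<open>A bound for the coordinates of \<open>L t\<close> with \<open>t\<close> in
          the box. It makes the transported measure finite on an exhausting sequence of
          boxes.\<close>
        define c where "c = (\<Sum>i\<in>I. \<Sum>j\<in>J. \<bar>L i j\<bar> * m)"
        have "lin_image I J L (?Q m) \<subseteq> PiE I (\<lambda>_. {-c..c})"
        proof
          fix z assume "z \<in> lin_image I J L (?Q m)"
          then obtain t where z: "z \<in> space (leb I)" and t: "t \<in> ?Q m" and eq: "\<forall>i\<in>I. z i = (\<Sum>j\<in>J. L i j * t j)"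
            by (auto simp: lin_image_def)
          have "\<bar>z i\<bar> \<le> c" if i: "i \<in> I" for i
          proof -
            have "\<bar>z i\<bar> \<le> (\<Sum>j\<in>J. \<bar>L i j * t j\<bar>)" using eq i by (simp add: sum_abs)
            also have "\<dots> \<le> (\<Sum>j\<in>J. \<bar>L i j\<bar> * m)"
            proof (intro sum_mono)
              fix j assume "j \<in> J"
              then have "\<bar>t j\<bar> \<le> m" using t by (auto simp: PiE_iff abs_le_iff)
              then show "\<bar>L i j * t j\<bar> \<le> \<bar>L i j\<bar> * m" by (simp add: abs_mult mult_left_mono)
            qed
            also have "\<dots> \<le> c" unfolding c_def
              using i by (intro member_le_sum[of i I "\<lambda>i. \<Sum>j\<in>J. \<bar>L i j\<bar> * m"]) (auto intro: sum_nonneg)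
            finally show ?thesis .
          qed
          then show "z \<in> PiE I (\<lambda>_. {-c..c})" using z by (auto simp: space_leb PiE_iff abs_le_iff minus_le_iff)
        qed
        from emeasure_leb_bounded_finite[OF fin(1) this] show ?thesis using \<nu>[OF Q] by auto
      qed
      moreover have "\<Union>(range ?Q) = space ?\<nu>"
      proof -
        have "\<exists>m. x \<in> ?Q m" if "x \<in> space (leb J)" for x
        proof -
          obtain m :: nat where m: "(\<Sum>j\<in>J. \<bar>x j\<bar>) \<le> m" using real_arch_simple by blast
          have "\<bar>x j\<bar> \<le> m" if "j \<in> J" for j
            using m member_le_sum[of j J "\<lambda>j. \<bar>x j\<bar>"] that by auto
          then show ?thesis using that by (intro exI[of _ m]) (auto simp: space_leb PiE_iff abs_le_iff minus_le_iff)
        qed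
        then show ?thesis by (auto simp: space_leb)
      qed
      ultimately show "\<exists>A. countable A \<and> A \<subseteq> sets ?\<nu> \<and> \<Union>A = space ?\<nu> \<and> (\<forall>a\<in>A. emeasure ?\<nu> a \<noteq> \<infinity>)"
        using Q by (intro exI[of _ "range ?Q"]) auto
    qed
    fix a :: "'j \<Rightarrow> real" and f :: "('j \<Rightarrow> real) \<Rightarrow> ennreal"
    assume f[measurable]: "f \<in> borel_measurable (leb J)"
    \<comment> \<open>Translation by \<open>a\<close> in the target of \<open>B\<close> corresponds
      to translation by its image \<open>b\<close> under \<open>L\<close>.\<close>
    define b where "b i = (\<Sum>j\<in>J. L i j * a j)" for i
    have tr[measurable]: "(\<lambda>x. \<lambda>j\<in>J. a j + x j) \<in> measurable (leb J) (leb J)"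
      by (intro measurable_lebI borel_measurable_add) auto
    have "(\<integral>\<^sup>+x. f (\<lambda>j\<in>J. a j + x j) \<partial>?\<nu>) = (\<integral>\<^sup>+z. f (\<lambda>j\<in>J. a j + ?T z j) \<partial>leb I)"
      by (simp add: nn_integral_distr cong: restrict_cong)
    also have "\<dots> = (\<integral>\<^sup>+z. f (?T (\<lambda>i\<in>I. b i + z i)) \<partial>leb I)"
    proof -
      have "(\<lambda>j\<in>J. a j + ?T z j) = ?T (\<lambda>i\<in>I. b i + z i)" for z
      proof (rule restrict_ext)
        fix j assume j: "j \<in> J"
        have "(\<Sum>l\<in>I. B j l * (\<lambda>i\<in>I. b i + z i) l) = (\<Sum>l\<in>I. B j l * b l) + (\<Sum>l\<in>I. B j l * z l)"
          by (simp add: distrib_left sum.distrib)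
        with BL[OF j, of a] j show "a j + ?T z j = (\<Sum>l\<in>I. B j l * (\<lambda>i\<in>I. b i + z i) l)"
          by (simp add: b_def)
      qed
      then show ?thesis by simp
    qed
    also have "\<dots> = (\<integral>\<^sup>+z. f (?T z) \<partial>leb I)"
      by (rule nn_integral_leb_translate[of I "\<lambda>z. f (?T z)"]) (auto intro: measurable_compose[OF T])
    also have "\<dots> = (\<integral>\<^sup>+x. f x \<partial>?\<nu>)"
      by (simp add: nn_integral_distr)
    finally show "(\<integral>\<^sup>+x. f (\<lambda>j\<in>J. a j + x j) \<partial>?\<nu>) = (\<integral>\<^sup>+x. f x \<partial>?\<nu>)" .
  qed (use A in auto)
  then show "emeasure (leb I) (lin_image I J L A) = emeasure (leb J) A * emeasure (leb I) (lin_image I J L (unit_cube J))"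
    by (simp only: \<nu>[OF A] \<nu>[OF unit_cube_sets[OF fin(2)]] emeasure_unit_cube[OF fin(2)] mult_1_right
        mult.commute[of "emeasure (leb J) A"])
qed

lemma emeasure_lin_image_singular:
  assumes "finite I" "\<exists>i\<in>I. u i \<noteq> 0" "\<And>t. (\<Sum>i\<in>I. u i * (\<Sum>j\<in>J. L i j * t j)) = 0"
  shows "emeasure (leb I) (lin_image I J L A) = 0"
proof (rule emeasure_eq_0)
  show "{z \<in> space (leb I). (\<Sum>i\<in>I. u i * z i) = 0} \<in> sets (leb I)"
    "emeasure (leb I) {z \<in> space (leb I). (\<Sum>i\<in>I. u i * z i) = 0} = 0"
    using leb_hyperplane_null[OF assms(1,2)] by (auto simp: null_sets_def)
  show "lin_image I J L A \<subseteq> {z \<in> space (leb I). (\<Sum>i\<in>I. u i * z i) = 0}"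
  proof
    fix z assume "z \<in> lin_image I J L A"
    then obtain t where z: "z \<in> space (leb I)" and eq: "\<forall>i\<in>I. z i = (\<Sum>j\<in>J. L i j * t j)"
      by (auto simp: lin_image_def)
    have "(\<Sum>i\<in>I. u i * z i) = (\<Sum>i\<in>I. u i * (\<Sum>j\<in>J. L i j * t j))"
      using eq by (intro sum.cong) auto
    with assms(3) z show "z \<in> {z \<in> space (leb I). (\<Sum>i\<in>I. u i * z i) = 0}" by simp
  qed
qed

text \<open>In the singular case both sides vanish, because all images lie in one hyperplane. The
  formula can therefore be applied to every value of a random matrix.\<close>

lemma emeasure_lin_image:
  assumes fin: "finite I" "finite J" "card I = card J" and A: "A \<in> sets (leb J)"
  shows "emeasure (leb I) (lin_image I J L A) = emeasure (leb J) A * emeasure (leb I) (lin_image I J L (unit_cube J))"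
proof (cases "injective_system I J L")
  case True
  from injective_system_inverse[OF fin True] obtain B where
    "\<And>z i. i \<in> I \<Longrightarrow> (\<Sum>j\<in>J. L i j * (\<Sum>l\<in>I. B j l * z l)) = z i"
    "\<And>t j. j \<in> J \<Longrightarrow> (\<Sum>l\<in>I. B j l * (\<Sum>j'\<in>J. L l j' * t j')) = t j" by blast
  from linear_iso_image(3)[OF fin(1,2) this A] show ?thesis .
next
  case False
  from singular_system_left_kernel[OF fin False] obtain u where
    u: "\<exists>i\<in>I. u i \<noteq> 0" "\<And>t. (\<Sum>i\<in>I. u i * (\<Sum>j\<in>J. L i j * t j)) = 0" by blast
  show ?thesis by (simp add: emeasure_lin_image_singular[OF fin(1) u])
qed

text \<open>Columns and rows are both required to be orthonormal, so that \<open>R\<close> and its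
  transpose can exchange roles.\<close>

definition orthogonal_on :: "'i set \<Rightarrow> ('i \<Rightarrow> 'i \<Rightarrow> real) \<Rightarrow> bool" where
  "orthogonal_on I R \<longleftrightarrow> (\<forall>a\<in>I. \<forall>b\<in>I. (\<Sum>c\<in>I. R c a * R c b) = of_bool (a = b)) \<and>
     (\<forall>a\<in>I. \<forall>b\<in>I. (\<Sum>c\<in>I. R a c * R b c) = of_bool (a = b))"

lemma orthogonal_on_cancel:
  assumes [simp]: "finite I" and R: "orthogonal_on I R" and i: "i \<in> I"
  shows "(\<Sum>c\<in>I. R c i * (\<Sum>b\<in>I. R c b * x b)) = x i"
    and "(\<Sum>c\<in>I. R i c * (\<Sum>b\<in>I. R b c * x b)) = x i"
proof -
  have "(\<Sum>c\<in>I. R c i * (\<Sum>b\<in>I. R c b * x b)) = (\<Sum>b\<in>I. (\<Sum>c\<in>I. R c i * R c b) * x b)"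
    unfolding sum_distrib_left sum_distrib_right by (subst sum.swap) (simp add: mult_ac)
  also have "\<dots> = (\<Sum>b\<in>I. if i = b then x b else 0)"
    using R i by (intro sum.cong) (auto simp: orthogonal_on_def)
  finally show "(\<Sum>c\<in>I. R c i * (\<Sum>b\<in>I. R c b * x b)) = x i" using i by simp
  have "(\<Sum>c\<in>I. R i c * (\<Sum>b\<in>I. R b c * x b)) = (\<Sum>b\<in>I. (\<Sum>c\<in>I. R i c * R b c) * x b)"
    unfolding sum_distrib_left sum_distrib_right by (subst sum.swap) (simp add: mult_ac)
  also have "\<dots> = (\<Sum>b\<in>I. if i = b then x b else 0)"
    using R i by (intro sum.cong) (auto simp: orthogonal_on_def)
  finally show "(\<Sum>c\<in>I. R i c * (\<Sum>b\<in>I. R b c * x b)) = x i" using i by simp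
qed

lemma orthogonal_on_inner:
  assumes [simp]: "finite I" and R: "orthogonal_on I R"
  shows "(\<Sum>a\<in>I. (\<Sum>b\<in>I. R a b * x b) * (\<Sum>b\<in>I. R a b * y b)) = (\<Sum>a\<in>I. x a * y a)"
proof -
  define Y where "Y a = (\<Sum>b\<in>I. R a b * y b)" for a
  have "(\<Sum>a\<in>I. (\<Sum>b\<in>I. R a b * x b) * Y a) = (\<Sum>b\<in>I. x b * (\<Sum>a\<in>I. R a b * Y a))"
    unfolding sum_distrib_left sum_distrib_right by (subst sum.swap) (simp add: mult_ac)
  also have "\<dots> = (\<Sum>b\<in>I. x b * y b)"
    using orthogonal_on_cancel(1)[OF _ R] by (intro sum.cong) (auto simp: Y_def)
  finally show ?thesis by (simp add: Y_def)
qed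

definition mat_apply :: "'i set \<Rightarrow> ('i \<Rightarrow> 'i \<Rightarrow> real) \<Rightarrow> ('i \<Rightarrow> real) \<Rightarrow> 'i \<Rightarrow> real" where
  "mat_apply I R x = (\<lambda>a\<in>I. \<Sum>b\<in>I. R a b * x b)"

lemma measurable_mat_apply [measurable]: "finite I \<Longrightarrow> mat_apply I R \<in> measurable (leb I) (leb I)"
  unfolding mat_apply_def by (intro measurable_lebI borel_measurable_sum borel_measurable_times) auto

text \<open>The scaling factor of an orthogonal map is 1 because it preserves the unit ball.\<close>

lemma distr_leb_orthogonal:
  assumes [simp]: "finite I" and R: "orthogonal_on I R"
  shows "distr (leb I) (leb I) (mat_apply I R) = leb I"
proof -
  have LB: "(\<Sum>j\<in>I. R j i * (\<Sum>l\<in>I. R j l * z l)) = z i"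
    and BL: "(\<Sum>l\<in>I. R i l * (\<Sum>j'\<in>I. R j' l * z j')) = z i" if "i \<in> I" for z i
    using orthogonal_on_cancel[OF _ R that] by auto
  note iso = linear_iso_image[of I I "\<lambda>i j. R j i" R, OF _ _ LB BL, simplified, folded mat_apply_def]
  define S where "S = {x \<in> space (leb I). (\<Sum>i\<in>I. x i * x i) \<le> 1}"
  have S[measurable]: "S \<in> sets (leb I)" unfolding S_def by measurable
  have "mat_apply I R -` S \<inter> space (leb I) = S"
    using orthogonal_on_inner[OF _ R, of x x for x]
    by (auto simp: S_def mat_apply_def space_leb)
  then have eq: "emeasure (leb I) S = emeasure (leb I) S * emeasure (leb I) (lin_image I I (\<lambda>i j. R j i) (unit_cube I))"
    using iso(1,3)[OF S] by simp
  have fin: "emeasure (leb I) S < \<infinity>"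
  proof (rule emeasure_leb_bounded_finite)
    show "S \<subseteq> PiE I (\<lambda>_. {-1..1})"
    proof
      fix x assume x: "x \<in> S"
      have "\<bar>x i\<bar> \<le> 1" if "i \<in> I" for i
      proof -
        have "x i * x i \<le> (\<Sum>i\<in>I. x i * x i)" using that by (intro member_le_sum) auto
        with x have "(x i)\<^sup>2 \<le> 1" by (auto simp: S_def power2_eq_square)
        then show ?thesis by (simp add: abs_square_le_1)
      qed
      then show "x \<in> PiE I (\<lambda>_. {-1..1})" using x by (auto simp: S_def space_leb PiE_iff abs_le_iff minus_le_iff)
    qed
  qed simp
  have pos: "0 < emeasure (leb I) S"
  proof -
    \<comment> \<open>A cube with this edge lies in the unit ball, since a sum of
      \<open>card I\<close> squares is then at most \<open>card I * r\<close>. Positive measure of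
      the ball is what permits the cancellation below.\<close>
    define r where "r = 1 / (real (card I) + 1)"
    have r: "r > 0" "r \<le> 1" "real (card I) * r \<le> 1" by (auto simp: r_def field_simps)
    have "PiE I (\<lambda>_. {0..r}) \<subseteq> S"
    proof
      fix x assume x: "x \<in> PiE I (\<lambda>_. {0..r})"
      have "(\<Sum>i\<in>I. x i * x i) \<le> (\<Sum>i\<in>I. r * 1)"
        using x r by (intro sum_mono mult_mono) (auto simp: PiE_iff intro: order_trans)
      also have "\<dots> \<le> 1" using r by simp
      finally show "x \<in> S" using x by (auto simp: S_def space_leb PiE_iff)
    qed
    then have "emeasure (leb I) (PiE I (\<lambda>_. {0..r})) \<le> emeasure (leb I) S"
      by (intro emeasure_mono) auto
    moreover have "0 < emeasure (leb I) (PiE I (\<lambda>_. {0..r}))"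
      using r by (subst emeasure_leb_box) (auto simp: zero_less_iff_neq_zero)
    ultimately show ?thesis by order
  qed
  have "emeasure (leb I) (lin_image I I (\<lambda>i j. R j i) (unit_cube I)) = 1"
    using ennreal_mult_cancel_left[of "emeasure (leb I) S" 1] eq fin pos by auto
  then show ?thesis
    using iso by (intro measure_eqI) (auto simp: emeasure_distr)
qed

section \<open>Standard Gaussian measures\<close>

abbreviation std_normal :: "real measure" where
  "std_normal \<equiv> density lborel std_normal_density"

definition gauss :: "'i set \<Rightarrow> ('i \<Rightarrow> real) measure" where
  "gauss I = PiM I (\<lambda>_. std_normal)"

lemma prob_space_std_normal: "prob_space std_normal"
  by (rule prob_space_normal_density) simp

interpretation gauss_prod: product_sigma_finite "\<lambda>_. std_normal"
  by (simp add: product_sigma_finite_def prob_space_std_normal prob_space_imp_sigma_finite)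

lemma sets_gauss [measurable_cong]: "sets (gauss I) = sets (leb I)"
  unfolding leb_def gauss_def by (intro sets_PiM_cong) auto

lemma space_gauss: "space (gauss I) = space (leb I)"
  by (rule sets_eq_imp_space_eq[OF sets_gauss])

lemma prob_space_gauss: "prob_space (gauss I)"
  unfolding gauss_def by (intro prob_space_PiM prob_space_std_normal)

lemma gauss_density:
  assumes [simp]: "finite I"
  shows "gauss I = density (leb I) (\<lambda>x. \<Prod>i\<in>I. ennreal (std_normal_density (x i)))"
  unfolding gauss_def
proof (rule gauss_prod.PiM_eqI[symmetric])
  show "sets (density (leb I) (\<lambda>x. \<Prod>i\<in>I. ennreal (std_normal_density (x i)))) = sets (PiM I (\<lambda>_. std_normal))"
    by (simp add: sets_gauss[unfolded gauss_def])
  fix A :: "'a \<Rightarrow> real set" assume A: "\<And>i. i \<in> I \<Longrightarrow> A i \<in> sets std_normal"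
  then have A'[measurable]: "A i \<in> sets borel" if "i \<in> I" for i using that by simp
  have "PiE I A \<in> sets (leb I)" using A by (intro box_in_sets_leb) auto
  then have "emeasure (density (leb I) (\<lambda>x. \<Prod>i\<in>I. ennreal (std_normal_density (x i)))) (PiE I A)
     = (\<integral>\<^sup>+x. (\<Prod>i\<in>I. ennreal (std_normal_density (x i))) * indicator (PiE I A) x \<partial>leb I)"
    by (subst emeasure_density) auto
  also have "\<dots> = (\<integral>\<^sup>+x. (\<Prod>i\<in>I. ennreal (std_normal_density (x i)) * indicator (A i) (x i)) \<partial>leb I)"
  proof (intro nn_integral_cong)
    fix x assume x: "x \<in> space (leb I)"
    have "indicator (PiE I A) x = (\<Prod>i\<in>I. indicator (A i) (x i) :: ennreal)"
      using x by (auto simp: indicator_def space_leb PiE_iff)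
    then show "(\<Prod>i\<in>I. ennreal (std_normal_density (x i))) * indicator (PiE I A) x
       = (\<Prod>i\<in>I. ennreal (std_normal_density (x i)) * indicator (A i) (x i))"
      by (simp add: prod.distrib)
  qed
  also have "\<dots> = (\<Prod>i\<in>I. \<integral>\<^sup>+y. ennreal (std_normal_density y) * indicator (A i) y \<partial>lborel)"
    unfolding leb_def by (intro lborel_prod.product_nn_integral_prod) auto
  also have "\<dots> = (\<Prod>i\<in>I. emeasure std_normal (A i))"
    by (intro prod.cong) (auto simp: emeasure_density)
  finally show "emeasure (density (leb I) (\<lambda>x. \<Prod>i\<in>I. ennreal (std_normal_density (x i)))) (PiE I A) = (\<Prod>i\<in>I. emeasure std_normal (A i))" .
qed simp

lemma nn_integral_gauss:
  assumes "finite I" "f \<in> borel_measurable (leb I)"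
  shows "(\<integral>\<^sup>+x. f x \<partial>gauss I) = (\<integral>\<^sup>+x. ennreal (\<Prod>i\<in>I. std_normal_density (x i)) * f x \<partial>leb I)"
  using assms by (simp add: gauss_density nn_integral_density prod_ennreal)

text \<open>The density is a function of the sum of squares, hence unchanged by \<open>R\<close>,
  and Lebesgue measure is invariant as well.\<close>

lemma distr_gauss_orthogonal:
  assumes [simp]: "finite I" and R: "orthogonal_on I R"
  shows "distr (gauss I) (gauss I) (mat_apply I R) = gauss I"
proof (rule measure_eqI)
  fix A assume "A \<in> sets (distr (gauss I) (gauss I) (mat_apply I R))"
  then have A[measurable]: "A \<in> sets (leb I)" by (simp add: sets_gauss)
  define \<phi> :: "('a \<Rightarrow> real) \<Rightarrow> real" where "\<phi> x = (\<Prod>i\<in>I. std_normal_density (x i))" for x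
  have \<phi>_eq: "\<phi> x = (1 / sqrt (2 * pi)) ^ card I * exp (- (\<Sum>i\<in>I. x i * x i) / 2)" for x
    unfolding \<phi>_def normal_density_def by (simp add: prod.distrib exp_sum[symmetric] sum_negf
      power2_eq_square sum_divide_distrib prod_dividef power_divide)
  have \<phi>_inv: "\<phi> (mat_apply I R x) = \<phi> x" for x
    using orthogonal_on_inner[OF _ R, of x x] by (simp add: \<phi>_eq mat_apply_def)
  have [measurable]: "\<phi> \<in> borel_measurable (leb I)" unfolding \<phi>_def by measurable
  have h: "(\<lambda>x. ennreal (\<phi> x) * indicator A x) \<in> borel_measurable (leb I)"
    by measurable
  have [measurable]: "mat_apply I R \<in> measurable (gauss I) (gauss I)"
    by (subst measurable_cong_sets[OF sets_gauss sets_gauss]) simp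
  have "emeasure (distr (gauss I) (gauss I) (mat_apply I R)) A = (\<integral>\<^sup>+x. indicator A x \<partial>distr (gauss I) (gauss I) (mat_apply I R))"
    using A by (simp add: sets_gauss)
  also have "\<dots> = (\<integral>\<^sup>+x. indicator A (mat_apply I R x) \<partial>gauss I)"
    by (subst nn_integral_distr) auto
  also have "\<dots> = (\<integral>\<^sup>+x. ennreal (\<phi> x) * indicator A (mat_apply I R x) \<partial>leb I)"
    unfolding \<phi>_def by (subst nn_integral_gauss) auto
  also have "\<dots> = (\<integral>\<^sup>+x. (\<lambda>x. ennreal (\<phi> x) * indicator A x) (mat_apply I R x) \<partial>leb I)"
    by (simp only: \<phi>_inv)
  also have "\<dots> = (\<integral>\<^sup>+x. ennreal (\<phi> x) * indicator A x \<partial>distr (leb I) (leb I) (mat_apply I R))"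
    using h by (intro nn_integral_distr[symmetric] measurable_mat_apply[OF assms(1)]) simp
  also have "\<dots> = (\<integral>\<^sup>+x. ennreal (\<phi> x) * indicator A x \<partial>leb I)"
    by (simp only: distr_leb_orthogonal[OF assms])
  also have "\<dots> = emeasure (gauss I) A"
    unfolding \<phi>_def by (subst nn_integral_gauss[symmetric]) (auto simp: sets_gauss)
  finally show "emeasure (distr (gauss I) (gauss I) (mat_apply I R)) A = emeasure (gauss I) A" .
qed simp

section \<open>Existential quantification over compact sets\<close>

text \<open>A continuous function on a compact set has a zero if its absolute value takes
  arbitrarily small values there, and this can be tested on a countable dense subset. An uncountable
  existential quantifier thus becomes countable set operations.\<close>

lemma measurable_ex_compact:
  fixes g :: "'a \<Rightarrow> 'b::{metric_space, second_countable_topology} \<Rightarrow> real"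
  assumes K: "compact K"
    and cont: "\<And>\<omega>. \<omega> \<in> space M \<Longrightarrow> continuous_on K (g \<omega>)"
    and meas: "\<And>x. x \<in> K \<Longrightarrow> (\<lambda>\<omega>. g \<omega> x) \<in> borel_measurable M"
  shows "{\<omega> \<in> space M. \<exists>x\<in>K. g \<omega> x = 0} \<in> sets M"
proof -
  obtain D where D: "countable D" "D \<subseteq> K" "K \<subseteq> closure D" by (rule separable)
  have "(\<exists>x\<in>K. g \<omega> x = 0) \<longleftrightarrow> (\<forall>m::nat. \<exists>q\<in>D. \<bar>g \<omega> q\<bar> < 1 / (real m + 1))" if \<omega>: "\<omega> \<in> space M" for \<omega>
  proof
    assume "\<exists>x\<in>K. g \<omega> x = 0"
    then obtain x where x: "x \<in> K" "g \<omega> x = 0" by blast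
    show "\<forall>m::nat. \<exists>q\<in>D. \<bar>g \<omega> q\<bar> < 1 / (real m + 1)"
    proof
      fix m :: nat
      have "0 < 1 / (real m + 1)" by simp
      with cont[OF \<omega>] x obtain r where r: "r > 0" "\<And>q. q \<in> K \<Longrightarrow> dist q x < r \<Longrightarrow> dist (g \<omega> q) (g \<omega> x) < 1 / (real m + 1)"
        unfolding continuous_on_iff by metis
      have "x \<in> closure D" using D x by auto
      then obtain q where "q \<in> D" "dist q x < r" using r by (metis closure_approachable)
      then show "\<exists>q\<in>D. \<bar>g \<omega> q\<bar> < 1 / (real m + 1)"
        using r(2)[of q] D x by (auto simp: dist_real_def intro!: bexI[of _ q])
    qed
  next
    assume *: "\<forall>m::nat. \<exists>q\<in>D. \<bar>g \<omega> q\<bar> < 1 / (real m + 1)"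
    then have "K \<noteq> {}" using D by blast
    moreover have "continuous_on K (\<lambda>x. \<bar>g \<omega> x\<bar>)" using cont[OF \<omega>] by (intro continuous_intros)
    ultimately obtain x where x: "x \<in> K" "\<And>y. y \<in> K \<Longrightarrow> \<bar>g \<omega> x\<bar> \<le> \<bar>g \<omega> y\<bar>"
      using continuous_attains_inf[OF K] by blast
    have "\<bar>g \<omega> x\<bar> < 1 / (real m + 1)" for m :: nat
      using * x D by (meson in_mono order_le_less_trans)
    then have "\<bar>g \<omega> x\<bar> \<le> 0"
      using reals_Archimedean[of "\<bar>g \<omega> x\<bar>"] by (metis add.commute inverse_eq_divide less_le_not_le not_less of_nat_Suc)
    then show "\<exists>x\<in>K. g \<omega> x = 0" using x(1) by auto
  qed
  then have "{\<omega> \<in> space M. \<exists>x\<in>K. g \<omega> x = 0} =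
     {\<omega> \<in> space M. \<forall>m::nat. \<exists>q\<in>D. \<bar>g \<omega> q\<bar> < 1 / (real m + 1)}" by blast
  also have "\<dots> \<in> sets M"
  proof -
    have [measurable]: "(\<lambda>\<omega>. g \<omega> q) \<in> borel_measurable M" if "q \<in> D" for q using meas D that by auto
    have "{\<omega> \<in> space M. \<bar>g \<omega> q\<bar> < 1 / (real m + 1)} \<in> sets M" if q: "q \<in> D" for m :: nat and q
      using q by measurable
    then show ?thesis
      using D by (intro sets.sets_Collect_countable_All sets.sets_Collect_countable_Bex) auto
  qed
  finally show ?thesis .
qed

text \<open>Extensional functions form a full product with the factor \<open>{undefined}\<close>
  outside \<open>I\<close>, so Tychonoff's theorem for the topology on all functions
  applies.\<close>

lemma compact_PiE_fun:
  fixes S :: "'i \<Rightarrow> 'b::topological_space set"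
  assumes "\<And>i. i \<in> I \<Longrightarrow> compact (S i)"
  shows "compact (PiE I S)"
proof -
  have "PiE I S = PiE UNIV (\<lambda>i. if i \<in> I then S i else {undefined})"
    by (auto simp: PiE_iff extensional_def split: if_splits)
  moreover have "compactin (product_topology (\<lambda>i. euclidean) UNIV) (PiE UNIV (\<lambda>i. if i \<in> I then S i else {undefined}))"
    unfolding compactin_PiE using assms by auto
  ultimately show ?thesis by (simp add: euclidean_product_topology)
qed

lemma continuous_on_coord: "continuous_on S (\<lambda>x. x i :: 'b::topological_space)"
  by (rule continuous_on_product_then_coordinatewise) simp

section \<open>Directions close to each other\<close>

definition ip :: "'h set \<Rightarrow> ('h \<Rightarrow> real) \<Rightarrow> ('h \<Rightarrow> real) \<Rightarrow> real" where
  "ip H u v = (\<Sum>h\<in>H. u h * v h)"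

lemma ip_commute: "ip H u v = ip H v u"
  by (simp add: ip_def mult.commute)

lemma ip_cong: "(\<And>h. h \<in> H \<Longrightarrow> u h = u' h) \<Longrightarrow> (\<And>h. h \<in> H \<Longrightarrow> v h = v' h) \<Longrightarrow> ip H u v = ip H u' v'"
  by (auto simp: ip_def intro!: sum.cong)

lemma ip_scale: "ip H (\<lambda>h. a * u h) v = a * ip H u v" "ip H u (\<lambda>h. a * v h) = a * ip H u v"
  by (auto simp: ip_def sum_distrib_left mult_ac)

lemma ip_diff: "ip H (\<lambda>h. u h - w h) v = ip H u v - ip H w v" "ip H v (\<lambda>h. u h - w h) = ip H v u - ip H v w"
  by (auto simp: ip_def algebra_simps sum_subtractf)

lemma ip_self_nonneg: "0 \<le> ip H u u"
  by (auto simp: ip_def intro: sum_nonneg)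

lemma ip_self_eq_0: "finite H \<Longrightarrow> ip H u u = 0 \<longleftrightarrow> (\<forall>h\<in>H. u h = 0)"
  by (auto simp: ip_def sum_nonneg_eq_0_iff)

lemma ip_Cauchy_Schwarz: "(ip H u v)\<^sup>2 \<le> ip H u u * ip H v v"
  using Cauchy_Schwarz_ineq_sum[of u v H] by (simp add: ip_def power2_eq_square)

text \<open>The tangent of the angle between the lines of \<open>u\<close> and \<open>y\<close> is at most \<open>s\<close>.\<close>

definition near_lines :: "real \<Rightarrow> 'h set \<Rightarrow> ('h \<Rightarrow> real) \<Rightarrow> ('h \<Rightarrow> real) \<Rightarrow> bool" where
  "near_lines s H u y \<longleftrightarrow> ip H u u * ip H y y \<le> (1 + s\<^sup>2) * (ip H u y)\<^sup>2"

lemma near_lines_scale: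
  assumes "c \<noteq> 0"
  shows "near_lines s H (\<lambda>h. c * u h) y \<longleftrightarrow> near_lines s H u y"
    and "near_lines s H u (\<lambda>h. c * y h) \<longleftrightarrow> near_lines s H u y"
proof -
  have c: "c\<^sup>2 > 0" using assms by simp
  have "near_lines s H (\<lambda>h. c * u h) y \<longleftrightarrow> c\<^sup>2 * (ip H u u * ip H y y) \<le> c\<^sup>2 * ((1 + s\<^sup>2) * (ip H u y)\<^sup>2)"
    by (simp add: near_lines_def ip_scale power_mult_distrib power2_eq_square mult_ac)
  then show "near_lines s H (\<lambda>h. c * u h) y \<longleftrightarrow> near_lines s H u y"
    using c by (simp add: near_lines_def)
  have "near_lines s H u (\<lambda>h. c * y h) \<longleftrightarrow> c\<^sup>2 * (ip H u u * ip H y y) \<le> c\<^sup>2 * ((1 + s\<^sup>2) * (ip H u y)\<^sup>2)"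
    by (simp add: near_lines_def ip_scale power_mult_distrib power2_eq_square mult_ac)
  then show "near_lines s H u (\<lambda>h. c * y h) \<longleftrightarrow> near_lines s H u y"
    using c by (simp add: near_lines_def)
qed

lemma near_lines_cong:
  "(\<And>h. h \<in> H \<Longrightarrow> u h = u' h) \<Longrightarrow> (\<And>h. h \<in> H \<Longrightarrow> y h = y' h) \<Longrightarrow> near_lines s H u y = near_lines s H u' y'"
  unfolding near_lines_def
  using ip_cong[of H u u' u u'] ip_cong[of H u u' y y'] ip_cong[of H y y' y y'] by simp

text \<open>Two lines at angle at most arctan \<open>s\<close> from a common line enclose at most
  twice this angle, and \<open>(1 - s\<^sup>2) / (1 + s\<^sup>2)\<close> is the cosine of the
  doubled angle. The unit vectors are split into components along \<open>y\<close> and orthogonal to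
  it.\<close>

lemma near_lines_common:
  assumes u: "ip H u u = 1" "ip H u' u' = 1" and y: "ip H y y > 0"
    and near: "near_lines s H u y" "near_lines s H u' y"
  shows "(1 - s\<^sup>2) \<le> (1 + s\<^sup>2) * \<bar>ip H u u'\<bar>"
proof -
  define Y where "Y = ip H y y"
  define a b where "a = ip H u y" and "b = ip H u' y"
  \<comment> \<open>The squared cosine of arctan \<open>s\<close>: the components along
    \<open>y\<close> have squared length at least \<open>t\<close>, the orthogonal remainders at
    most \<open>1 - t\<close>.\<close>
  define t where "t = 1 / (1 + s\<^sup>2)"
  have s: "1 + s\<^sup>2 > 0" by (simp add: add_pos_nonneg)
  have t: "t > 0" "t \<le> 1" using s by (auto simp: t_def)
  have Y: "Y > 0" using y by (simp add: Y_def)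
  have ab: "t * Y \<le> a\<^sup>2" "t * Y \<le> b\<^sup>2"
    using near u s by (auto simp: near_lines_def a_def b_def Y_def t_def field_simps)
  define p q where "p h = u h - (a / Y) * y h" and "q h = u' h - (b / Y) * y h" for h
  have pp: "ip H p p = 1 - a\<^sup>2 / Y" and qq: "ip H q q = 1 - b\<^sup>2 / Y" and pq: "ip H p q = ip H u u' - a * b / Y"
    unfolding p_def q_def ip_diff ip_scale u ip_commute[of H y u] ip_commute[of H y u'] a_def[symmetric] b_def[symmetric] Y_def[symmetric]
    using Y by (auto simp: field_simps power2_eq_square)
  have le: "ip H p p \<le> 1 - t" "ip H q q \<le> 1 - t"
    using ab Y by (auto simp: pp qq field_simps)
  have "\<bar>ip H p q\<bar> \<le> 1 - t"
  proof -
    have "(ip H p q)\<^sup>2 \<le> ip H p p * ip H q q" by (rule ip_Cauchy_Schwarz)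
    also have "\<dots> \<le> (1 - t) * (1 - t)" using le t by (intro mult_mono ip_self_nonneg) auto
    finally show ?thesis using t by (intro power2_le_imp_le[of "\<bar>ip H p q\<bar>"]) (auto simp: power2_eq_square)
  qed
  moreover have "t \<le> \<bar>a * b / Y\<bar>"
  proof -
    have "(t * Y) * (t * Y) \<le> a\<^sup>2 * b\<^sup>2" using ab t Y by (intro mult_mono) auto
    then have "(t * Y)\<^sup>2 \<le> \<bar>a * b\<bar>\<^sup>2" by (simp add: power2_eq_square mult_ac)
    then have "t * Y \<le> \<bar>a * b\<bar>" by (rule power2_le_imp_le) simp
    then show ?thesis using Y by (simp add: field_simps)
  qed
  ultimately have "t - (1 - t) \<le> \<bar>ip H u u'\<bar>" unfolding pq by linarith
  then show ?thesis using s by (simp add: t_def field_simps)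
qed

text \<open>The case of equality in the Cauchy-Schwarz inequality.\<close>

lemma ip_unit_proportional:
  assumes "finite H" "ip H u u = 1" "ip H u' u' = 1" "\<bar>ip H u u'\<bar> \<ge> 1"
  obtains c where "c \<noteq> 0" "\<And>h. h \<in> H \<Longrightarrow> u' h = c * u h"
proof -
  define c where "c = ip H u u'"
  have "1 \<le> c\<^sup>2" using assms(4) by (metis c_def abs_one abs_square_less_1 linorder_not_le power2_abs)
  have "ip H (\<lambda>h. u' h - c * u h) (\<lambda>h. u' h - c * u h) = 1 - c\<^sup>2"
    by (simp add: ip_diff ip_scale assms ip_commute[of H u' u] c_def[symmetric] power2_eq_square)
  with \<open>1 \<le> c\<^sup>2\<close> have "ip H (\<lambda>h. u' h - c * u h) (\<lambda>h. u' h - c * u h) = 0"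
    using ip_self_nonneg[of H "\<lambda>h. u' h - c * u h"] by simp
  then have "\<forall>h\<in>H. u' h = c * u h" by (simp add: ip_self_eq_0 assms)
  moreover have "c \<noteq> 0" using \<open>1 \<le> c\<^sup>2\<close> by auto
  ultimately show thesis using that by blast
qed

text \<open>The reflection that exchanges \<open>y\<close> with the vector of the same length on the
  axis \<open>p\<close>. Symmetry is recorded because it makes the matrix its own inverse and keeps
  transposes out of the later formulas.\<close>

lemma householder:
  fixes y :: "'h \<Rightarrow> real"
  assumes [simp]: "finite H" and p: "p \<in> H"
  obtains R where "\<And>a b. R a b = R b a" "orthogonal_on H R"
    "\<And>a. a \<in> H \<Longrightarrow> (\<Sum>b\<in>H. R a b * y b) = sqrt (ip H y y) * of_bool (a = p)"
proof -
  define r where "r = sqrt (ip H y y)"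
  have rr: "r * r = ip H y y" using ip_self_nonneg[of H y] by (simp add: r_def)
  define u where "u h = y h - r * of_bool (h = p)" for h
  \<comment> \<open>If \<open>y\<close> is a nonnegative multiple of the axis vector then
    \<open>u\<close> vanishes on \<open>H\<close>, division by zero gives 0, and \<open>R\<close> is
    the identity.\<close>
  define c where "c = 2 / ip H u u"
  define R :: "'h \<Rightarrow> 'h \<Rightarrow> real" where "R a b = of_bool (a = b) - c * u a * u b" for a b
  have sumR: "(\<Sum>b\<in>H. R a b * z b) = z a - c * u a * ip H u z" if "a \<in> H" for a z
  proof -
    have "(\<Sum>b\<in>H. R a b * z b) = (\<Sum>b\<in>H. of_bool (a = b) * z b) - (\<Sum>b\<in>H. c * u a * (u b * z b))"
      by (simp add: R_def left_diff_distrib sum_subtractf mult.assoc)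
    with that show ?thesis by (simp add: ip_def sum_distrib_left)
  qed
  have sym: "R a b = R b a" for a b by (auto simp: R_def)
  have sq: "(\<Sum>c\<in>H. R a c * R c b) = of_bool (a = b)" if "a \<in> H" "b \<in> H" for a b
  proof -
    have "ip H u (\<lambda>c. R c b) = (\<Sum>c\<in>H. R b c * u c)" by (simp add: ip_def sym[of b] mult.commute)
    also have "\<dots> = u b - c * u b * ip H u u" using that by (simp add: sumR)
    finally have "(\<Sum>c\<in>H. R a c * R c b) = R a b - c * u a * (u b - c * u b * ip H u u)"
      using that by (simp add: sumR)
    also have "\<dots> = of_bool (a = b) + c * u a * u b * (c * ip H u u - 2)"
      by (simp add: R_def algebra_simps)
    also have "c * u a * u b * (c * ip H u u - 2) = 0" by (auto simp: c_def)
    finally show ?thesis by simp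
  qed
  have "(\<Sum>c\<in>H. R c a * R c b) = (\<Sum>c\<in>H. R a c * R c b)"
    "(\<Sum>c\<in>H. R a c * R b c) = (\<Sum>c\<in>H. R a c * R c b)" for a b
    by (auto intro!: sum.cong simp: sym[of _ a] sym[of b])
  then have orth: "orthogonal_on H R" unfolding orthogonal_on_def using sq by simp
  have ipp: "ip H (\<lambda>h. of_bool (h = p)) z = z p" for z
    using p by (simp add: ip_def)
  have u_eq: "u = (\<lambda>h. y h - r * of_bool (h = p))" by (intro ext) (rule u_def)
  have uy: "ip H u y = r * r - r * y p"
    by (simp only: u_eq ip_diff ip_scale ipp rr)
  have "ip H u u = ip H u y - r * ip H u (\<lambda>h. of_bool (h = p))"
    by (subst (2) u_eq) (simp only: ip_diff ip_scale)
  also have "ip H u (\<lambda>h. of_bool (h = p)) = u p" using p by (simp add: ip_def)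
  finally have uu: "ip H u u = 2 * ip H u y"
    using u_def[of p] by (simp add: uy algebra_simps)
  have "(\<Sum>b\<in>H. R a b * y b) = r * of_bool (a = p)" if a: "a \<in> H" for a
  proof (cases "ip H u u = 0")
    case True
    then have "u a = 0" using a by (simp add: ip_self_eq_0)
    moreover from this a have "(\<Sum>b\<in>H. R a b * y b) = y a" by (simp add: sumR)
    ultimately show ?thesis using u_def[of a] by linarith
  next
    case False
    then have "c * ip H u y = 1" by (simp add: c_def uu)
    then have "c * u a * ip H u y = u a" by (simp add: mult_ac)
    with a have "(\<Sum>b\<in>H. R a b * y b) = y a - u a" by (simp add: sumR)
    then show ?thesis using u_def[of a] by linarith
  qed
  then show thesis using that[OF sym orth] by (simp add: r_def)
qed

section \<open>Counting the roots by averaging\<close>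

locale multihom =
  fixes k n :: nat and ns :: "nat \<Rightarrow> nat" and \<delta> :: "nat \<Rightarrow> nat \<Rightarrow> nat"
begin

definition X :: "(nat \<times> nat) set" where
  "X = (SIGMA j:{1..k}. {..ns j})"

text \<open>Each point of the root space has \<open>2 ^ k\<close> representatives here. The set is
  compact, which makes the existence of a root with closed side conditions a measurable
  event.\<close>

definition sphere_prod :: "(nat \<times> nat \<Rightarrow> real) set" where
  "sphere_prod = {x \<in> PiE X (\<lambda>_. UNIV). \<forall>j\<in>{1..k}. ip {..ns j} (\<lambda>h. x (j, h)) (\<lambda>h. x (j, h)) = 1}"

definition near :: "real \<Rightarrow> (nat \<times> nat \<Rightarrow> real) \<Rightarrow> (nat \<times> nat \<Rightarrow> real) \<Rightarrow> bool" where
  "near s x y \<longleftrightarrow> (\<forall>j\<in>{1..k}. near_lines s {..ns j} (\<lambda>h. x (j, h)) (\<lambda>h. y (j, h)))"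

definition north :: "nat \<times> nat \<Rightarrow> real" where
  "north = (\<lambda>(j, h)\<in>X. of_bool (h = 0))"

text \<open>Stated for arbitrary functions \<open>g\<close>, since it is applied to polynomials
  given by coefficients and to those given by words. The centre \<open>y\<close> need not consist of
  unit vectors, because \<open>near\<close> is unaffected by nonzero factors in each block.\<close>

definition hit :: "real \<Rightarrow> (nat \<Rightarrow> (nat \<times> nat \<Rightarrow> real) \<Rightarrow> real) \<Rightarrow> (nat \<times> nat \<Rightarrow> real) \<Rightarrow> bool" where
  "hit s g y \<longleftrightarrow> (\<exists>x\<in>sphere_prod. (\<forall>i\<in>{1..n}. g i x = 0) \<and> near s x y)"

definition pev :: "(nat \<Rightarrow> (nat \<Rightarrow> nat \<Rightarrow> nat) \<Rightarrow> real) \<Rightarrow> nat \<Rightarrow> (nat \<times> nat \<Rightarrow> real) \<Rightarrow> real" where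
  "pev f i x = mpoly_eval k ns (\<delta> i) (f i) (\<lambda>j h. x (j, h))"

text \<open>The quantity v(\<open>s\<close>) of the overview; the choice of the point is immaterial
  by \<open>near_sphere_measure\<close>.\<close>

definition cap_measure :: "real \<Rightarrow> ennreal" where
  "cap_measure s = emeasure (gauss X) {y \<in> space (leb X). near s north y}"

definition hit_measure :: "real \<Rightarrow> (nat \<Rightarrow> (nat \<Rightarrow> nat \<Rightarrow> nat) \<Rightarrow> real) \<Rightarrow> ennreal" where
  "hit_measure s f = emeasure (gauss X) {y \<in> space (leb X). hit s (pev f) y}"

lemma finite_X [simp]: "finite X"
  by (simp add: X_def)

lemma in_X [simp]: "(j, h) \<in> X \<longleftrightarrow> 1 \<le> j \<and> j \<le> k \<and> h \<le> ns j"
  by (auto simp: X_def)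

section \<open>Rotations acting in each block of variables\<close>

definition block_matrix :: "(nat \<Rightarrow> nat \<Rightarrow> nat \<Rightarrow> real) \<Rightarrow> nat \<times> nat \<Rightarrow> nat \<times> nat \<Rightarrow> real" where
  "block_matrix R v w = (if fst v = fst w then R (fst v) (snd v) (snd w) else 0)"

lemma sum_block:
  fixes g :: "nat \<times> nat \<Rightarrow> real"
  assumes "j \<in> {1..k}"
  shows "(\<Sum>v\<in>X. if fst v = j then g v else 0) = (\<Sum>h\<le>ns j. g (j, h))"
proof -
  have "(\<Sum>v\<in>X. if fst v = j then g v else 0) = (\<Sum>j'\<in>{1..k}. \<Sum>h\<le>ns j'. if j' = j then g (j', h) else 0)"
    unfolding X_def by (subst sum.Sigma) (auto intro!: sum.cong)
  also have "\<dots> = (\<Sum>j'\<in>{1..k}. if j' = j then \<Sum>h\<le>ns j'. g (j', h) else 0)"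
    by (intro sum.cong) auto
  also have "\<dots> = (\<Sum>h\<le>ns j. g (j, h))" using assms by simp
  finally show ?thesis .
qed

lemma block_matrix_apply:
  assumes "(j, h) \<in> X"
  shows "mat_apply X (block_matrix R) x (j, h) = (\<Sum>h'\<le>ns j. R j h h' * x (j, h'))"
proof -
  have "mat_apply X (block_matrix R) x (j, h) = (\<Sum>v\<in>X. if fst v = j then R j h (snd v) * x v else 0)"
    using assms by (auto simp: mat_apply_def block_matrix_def intro!: sum.cong)
  also have "\<dots> = (\<Sum>h'\<le>ns j. R j h h' * x (j, h'))"
    using assms by (subst sum_block) auto
  finally show ?thesis .
qed

lemma orthogonal_block_matrix:
  assumes R: "\<And>j. j \<in> {1..k} \<Longrightarrow> orthogonal_on {..ns j} (R j)"
  shows "orthogonal_on X (block_matrix R)"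
proof -
  have "(\<Sum>c\<in>X. block_matrix R c (j, a) * block_matrix R c (j', b)) = of_bool ((j, a) = (j', b)) \<and>
        (\<Sum>c\<in>X. block_matrix R (j, a) c * block_matrix R (j', b) c) = of_bool ((j, a) = (j', b))"
    if "(j, a) \<in> X" "(j', b) \<in> X" for j a j' b
  proof -
    show ?thesis
    proof (cases "j = j'")
      case True
      have "(\<Sum>c\<in>X. block_matrix R c (j, a) * block_matrix R c (j', b)) =
          (\<Sum>c\<in>X. if fst c = j then R j (snd c) a * R j (snd c) b else 0)"
        "(\<Sum>c\<in>X. block_matrix R (j, a) c * block_matrix R (j', b) c) =
          (\<Sum>c\<in>X. if fst c = j then R j a (snd c) * R j b (snd c) else 0)"
        using True by (auto simp: block_matrix_def intro!: sum.cong)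
      moreover have "j \<in> {1..k}" using that by auto
      ultimately show ?thesis
        using R[of j] that True by (simp add: sum_block orthogonal_on_def)
    next
      case False
      then have "(\<Sum>c\<in>X. block_matrix R c (j, a) * block_matrix R c (j', b)) = 0"
        "(\<Sum>c\<in>X. block_matrix R (j, a) c * block_matrix R (j', b) c) = 0"
        by (auto simp: block_matrix_def intro!: sum.neutral)
      with False show ?thesis by simp
    qed
  qed
  then show ?thesis unfolding orthogonal_on_def by (intro conjI ballI) force+
qed

lemma block_ip_invariant:
  assumes R: "\<And>j. j \<in> {1..k} \<Longrightarrow> orthogonal_on {..ns j} (R j)" and j: "j \<in> {1..k}"
  shows "ip {..ns j} (\<lambda>h. mat_apply X (block_matrix R) x (j, h)) (\<lambda>h. mat_apply X (block_matrix R) y (j, h))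
    = ip {..ns j} (\<lambda>h. x (j, h)) (\<lambda>h. y (j, h))"
proof -
  have "ip {..ns j} (\<lambda>h. mat_apply X (block_matrix R) x (j, h)) (\<lambda>h. mat_apply X (block_matrix R) y (j, h))
    = (\<Sum>h\<le>ns j. (\<Sum>h'\<le>ns j. R j h h' * x (j, h')) * (\<Sum>h'\<le>ns j. R j h h' * y (j, h')))"
    using j by (simp add: ip_def block_matrix_apply)
  also have "\<dots> = ip {..ns j} (\<lambda>h. x (j, h)) (\<lambda>h. y (j, h))"
    using orthogonal_on_inner[OF _ R[OF j], of "\<lambda>h. x (j, h)" "\<lambda>h. y (j, h)"] by (simp add: ip_def)
  finally show ?thesis .
qed

lemma near_block_invariant:
  assumes "\<And>j. j \<in> {1..k} \<Longrightarrow> orthogonal_on {..ns j} (R j)"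
  shows "near s (mat_apply X (block_matrix R) x) (mat_apply X (block_matrix R) y) \<longleftrightarrow> near s x y"
  using block_ip_invariant[OF assms] by (simp add: near_def near_lines_def)

text \<open>One reflection for each block. The factor in front of \<open>north\<close> is the length
  of the block and does no harm, as nearness concerns lines.\<close>

lemma rotate_to_north:
  obtains R where "\<And>j a b. R j a b = R j b a" "\<And>j. j \<in> {1..k} \<Longrightarrow> orthogonal_on {..ns j} (R j)"
    "\<And>j h. (j, h) \<in> X \<Longrightarrow> mat_apply X (block_matrix R) z (j, h) =
       sqrt (ip {..ns j} (\<lambda>h. z (j, h)) (\<lambda>h. z (j, h))) * north (j, h)"
proof -
  have ex: "\<exists>R. (\<forall>a b. R a b = R b a) \<and> orthogonal_on {..ns j} R \<and>
    (\<forall>a\<le>ns j. (\<Sum>b\<le>ns j. R a b * z (j, b)) = sqrt (ip {..ns j} (\<lambda>h. z (j, h)) (\<lambda>h. z (j, h))) * of_bool (a = 0))" for j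
  proof -
    obtain R where "\<And>a b. R a b = R b a" "orthogonal_on {..ns j} R"
      "\<And>a. a \<in> {..ns j} \<Longrightarrow> (\<Sum>b\<le>ns j. R a b * z (j, b)) = sqrt (ip {..ns j} (\<lambda>h. z (j, h)) (\<lambda>h. z (j, h))) * of_bool (a = 0)"
      using householder[of "{..ns j}" 0 "\<lambda>h. z (j, h)"] by blast
    then show ?thesis by (intro exI[of _ R]) blast
  qed
  have "\<exists>R. \<forall>j. (\<forall>a b. R j a b = R j b a) \<and> orthogonal_on {..ns j} (R j) \<and>
    (\<forall>a\<le>ns j. (\<Sum>b\<le>ns j. R j a b * z (j, b)) = sqrt (ip {..ns j} (\<lambda>h. z (j, h)) (\<lambda>h. z (j, h))) * of_bool (a = 0))"
    by (rule choice, rule allI, rule ex)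
  then obtain R where R': "\<forall>j. (\<forall>a b. R j a b = R j b a) \<and> orthogonal_on {..ns j} (R j) \<and>
    (\<forall>a\<le>ns j. (\<Sum>b\<le>ns j. R j a b * z (j, b)) = sqrt (ip {..ns j} (\<lambda>h. z (j, h)) (\<lambda>h. z (j, h))) * of_bool (a = 0))"
    by (elim exE)
  have R1: "R j a b = R j b a" for j a b
    using conjunct1[OF spec[OF R', of j]] by blast
  have R2: "orthogonal_on {..ns j} (R j)" for j
    by (rule conjunct1[OF conjunct2[OF spec[OF R']]])
  have R3: "(\<Sum>b\<le>ns j. R j a b * z (j, b)) = sqrt (ip {..ns j} (\<lambda>h. z (j, h)) (\<lambda>h. z (j, h))) * of_bool (a = 0)"
    if "a \<le> ns j" for j a
    using conjunct2[OF conjunct2[OF spec[OF R', of j]]] that by blast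
  show thesis
  proof (rule that[of R])
    fix j h assume "(j, h) \<in> X"
    then show "mat_apply X (block_matrix R) z (j, h) = sqrt (ip {..ns j} (\<lambda>h. z (j, h)) (\<lambda>h. z (j, h))) * north (j, h)"
      using R3[of h j] by (simp add: block_matrix_apply north_def)
  qed (rule R1 R2)+
qed

lemma near_cong:
  "(\<And>v. v \<in> X \<Longrightarrow> x v = x' v) \<Longrightarrow> (\<And>v. v \<in> X \<Longrightarrow> y v = y' v) \<Longrightarrow> near s x y = near s x' y'"
  unfolding near_def by (intro ball_cong refl near_lines_cong) auto

lemma near_measurable: "{y \<in> space (leb X). near s x y} \<in> sets (leb X)"
proof -
  have "(\<lambda>y. y v) \<in> borel_measurable (leb X)" if "v \<in> X" for v using that by (rule measurable_leb_coord)
  then have "(\<lambda>y. ip {..ns j} (\<lambda>h. y (j, h)) (\<lambda>h. y (j, h))) \<in> borel_measurable (leb X)"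
    "(\<lambda>y. ip {..ns j} (\<lambda>h. x (j, h)) (\<lambda>h. y (j, h))) \<in> borel_measurable (leb X)" if "j \<in> {1..k}" for j
    using that unfolding ip_def by (auto intro!: borel_measurable_sum borel_measurable_times)
  then have "{y \<in> space (leb X). near_lines s {..ns j} (\<lambda>h. x (j, h)) (\<lambda>h. y (j, h))} \<in> sets (leb X)" if "j \<in> {1..k}" for j
    using that unfolding near_lines_def by (intro borel_measurable_le) auto
  then show ?thesis unfolding near_def by (intro sets.sets_Collect_finite_All) auto
qed

lemma emeasure_gauss_orthogonal:
  assumes "finite I" "orthogonal_on I R" "A \<in> sets (leb I)"
  shows "emeasure (gauss I) {y \<in> space (leb I). mat_apply I R y \<in> A} = emeasure (gauss I) A"
proof -
  have "mat_apply I R \<in> measurable (gauss I) (gauss I)"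
    using assms by (subst measurable_cong_sets[OF sets_gauss sets_gauss]) simp
  then have "emeasure (distr (gauss I) (gauss I) (mat_apply I R)) A = emeasure (gauss I) (mat_apply I R -` A \<inter> space (gauss I))"
    using assms by (intro emeasure_distr) (auto simp: sets_gauss)
  also have "mat_apply I R -` A \<inter> space (gauss I) = {y \<in> space (leb I). mat_apply I R y \<in> A}"
    by (auto simp: space_gauss)
  finally show ?thesis using distr_gauss_orthogonal[OF assms(1,2)] by simp
qed

lemma mat_apply_space [simp]: "mat_apply I R y \<in> space (leb I)"
  by (auto simp: mat_apply_def space_leb)

text \<open>Moving \<open>x\<close> to \<open>north\<close> by an orthogonal block matrix preserves
  nearness and the Gaussian measure.\<close>

lemma near_sphere_measure:
  assumes x: "x \<in> sphere_prod"
  shows "emeasure (gauss X) {y \<in> space (leb X). near s x y} = cap_measure s"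
proof -
  obtain R where R: "\<And>j. j \<in> {1..k} \<Longrightarrow> orthogonal_on {..ns j} (R j)"
    "\<And>j h. (j, h) \<in> X \<Longrightarrow> mat_apply X (block_matrix R) x (j, h) =
       sqrt (ip {..ns j} (\<lambda>h. x (j, h)) (\<lambda>h. x (j, h))) * north (j, h)" using rotate_to_north[of x] by metis
  have eq: "mat_apply X (block_matrix R) x v = north v" if "v \<in> X" for v
    using R(2)[of "fst v" "snd v"] that x by (cases v) (auto simp: sphere_prod_def)
  have "near s x y \<longleftrightarrow> near s north (mat_apply X (block_matrix R) y)" for y
    using near_block_invariant[OF R(1), of s x y] near_cong[of "mat_apply X (block_matrix R) x" north] eq by metis
  then have "{y \<in> space (leb X). near s x y} = {y \<in> space (leb X). mat_apply X (block_matrix R) y \<in> {y \<in> space (leb X). near s north y}}"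
    by auto
  then show ?thesis
    unfolding cap_measure_def using emeasure_gauss_orthogonal[OF finite_X orthogonal_block_matrix[OF R(1)] near_measurable[of s north]]
    by simp
qed

lemma compact_sphere_prod: "compact sphere_prod"
proof -
  have "compact (PiE X (\<lambda>_. {-1..1::real}))" by (intro compact_PiE_fun) simp
  moreover have "closed {x :: nat \<times> nat \<Rightarrow> real. \<forall>j\<in>{1..k}. ip {..ns j} (\<lambda>h. x (j, h)) (\<lambda>h. x (j, h)) = 1}"
  proof -
    have "closed {x :: nat \<times> nat \<Rightarrow> real. ip {..ns j} (\<lambda>h. x (j, h)) (\<lambda>h. x (j, h)) = 1}" for j
      unfolding ip_def by (intro closed_Collect_eq continuous_on_sum continuous_on_mult continuous_on_coord continuous_on_const)
    then have "closed (\<Inter>j\<in>{1..k}. {x :: nat \<times> nat \<Rightarrow> real. ip {..ns j} (\<lambda>h. x (j, h)) (\<lambda>h. x (j, h)) = 1})"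
      by (intro closed_INT) auto
    then show ?thesis by (simp add: INT_iff Collect_ball_eq)
  qed
  ultimately have "compact (PiE X (\<lambda>_. {-1..1::real}) \<inter> {x. \<forall>j\<in>{1..k}. ip {..ns j} (\<lambda>h. x (j, h)) (\<lambda>h. x (j, h)) = 1})"
    by (rule compact_Int_closed)
  also have "PiE X (\<lambda>_. {-1..1::real}) \<inter> {x. \<forall>j\<in>{1..k}. ip {..ns j} (\<lambda>h. x (j, h)) (\<lambda>h. x (j, h)) = 1} = sphere_prod"
  proof -
    have "\<bar>x (j, h)\<bar> \<le> 1" if "x \<in> sphere_prod" "(j, h) \<in> X" for x j h
    proof -
      have "x (j, h) * x (j, h) \<le> ip {..ns j} (\<lambda>h. x (j, h)) (\<lambda>h. x (j, h))"
        unfolding ip_def using that by (intro member_le_sum) auto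
      also have "\<dots> = 1" using that by (auto simp: sphere_prod_def)
      finally show ?thesis by (simp add: abs_square_le_1 power2_eq_square flip: power2_eq_square)
    qed
    then have "sphere_prod \<subseteq> PiE X (\<lambda>_. {-1..1})"
    proof (intro subsetI PiE_I)
      fix x v assume b: "\<And>x j h. x \<in> sphere_prod \<Longrightarrow> (j, h) \<in> X \<Longrightarrow> \<bar>x (j, h)\<bar> \<le> 1" and x: "x \<in> sphere_prod" and v: "v \<in> X"
      show "x v \<in> {-1..1}" using b[OF x, of "fst v" "snd v"] v by (auto simp: abs_le_iff)
    qed (auto simp: sphere_prod_def PiE_iff extensional_def)
    then show ?thesis by (auto simp: sphere_prod_def PiE_iff)
  qed
  finally show ?thesis .
qed

lemma pev_cong: "(\<And>v. v \<in> X \<Longrightarrow> x v = y v) \<Longrightarrow> pev f i x = pev f i y"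
  unfolding pev_def using mpoly_eval_scale[of k ns "\<lambda>j h. x (j, h)" "\<lambda>_. 1" "\<lambda>j h. y (j, h)"] by auto

section \<open>Points of the root space as classes of unit vectors\<close>

definition point :: "(nat \<times> nat \<Rightarrow> real) \<Rightarrow> nat \<Rightarrow> (nat \<Rightarrow> real) set" where
  "point x = (\<lambda>j\<in>{1..k}. proj_rel (ns j) `` {\<lambda>h\<in>{..ns j}. x (j, h)})"

lemma block_nonzero:
  assumes "ip {..ns j} (\<lambda>h. x (j, h)) (\<lambda>h. x (j, h)) \<noteq> 0"
  shows "(\<lambda>h\<in>{..ns j}. x (j, h)) \<in> nonzero_vectors (ns j)"
  using assms ip_self_eq_0[of "{..ns j}" "\<lambda>h. x (j, h)"] by (auto simp: nonzero_vectors_def)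

lemma point_in_root_space: "x \<in> sphere_prod \<Longrightarrow> point x \<in> root_space k ns"
  using block_nonzero by (auto simp: point_def root_space_def real_proj_space_def sphere_prod_def intro!: quotientI)

lemma point_representative:
  assumes x: "x \<in> sphere_prod"
  shows "(\<lambda>j\<in>{1..k}. \<lambda>h\<in>{..ns j}. x (j, h)) \<in> (\<Pi>\<^sub>E j\<in>{1..k}. point x j)"
proof -
  have "(\<lambda>h\<in>{..ns j}. x (j, h)) \<in> proj_rel (ns j) `` {\<lambda>h\<in>{..ns j}. x (j, h)}" if "j \<in> {1..k}" for j
    using equiv_class_self[OF equiv_proj_rel block_nonzero[of j x]] x that by (auto simp: sphere_prod_def)
  then show ?thesis by (auto simp: point_def)
qed

lemma point_surj:
  assumes \<zeta>: "\<zeta> \<in> root_space k ns"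
  obtains x where "x \<in> sphere_prod" "point x = \<zeta>"
proof -
  have "\<exists>u. u \<in> nonzero_vectors (ns j) \<and> ip {..ns j} u u = 1 \<and> proj_rel (ns j) `` {u} = \<zeta> j" if j: "j \<in> {1..k}" for j
  proof -
    have "\<zeta> j \<in> nonzero_vectors (ns j) // proj_rel (ns j)"
      using \<zeta> j by (auto simp: root_space_def real_proj_space_def PiE_iff)
    then obtain v where v: "v \<in> nonzero_vectors (ns j)" "\<zeta> j = proj_rel (ns j) `` {v}" by (rule quotientE)
    define r where "r = sqrt (ip {..ns j} v v)"
    have "ip {..ns j} v v \<noteq> 0" using v(1) by (auto simp: ip_self_eq_0 nonzero_vectors_def)
    then have r: "r > 0" "r * r = ip {..ns j} v v" using ip_self_nonneg[of "{..ns j}" v] by (auto simp: r_def)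
    define u where "u = (\<lambda>h\<in>{..ns j}. v h / r)"
    have u: "u \<in> nonzero_vectors (ns j)" using v(1) r by (auto simp: nonzero_vectors_def u_def)
    have "ip {..ns j} u u = ip {..ns j} (\<lambda>h. (1 / r) * v h) (\<lambda>h. (1 / r) * v h)"
      by (intro ip_cong) (auto simp: u_def)
    also have "\<dots> = (1 / r) * ((1 / r) * ip {..ns j} v v)" by (simp only: ip_scale)
    also have "\<dots> = 1" using r by (simp add: r(2)[symmetric])
    finally have "ip {..ns j} u u = 1" .
    moreover have "(u, v) \<in> proj_rel (ns j)"
      using u v r by (auto simp: proj_rel_def u_def intro!: exI[of _ r])
    then have "proj_rel (ns j) `` {u} = \<zeta> j" unfolding v(2) by (rule equiv_class_eq[OF equiv_proj_rel])
    ultimately show ?thesis using u by blast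
  qed
  then obtain u where u: "\<And>j. j \<in> {1..k} \<Longrightarrow> u j \<in> nonzero_vectors (ns j) \<and> ip {..ns j} (u j) (u j) = 1 \<and> proj_rel (ns j) `` {u j} = \<zeta> j"
    by metis
  define x where "x = (\<lambda>(j, h)\<in>X. u j h)"
  have xu: "x (j, h) = u j h" if "j \<in> {1..k}" "h \<le> ns j" for j h using that by (auto simp: x_def)
  have xu': "(\<lambda>h\<in>{..ns j}. x (j, h)) = u j" if "j \<in> {1..k}" for j
    using u[OF that] xu[OF that] by (auto simp: nonzero_vectors_def PiE_iff extensional_def fun_eq_iff)
  have "point x = \<zeta>"
  proof
    fix j
    show "point x j = \<zeta> j"
    proof (cases "j \<in> {1..k}")
      case True
      then show ?thesis using u[OF True] xu'[OF True] by (simp add: point_def)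
    next
      case False
      then show ?thesis using \<zeta> by (auto simp: point_def root_space_def PiE_iff extensional_def)
    qed
  qed
  moreover have "x \<in> sphere_prod"
  proof -
    have "ip {..ns j} (\<lambda>h. x (j, h)) (\<lambda>h. x (j, h)) = 1" if "j \<in> {1..k}" for j
      using u[OF that] xu[OF that] ip_cong[of "{..ns j}" "\<lambda>h. x (j, h)" "u j" "\<lambda>h. x (j, h)" "u j"] by simp
    moreover have "x \<in> PiE X (\<lambda>_. UNIV)" by (auto simp: x_def)
    ultimately show ?thesis by (simp add: sphere_prod_def)
  qed
  ultimately show thesis using that by blast
qed

lemma point_eq_iff:
  assumes x: "x \<in> sphere_prod" and y: "y \<in> sphere_prod"
  shows "point x = point y \<longleftrightarrow> (\<forall>j\<in>{1..k}. \<exists>c. c \<noteq> 0 \<and> (\<forall>h\<le>ns j. y (j, h) = c * x (j, h)))"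
proof -
  have "point x = point y \<longleftrightarrow> (\<forall>j\<in>{1..k}. proj_rel (ns j) `` {\<lambda>h\<in>{..ns j}. x (j, h)} = proj_rel (ns j) `` {\<lambda>h\<in>{..ns j}. y (j, h)})"
    by (auto simp: point_def fun_eq_iff)
  also have "\<dots> \<longleftrightarrow> (\<forall>j\<in>{1..k}. \<exists>c. c \<noteq> 0 \<and> (\<forall>h\<le>ns j. y (j, h) = c * x (j, h)))"
  proof (intro ball_cong refl)
    fix j assume j: "j \<in> {1..k}"
    have nz: "(\<lambda>h\<in>{..ns j}. x (j, h)) \<in> nonzero_vectors (ns j)" "(\<lambda>h\<in>{..ns j}. y (j, h)) \<in> nonzero_vectors (ns j)"
      using block_nonzero[of j x] block_nonzero[of j y] x y j by (auto simp: sphere_prod_def)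
    then have "proj_rel (ns j) `` {\<lambda>h\<in>{..ns j}. x (j, h)} = proj_rel (ns j) `` {\<lambda>h\<in>{..ns j}. y (j, h)} \<longleftrightarrow>
      (\<lambda>h\<in>{..ns j}. x (j, h), \<lambda>h\<in>{..ns j}. y (j, h)) \<in> proj_rel (ns j)"
      by (intro eq_equiv_class_iff[OF equiv_proj_rel])
    then show "(proj_rel (ns j) `` {\<lambda>h\<in>{..ns j}. x (j, h)} = proj_rel (ns j) `` {\<lambda>h\<in>{..ns j}. y (j, h)}) =
      (\<exists>c. c \<noteq> 0 \<and> (\<forall>h\<le>ns j. y (j, h) = c * x (j, h)))"
      using nz by (auto simp: proj_rel_def)
  qed
  finally show ?thesis .
qed

lemma point_root_iff:
  assumes x: "x \<in> sphere_prod"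
  shows "point x \<in> root_set k ns n \<delta> f \<longleftrightarrow> (\<forall>i\<in>{1..n}. pev f i x = 0)"
proof -
  have "vanishes_at k ns (\<delta> i) (f i) (point x) \<longleftrightarrow> pev f i x = 0" for i
  proof -
    have "vanishes_at k ns (\<delta> i) (f i) (point x) \<longleftrightarrow>
        mpoly_eval k ns (\<delta> i) (f i) (\<lambda>j\<in>{1..k}. \<lambda>h\<in>{..ns j}. x (j, h)) = 0"
      using vanishes_at_iff[OF point_in_root_space[OF x] point_representative[OF x]] .
    also have "mpoly_eval k ns (\<delta> i) (f i) (\<lambda>j\<in>{1..k}. \<lambda>h\<in>{..ns j}. x (j, h)) = pev f i x"
      unfolding pev_def using mpoly_eval_scale[of k ns "\<lambda>j\<in>{1..k}. \<lambda>h\<in>{..ns j}. x (j, h)" "\<lambda>_. 1" "\<lambda>j h. x (j, h)"] by auto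
    finally show ?thesis .
  qed
  then show ?thesis using point_in_root_space[OF x] by (simp add: root_set_def)
qed

lemma near_point_cong:
  assumes x: "x \<in> sphere_prod" and x': "x' \<in> sphere_prod" and eq: "point x = point x'"
  shows "near s x y \<longleftrightarrow> near s x' y"
  unfolding near_def
proof (intro ball_cong refl)
  fix j assume "j \<in> {1..k}"
  then obtain c where c: "c \<noteq> 0" "\<forall>h\<le>ns j. x' (j, h) = c * x (j, h)" using eq point_eq_iff[OF x x'] by blast
  have "near_lines s {..ns j} (\<lambda>h. x' (j, h)) (\<lambda>h. y (j, h)) = near_lines s {..ns j} (\<lambda>h. c * x (j, h)) (\<lambda>h. y (j, h))"
    using c by (intro near_lines_cong) auto
  then show "near_lines s {..ns j} (\<lambda>h. x (j, h)) (\<lambda>h. y (j, h)) = near_lines s {..ns j} (\<lambda>h. x' (j, h)) (\<lambda>h. y (j, h))"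
    using near_lines_scale(1)[OF c(1), of s "{..ns j}" "\<lambda>h. x (j, h)"] by simp
qed

text \<open>Any unit representative serves; by \<open>near_point_cong\<close> the neighbourhoods do
  not depend on the choice.\<close>

definition rep :: "(nat \<Rightarrow> (nat \<Rightarrow> real) set) \<Rightarrow> nat \<times> nat \<Rightarrow> real" where
  "rep \<zeta> = (SOME x. x \<in> sphere_prod \<and> point x = \<zeta>)"

lemma rep: "\<zeta> \<in> root_space k ns \<Longrightarrow> rep \<zeta> \<in> sphere_prod" "\<zeta> \<in> root_space k ns \<Longrightarrow> point (rep \<zeta>) = \<zeta>"
  using someI_ex[of "\<lambda>x. x \<in> sphere_prod \<and> point x = \<zeta>"] point_surj[of \<zeta>] by (auto simp: rep_def)

lemma hit_iff_near_root:
  "hit s (pev f) y \<longleftrightarrow> (\<exists>\<zeta>\<in>root_set k ns n \<delta> f. near s (rep \<zeta>) y)"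
proof
  assume "hit s (pev f) y"
  then obtain x where x: "x \<in> sphere_prod" "\<forall>i\<in>{1..n}. pev f i x = 0" "near s x y" by (auto simp: hit_def)
  then have "point x \<in> root_set k ns n \<delta> f" by (simp add: point_root_iff)
  moreover have "near s (rep (point x)) y"
    using near_point_cong[OF x(1), of "rep (point x)"] rep[OF point_in_root_space[OF x(1)]] x by auto
  ultimately show "\<exists>\<zeta>\<in>root_set k ns n \<delta> f. near s (rep \<zeta>) y" by blast
next
  assume "\<exists>\<zeta>\<in>root_set k ns n \<delta> f. near s (rep \<zeta>) y"
  then obtain \<zeta> where \<zeta>: "\<zeta> \<in> root_set k ns n \<delta> f" "near s (rep \<zeta>) y" by blast
  then have "\<zeta> \<in> root_space k ns" by (simp add: root_set_def)
  from rep[OF this] \<zeta> show "hit s (pev f) y" unfolding hit_def using point_root_iff[of "rep \<zeta>" f] by auto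
qed

section \<open>Null sets and measurability of the hit event\<close>

lemma continuous_on_pev: "continuous_on S (pev f i)"
  unfolding pev_def mpoly_eval_def
  by (intro continuous_on_sum continuous_on_mult continuous_on_prod continuous_on_power continuous_on_const continuous_on_coord)

lemma AE_gauss_nonzero:
  assumes "finite I" "v \<in> I"
  shows "AE y in gauss I. y v \<noteq> 0"
proof -
  have "(\<Sum>w\<in>I. of_bool (w = v) * y w) = y v" for y :: "'a \<Rightarrow> real" using assms by simp
  then have "{y \<in> space (leb I). y v = 0} \<in> null_sets (leb I)"
    using leb_hyperplane_null[OF assms(1), of "\<lambda>w. of_bool (w = v)"] assms by auto
  then have "AE y in leb I. y v \<noteq> 0" by (rule AE_I'[where N="{y \<in> space (leb I). y v = 0}"]) auto
  moreover have "(\<lambda>x. \<Prod>i\<in>I. ennreal (std_normal_density (x i))) \<in> borel_measurable (leb I)"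
    by measurable
  ultimately show ?thesis
    unfolding gauss_density[OF assms(1)] by (subst AE_density) (auto elim: eventually_mono)
qed

text \<open>All conditions on a witness are collected in one continuous function that vanishes
  exactly when they hold: absolute values for equations, positive parts for inequalities. Functions
  and centre may both depend on the outcome, as they do on product spaces.\<close>

lemma hit_measurable:
  assumes cont: "\<And>\<omega> i. \<omega> \<in> space N \<Longrightarrow> continuous_on sphere_prod (g \<omega> i)"
    and g: "\<And>i x. i \<in> {1..n} \<Longrightarrow> x \<in> sphere_prod \<Longrightarrow> (\<lambda>\<omega>. g \<omega> i x) \<in> borel_measurable N"
    and y: "\<And>v. v \<in> X \<Longrightarrow> (\<lambda>\<omega>. y \<omega> v) \<in> borel_measurable N"
  shows "{\<omega> \<in> space N. hit s (g \<omega>) (y \<omega>)} \<in> sets N"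
proof -
  define G where "G \<omega> x = (\<Sum>i\<in>{1..n}. \<bar>g \<omega> i x\<bar>) + (\<Sum>j\<in>{1..k}. max 0 (ip {..ns j} (\<lambda>h. x (j, h)) (\<lambda>h. x (j, h)) * ip {..ns j} (\<lambda>h. y \<omega> (j, h)) (\<lambda>h. y \<omega> (j, h))
     - (1 + s\<^sup>2) * (ip {..ns j} (\<lambda>h. x (j, h)) (\<lambda>h. y \<omega> (j, h)))\<^sup>2))" for \<omega> x
  have "G \<omega> x = 0 \<longleftrightarrow> (\<forall>i\<in>{1..n}. g \<omega> i x = 0) \<and> near s x (y \<omega>)" for \<omega> x
    unfolding G_def by (subst add_nonneg_eq_0_iff)
      (auto simp: near_def near_lines_def sum_nonneg sum_nonneg_eq_0_iff max_def split: if_splits)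
  then have "{\<omega> \<in> space N. hit s (g \<omega>) (y \<omega>)} = {\<omega> \<in> space N. \<exists>x\<in>sphere_prod. G \<omega> x = 0}"
    by (simp add: hit_def)
  also have "\<dots> \<in> sets N"
  proof (rule measurable_ex_compact[OF compact_sphere_prod])
    show "continuous_on sphere_prod (G \<omega>)" if "\<omega> \<in> space N" for \<omega>
      unfolding G_def ip_def using cont[OF that]
      by (intro continuous_on_add continuous_on_sum continuous_on_rabs continuous_on_max continuous_on_const continuous_on_diff
          continuous_on_mult continuous_on_power continuous_on_coord) auto
    show "(\<lambda>\<omega>. G \<omega> x) \<in> borel_measurable N" if "x \<in> sphere_prod" for x
      unfolding G_def ip_def using g[OF _ that] y
      by (intro borel_measurable_add borel_measurable_sum borel_measurable_abs borel_measurable_max borel_measurable_const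
          borel_measurable_diff borel_measurable_times borel_measurable_power) auto
  qed
  finally show ?thesis .
qed

section \<open>Comparison of the hit measure with the number of roots\<close>

lemma hit_measure_le:
  assumes pos: "cap_measure s > 0"
  shows "hit_measure s f \<le> cap_measure s * emeasure (count_space UNIV) (root_set k ns n \<delta> f)"
proof (cases "finite (root_set k ns n \<delta> f)")
  case False
  \<comment> \<open>With infinitely many roots the right-hand side is infinite, since the first
    factor is positive.\<close>
  then show ?thesis using pos by (simp add: ennreal_mult_top)
next
  case True
  let ?Z = "root_set k ns n \<delta> f"
  \<comment> \<open>The hit set is the union of the neighbourhoods of the roots, all of equal
    measure. Overlaps only decrease its measure, so the radius need not be small compared with the
    distances of the roots.\<close>
  have "{y \<in> space (leb X). hit s (pev f) y} = (\<Union>\<zeta>\<in>?Z. {y \<in> space (leb X). near s (rep \<zeta>) y})"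
    by (auto simp: hit_iff_near_root)
  then have "hit_measure s f \<le> (\<Sum>\<zeta>\<in>?Z. emeasure (gauss X) {y \<in> space (leb X). near s (rep \<zeta>) y})"
    unfolding hit_measure_def using True near_measurable
    by (auto intro!: emeasure_subadditive_finite simp: sets_gauss)
  also have "\<dots> = (\<Sum>\<zeta>\<in>?Z. cap_measure s)"
    by (intro sum.cong near_sphere_measure rep) (auto simp: root_set_def)
  also have "\<dots> = cap_measure s * emeasure (count_space UNIV) ?Z"
    using True by (simp add: mult.commute)
  finally show ?thesis .
qed

text \<open>In some block the unit representatives have inner product of absolute value
  \<open>q < 1\<close>. A common nearby line then forces \<open>s\<close> above a constant. A vector
  \<open>y\<close> that vanishes in a block counts as near to everything in that block; requiring
  \<open>y (j, 0) \<noteq> 0\<close> excludes such vectors and costs only a null set.\<close>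

lemma near_separated:
  assumes x: "x \<in> sphere_prod" and x': "x' \<in> sphere_prod" and neq: "point x \<noteq> point x'"
  obtains r where "r > 0"
    "\<And>s y. 0 < s \<Longrightarrow> s < r \<Longrightarrow> (\<And>j. j \<in> {1..k} \<Longrightarrow> y (j, 0) \<noteq> 0) \<Longrightarrow> near s x y \<Longrightarrow> near s x' y \<Longrightarrow> False"
proof -
  obtain j where j: "j \<in> {1..k}" and nex: "\<not> (\<exists>c. c \<noteq> 0 \<and> (\<forall>h\<le>ns j. x' (j, h) = c * x (j, h)))"
    using neq point_eq_iff[OF x x'] by blast
  have unit: "ip {..ns j} (\<lambda>h. x (j, h)) (\<lambda>h. x (j, h)) = 1" "ip {..ns j} (\<lambda>h. x' (j, h)) (\<lambda>h. x' (j, h)) = 1"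
    using x x' j by (auto simp: sphere_prod_def)
  define q where "q = \<bar>ip {..ns j} (\<lambda>h. x (j, h)) (\<lambda>h. x' (j, h))\<bar>"
  have "q < 1"
  proof (rule ccontr)
    assume "\<not> q < 1"
    then have "\<bar>ip {..ns j} (\<lambda>h. x (j, h)) (\<lambda>h. x' (j, h))\<bar> \<ge> 1" by (simp add: q_def)
    then obtain c where "c \<noteq> 0" "\<And>h. h \<in> {..ns j} \<Longrightarrow> x' (j, h) = c * x (j, h)"
      using ip_unit_proportional[OF finite_atMost unit] by metis
    with nex show False by auto
  qed
  moreover have "0 \<le> q" by (simp add: q_def)
  ultimately have q: "q < 1" "0 \<le> q" by auto
  \<comment> \<open>Obtained by solving \<open>1 - s\<^sup>2 \<le> (1 + s\<^sup>2) * q\<close> for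
    \<open>s\<close>.\<close>
  define r where "r = sqrt ((1 - q) / (1 + q))"
  have r: "r > 0" using q by (simp add: r_def)
  show thesis
  proof (rule that[OF r])
    fix s y assume s: "0 < s" "s < r" and nz: "\<And>j. j \<in> {1..k} \<Longrightarrow> y (j, 0) \<noteq> 0" and near: "near s x y" "near s x' y"
    have "ip {..ns j} (\<lambda>h. y (j, h)) (\<lambda>h. y (j, h)) \<noteq> 0" using nz[OF j] by (auto simp: ip_self_eq_0)
    then have "ip {..ns j} (\<lambda>h. y (j, h)) (\<lambda>h. y (j, h)) > 0" using ip_self_nonneg by (metis less_eq_real_def)
    from near_lines_common[OF unit this] have "1 - s\<^sup>2 \<le> (1 + s\<^sup>2) * q"
      using near j by (auto simp: near_def q_def)
    then have "(1 - q) / (1 + q) \<le> s\<^sup>2" using q by (simp add: field_simps)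
    then have "r \<le> s" unfolding r_def using s by (simp add: real_le_lsqrt)
    with s show False by simp
  qed
qed

text \<open>Below the smallest separation of pairs in \<open>T\<close> the neighbourhoods are
  disjoint up to a null set, so their measures add. Working with finite subsets of the roots covers
  infinite root sets too.\<close>

lemma hit_measure_ge:
  assumes T: "finite T" "T \<subseteq> root_set k ns n \<delta> f"
  obtains r where "r > 0" "\<And>s. 0 < s \<Longrightarrow> s < r \<Longrightarrow> of_nat (card T) * cap_measure s \<le> hit_measure s f"
proof -
  have T': "\<zeta> \<in> root_space k ns" if "\<zeta> \<in> T" for \<zeta> using T that by (auto simp: root_set_def)
  have "\<exists>r>0. \<forall>s y. 0 < s \<longrightarrow> s < r \<longrightarrow> (\<forall>j\<in>{1..k}. y (j, 0) \<noteq> 0) \<longrightarrow> \<not> (near s (rep \<zeta>) y \<and> near s (rep \<zeta>') y)"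
    if "\<zeta> \<in> T" "\<zeta>' \<in> T" "\<zeta> \<noteq> \<zeta>'" for \<zeta> \<zeta>'
    using near_separated[OF rep(1)[OF T'[OF that(1)]] rep(1)[OF T'[OF that(2)]]] rep(2)[OF T'] that by metis
  then obtain r where r: "\<And>\<zeta> \<zeta>'. \<zeta> \<in> T \<Longrightarrow> \<zeta>' \<in> T \<Longrightarrow> \<zeta> \<noteq> \<zeta>' \<Longrightarrow> r \<zeta> \<zeta>' > 0"
    "\<And>\<zeta> \<zeta>' s y. \<zeta> \<in> T \<Longrightarrow> \<zeta>' \<in> T \<Longrightarrow> \<zeta> \<noteq> \<zeta>' \<Longrightarrow> 0 < s \<Longrightarrow> s < r \<zeta> \<zeta>' \<Longrightarrow> (\<forall>j\<in>{1..k}. y (j, 0) \<noteq> 0) \<Longrightarrow>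
       \<not> (near s (rep \<zeta>) y \<and> near s (rep \<zeta>') y)" by metis
  \<comment> \<open>The element 1 keeps the set nonempty if \<open>T\<close> has at most one
    point.\<close>
  define r0 where "r0 = Min (insert 1 ((\<lambda>(\<zeta>, \<zeta>'). r \<zeta> \<zeta>') ` {p \<in> T \<times> T. fst p \<noteq> snd p}))"
  have fin: "finite {p \<in> T \<times> T. fst p \<noteq> snd p}" using T by auto
  have r0: "r0 > 0" unfolding r0_def using fin r(1) by (subst Min_gr_iff) auto
  have r0_le: "r0 \<le> r \<zeta> \<zeta>'" if "\<zeta> \<in> T" "\<zeta>' \<in> T" "\<zeta> \<noteq> \<zeta>'" for \<zeta> \<zeta>'
    unfolding r0_def using fin that by (intro Min_le) (auto intro!: image_eqI[of _ _ "(\<zeta>, \<zeta>')"])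
  show thesis
  proof (rule that[OF r0])
    fix s :: real assume s: "0 < s" "s < r0"
    define G where "G = {y \<in> space (leb X). \<forall>j\<in>{1..k}. y (j, 0) \<noteq> 0}"
    have G: "G \<in> sets (leb X)" unfolding G_def
      by (intro sets.sets_Collect_finite_All sets.sets_Collect_neg borel_measurable_eq measurable_leb_coord) auto
    have AE_G: "AE y in gauss X. y \<in> G"
    proof -
      have "AE y in gauss X. \<forall>j\<in>{1..k}. y (j, 0) \<noteq> 0"
        by (intro AE_finite_allI AE_gauss_nonzero) auto
      then show ?thesis using AE_space by eventually_elim (auto simp: G_def space_gauss)
    qed
    define N where "N \<zeta> = {y \<in> space (leb X). near s (rep \<zeta>) y} \<inter> G" for \<zeta>
    have N: "N \<zeta> \<in> sets (gauss X)" for \<zeta> unfolding N_def sets_gauss using near_measurable G by auto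
    have "emeasure (gauss X) (N \<zeta>) = cap_measure s" if "\<zeta> \<in> T" for \<zeta>
    proof -
      have "emeasure (gauss X) (N \<zeta>) = emeasure (gauss X) {y \<in> space (leb X). near s (rep \<zeta>) y}"
      proof (rule emeasure_eq_AE)
        show "AE y in gauss X. y \<in> N \<zeta> \<longleftrightarrow> y \<in> {y \<in> space (leb X). near s (rep \<zeta>) y}"
          using AE_G by eventually_elim (simp add: N_def)
      qed (use N near_measurable in \<open>simp_all add: sets_gauss\<close>)
      with near_sphere_measure[OF rep(1)[OF T'[OF that]]] show ?thesis by simp
    qed
    then have "of_nat (card T) * cap_measure s = (\<Sum>\<zeta>\<in>T. emeasure (gauss X) (N \<zeta>))" by simp
    also have "\<dots> = emeasure (gauss X) (\<Union>\<zeta>\<in>T. N \<zeta>)"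
    proof (rule sum_emeasure)
      show "disjoint_family_on N T"
        unfolding disjoint_family_on_def N_def G_def using r(2) r0_le s by fastforce
    qed (use N T in auto)
    also have "\<dots> \<le> hit_measure s f"
      unfolding hit_measure_def
    proof (rule emeasure_mono)
      show "(\<Union>\<zeta>\<in>T. N \<zeta>) \<subseteq> {y \<in> space (leb X). hit s (pev f) y}"
        using T by (auto simp: N_def hit_iff_near_root)
      show "{y \<in> space (leb X). hit s (pev f) y} \<in> sets (gauss X)"
        unfolding sets_gauss by (intro hit_measurable continuous_on_pev measurable_leb_coord) auto
    qed
    finally show "of_nat (card T) * cap_measure s \<le> hit_measure s f" .
  qed
qed

end

section \<open>Sums of groups of independent standard normals\<close>

lemma indep_vars_gauss_coords:
  assumes "finite I"
  shows "prob_space.indep_vars (gauss I) (\<lambda>_. borel) (\<lambda>i \<xi>. \<xi> i) I"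
proof -
  interpret prob_space "gauss I" by (rule prob_space_gauss)
  have coord: "distr (gauss I) borel (\<lambda>\<xi>. \<xi> i) = std_normal" if "i \<in> I" for i
  proof -
    have "distr (gauss I) borel (\<lambda>\<xi>. \<xi> i) = distr (gauss I) std_normal (\<lambda>\<xi>. \<xi> i)"
      by (intro distr_cong) auto
    also have "\<dots> = std_normal"
      unfolding gauss_def using that by (intro distr_PiM_component prob_space_std_normal)
    finally show ?thesis .
  qed
  have rv: "(\<lambda>\<xi>. \<xi> i) \<in> borel_measurable (gauss I)" if "i \<in> I" for i
    using measurable_leb_coord[OF that] by (simp cong: measurable_cong_sets add: sets_gauss)
  show ?thesis
  proof (cases "I = {}")
    case True
    show ?thesis unfolding indep_vars_def indep_sets_def using True by simp
  next
    case False
    have "distr (gauss I) (PiM I (\<lambda>_. borel)) (\<lambda>x. \<lambda>i\<in>I. x i) = distr (gauss I) (gauss I) (\<lambda>x. x)"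
      by (intro distr_cong) (auto simp: sets_gauss sets_leb space_gauss space_leb PiE_iff extensional_def)
    also have "\<dots> = PiM I (\<lambda>i. distr (gauss I) borel (\<lambda>\<xi>. \<xi> i))"
      unfolding distr_id by (subst (1) gauss_def, intro PiM_cong refl) (simp add: coord)
    finally show ?thesis using False rv by (subst indep_vars_iff_distr_eq_PiM') auto
  qed
qed

text \<open>Sums over disjoint groups of independent variables are independent, with the size of the
  group as variance. An empty sum is constant and has no density, hence the second condition on
  \<open>K\<close>. The lemma serves for the coefficients and again for the entries of the linear
  part.\<close>

lemma gauss_group_sums:
  assumes fin: "finite I" and K: "\<And>l. l \<in> L \<Longrightarrow> K l \<subseteq> I" "\<And>l. l \<in> L \<Longrightarrow> K l \<noteq> {}" and disj: "disjoint_family_on K L"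
  shows "prob_space.indep_vars (gauss I) (\<lambda>_. borel) (\<lambda>l \<xi>. \<Sum>p\<in>K l. \<xi> p) L"
    and "l \<in> L \<Longrightarrow> distributed (gauss I) lborel (\<lambda>\<xi>. \<Sum>p\<in>K l. \<xi> p) (normal_density 0 (sqrt (card (K l))))"
proof -
  interpret prob_space "gauss I" by (rule prob_space_gauss)
  note ind = indep_vars_gauss_coords[OF fin]
  have "indep_vars (\<lambda>_. borel) (\<lambda>l \<xi>. (\<lambda>g. \<Sum>p\<in>K l. g p) (restrict (\<lambda>i. \<xi> i) (K l))) L"
    by (rule indep_vars_compose2[OF indep_vars_restrict[OF ind K(1) disj]]) (auto intro!: borel_measurable_sum)
  then show "indep_vars (\<lambda>_. borel) (\<lambda>l \<xi>. \<Sum>p\<in>K l. \<xi> p) L"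
    by (simp cong: sum.cong)
  assume l: "l \<in> L"
  have "distributed (gauss I) lborel (\<lambda>\<xi>. \<Sum>p\<in>K l. \<xi> p) (normal_density (\<Sum>p\<in>K l. 0) (sqrt (\<Sum>p\<in>K l. 1\<^sup>2)))"
  proof (rule sum_indep_normal)
    show "indep_vars (\<lambda>_. borel) (\<lambda>p \<xi>. \<xi> p) (K l)" by (rule indep_vars_subset[OF ind K(1)[OF l]])
    show "finite (K l)" using K(1)[OF l] fin by (rule finite_subset)
    fix p assume "p \<in> K l"
    then have p: "p \<in> I" using K(1)[OF l] by auto
    have "distr (gauss I) lborel (\<lambda>\<xi>. \<xi> p) = distr (gauss I) std_normal (\<lambda>\<xi>. \<xi> p)"
      by (intro distr_cong) auto
    also have "\<dots> = std_normal"
      unfolding gauss_def using p by (intro distr_PiM_component prob_space_std_normal)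
    finally show "distributed (gauss I) lborel (\<lambda>\<xi>. \<xi> p) (normal_density 0 1)"
      unfolding distributed_def using measurable_leb_coord[OF p] by (simp cong: measurable_cong_sets add: sets_gauss)
  qed (use K(2)[OF l] in auto)
  then show "distributed (gauss I) lborel (\<lambda>\<xi>. \<Sum>p\<in>K l. \<xi> p) (normal_density 0 (sqrt (card (K l))))"
    by simp
qed

section \<open>Counting words of given content\<close>

text \<open>The multinomial coefficient, by induction on the positions: words with letter
  \<open>h\<close> at \<open>q\<close> correspond to words on \<open>P\<close> with one
  \<open>h\<close> less, and the terms add up because the exponents sum to the number of
  positions.\<close>

lemma card_words_content:
  fixes \<alpha> :: "nat \<Rightarrow> nat"
  assumes "finite P" "(\<Sum>h\<le>m. \<alpha> h) = card P"
  shows "real (card {g \<in> P \<rightarrow>\<^sub>E {..m}. \<forall>h\<le>m. card {p \<in> P. g p = h} = \<alpha> h}) = fact (card P) / (\<Prod>h\<le>m. fact (\<alpha> h))"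
  using assms
proof (induction P arbitrary: \<alpha> rule: finite_induct)
  case empty
  then have "\<forall>h\<le>m. \<alpha> h = 0" by simp
  then have "{g \<in> {} \<rightarrow>\<^sub>E {..m}. \<forall>h\<le>m. card {p \<in> {}. g p = h} = \<alpha> h} = {\<lambda>_. undefined}" by auto
  then show ?case using \<open>\<forall>h\<le>m. \<alpha> h = 0\<close> by simp
next
  case (insert q P)
  \<comment> \<open>Words on \<open>P\<close> that acquire the content \<alpha> when the letter
    \<open>h\<close> is put at \<open>q\<close>. Adding \<open>of_bool\<close> avoids truncated
    subtraction.\<close>
  define S where "S h = {g \<in> P \<rightarrow>\<^sub>E {..m}. \<forall>h'\<le>m. card {p \<in> P. g p = h'} + of_bool (h = h') = \<alpha> h'}" for h
  have cnt: "card {p \<in> insert q P. g p = h'} = card {p \<in> P. g p = h'} + of_bool (g q = h')" for g :: "'a \<Rightarrow> nat" and h'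
  proof -
    have "{p \<in> insert q P. g p = h'} = (if g q = h' then insert q {p \<in> P. g p = h'} else {p \<in> P. g p = h'})" by auto
    then show ?thesis using insert by auto
  qed
  have fix1: "{p \<in> P. (g(q := h)) p = h'} = {p \<in> P. g p = h'}" for g h h' using insert by auto
  have decomp: "{g \<in> insert q P \<rightarrow>\<^sub>E {..m}. \<forall>h\<le>m. card {p \<in> insert q P. g p = h} = \<alpha> h} = (\<Union>h\<in>{..m}. (\<lambda>g. g(q := h)) ` S h)"
    (is "?A = ?B")
  proof (intro set_eqI iffI)
    fix g assume g: "g \<in> ?A"
    have g1: "\<forall>h\<le>m. card {p \<in> P. g p = h} + of_bool (g q = h) = \<alpha> h" using g unfolding mem_Collect_eq cnt by simp
    have "g(q := undefined) \<in> P \<rightarrow>\<^sub>E {..m}" using g insert.hyps by (auto simp: PiE_iff extensional_def)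
    with g1 have "g(q := undefined) \<in> S (g q)" unfolding S_def mem_Collect_eq fix1 by simp
    moreover have "g = (g(q := undefined))(q := g q)" by auto
    moreover have "g q \<in> {..m}" using g by (auto simp: PiE_iff)
    ultimately show "g \<in> ?B" by (intro UN_I[of "g q"] image_eqI[of _ _ "g(q := undefined)"])
  next
    fix g assume "g \<in> ?B"
    then obtain h g' where h: "h \<le> m" and g': "g' \<in> S h" and g: "g = g'(q := h)" by auto
    show "g \<in> ?A" using g' h unfolding g mem_Collect_eq cnt fix1 S_def by (auto simp: PiE_iff extensional_def)
  qed
  have finS: "finite (S h)" for h unfolding S_def
    by (rule finite_subset[of _ "P \<rightarrow>\<^sub>E {..m}"], blast, rule finite_PiE[OF insert.hyps(1)]) simp
  have "card ?A = (\<Sum>h\<le>m. card ((\<lambda>g. g(q := h)) ` S h))"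
    unfolding decomp
  proof (intro card_UN_disjoint ballI impI)
    fix h h' :: nat assume "h \<noteq> h'"
    then show "(\<lambda>g. g(q := h)) ` S h \<inter> (\<lambda>g. g(q := h')) ` S h' = {}"
      by (auto dest: fun_cong[of _ _ q])
  qed (use finS in auto)
  also have "\<dots> = (\<Sum>h\<le>m. card (S h))"
  proof (intro sum.cong refl card_image inj_onI)
    fix h g g' assume "g \<in> S h" "g' \<in> S h" "g(q := h) = g'(q := h)"
    then show "g = g'" using insert.hyps
      by (auto simp: S_def PiE_iff extensional_def fun_eq_iff split: if_splits) (metis)
  qed
  finally have A: "card ?A = (\<Sum>h\<le>m. card (S h))" .
  \<comment> \<open>For a letter with \<open>\<alpha> h = 0\<close> both sides vanish, so it fits
    into the same formula.\<close>
  have S: "real (card (S h)) = real (\<alpha> h) * (fact (card P) / (\<Prod>h\<le>m. fact (\<alpha> h)))" if h: "h \<le> m" for h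
  proof (cases "\<alpha> h = 0")
    case True
    then have "S h = {}" using h unfolding S_def by auto
    then show ?thesis using True by simp
  next
    case False
    define \<beta> where "\<beta> = \<alpha>(h := \<alpha> h - 1)"
    have "S h = {g \<in> P \<rightarrow>\<^sub>E {..m}. \<forall>h\<le>m. card {p \<in> P. g p = h} = \<beta> h}"
      using False unfolding S_def \<beta>_def by (intro Collect_cong conj_cong refl all_cong) auto
    moreover have "(\<Sum>h\<le>m. \<alpha> h) = \<alpha> h + (\<Sum>h\<in>{..m}-{h}. \<alpha> h)" "(\<Sum>h\<le>m. \<beta> h) = \<beta> h + (\<Sum>h\<in>{..m}-{h}. \<beta> h)"
      using h by (auto intro!: sum.remove)
    moreover have "(\<Sum>h\<in>{..m}-{h}. \<beta> h) = (\<Sum>h\<in>{..m}-{h}. \<alpha> h)" by (intro sum.cong) (auto simp: \<beta>_def)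
    ultimately have "real (card (S h)) = fact (card P) / (\<Prod>h\<le>m. fact (\<beta> h))"
      using insert False by (simp add: \<beta>_def)
    moreover have "(\<Prod>h\<le>m. fact (\<alpha> h) :: real) = real (\<alpha> h) * (\<Prod>h\<le>m. fact (\<beta> h))"
    proof -
      have "(\<Prod>h\<le>m. fact (\<alpha> h) :: real) = fact (\<alpha> h) * (\<Prod>h\<in>{..m}-{h}. fact (\<alpha> h))"
        "(\<Prod>h\<le>m. fact (\<beta> h) :: real) = fact (\<beta> h) * (\<Prod>h\<in>{..m}-{h}. fact (\<beta> h))"
        using h by (auto intro!: prod.remove)
      moreover have "(\<Prod>h\<in>{..m}-{h}. fact (\<beta> h) :: real) = (\<Prod>h\<in>{..m}-{h}. fact (\<alpha> h))"
        by (intro prod.cong) (auto simp: \<beta>_def)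
      moreover have "(fact (\<alpha> h) :: real) = real (\<alpha> h) * fact (\<beta> h)"
        using False by (simp add: \<beta>_def fact_reduce)
      ultimately show ?thesis by simp
    qed
    ultimately show ?thesis using False by simp
  qed
  have "real (card ?A) = (\<Sum>h\<le>m. real (\<alpha> h) * (fact (card P) / (\<Prod>h\<le>m. fact (\<alpha> h))))"
    unfolding A of_nat_sum using S by (intro sum.cong) auto
  also have "\<dots> = real (\<Sum>h\<le>m. \<alpha> h) * (fact (card P) / (\<Prod>h\<le>m. fact (\<alpha> h)))"
    by (simp add: sum_distrib_right sum_divide_distrib)
  also have "\<dots> = fact (card (insert q P)) / (\<Prod>h\<le>m. fact (\<alpha> h))"
    using insert by simp
  finally show ?case .
qed

section \<open>The word model of the random system\<close>

text \<open>A word of multidegree \<open>\<delta> i\<close> picks, for each block \<open>j\<close>, one of the \<open>ns j + 1\<close> variables for each of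
  \<open>\<delta> i j\<close> positions; there are \<open>1 / eta a\<close> words with content \<open>a\<close>. In terms of words a rotation of the
  variables acts on the coefficients by a tensor power, which is orthogonal again.\<close>

context multihom
begin

definition words :: "nat \<Rightarrow> (nat \<Rightarrow> nat \<Rightarrow> nat) set" where
  "words i = (\<Pi>\<^sub>E j\<in>{1..k}. {1..\<delta> i j} \<rightarrow>\<^sub>E {..ns j})"

definition Om :: "(nat \<times> (nat \<Rightarrow> nat \<Rightarrow> nat)) set" where
  "Om = (SIGMA i:{1..n}. words i)"

text \<open>A tensor contracted with the variables, one factor for each position. Words that give
  the same monomial keep separate coefficients.\<close>

definition fld :: "(nat \<times> (nat \<Rightarrow> nat \<Rightarrow> nat) \<Rightarrow> real) \<Rightarrow> nat \<Rightarrow> (nat \<times> nat \<Rightarrow> real) \<Rightarrow> real" where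
  "fld \<xi> i x = (\<Sum>\<omega>\<in>words i. \<xi> (i, \<omega>) * (\<Prod>j\<in>{1..k}. \<Prod>p\<in>{1..\<delta> i j}. x (j, \<omega> j p)))"

definition content :: "nat \<Rightarrow> (nat \<Rightarrow> nat \<Rightarrow> nat) \<Rightarrow> nat \<Rightarrow> nat \<Rightarrow> nat" where
  "content i \<omega> = (\<lambda>j\<in>{1..k}. \<lambda>h\<in>{..ns j}. card {p \<in> {1..\<delta> i j}. \<omega> j p = h})"

text \<open>Letting the variables commute: the entries of all words with the same monomial are
  added.\<close>

definition collapse :: "(nat \<times> (nat \<Rightarrow> nat \<Rightarrow> nat) \<Rightarrow> real) \<Rightarrow> nat \<Rightarrow> (nat \<Rightarrow> nat \<Rightarrow> nat) \<Rightarrow> real" where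
  "collapse \<xi> i a = (\<Sum>\<omega>\<in>{\<omega> \<in> words i. content i \<omega> = a}. \<xi> (i, \<omega>))"

lemma finite_words [simp]: "finite (words i)"
  unfolding words_def by (intro finite_PiE) auto

lemma finite_Om [simp]: "finite Om"
  by (simp add: Om_def)

lemma words_letter: "\<omega> \<in> words i \<Longrightarrow> j \<in> {1..k} \<Longrightarrow> p \<in> {1..\<delta> i j} \<Longrightarrow> \<omega> j p \<le> ns j"
  unfolding words_def by (auto simp: PiE_iff)

lemma content_in: "\<omega> \<in> words i \<Longrightarrow> content i \<omega> \<in> multi_exps k ns (\<delta> i)"
proof -
  assume \<omega>: "\<omega> \<in> words i"
  have "(\<Sum>h\<le>ns j. card {p \<in> {1..\<delta> i j}. \<omega> j p = h}) = \<delta> i j" if j: "j \<in> {1..k}" for j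
    using sum.group[of "{1..\<delta> i j}" "{..ns j}" "\<omega> j" "\<lambda>_. 1::nat"] words_letter[OF \<omega> j] by (auto simp: image_subset_iff)
  then show ?thesis by (auto simp: content_def multi_exps_def)
qed

lemma pev_collapse: "pev (collapse \<xi>) i x = fld \<xi> i x"
proof -
  have mono: "(\<Prod>j\<in>{1..k}. \<Prod>h\<le>ns j. x (j, h) ^ content i \<omega> j h) = (\<Prod>j\<in>{1..k}. \<Prod>p\<in>{1..\<delta> i j}. x (j, \<omega> j p))"
    if \<omega>: "\<omega> \<in> words i" for \<omega>
  proof (rule prod.cong[OF refl])
    fix j assume j: "j \<in> {1..k}"
    have "(\<Prod>p\<in>{1..\<delta> i j}. x (j, \<omega> j p)) = (\<Prod>h\<le>ns j. \<Prod>p\<in>{p. p \<in> {1..\<delta> i j} \<and> \<omega> j p = h}. x (j, \<omega> j p))"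
      by (intro prod.group[symmetric]) (use words_letter[OF \<omega> j] in auto)
    also have "\<dots> = (\<Prod>h\<le>ns j. x (j, h) ^ content i \<omega> j h)"
      using j by (intro prod.cong refl) (simp add: content_def)
    finally show "(\<Prod>h\<le>ns j. x (j, h) ^ content i \<omega> j h) = (\<Prod>p\<in>{1..\<delta> i j}. x (j, \<omega> j p))" by (rule sym)
  qed
  have "pev (collapse \<xi>) i x = (\<Sum>a\<in>multi_exps k ns (\<delta> i). \<Sum>\<omega>\<in>{\<omega>. \<omega> \<in> words i \<and> content i \<omega> = a}.
      \<xi> (i, \<omega>) * (\<Prod>j\<in>{1..k}. \<Prod>h\<le>ns j. x (j, h) ^ content i \<omega> j h))"
    unfolding pev_def mpoly_eval_def collapse_def sum_distrib_right by (intro sum.cong refl) auto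
  also have "\<dots> = (\<Sum>\<omega>\<in>words i. \<xi> (i, \<omega>) * (\<Prod>j\<in>{1..k}. \<Prod>h\<le>ns j. x (j, h) ^ content i \<omega> j h))"
    using content_in by (intro sum.group finite_multi_exps) auto
  also have "\<dots> = fld \<xi> i x" unfolding fld_def using mono by (intro sum.cong) auto
  finally show ?thesis .
qed

text \<open>A word is chosen independently in each block, which yields one multinomial coefficient
  per block; their product is the reciprocal of \<open>eta\<close>.\<close>

lemma card_content:
  assumes a: "a \<in> multi_exps k ns (\<delta> i)"
  shows "real (card {\<omega> \<in> words i. content i \<omega> = a}) = inverse (eta k ns a)"
proof -
  have aj: "(\<Sum>h\<le>ns j. a j h) = \<delta> i j" if "j \<in> {1..k}" for j
    using a that by (auto simp: multi_exps_def PiE_iff)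
  have "{\<omega> \<in> words i. content i \<omega> = a} =
    (\<Pi>\<^sub>E j\<in>{1..k}. {g \<in> {1..\<delta> i j} \<rightarrow>\<^sub>E {..ns j}. \<forall>h\<le>ns j. card {p \<in> {1..\<delta> i j}. g p = h} = a j h})" (is "?A = ?B")
  proof (intro set_eqI iffI)
    fix \<omega> assume "\<omega> \<in> ?A"
    then show "\<omega> \<in> ?B" by (auto simp: words_def content_def PiE_iff)
  next
    fix \<omega> assume \<omega>: "\<omega> \<in> ?B"
    then have "\<omega> \<in> words i" by (auto simp: words_def PiE_iff)
    moreover have "content i \<omega> j h = a j h" for j h
      using \<omega> a by (cases "j \<in> {1..k}"; cases "h \<le> ns j")
        (auto simp: content_def PiE_iff multi_exps_def extensional_def)
    ultimately show "\<omega> \<in> ?A" by (auto simp: fun_eq_iff)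
  qed
  then have "real (card ?A) = (\<Prod>j\<in>{1..k}. real (card {g \<in> {1..\<delta> i j} \<rightarrow>\<^sub>E {..ns j}. \<forall>h\<le>ns j. card {p \<in> {1..\<delta> i j}. g p = h} = a j h}))"
    by (simp add: card_PiE)
  also have "\<dots> = (\<Prod>j\<in>{1..k}. fact (\<Sum>h\<le>ns j. a j h) / (\<Prod>h\<le>ns j. fact (a j h)))"
    using aj by (intro prod.cong refl) (subst card_words_content, auto)
  also have "\<dots> = inverse (eta k ns a)"
    by (simp add: eta_def prod_dividef)
  finally show ?thesis .
qed

lemma eta_pos: "0 < eta k ns a"
  unfolding eta_def by (intro prod_pos) (auto intro!: divide_pos_pos prod_pos)

text \<open>The prescribed variance is the number of words with the given content, so the standard
  Gaussian measure on \<open>Om\<close> carries a system with exactly the required law.\<close>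

lemma random_system_collapse: "random_system (gauss Om) k ns n \<delta> (\<lambda>i a \<xi>. collapse \<xi> i a)"
proof -
  interpret prob_space "gauss Om" by (rule prob_space_gauss)
  define J where "J = (SIGMA i:{1..n}. multi_exps k ns (\<delta> i))"
  define K where "K = (\<lambda>(i, a). Pair i ` {\<omega> \<in> words i. content i \<omega> = a})"
  have coll: "collapse \<xi> i a = (\<Sum>p\<in>K (i, a). \<xi> p)" for \<xi> i a
    unfolding collapse_def K_def by (simp add: sum.reindex inj_on_def)
  have card: "real (card (K (i, a))) = inverse (eta k ns a)" if "(i, a) \<in> J" for i a
    using card_content[of a i] that by (simp add: K_def J_def card_image inj_on_def)
  have K: "K l \<subseteq> Om" "K l \<noteq> {}" if "l \<in> J" for l
  proof -
    obtain i a where l: "l = (i, a)" by (cases l)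
    show "K l \<subseteq> Om" using that by (auto simp: l K_def J_def Om_def)
    have "real (card (K l)) \<noteq> 0" using card[of i a] that eta_pos[of a] by (simp add: l)
    then show "K l \<noteq> {}" by auto
  qed
  have "disjoint_family_on K J" by (auto simp: disjoint_family_on_def K_def)
  note sums = gauss_group_sums[OF finite_Om K this]
  have "indep_vars (\<lambda>_. borel) (\<lambda>(i, a). \<lambda>\<xi>. collapse \<xi> i a) J"
    using sums(1) by (simp add: coll case_prod_unfold)
  moreover have "distributed (gauss Om) lborel (\<lambda>\<xi>. collapse \<xi> i a) (normal_density 0 (sqrt (inverse (eta k ns a))))"
    if "i \<in> {1..n}" "a \<in> multi_exps k ns (\<delta> i)" for i a
    using sums(2)[of "(i, a)"] card[of i a] that by (simp add: coll J_def)
  ultimately show ?thesis unfolding random_system_def J_def using prob_space_axioms by blast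
qed

end

section \<open>Rotation invariance and reduction to a neighbourhood of one point\<close>

context multihom
begin

text \<open>The direct sum over \<open>i\<close> of the tensor products of the blocks
  \<open>R j\<close>, each repeated \<open>\<delta> i j\<close> times.\<close>

definition word_matrix where
  "word_matrix R v w = (if fst v = fst w
     then \<Prod>j\<in>{1..k}. \<Prod>p\<in>{1..\<delta> (fst v) j}. R j (snd v j p) (snd w j p) else (0::real))"

text \<open>Distributivity in the form that makes sums over words factor into one sum for each
  position.\<close>

lemma sum_words:
  fixes G :: "nat \<Rightarrow> nat \<Rightarrow> nat \<Rightarrow> real"
  shows "(\<Sum>\<omega>\<in>words i. \<Prod>j\<in>{1..k}. \<Prod>p\<in>{1..\<delta> i j}. G j p (\<omega> j p)) =
    (\<Prod>j\<in>{1..k}. \<Prod>p\<in>{1..\<delta> i j}. \<Sum>h\<le>ns j. G j p h)"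
proof -
  have "(\<Prod>j\<in>{1..k}. \<Prod>p\<in>{1..\<delta> i j}. \<Sum>h\<le>ns j. G j p h) =
    (\<Prod>j\<in>{1..k}. \<Sum>g\<in>{1..\<delta> i j} \<rightarrow>\<^sub>E {..ns j}. \<Prod>p\<in>{1..\<delta> i j}. G j p (g p))"
    by (rule prod.cong[OF refl]) (simp add: prod_sum_PiE)
  also have "\<dots> = (\<Sum>\<omega>\<in>words i. \<Prod>j\<in>{1..k}. \<Prod>p\<in>{1..\<delta> i j}. G j p (\<omega> j p))"
    unfolding words_def by (rule prod_sum_PiE) (auto intro!: finite_PiE)
  finally show ?thesis by simp
qed

lemma sum_Om:
  fixes g :: "nat \<times> (nat \<Rightarrow> nat \<Rightarrow> nat) \<Rightarrow> real"
  assumes "i \<in> {1..n}"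
  shows "(\<Sum>v\<in>Om. if fst v = i then g v else 0) = (\<Sum>\<omega>\<in>words i. g (i, \<omega>))"
proof -
  have "(\<Sum>v\<in>Om. if fst v = i then g v else 0) = (\<Sum>i'\<in>{1..n}. \<Sum>\<omega>\<in>words i'. if i' = i then g (i', \<omega>) else 0)"
    unfolding Om_def by (subst sum.Sigma) (auto intro!: sum.cong)
  also have "\<dots> = (\<Sum>i'\<in>{1..n}. if i' = i then \<Sum>\<omega>\<in>words i'. g (i', \<omega>) else 0)"
    by (intro sum.cong) auto
  also have "\<dots> = (\<Sum>\<omega>\<in>words i. g (i, \<omega>))" using assms by simp
  finally show ?thesis .
qed

lemma words_eq_iff:
  assumes "\<omega> \<in> words i" "\<omega>' \<in> words i"
  shows "\<omega> = \<omega>' \<longleftrightarrow> (\<forall>j\<in>{1..k}. \<forall>p\<in>{1..\<delta> i j}. \<omega> j p = \<omega>' j p)"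
proof
  assume eq: "\<forall>j\<in>{1..k}. \<forall>p\<in>{1..\<delta> i j}. \<omega> j p = \<omega>' j p"
  show "\<omega> = \<omega>'"
  proof (intro ext)
    fix j p
    show "\<omega> j p = \<omega>' j p"
    proof (cases "j \<in> {1..k}")
      case True
      then have "\<omega> j \<in> {1..\<delta> i j} \<rightarrow>\<^sub>E {..ns j}" "\<omega>' j \<in> {1..\<delta> i j} \<rightarrow>\<^sub>E {..ns j}"
        using assms by (auto simp: words_def PiE_iff)
      then show ?thesis using eq True by (cases "p \<in> {1..\<delta> i j}") (auto simp: PiE_iff extensional_def)
    next
      case False
      then show ?thesis using assms by (auto simp: words_def PiE_iff extensional_def)
    qed
  qed
qed auto

text \<open>The inner product of two columns factors over the positions into inner products of
  columns of the blocks, each 0 or 1. Symmetry of the blocks reduces rows to columns.\<close>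

lemma orthogonal_word_matrix:
  assumes sym: "\<And>j a b. R j a b = R j b a" and R: "\<And>j. j \<in> {1..k} \<Longrightarrow> orthogonal_on {..ns j} (R j)"
  shows "orthogonal_on Om (word_matrix R)"
proof -
  have wsym: "word_matrix R v w = word_matrix R w v" for v w
    by (auto simp: word_matrix_def intro!: prod.cong sym)
  have "(\<Sum>c\<in>Om. word_matrix R c (i, a) * word_matrix R c (i', b)) = of_bool ((i, a) = (i', b))"
    if "(i, a) \<in> Om" "(i', b) \<in> Om" for i a i' b
  proof (cases "i = i'")
    case True
    have i: "i \<in> {1..n}" "a \<in> words i" "b \<in> words i" using that True by (auto simp: Om_def)
    have "(\<Sum>c\<in>Om. word_matrix R c (i, a) * word_matrix R c (i', b)) =
       (\<Sum>c\<in>Om. if fst c = i then (\<Prod>j\<in>{1..k}. \<Prod>p\<in>{1..\<delta> i j}. R j (snd c j p) (a j p) * R j (snd c j p) (b j p)) else 0)"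
      using True by (auto simp: word_matrix_def prod.distrib intro!: sum.cong)
    also have "\<dots> = (\<Sum>\<omega>\<in>words i. \<Prod>j\<in>{1..k}. \<Prod>p\<in>{1..\<delta> i j}. R j (\<omega> j p) (a j p) * R j (\<omega> j p) (b j p))"
      using i by (subst sum_Om) auto
    also have "\<dots> = (\<Prod>j\<in>{1..k}. \<Prod>p\<in>{1..\<delta> i j}. \<Sum>h\<le>ns j. R j h (a j p) * R j h (b j p))"
      by (rule sum_words)
    also have "\<dots> = (\<Prod>j\<in>{1..k}. \<Prod>p\<in>{1..\<delta> i j}. of_bool (a j p = b j p))"
    proof (intro prod.cong refl)
      fix j p assume "j \<in> {1..k}" "p \<in> {1..\<delta> i j}"
      then show "(\<Sum>h\<le>ns j. R j h (a j p) * R j h (b j p)) = of_bool (a j p = b j p)"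
        using R[of j] words_letter[of a i j p] words_letter[of b i j p] i by (auto simp: orthogonal_on_def)
    qed
    also have "\<dots> = of_bool (a = b)"
      unfolding words_eq_iff[OF i(2,3)] by (auto simp: of_bool_def intro!: prod.neutral)
    finally show ?thesis using True by simp
  next
    case False
    then have "(\<Sum>c\<in>Om. word_matrix R c (i, a) * word_matrix R c (i', b)) = 0"
      by (auto simp: word_matrix_def intro!: sum.neutral)
    with False show ?thesis by simp
  qed
  then have 1: "\<forall>v\<in>Om. \<forall>w\<in>Om. (\<Sum>c\<in>Om. word_matrix R c v * word_matrix R c w) = of_bool (v = w)"
    by force
  moreover have "(\<Sum>c\<in>Om. word_matrix R v c * word_matrix R w c) = (\<Sum>c\<in>Om. word_matrix R c v * word_matrix R c w)" for v w
    by (intro sum.cong refl arg_cong2[where f="(*)"] wsym)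
  ultimately show ?thesis unfolding orthogonal_on_def by simp
qed

text \<open>Contracting a tensor with rotated vectors is contracting the rotated tensor with the
  original vectors. Symmetry of \<open>R\<close> removes the transpose that would otherwise
  appear.\<close>

lemma fld_rotate:
  assumes sym: "\<And>j a b. R j a b = R j b a" and i: "i \<in> {1..n}"
  shows "fld \<xi> i (mat_apply X (block_matrix R) x) = fld (mat_apply Om (word_matrix R) \<xi>) i x"
proof -
  have mono: "(\<Prod>j\<in>{1..k}. \<Prod>p\<in>{1..\<delta> i j}. mat_apply X (block_matrix R) x (j, \<omega> j p)) =
      (\<Sum>\<omega>'\<in>words i. word_matrix R (i, \<omega>') (i, \<omega>) * (\<Prod>j\<in>{1..k}. \<Prod>p\<in>{1..\<delta> i j}. x (j, \<omega>' j p)))"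
    if \<omega>: "\<omega> \<in> words i" for \<omega>
  proof -
    have "(\<Prod>j\<in>{1..k}. \<Prod>p\<in>{1..\<delta> i j}. mat_apply X (block_matrix R) x (j, \<omega> j p)) =
      (\<Prod>j\<in>{1..k}. \<Prod>p\<in>{1..\<delta> i j}. \<Sum>h\<le>ns j. R j h (\<omega> j p) * x (j, h))"
    proof (intro prod.cong refl)
      fix j p assume "j \<in> {1..k}" "p \<in> {1..\<delta> i j}"
      then show "mat_apply X (block_matrix R) x (j, \<omega> j p) = (\<Sum>h\<le>ns j. R j h (\<omega> j p) * x (j, h))"
        using words_letter[OF \<omega>, of j p] sym[of j "\<omega> j p"] by (subst block_matrix_apply) auto
    qed
    also have "\<dots> = (\<Sum>\<omega>'\<in>words i. \<Prod>j\<in>{1..k}. \<Prod>p\<in>{1..\<delta> i j}. R j (\<omega>' j p) (\<omega> j p) * x (j, \<omega>' j p))"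
      by (rule sum_words[symmetric])
    also have "\<dots> = (\<Sum>\<omega>'\<in>words i. word_matrix R (i, \<omega>') (i, \<omega>) * (\<Prod>j\<in>{1..k}. \<Prod>p\<in>{1..\<delta> i j}. x (j, \<omega>' j p)))"
      by (simp add: word_matrix_def prod.distrib)
    finally show ?thesis .
  qed
  have coef: "mat_apply Om (word_matrix R) \<xi> (i, \<omega>') = (\<Sum>\<omega>\<in>words i. word_matrix R (i, \<omega>') (i, \<omega>) * \<xi> (i, \<omega>))"
    if "\<omega>' \<in> words i" for \<omega>'
  proof -
    have "mat_apply Om (word_matrix R) \<xi> (i, \<omega>') = (\<Sum>v\<in>Om. if fst v = i then word_matrix R (i, \<omega>') v * \<xi> v else 0)"
      using i that by (auto simp: mat_apply_def Om_def word_matrix_def intro!: sum.cong)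
    then show ?thesis using i by (simp add: sum_Om)
  qed
  have "fld \<xi> i (mat_apply X (block_matrix R) x) = (\<Sum>\<omega>\<in>words i. \<Sum>\<omega>'\<in>words i.
      \<xi> (i, \<omega>) * (word_matrix R (i, \<omega>') (i, \<omega>) * (\<Prod>j\<in>{1..k}. \<Prod>p\<in>{1..\<delta> i j}. x (j, \<omega>' j p))))"
    unfolding fld_def sum_distrib_left[symmetric] using mono by (intro sum.cong) auto
  also have "\<dots> = (\<Sum>\<omega>'\<in>words i. (\<Sum>\<omega>\<in>words i. word_matrix R (i, \<omega>') (i, \<omega>) * \<xi> (i, \<omega>)) * (\<Prod>j\<in>{1..k}. \<Prod>p\<in>{1..\<delta> i j}. x (j, \<omega>' j p)))"
    unfolding sum_distrib_right by (subst sum.swap) (simp add: mult_ac)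
  also have "\<dots> = fld (mat_apply Om (word_matrix R) \<xi>) i x"
    unfolding fld_def using coef by (intro sum.cong) auto
  finally show ?thesis .
qed

section \<open>The probability of a root near a given point\<close>

lemma fld_cong: "(\<And>v. v \<in> X \<Longrightarrow> x v = y v) \<Longrightarrow> fld \<xi> i x = fld \<xi> i y"
  unfolding pev_collapse[symmetric] by (rule pev_cong)

lemma continuous_on_fld: "continuous_on S (fld \<xi> i)"
  unfolding pev_collapse[symmetric] by (rule continuous_on_pev)

lemma measurable_fld [measurable]: "i \<in> {1..n} \<Longrightarrow> (\<lambda>\<xi>. fld \<xi> i x) \<in> borel_measurable (leb Om)"
  unfolding fld_def
  by (intro borel_measurable_sum borel_measurable_times measurable_leb_coord borel_measurable_const) (auto simp: Om_def)

text \<open>The quantity p(\<open>s\<close>) of the overview.\<close>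

definition hit_prob :: "real \<Rightarrow> ennreal" where
  "hit_prob s = emeasure (gauss Om) {\<xi> \<in> space (leb Om). hit s (fld \<xi>) north}"

lemma hit_fld_measurable: "{\<xi> \<in> space (leb Om). hit s (fld \<xi>) y} \<in> sets (leb Om)"
  by (intro hit_measurable continuous_on_fld measurable_fld) auto

lemma block_matrix_involution:
  assumes sym: "\<And>j a b. R j a b = R j b a" and R: "\<And>j. j \<in> {1..k} \<Longrightarrow> orthogonal_on {..ns j} (R j)" and v: "v \<in> X"
  shows "mat_apply X (block_matrix R) (mat_apply X (block_matrix R) x) v = x v"
proof -
  have bsym: "block_matrix R v w = block_matrix R w v" for v w by (auto simp: block_matrix_def sym)
  have "mat_apply X (block_matrix R) (mat_apply X (block_matrix R) x) v =
    (\<Sum>c\<in>X. block_matrix R c v * (\<Sum>b\<in>X. block_matrix R c b * x b))"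
    using v by (simp add: mat_apply_def bsym[of v] cong: sum.cong)
  also have "\<dots> = x v" using orthogonal_on_cancel(1)[OF finite_X orthogonal_block_matrix[OF R] v] .
  finally show ?thesis .
qed

lemma mat_apply_sphere_prod:
  assumes R: "\<And>j. j \<in> {1..k} \<Longrightarrow> orthogonal_on {..ns j} (R j)" and x: "x \<in> sphere_prod"
  shows "mat_apply X (block_matrix R) x \<in> sphere_prod"
  using block_ip_invariant[OF R] x by (auto simp: sphere_prod_def mat_apply_def)

text \<open>Reflections that take each block of \<open>y\<close> to a multiple of
  \<open>north\<close> carry roots near \<open>y\<close> to roots near \<open>north\<close>, and act
  on the coefficients by an orthogonal matrix. The blocks of \<open>y\<close> must not vanish, since
  they have to span lines.\<close>

lemma hit_rotate:
  assumes y: "\<And>j. j \<in> {1..k} \<Longrightarrow> y (j, 0) \<noteq> 0"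
  obtains Q where "orthogonal_on Om Q" "\<And>\<xi>. hit s (fld \<xi>) y \<longleftrightarrow> hit s (fld (mat_apply Om Q \<xi>)) north"
proof -
  obtain R where sym: "\<And>j a b. R j a b = R j b a" and R: "\<And>j. j \<in> {1..k} \<Longrightarrow> orthogonal_on {..ns j} (R j)"
    and Ry: "\<And>j h. (j, h) \<in> X \<Longrightarrow> mat_apply X (block_matrix R) y (j, h) =
       sqrt (ip {..ns j} (\<lambda>h. y (j, h)) (\<lambda>h. y (j, h))) * north (j, h)" by (rule rotate_to_north[of y], rule that)
  let ?S = "mat_apply X (block_matrix R)"
  have near: "near s (?S x) y \<longleftrightarrow> near s x north" for x
  proof -
    have "near s (?S x) y \<longleftrightarrow> near s (?S (?S x)) (?S y)" using near_block_invariant[OF R] by blast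
    also have "\<dots> \<longleftrightarrow> near s x (?S y)" by (intro near_cong block_matrix_involution sym R refl)
    also have "\<dots> \<longleftrightarrow> near s x north"
      unfolding near_def
    proof (intro ball_cong refl)
      fix j assume j: "j \<in> {1..k}"
      define r where "r = sqrt (ip {..ns j} (\<lambda>h. y (j, h)) (\<lambda>h. y (j, h)))"
      have "ip {..ns j} (\<lambda>h. y (j, h)) (\<lambda>h. y (j, h)) \<noteq> 0" using y[OF j] by (auto simp: ip_self_eq_0)
      then have r: "r \<noteq> 0" by (simp add: r_def)
      have "near_lines s {..ns j} (\<lambda>h. x (j, h)) (\<lambda>h. ?S y (j, h)) = near_lines s {..ns j} (\<lambda>h. x (j, h)) (\<lambda>h. r * north (j, h))"
        using Ry j by (intro near_lines_cong) (auto simp: r_def)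
      then show "near_lines s {..ns j} (\<lambda>h. x (j, h)) (\<lambda>h. ?S y (j, h)) = near_lines s {..ns j} (\<lambda>h. x (j, h)) (\<lambda>h. north (j, h))"
        using near_lines_scale(2)[OF r, of s "{..ns j}" "\<lambda>h. x (j, h)" "\<lambda>h. north (j, h)"] by simp
    qed
    finally show ?thesis .
  qed
  show thesis
  proof (rule that[OF orthogonal_word_matrix[OF sym R]])
    fix \<xi>
    show "hit s (fld \<xi>) y \<longleftrightarrow> hit s (fld (mat_apply Om (word_matrix R) \<xi>)) north"
    proof
      assume "hit s (fld \<xi>) y"
      then obtain x where x: "x \<in> sphere_prod" "\<forall>i\<in>{1..n}. fld \<xi> i x = 0" "near s x y" by (auto simp: hit_def)
      have xx: "?S (?S x) v = x v" if "v \<in> X" for v using block_matrix_involution[OF sym R that] .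
      have "fld (mat_apply Om (word_matrix R) \<xi>) i (?S x) = 0" if "i \<in> {1..n}" for i
        using fld_rotate[where R=R and \<xi>=\<xi> and x="?S x", OF sym that] fld_cong[where x="?S (?S x)" and y=x] xx x(2) that by simp
      moreover have "near s (?S x) north" using near[of "?S x"] near_cong[where x="?S (?S x)" and x'=x and y=y and y'=y and s=s] xx x(3) by simp
      ultimately show "hit s (fld (mat_apply Om (word_matrix R) \<xi>)) north"
        unfolding hit_def using mat_apply_sphere_prod[OF R x(1)] by blast
    next
      assume "hit s (fld (mat_apply Om (word_matrix R) \<xi>)) north"
      then obtain x where x: "x \<in> sphere_prod" "\<forall>i\<in>{1..n}. fld (mat_apply Om (word_matrix R) \<xi>) i x = 0" "near s x north"
        by (auto simp: hit_def)
      have "fld \<xi> i (?S x) = 0" if "i \<in> {1..n}" for i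
        using fld_rotate[where R=R and \<xi>=\<xi> and x=x, OF sym that] x(2) that by simp
      moreover have "near s (?S x) y" using near x(3) by blast
      ultimately show "hit s (fld \<xi>) y"
        unfolding hit_def using mat_apply_sphere_prod[OF R x(1)] by blast
    qed
  qed
qed

lemma hit_prob_point:
  assumes y: "\<And>j. j \<in> {1..k} \<Longrightarrow> y (j, 0) \<noteq> 0"
  shows "emeasure (gauss Om) {\<xi> \<in> space (leb Om). hit s (fld \<xi>) y} = hit_prob s"
proof -
  obtain Q where Q: "orthogonal_on Om Q" "\<And>\<xi>. hit s (fld \<xi>) y \<longleftrightarrow> hit s (fld (mat_apply Om Q \<xi>)) north"
    using hit_rotate[of y s] y by blast
  have "{\<xi> \<in> space (leb Om). hit s (fld \<xi>) y} = {\<xi> \<in> space (leb Om). mat_apply Om Q \<xi> \<in> {\<xi> \<in> space (leb Om). hit s (fld \<xi>) north}}"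
    using Q(2) by auto
  then show ?thesis
    unfolding hit_prob_def using emeasure_gauss_orthogonal[OF finite_Om Q(1) hit_fld_measurable] by simp
qed

lemma AE_gauss_blocks: "AE y in gauss X. \<forall>j\<in>{1..k}. y (j, 0) \<noteq> 0"
  by (intro AE_finite_allI AE_gauss_nonzero) auto

lemma hit_cong: "(\<And>i x. i \<in> {1..n} \<Longrightarrow> g i x = g' i x) \<Longrightarrow> hit s g y = hit s g' y"
  by (simp add: hit_def)

text \<open>Tonelli: the order of coefficients and centre is exchanged, and for almost every fixed
  centre the probability of a hit is that at \<open>north\<close>.\<close>

lemma nn_integral_hit_measure_gauss:
  "(\<integral>\<^sup>+\<xi>. hit_measure s (collapse \<xi>) \<partial>gauss Om) = hit_prob s"
proof -
  interpret A: prob_space "gauss Om" by (rule prob_space_gauss)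
  interpret B: prob_space "gauss X" by (rule prob_space_gauss)
  interpret P: pair_sigma_finite "gauss Om" "gauss X" ..
  let ?H = "{p \<in> space (gauss Om \<Otimes>\<^sub>M gauss X). hit s (fld (fst p)) (snd p)}"
  have [measurable]: "(\<lambda>p. snd p v) \<in> borel_measurable (gauss Om \<Otimes>\<^sub>M gauss X)" if "v \<in> X" for v
    using measurable_compose[OF measurable_snd, of "\<lambda>y. y v" "gauss X" borel "gauss Om"] measurable_leb_coord[OF that]
    by (simp cong: measurable_cong_sets add: sets_gauss)
  have [measurable]: "(\<lambda>p. fld (fst p) i x) \<in> borel_measurable (gauss Om \<Otimes>\<^sub>M gauss X)" if "i \<in> {1..n}" for i x
    using measurable_compose[OF measurable_fst, of "\<lambda>\<xi>. fld \<xi> i x" "gauss Om" borel "gauss X"] measurable_fld[OF that]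
    by (simp cong: measurable_cong_sets add: sets_gauss)
  have H[measurable]: "?H \<in> sets (gauss Om \<Otimes>\<^sub>M gauss X)"
    by (intro hit_measurable continuous_on_fld) auto
  have "(\<integral>\<^sup>+\<xi>. hit_measure s (collapse \<xi>) \<partial>gauss Om) = (\<integral>\<^sup>+\<xi>. \<integral>\<^sup>+y. indicator ?H (\<xi>, y) \<partial>gauss X \<partial>gauss Om)"
  proof (intro nn_integral_cong)
    fix \<xi> assume \<xi>: "\<xi> \<in> space (gauss Om)"
    have "pev (collapse \<xi>) = fld \<xi>" by (intro ext) (rule pev_collapse)
    then have "hit_measure s (collapse \<xi>) = (\<integral>\<^sup>+y. indicator {y \<in> space (leb X). hit s (fld \<xi>) y} y \<partial>gauss X)"
      unfolding hit_measure_def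
      by (subst nn_integral_indicator) (auto simp: sets_gauss intro!: hit_measurable continuous_on_fld measurable_leb_coord)
    also have "\<dots> = (\<integral>\<^sup>+y. indicator ?H (\<xi>, y) \<partial>gauss X)"
      using \<xi> by (intro nn_integral_cong) (auto simp: indicator_def space_pair_measure space_gauss)
    finally show "hit_measure s (collapse \<xi>) = (\<integral>\<^sup>+y. indicator ?H (\<xi>, y) \<partial>gauss X)" .
  qed
  also have "\<dots> = (\<integral>\<^sup>+y. \<integral>\<^sup>+\<xi>. indicator ?H (\<xi>, y) \<partial>gauss Om \<partial>gauss X)"
    by (rule P.Fubini[symmetric]) measurable
  also have "\<dots> = (\<integral>\<^sup>+y. hit_prob s \<partial>gauss X)"
  proof (rule nn_integral_cong_AE)
    show "AE y in gauss X. (\<integral>\<^sup>+\<xi>. indicator ?H (\<xi>, y) \<partial>gauss Om) = hit_prob s"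
      using AE_gauss_blocks AE_space
    proof eventually_elim
      fix y assume y: "\<forall>j\<in>{1..k}. y (j, 0) \<noteq> 0" "y \<in> space (gauss X)"
      have "(\<integral>\<^sup>+\<xi>. indicator ?H (\<xi>, y) \<partial>gauss Om) = (\<integral>\<^sup>+\<xi>. indicator {\<xi> \<in> space (leb Om). hit s (fld \<xi>) y} \<xi> \<partial>gauss Om)"
        using y by (intro nn_integral_cong) (auto simp: indicator_def space_pair_measure space_gauss)
      also have "\<dots> = hit_prob s"
        using y hit_prob_point[of y s] hit_fld_measurable[of s y] by (simp add: sets_gauss)
      finally show "(\<integral>\<^sup>+\<xi>. indicator ?H (\<xi>, y) \<partial>gauss Om) = hit_prob s" .
    qed
  qed
  also have "\<dots> = hit_prob s" by (simp add: B.emeasure_space_1)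
  finally show ?thesis .
qed

section \<open>Transfer between random systems\<close>

definition coefs :: "(nat \<times> (nat \<Rightarrow> nat \<Rightarrow> nat)) set" where
  "coefs = (SIGMA i:{1..n}. multi_exps k ns (\<delta> i))"

lemma finite_coefs [simp]: "finite coefs"
  by (simp add: coefs_def finite_multi_exps)

text \<open>Independence and the marginal laws determine the joint law of the finitely many
  coefficients. Any two random systems therefore give the same mean of \<open>hit_measure\<close>,
  whatever their probability spaces.\<close>

lemma random_system_distr:
  assumes n: "n \<ge> 1" and F: "random_system M k ns n \<delta> F"
  shows "distr M (leb coefs) (\<lambda>w. \<lambda>(i, a)\<in>coefs. F i a w) =
     PiM coefs (\<lambda>(i, a). density lborel (normal_density 0 (sqrt (inverse (eta k ns a)))))"
    and "(\<lambda>w. \<lambda>(i, a)\<in>coefs. F i a w) \<in> measurable M (leb coefs)"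
proof -
  interpret prob_space M using F by (simp add: random_system_def)
  have dist: "distributed M lborel (F i a) (normal_density 0 (sqrt (inverse (eta k ns a))))" if "(i, a) \<in> coefs" for i a
    using F that by (auto simp: random_system_def coefs_def)
  have meas: "F i a \<in> borel_measurable M" if "(i, a) \<in> coefs" for i a
    using distributed_measurable[OF dist[OF that]] by simp
  then show m: "(\<lambda>w. \<lambda>(i, a)\<in>coefs. F i a w) \<in> measurable M (leb coefs)"
    by (intro measurable_lebI) auto
  \<comment> \<open>The exponent that puts the whole degree on the variables with index 0. It shows
    that there is a coefficient at all, as required for expressing independence by a product
    law.\<close>
  have "(1, \<lambda>j\<in>{1..k}. \<lambda>h\<in>{..ns j}. if h = 0 then \<delta> 1 j else 0) \<in> coefs"
    using n by (auto simp: coefs_def multi_exps_def)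
  then have ne: "coefs \<noteq> {}" by auto
  have ind: "indep_vars (\<lambda>_. borel) (\<lambda>(i, a). F i a) coefs"
    using F by (simp add: random_system_def coefs_def)
  have "distr M (leb coefs) (\<lambda>w. \<lambda>(i, a)\<in>coefs. F i a w) = distr M (PiM coefs (\<lambda>_. borel)) (\<lambda>w. \<lambda>p\<in>coefs. (case p of (i, a) \<Rightarrow> F i a) w)"
    by (intro distr_cong) (auto simp: sets_leb case_prod_unfold)
  also have "\<dots> = PiM coefs (\<lambda>p. distr M borel (case p of (i, a) \<Rightarrow> F i a))"
    using indep_vars_iff_distr_eq_PiM'[OF ne, where M'="\<lambda>_. borel" and X="\<lambda>(i, a). F i a"] ind meas by auto
  also have "\<dots> = PiM coefs (\<lambda>(i, a). density lborel (normal_density 0 (sqrt (inverse (eta k ns a)))))"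
  proof (intro PiM_cong refl)
    fix p assume p: "p \<in> coefs"
    obtain i a where ia: "p = (i, a)" by (cases p)
    have "distr M borel (F i a) = distr M lborel (F i a)" by (intro distr_cong) auto
    then show "distr M borel (case p of (i, a) \<Rightarrow> F i a) = (case p of (i, a) \<Rightarrow> density lborel (normal_density 0 (sqrt (inverse (eta k ns a)))))"
      using distributed_distr_eq_density[OF dist[of i a]] p by (simp add: ia)
  qed
  finally show "distr M (leb coefs) (\<lambda>w. \<lambda>(i, a)\<in>coefs. F i a w) =
     PiM coefs (\<lambda>(i, a). density lborel (normal_density 0 (sqrt (inverse (eta k ns a)))))" .
qed

lemma pev_coefs_cong:
  assumes "\<And>a. (i, a) \<in> coefs \<Longrightarrow> f i a = f' i a" "i \<in> {1..n}"
  shows "pev f i x = pev f' i x"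
  unfolding pev_def mpoly_eval_def using assms by (intro sum.cong) (auto simp: coefs_def)

lemma hit_measure_coefs_cong:
  assumes "\<And>i a. (i, a) \<in> coefs \<Longrightarrow> f i a = f' i a"
  shows "hit_measure s f = hit_measure s f'"
proof -
  have "hit s (pev f) y = hit s (pev f') y" for y
    by (rule hit_cong) (rule pev_coefs_cong[OF assms])
  then show ?thesis by (simp add: hit_measure_def)
qed

text \<open>Hits form a measurable set of pairs of coefficients and centres, and the measure of its
  sections is a measurable function.\<close>

lemma hit_measure_measurable: "(\<lambda>c. hit_measure s (\<lambda>i a. c (i, a))) \<in> borel_measurable (leb coefs)"
proof -
  interpret B: prob_space "gauss X" by (rule prob_space_gauss)
  let ?H = "{p \<in> space (leb coefs \<Otimes>\<^sub>M gauss X). hit s (pev (\<lambda>i a. fst p (i, a))) (snd p)}"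
  have [measurable]: "(\<lambda>p. snd p v) \<in> borel_measurable (leb coefs \<Otimes>\<^sub>M gauss X)" if "v \<in> X" for v
    using measurable_compose[OF measurable_snd, of "\<lambda>y. y v" "gauss X" borel "leb coefs"] measurable_leb_coord[OF that]
    by (simp cong: measurable_cong_sets add: sets_gauss)
  have "(\<lambda>c. pev (\<lambda>i a. c (i, a)) i x) \<in> borel_measurable (leb coefs)" if "i \<in> {1..n}" for i x
    unfolding pev_def mpoly_eval_def using that
    by (intro borel_measurable_sum borel_measurable_times measurable_leb_coord borel_measurable_const) (auto simp: coefs_def)
  then have "(\<lambda>p. pev (\<lambda>i a. fst p (i, a)) i x) \<in> borel_measurable (leb coefs \<Otimes>\<^sub>M gauss X)" if "i \<in> {1..n}" for i x
    using measurable_compose[OF measurable_fst, of "\<lambda>c. pev (\<lambda>i a. c (i, a)) i x" "leb coefs" borel "gauss X"] that by simp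
  then have H: "?H \<in> sets (leb coefs \<Otimes>\<^sub>M gauss X)"
    by (intro hit_measurable continuous_on_pev) auto
  have "(\<lambda>c. emeasure (gauss X) (Pair c -` ?H)) \<in> borel_measurable (leb coefs)"
    by (rule B.measurable_emeasure_Pair[OF H])
  moreover have "hit_measure s (\<lambda>i a. c (i, a)) = emeasure (gauss X) (Pair c -` ?H)" if "c \<in> space (leb coefs)" for c
    unfolding hit_measure_def using that by (intro arg_cong[where f="emeasure (gauss X)"]) (auto simp: space_pair_measure space_gauss)
  ultimately show ?thesis by (simp cong: measurable_cong)
qed

lemma hit_measure_random_measurable:
  assumes n: "n \<ge> 1" and F: "random_system M k ns n \<delta> F"
  shows "(\<lambda>w. hit_measure s (\<lambda>i a. F i a w)) \<in> borel_measurable M"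
proof -
  have "(\<lambda>w. hit_measure s (\<lambda>i a. (\<lambda>(i, a)\<in>coefs. F i a w) (i, a))) \<in> borel_measurable M"
    by (rule measurable_compose[OF random_system_distr(2)[OF assms] hit_measure_measurable])
  moreover have "hit_measure s (\<lambda>i a. (\<lambda>(i, a)\<in>coefs. F i a w) (i, a)) = hit_measure s (\<lambda>i a. F i a w)" for w
    by (intro hit_measure_coefs_cong) auto
  ultimately show ?thesis by simp
qed

lemma nn_integral_hit_measure_coefs:
  assumes n: "n \<ge> 1" and F: "random_system M k ns n \<delta> F"
  shows "(\<integral>\<^sup>+w. hit_measure s (\<lambda>i a. F i a w) \<partial>M) =
    (\<integral>\<^sup>+c. hit_measure s (\<lambda>i a. c (i, a)) \<partial>PiM coefs (\<lambda>(i, a). density lborel (normal_density 0 (sqrt (inverse (eta k ns a))))))"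
proof -
  have "(\<integral>\<^sup>+w. hit_measure s (\<lambda>i a. F i a w) \<partial>M) = (\<integral>\<^sup>+w. hit_measure s (\<lambda>i a. (\<lambda>(i, a)\<in>coefs. F i a w) (i, a)) \<partial>M)"
    by (intro nn_integral_cong hit_measure_coefs_cong) auto
  also have "\<dots> = (\<integral>\<^sup>+c. hit_measure s (\<lambda>i a. c (i, a)) \<partial>distr M (leb coefs) (\<lambda>w. \<lambda>(i, a)\<in>coefs. F i a w))"
    using hit_measure_measurable by (intro nn_integral_distr[symmetric] random_system_distr(2)[OF assms]) simp
  finally show ?thesis unfolding random_system_distr(1)[OF assms] .
qed

lemma nn_integral_hit_measure:
  assumes n: "n \<ge> 1" and F: "random_system M k ns n \<delta> F"
  shows "(\<integral>\<^sup>+w. hit_measure s (\<lambda>i a. F i a w) \<partial>M) = hit_prob s"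
  using nn_integral_hit_measure_coefs[OF assms, of s] nn_integral_hit_measure_coefs[OF n random_system_collapse, of s]
    nn_integral_hit_measure_gauss[of s] by simp

end

section \<open>Zeros of a perturbed linear system\<close>

text \<open>On a compact set the residual of the linear system has a positive minimum, which a
  perturbation of order \<open>s\<close> cannot consume for small \<open>s\<close>.\<close>

lemma perturbed_zero_avoid:
  fixes H :: "real \<Rightarrow> 'i \<Rightarrow> ('v \<Rightarrow> real) \<Rightarrow> real"
  assumes [simp]: "finite I" "finite V" and C: "compact C"
    and bd: "\<And>s i \<tau>. 0 < s \<Longrightarrow> s \<le> 1 \<Longrightarrow> i \<in> I \<Longrightarrow> \<tau> \<in> C \<Longrightarrow> \<bar>H s i \<tau> - (\<Sum>v\<in>V. L i v * \<tau> v)\<bar> \<le> s * K"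
    and z: "\<not> (\<exists>\<tau>\<in>C. \<forall>i\<in>I. z i + (\<Sum>v\<in>V. L i v * \<tau> v) = 0)"
  obtains s0 where "s0 > 0" "\<And>s. 0 < s \<Longrightarrow> s < s0 \<Longrightarrow> \<not> (\<exists>\<tau>\<in>C. \<forall>i\<in>I. z i + H s i \<tau> = 0)"
proof (cases "C = {}")
  case True
  then show thesis using that[of 1] by auto
next
  case False
  define G where "G \<tau> = (\<Sum>i\<in>I. \<bar>z i + (\<Sum>v\<in>V. L i v * \<tau> v)\<bar>)" for \<tau>
  have "continuous_on C G" unfolding G_def
    by (intro continuous_on_sum continuous_on_rabs continuous_on_add continuous_on_const continuous_on_mult continuous_on_coord)
  then obtain \<tau>0 where \<tau>0: "\<tau>0 \<in> C" "\<And>\<tau>. \<tau> \<in> C \<Longrightarrow> G \<tau>0 \<le> G \<tau>"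
    using continuous_attains_inf[OF C False] by blast
  have "G \<tau>0 \<noteq> 0" using z \<tau>0(1) by (auto simp: G_def sum_nonneg_eq_0_iff)
  moreover have "G \<tau>0 \<ge> 0" by (auto simp: G_def intro: sum_nonneg)
  ultimately have pos: "G \<tau>0 > 0" by simp
  \<comment> \<open>The summand 1 makes \<open>A\<close> positive also if \<open>I\<close> is empty
    or \<open>K\<close> is 0.\<close>
  define A where "A = card I * \<bar>K\<bar> + 1"
  have A: "A > 0" by (simp add: A_def add_nonneg_pos)
  show thesis
  proof (rule that[of "min 1 (G \<tau>0 / A)"])
    show "min 1 (G \<tau>0 / A) > 0" using pos A by simp
    fix s assume s: "0 < s" "s < min 1 (G \<tau>0 / A)"
    show "\<not> (\<exists>\<tau>\<in>C. \<forall>i\<in>I. z i + H s i \<tau> = 0)"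
    proof
      assume "\<exists>\<tau>\<in>C. \<forall>i\<in>I. z i + H s i \<tau> = 0"
      then obtain \<tau> where \<tau>: "\<tau> \<in> C" "\<forall>i\<in>I. z i + H s i \<tau> = 0" by blast
      have "G \<tau> \<le> (\<Sum>i\<in>I. s * \<bar>K\<bar>)"
        unfolding G_def
      proof (intro sum_mono)
        fix i assume i: "i \<in> I"
        have "s * K \<le> s * \<bar>K\<bar>" using s by (intro mult_left_mono) auto
        moreover have "z i = - H s i \<tau>" using \<tau>(2) i by (simp add: eq_neg_iff_add_eq_0)
        moreover have "\<bar>H s i \<tau> - (\<Sum>v\<in>V. L i v * \<tau> v)\<bar> \<le> s * K" using bd s \<tau>(1) i by simp
        ultimately show "\<bar>z i + (\<Sum>v\<in>V. L i v * \<tau> v)\<bar> \<le> s * \<bar>K\<bar>" by linarith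
      qed
      also have "\<dots> \<le> s * A" using s by (simp add: A_def algebra_simps)
      also have "\<dots> < G \<tau>0" using s A by (simp add: field_simps)
      finally show False using \<tau>0(2)[OF \<tau>(1)] by simp
    qed
  qed
qed

text \<open>One step of the contraction iteration, started at a minimiser of the residual, replaces the
  iteration itself.\<close>

lemma perturbed_zero_exists:
  fixes H :: "real \<Rightarrow> 'i \<Rightarrow> ('v \<Rightarrow> real) \<Rightarrow> real"
  assumes fin[simp]: "finite I" "finite V"
    and LB: "\<And>z i. i \<in> I \<Longrightarrow> (\<Sum>v\<in>V. L i v * (\<Sum>l\<in>I. B v l * z l)) = z i"
    and BL: "\<And>t v. v \<in> V \<Longrightarrow> (\<Sum>l\<in>I. B v l * (\<Sum>v'\<in>V. L l v' * t v')) = t v"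
    and \<rho>: "\<rho> > 0" and \<tau>0: "\<tau>0 \<in> PiE V (\<lambda>_. UNIV)"
    and S: "{\<tau> \<in> PiE V (\<lambda>_. UNIV). \<forall>v\<in>V. \<bar>\<tau> v - \<tau>0 v\<bar> \<le> \<rho>} \<subseteq> C"
    and bd: "\<And>s i \<tau>. 0 < s \<Longrightarrow> s \<le> 1 \<Longrightarrow> i \<in> I \<Longrightarrow> \<tau> \<in> C \<Longrightarrow> \<bar>H s i \<tau> - (\<Sum>v\<in>V. L i v * \<tau> v)\<bar> \<le> s * K"
    and lip: "\<And>s i \<tau> \<tau>'. 0 < s \<Longrightarrow> s \<le> 1 \<Longrightarrow> i \<in> I \<Longrightarrow> \<tau> \<in> C \<Longrightarrow> \<tau>' \<in> C \<Longrightarrow>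
        \<bar>(H s i \<tau> - (\<Sum>v\<in>V. L i v * \<tau> v)) - (H s i \<tau>' - (\<Sum>v\<in>V. L i v * \<tau>' v))\<bar> \<le> s * K * (\<Sum>v\<in>V. \<bar>\<tau> v - \<tau>' v\<bar>)"
    and cont: "\<And>s i. i \<in> I \<Longrightarrow> continuous_on C (H s i)"
    and z: "\<And>i. i \<in> I \<Longrightarrow> z i + (\<Sum>v\<in>V. L i v * \<tau>0 v) = 0"
  obtains s0 where "s0 > 0" "\<And>s. 0 < s \<Longrightarrow> s < s0 \<Longrightarrow> \<exists>\<tau>\<in>C. \<forall>i\<in>I. z i + H s i \<tau> = 0"
proof -
  define S where "S = {\<tau> \<in> PiE V (\<lambda>_. UNIV). \<forall>v\<in>V. \<bar>\<tau> v - \<tau>0 v\<bar> \<le> \<rho>}"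
  have SC: "S \<subseteq> C" using S by (simp add: S_def)
  have S0: "\<tau>0 \<in> S" using \<tau>0 \<rho> by (simp add: S_def)
  have "\<bar>x - y\<bar> \<le> \<rho> \<longleftrightarrow> x \<in> {y - \<rho>..y + \<rho>}" for x y :: real by auto
  then have "S = PiE V (\<lambda>v. {\<tau>0 v - \<rho>..\<tau>0 v + \<rho>})" unfolding S_def PiE_iff set_eq_iff mem_Collect_eq by (simp, blast)
  then have Sc: "compact S" by (auto intro: compact_PiE_fun)
  define \<beta> where "\<beta> = (\<Sum>v\<in>V. \<Sum>i\<in>I. \<bar>B v i\<bar>)"
  have \<beta>: "\<beta> \<ge> 0" unfolding \<beta>_def by (intro sum_nonneg) auto
  \<comment> \<open>If \<open>s * A \<le> 1\<close>, the first summand gives contraction by the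
    factor 1/2 and the second keeps the iterates within distance \<open>\<rho>\<close> of
    \<open>\<tau>0\<close>.\<close>
  define A where "A = 2 * \<beta> * \<bar>K\<bar> + \<beta> * \<bar>K\<bar> / \<rho> + 1"
  have A: "A \<ge> 1" "2 * \<beta> * \<bar>K\<bar> \<le> A" "\<beta> * \<bar>K\<bar> / \<rho> \<le> A" using \<beta> \<rho> by (auto simp: A_def)
  show thesis
  proof (rule that[of "1 / A"])
    show "1 / A > 0" using A by simp
    fix s assume s: "0 < s" "s < 1 / A"
    have sA: "s * A \<le> 1" using s A by (simp add: field_simps)
    have s1: "s \<le> 1" 
    proof -
      have "s * 1 \<le> s * A" using A(1) s(1) by (intro mult_left_mono) auto
      with sA show ?thesis by linarith
    qed
    have half: "s * \<bar>K\<bar> * \<beta> \<le> 1 / 2"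
    proof -
      have "s * (2 * \<beta> * \<bar>K\<bar>) \<le> s * A" using A(2) s(1) by (intro mult_left_mono) auto
      with sA have "2 * (s * \<bar>K\<bar> * \<beta>) \<le> 1" by (simp add: mult_ac)
      then show ?thesis by simp
    qed
    have rho: "s * \<bar>K\<bar> * \<beta> \<le> \<rho>"
    proof -
      have "s * (\<beta> * \<bar>K\<bar> / \<rho>) \<le> s * A" using A(3) s(1) by (intro mult_left_mono) auto
      with sA have "s * (\<beta> * \<bar>K\<bar> / \<rho>) \<le> 1" by linarith
      then show ?thesis using \<rho> by (simp add: field_simps)
    qed
    define D where "D \<tau> i = H s i \<tau> - (\<Sum>v\<in>V. L i v * \<tau> v)" for \<tau> i
    have D: "\<bar>D \<tau> i\<bar> \<le> s * \<bar>K\<bar>" if "i \<in> I" "\<tau> \<in> C" for \<tau> i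
    proof -
      have "s * K \<le> s * \<bar>K\<bar>" using s by (intro mult_left_mono) auto
      with bd[OF s(1) s1 that] show ?thesis by (simp add: D_def)
    qed
    have Dl: "\<bar>D \<tau> i - D \<tau>' i\<bar> \<le> s * \<bar>K\<bar> * (\<Sum>v\<in>V. \<bar>\<tau> v - \<tau>' v\<bar>)" if "i \<in> I" "\<tau> \<in> C" "\<tau>' \<in> C" for \<tau> \<tau>' i
    proof -
      have "s * K * (\<Sum>v\<in>V. \<bar>\<tau> v - \<tau>' v\<bar>) \<le> s * \<bar>K\<bar> * (\<Sum>v\<in>V. \<bar>\<tau> v - \<tau>' v\<bar>)"
        using s by (intro mult_right_mono mult_left_mono sum_nonneg) auto
      with lip[OF s(1) s1 that] show ?thesis by (simp add: D_def)
    qed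
    define E where "E \<tau> v = (\<Sum>i\<in>I. B v i * D \<tau> i)" for \<tau> v
    \<comment> \<open>The residual multiplied by the inverse of the linear part: the deviation from
      \<open>\<tau>0\<close> up to a small error \<open>E\<close>.\<close>
    define \<Phi> where "\<Phi> \<tau> v = (\<Sum>i\<in>I. B v i * (z i + H s i \<tau>))" for \<tau> v
    have \<Phi>: "\<Phi> \<tau> v = \<tau> v - \<tau>0 v + E \<tau> v" if v: "v \<in> V" for \<tau> v
    proof -
      have "\<Phi> \<tau> v = (\<Sum>i\<in>I. B v i * (\<Sum>v'\<in>V. L i v' * (\<tau> v' - \<tau>0 v')) + B v i * D \<tau> i)"
        unfolding \<Phi>_def
      proof (intro sum.cong refl)
        fix i assume "i \<in> I"
        then have "z i = - (\<Sum>v\<in>V. L i v * \<tau>0 v)" using z by force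
        then show "B v i * (z i + H s i \<tau>) = B v i * (\<Sum>v'\<in>V. L i v' * (\<tau> v' - \<tau>0 v')) + B v i * D \<tau> i"
          by (simp add: D_def algebra_simps sum_subtractf)
      qed
      then show ?thesis using BL[OF v, of "\<lambda>v. \<tau> v - \<tau>0 v"] by (simp add: E_def sum.distrib)
    qed
    have sumE: "(\<Sum>v\<in>V. \<bar>\<Sum>i\<in>I. B v i * d i\<bar>) \<le> \<beta> * c" if d: "\<And>i. i \<in> I \<Longrightarrow> \<bar>d i\<bar> \<le> c" for d c
    proof -
      have "(\<Sum>v\<in>V. \<bar>\<Sum>i\<in>I. B v i * d i\<bar>) \<le> (\<Sum>v\<in>V. \<Sum>i\<in>I. \<bar>B v i\<bar> * c)"
        by (intro sum_mono order_trans[OF sum_abs]) (auto simp: abs_mult intro!: mult_left_mono d)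
      also have "\<dots> = \<beta> * c" by (simp add: \<beta>_def sum_distrib_right)
      finally show ?thesis .
    qed
    define F where "F \<tau> = (\<Sum>v\<in>V. \<bar>\<Phi> \<tau> v\<bar>)" for \<tau>
    have "continuous_on S F" unfolding F_def \<Phi>_def
      by (intro continuous_on_sum continuous_on_rabs continuous_on_mult continuous_on_add continuous_on_const
          continuous_on_subset[OF cont SC]) auto
    then obtain t where t: "t \<in> S" "\<And>\<tau>. \<tau> \<in> S \<Longrightarrow> F t \<le> F \<tau>"
      using continuous_attains_inf[OF Sc] S0 by blast
    \<comment> \<open>One step of the iteration. Its residual is at most half that of the minimiser
      \<open>t\<close>, so the minimum must be zero.\<close>
    define t' where "t' = (\<lambda>v\<in>V. t v - \<Phi> t v)"
    have t'v: "t' v = \<tau>0 v - E t v" if "v \<in> V" for v using that by (simp add: t'_def \<Phi>)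
    have "t' \<in> S"
    proof -
      have "\<bar>E t v\<bar> \<le> \<rho>" if "v \<in> V" for v
      proof -
        have "\<bar>E t v\<bar> \<le> (\<Sum>v\<in>V. \<bar>E t v\<bar>)" using that by (intro member_le_sum) auto
        also have "\<dots> \<le> \<beta> * (s * \<bar>K\<bar>)" unfolding E_def using t SC by (intro sumE D) auto
        finally show ?thesis using rho by (simp add: mult_ac)
      qed
      then show ?thesis by (auto simp: S_def t'v) (auto simp: t'_def)
    qed
    have "F t' = (\<Sum>v\<in>V. \<bar>\<Sum>i\<in>I. B v i * (D t' i - D t i)\<bar>)"
      unfolding F_def using \<Phi> t'v by (intro sum.cong refl) (simp add: E_def right_diff_distrib sum_subtractf)
    also have "\<dots> \<le> \<beta> * (s * \<bar>K\<bar> * (\<Sum>v\<in>V. \<bar>t' v - t v\<bar>))"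
      using t \<open>t' \<in> S\<close> SC by (intro sumE Dl) auto
    also have "(\<Sum>v\<in>V. \<bar>t' v - t v\<bar>) = F t" unfolding F_def by (intro sum.cong) (auto simp: t'_def)
    also have "\<beta> * (s * \<bar>K\<bar> * F t) \<le> 1 / 2 * F t"
      using mult_right_mono[OF half, of "F t"] by (simp add: F_def sum_nonneg mult_ac)
    finally have "F t \<le> 1 / 2 * F t" using t(2)[OF \<open>t' \<in> S\<close>] by simp
    then have "F t \<le> 0" by simp
    moreover have "F t \<ge> 0" unfolding F_def by (intro sum_nonneg) auto
    ultimately have "F t = 0" by simp
    then have \<Phi>0: "\<forall>v\<in>V. \<Phi> t v = 0" by (simp add: F_def sum_nonneg_eq_0_iff)
    have "z i + H s i t = 0" if i: "i \<in> I" for i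
      using LB[OF i, of "\<lambda>i. z i + H s i t"] \<Phi>0 by (simp add: \<Phi>_def)
    then show "\<exists>\<tau>\<in>C. \<forall>i\<in>I. z i + H s i \<tau> = 0" using t SC by blast
  qed
qed

text \<open>Countability of the index type makes the functions on it a metric space, as the
  compactness argument requires.\<close>

lemma lin_image_compact_measurable:
  fixes C :: "('v::countable \<Rightarrow> real) set"
  assumes "finite I" "finite V" "compact C"
  shows "lin_image I V L C \<in> sets (leb I)"
proof -
  have "lin_image I V L C = {z \<in> space (leb I). \<exists>t\<in>C. (\<Sum>i\<in>I. \<bar>z i - (\<Sum>j\<in>V. L i j * t j)\<bar>) = 0}"
    using assms by (auto simp: lin_image_def sum_nonneg_eq_0_iff)
  also have "\<dots> \<in> sets (leb I)"
  proof (rule measurable_ex_compact[OF assms(3)])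
    show "continuous_on C (\<lambda>t. \<Sum>i\<in>I. \<bar>z i - (\<Sum>j\<in>V. L i j * t j)\<bar>)" for z
      by (intro continuous_on_sum continuous_on_rabs continuous_on_diff continuous_on_const continuous_on_mult continuous_on_coord)
    show "(\<lambda>z. \<Sum>i\<in>I. \<bar>z i - (\<Sum>j\<in>V. L i j * t j)\<bar>) \<in> borel_measurable (leb I)" for t
      by (intro borel_measurable_sum borel_measurable_abs borel_measurable_diff measurable_leb_coord borel_measurable_const) auto
  qed
  finally show ?thesis .
qed

section \<open>Limit of the set of constant terms that admit a zero\<close>

lemma std_normal_density_0: "std_normal_density 0 = 1 / sqrt (2 * pi)"
  by (simp add: std_normal_density_def)

lemma std_normal_density_le: "std_normal_density x \<le> std_normal_density 0"
  by (simp add: std_normal_density_def divide_right_mono)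

lemma tendsto_std_normal_density: "(f \<longlongrightarrow> 0) F \<Longrightarrow> ((\<lambda>x. std_normal_density (f x)) \<longlongrightarrow> std_normal_density 0) F"
  unfolding std_normal_density_def by (intro tendsto_intros) auto

text \<open>Dominated convergence in the constant terms \<open>z\<close>. Outside the image of
  \<open>C\<close> zeros are excluded for small \<open>s\<close> by compactness; in the image of
  \<open>C0\<close> under an injective \<open>L\<close> a zero is constructed. The image of the
  boundary \<open>C - C0\<close> under an injective \<open>L\<close> is null, as is the whole image
  of a singular \<open>L\<close>. Symmetry of \<open>C\<close> and \<open>C0\<close> absorbs the
  sign in \<open>z = - L \<tau>\<close>. The second claim provides the majorant for a later
  integration over the remaining coefficients.\<close>

lemma perturbed_zero_set_limit:
  fixes H :: "real \<Rightarrow> 'i \<Rightarrow> ('v::countable \<Rightarrow> real) \<Rightarrow> real"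
  assumes fin[simp]: "finite I" "finite V" and card: "card I = card V"
    and C: "compact C" "C \<in> sets (leb V)" and C0: "C0 \<in> sets (leb V)" "C0 \<subseteq> C" "emeasure (leb V) (C - C0) = 0"
    and sym: "\<And>\<tau>. \<tau> \<in> C \<Longrightarrow> (\<lambda>v\<in>V. - \<tau> v) \<in> C" "\<And>\<tau>. \<tau> \<in> C0 \<Longrightarrow> (\<lambda>v\<in>V. - \<tau> v) \<in> C0"
    and inner: "\<And>\<tau>0. \<tau>0 \<in> C0 \<Longrightarrow> \<exists>\<rho>>0. {\<tau> \<in> PiE V (\<lambda>_. UNIV). \<forall>v\<in>V. \<bar>\<tau> v - \<tau>0 v\<bar> \<le> \<rho>} \<subseteq> C"
    and bd: "\<And>s i \<tau>. 0 < s \<Longrightarrow> s \<le> 1 \<Longrightarrow> i \<in> I \<Longrightarrow> \<tau> \<in> C \<Longrightarrow> \<bar>H s i \<tau> - (\<Sum>v\<in>V. L i v * \<tau> v)\<bar> \<le> s * K"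
    and lip: "\<And>s i \<tau> \<tau>'. 0 < s \<Longrightarrow> s \<le> 1 \<Longrightarrow> i \<in> I \<Longrightarrow> \<tau> \<in> C \<Longrightarrow> \<tau>' \<in> C \<Longrightarrow>
        \<bar>(H s i \<tau> - (\<Sum>v\<in>V. L i v * \<tau> v)) - (H s i \<tau>' - (\<Sum>v\<in>V. L i v * \<tau>' v))\<bar> \<le> s * K * (\<Sum>v\<in>V. \<bar>\<tau> v - \<tau>' v\<bar>)"
    and cont: "\<And>s i. i \<in> I \<Longrightarrow> continuous_on C (H s i)"
    and b: "\<And>s i \<tau>. 0 < s \<Longrightarrow> s \<le> 1 \<Longrightarrow> i \<in> I \<Longrightarrow> \<tau> \<in> C \<Longrightarrow> \<bar>H s i \<tau>\<bar> \<le> b"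
    and \<sigma>: "\<And>m. 0 < \<sigma> m" "\<And>m. \<sigma> m \<le> 1" "\<sigma> \<longlonglongrightarrow> 0"
  defines "u \<equiv> \<lambda>m z. ennreal (\<Prod>i\<in>I. std_normal_density (\<sigma> m * z i)) * indicator {z \<in> space (leb I). \<exists>\<tau>\<in>C. \<forall>i\<in>I. z i + H (\<sigma> m) i \<tau> = 0} z"
  shows "\<And>m. u m \<in> borel_measurable (leb I)"
    and "\<And>m. (\<integral>\<^sup>+z. u m z \<partial>leb I) \<le> ennreal (std_normal_density 0 ^ card I * (2 * b) ^ card I)"
    and "(\<lambda>m. \<integral>\<^sup>+z. u m z \<partial>leb I) \<longlonglongrightarrow> ennreal (std_normal_density 0 ^ card I) * emeasure (leb I) (lin_image I V L C)"
proof -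
  let ?\<phi> = "std_normal_density 0"
  define Z where "Z m = {z \<in> space (leb I). \<exists>\<tau>\<in>C. \<forall>i\<in>I. z i + H (\<sigma> m) i \<tau> = 0}" for m
  have u: "u m z = ennreal (\<Prod>i\<in>I. std_normal_density (\<sigma> m * z i)) * indicator (Z m) z" for m z
    by (simp add: u_def Z_def)
  have Zm: "Z m \<in> sets (leb I)" for m
  proof -
    have "Z m = {z \<in> space (leb I). \<exists>\<tau>\<in>C. (\<Sum>i\<in>I. \<bar>z i + H (\<sigma> m) i \<tau>\<bar>) = 0}"
      by (auto simp: Z_def sum_nonneg_eq_0_iff)
    also have "\<dots> \<in> sets (leb I)"
    proof (rule measurable_ex_compact[OF C(1)])
      show "continuous_on C (\<lambda>\<tau>. \<Sum>i\<in>I. \<bar>z i + H (\<sigma> m) i \<tau>\<bar>)" for z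
        by (intro continuous_on_sum continuous_on_rabs continuous_on_add continuous_on_const cont)
      show "(\<lambda>z. \<Sum>i\<in>I. \<bar>z i + H (\<sigma> m) i \<tau>\<bar>) \<in> borel_measurable (leb I)" for \<tau>
        by (intro borel_measurable_sum borel_measurable_abs borel_measurable_add measurable_leb_coord borel_measurable_const) auto
    qed
    finally show ?thesis .
  qed
  have dens: "(\<lambda>z. \<Prod>i\<in>I. std_normal_density (\<sigma> m * z i)) \<in> borel_measurable (leb I)" for m
  proof (intro borel_measurable_prod)
    fix i assume "i \<in> I"
    then have "(\<lambda>z. \<sigma> m * z i) \<in> borel_measurable (leb I)"
      by (intro borel_measurable_times borel_measurable_const measurable_leb_coord)
    then show "(\<lambda>z. std_normal_density (\<sigma> m * z i)) \<in> borel_measurable (leb I)" by measurable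
  qed
  show um: "u m \<in> borel_measurable (leb I)" for m
    unfolding u using Zm dens by (intro borel_measurable_times_ennreal borel_measurable_indicator measurable_compose[OF dens measurable_ennreal])
  define w where "w z = ennreal (?\<phi> ^ card I) * indicator (PiE I (\<lambda>_. {-b..b})) z" for z :: "'i \<Rightarrow> real"
  have box: "PiE I (\<lambda>_. {-b..b}) \<in> sets (leb I)" by (intro box_in_sets_leb) auto
  have wm: "w \<in> borel_measurable (leb I)" unfolding w_def using box by (intro borel_measurable_times_ennreal borel_measurable_indicator) auto
  have prodle: "(\<Prod>i\<in>I. std_normal_density (\<sigma> m * z i)) \<le> ?\<phi> ^ card I" for m z
    using prod_mono[of I "\<lambda>i. std_normal_density (\<sigma> m * z i)" "\<lambda>_. ?\<phi>"] std_normal_density_le by simp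
  \<comment> \<open>A zero in \<open>C\<close> bounds every coordinate of \<open>z\<close> by
    \<open>b\<close>, which confines the sets for all \<open>m\<close> to one box.\<close>
  have uw: "u m z \<le> w z" for m z
  proof (cases "z \<in> Z m")
    case True
    then obtain \<tau> where \<tau>: "\<tau> \<in> C" "\<forall>i\<in>I. z i + H (\<sigma> m) i \<tau> = 0" and zs: "z \<in> space (leb I)" by (auto simp: Z_def)
    have "\<bar>z i\<bar> \<le> b" if "i \<in> I" for i
    proof -
      have "z i = - H (\<sigma> m) i \<tau>" using \<tau> that by force
      then show ?thesis using b[OF \<sigma>(1,2) that \<tau>(1), of m] by simp
    qed
    then have "z \<in> PiE I (\<lambda>_. {-b..b})" using zs by (auto simp: space_leb PiE_iff abs_le_iff minus_le_iff)
    then show ?thesis unfolding u w_def using True prodle by (auto intro: ennreal_leI)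
  next
    case False
    then show ?thesis by (simp add: u)
  qed
  have wint: "(\<integral>\<^sup>+z. w z \<partial>leb I) \<le> ennreal (?\<phi> ^ card I * (2 * b) ^ card I)" if "b \<ge> 0"
  proof -
    have "emeasure (leb I) (PiE I (\<lambda>_. {-b..b})) = (\<Prod>i\<in>I. emeasure lborel {-b..b})"
      by (intro emeasure_leb_box) auto
    also have "\<dots> = ennreal ((2 * b) ^ card I)"
      using that by (simp add: ennreal_power del: power_mult_distrib)
    finally show ?thesis unfolding w_def using box that by (simp add: nn_integral_cmult ennreal_mult)
  qed
  have b0: "b \<ge> 0" if "i \<in> I" "\<tau> \<in> C" for i \<tau> using b[OF \<sigma>(1,2) that, of 0] by simp
  show "(\<integral>\<^sup>+z. u m z \<partial>leb I) \<le> ennreal (?\<phi> ^ card I * (2 * b) ^ card I)" for m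
  \<comment> \<open>The bound \<open>b\<close> may be negative if there are no equations or no
    points in \<open>C\<close>; these cases are settled directly.\<close>
  proof (cases "I = {} \<or> C = {} \<or> b \<ge> 0")
    case True
    then consider "b \<ge> 0" | "C = {}" | "I = {}" by auto
    then show ?thesis
    proof cases
      case 1
      then show ?thesis using order_trans[OF nn_integral_mono[of "leb I" "u m" w] wint] uw by blast
    next
      case 2
      then have "Z m = {}" by (auto simp: Z_def)
      then show ?thesis by (simp add: u)
    next
      case 3
      have "(\<integral>\<^sup>+z. u m z \<partial>leb I) \<le> (\<integral>\<^sup>+z. w z \<partial>leb I)" using uw by (intro nn_integral_mono)
      also have "\<dots> \<le> 1" using emeasure_leb_box[of I "\<lambda>_. {-b..b}"] box 3
        unfolding w_def by (simp add: nn_integral_cmult)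
      finally show ?thesis using 3 by simp
    qed
  next
    case False
    then show ?thesis using b0 by (metis all_not_in_conv)
  qed
  have im: "lin_image I V L C \<in> sets (leb I)" by (rule lin_image_compact_measurable[OF fin C(1)])
  have negL: "z \<in> lin_image I V L A \<longleftrightarrow> z \<in> space (leb I) \<and> (\<exists>\<tau>\<in>A. \<forall>i\<in>I. z i + (\<Sum>v\<in>V. L i v * \<tau> v) = 0)"
    if A: "\<And>\<tau>. \<tau> \<in> A \<Longrightarrow> (\<lambda>v\<in>V. - \<tau> v) \<in> A" for A z
  proof -
    have *: "(\<Sum>v\<in>V. L i v * (\<lambda>v\<in>V. - \<tau> v) v) = - (\<Sum>v\<in>V. L i v * \<tau> v)" for i \<tau>
      by (simp add: sum_negf)
    show ?thesis
      unfolding lin_image_def mem_Collect_eq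
    proof (intro conj_cong refl iffI)
      assume "\<exists>t\<in>A. \<forall>i\<in>I. z i = (\<Sum>j\<in>V. L i j * t j)"
      then obtain t where "t \<in> A" "\<forall>i\<in>I. z i = (\<Sum>j\<in>V. L i j * t j)" by blast
      then show "\<exists>\<tau>\<in>A. \<forall>i\<in>I. z i + (\<Sum>v\<in>V. L i v * \<tau> v) = 0"
        using *[of _ t] A[of t] by (intro bexI[of _ "\<lambda>v\<in>V. - t v"]) (simp_all only:, simp_all)
    next
      assume "\<exists>\<tau>\<in>A. \<forall>i\<in>I. z i + (\<Sum>v\<in>V. L i v * \<tau> v) = 0"
      then obtain t where "t \<in> A" "\<forall>i\<in>I. z i + (\<Sum>v\<in>V. L i v * t v) = 0" by blast
      then show "\<exists>t\<in>A. \<forall>i\<in>I. z i = (\<Sum>j\<in>V. L i j * t j)"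
        using *[of _ t] A[of t] by (intro bexI[of _ "\<lambda>v\<in>V. - t v"]) (simp_all only:, auto simp: eq_neg_iff_add_eq_0)
    qed
  qed
  have AE: "AE z in leb I. z \<notin> lin_image I V L C \<or> (injective_system I V L \<and> z \<in> lin_image I V L C0)"
  proof (cases "injective_system I V L")
    case True
    from injective_system_inverse[OF fin card True] obtain B where
      B: "\<And>z i. i \<in> I \<Longrightarrow> (\<Sum>j\<in>V. L i j * (\<Sum>l\<in>I. B j l * z l)) = z i"
      "\<And>t j. j \<in> V \<Longrightarrow> (\<Sum>l\<in>I. B j l * (\<Sum>j'\<in>V. L l j' * t j')) = t j" by blast
    have CC: "C - C0 \<in> sets (leb V)" using C C0 by auto
    have "lin_image I V L (C - C0) \<in> null_sets (leb I)"
      using linear_iso_image(2)[OF fin B CC] linear_iso_image(3)[OF fin B CC] C0(3) by (auto intro: null_setsI)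
    then have "AE z in leb I. z \<notin> lin_image I V L (C - C0)" by (rule AE_not_in)
    then show ?thesis
      by eventually_elim (use True in \<open>auto simp: lin_image_def\<close>)
  next
    case False
    from singular_system_left_kernel[OF fin card False] obtain u where
      "\<exists>i\<in>I. u i \<noteq> 0" "\<And>t. (\<Sum>i\<in>I. u i * (\<Sum>j\<in>V. L i j * t j)) = 0" by blast
    from emeasure_lin_image_singular[OF fin(1) this] have "lin_image I V L C \<in> null_sets (leb I)"
      using im by (intro null_setsI) auto
    from AE_not_in[OF this] show ?thesis by eventually_elim auto
  qed
  define u' where "u' z = ennreal (?\<phi> ^ card I) * indicator (lin_image I V L C) z" for z
  have conv: "AE z in leb I. (\<lambda>m. u m z) \<longlonglongrightarrow> u' z"
    using AE AE_space
  proof eventually_elim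
    fix z assume z: "z \<notin> lin_image I V L C \<or> (injective_system I V L \<and> z \<in> lin_image I V L C0)" "z \<in> space (leb I)"
    have small: "eventually (\<lambda>m. \<sigma> m < s0) sequentially" if "s0 > 0" for s0
      using order_tendstoD(2)[OF \<sigma>(3) that] .
    show "(\<lambda>m. u m z) \<longlonglongrightarrow> u' z"
    proof (cases "z \<in> lin_image I V L C")
      case False
      then have "\<not> (\<exists>\<tau>\<in>C. \<forall>i\<in>I. z i + (\<Sum>v\<in>V. L i v * \<tau> v) = 0)" using negL[of C z] sym(1) z(2) by blast
      note no_zero = this
      have "\<exists>s0>0. \<forall>s. 0 < s \<longrightarrow> s < s0 \<longrightarrow> \<not> (\<exists>\<tau>\<in>C. \<forall>i\<in>I. z i + H s i \<tau> = 0)"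
        by (rule perturbed_zero_avoid[OF fin C(1) _ no_zero, where H=H and K=K]) (use bd in blast)+
      then obtain s0 where s0: "s0 > 0" "\<And>s. 0 < s \<Longrightarrow> s < s0 \<Longrightarrow> \<not> (\<exists>\<tau>\<in>C. \<forall>i\<in>I. z i + H s i \<tau> = 0)"
        by blast
      have "eventually (\<lambda>m. u m z = u' z) sequentially"
        using small[OF s0(1)]
      proof eventually_elim
        fix m assume "\<sigma> m < s0"
        then have "z \<notin> Z m" using s0(2)[OF \<sigma>(1)] by (auto simp: Z_def)
        then show "u m z = u' z" using False by (simp add: u u'_def)
      qed
      then show ?thesis by (rule tendsto_eventually)
    next
      case True
      then have inj: "injective_system I V L" and "z \<in> lin_image I V L C0" using z by auto
      then obtain \<tau>0 where \<tau>0: "\<tau>0 \<in> C0" "\<And>i. i \<in> I \<Longrightarrow> z i + (\<Sum>v\<in>V. L i v * \<tau>0 v) = 0"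
        using negL[of C0 z] sym(2) by blast
      obtain \<rho> where \<rho>: "\<rho> > 0" "{\<tau> \<in> PiE V (\<lambda>_. UNIV). \<forall>v\<in>V. \<bar>\<tau> v - \<tau>0 v\<bar> \<le> \<rho>} \<subseteq> C" using inner[OF \<tau>0(1)] by blast
      have \<tau>0E: "\<tau>0 \<in> PiE V (\<lambda>_. UNIV)" using \<tau>0(1) sets.sets_into_space[OF C0(1)] by (auto simp: space_leb)
      from injective_system_inverse[OF fin card inj] obtain B where
        B: "\<And>z i. i \<in> I \<Longrightarrow> (\<Sum>j\<in>V. L i j * (\<Sum>l\<in>I. B j l * z l)) = z i"
        "\<And>t j. j \<in> V \<Longrightarrow> (\<Sum>l\<in>I. B j l * (\<Sum>j'\<in>V. L l j' * t j')) = t j" by blast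
      have "\<exists>s0>0. \<forall>s. 0 < s \<longrightarrow> s < s0 \<longrightarrow> (\<exists>\<tau>\<in>C. \<forall>i\<in>I. z i + H s i \<tau> = 0)"
        by (rule perturbed_zero_exists[where H=H and K=K and L=L and z=z and ?\<tau>0.0=\<tau>0 and \<rho>=\<rho> and C=C and I=I and V=V and B=B])
          (fact fin B \<rho> \<tau>0E bd lip cont \<tau>0(2) | blast)+
      then obtain s0 where s0: "s0 > 0" "\<And>s. 0 < s \<Longrightarrow> s < s0 \<Longrightarrow> \<exists>\<tau>\<in>C. \<forall>i\<in>I. z i + H s i \<tau> = 0"
        by blast
      have "eventually (\<lambda>m. ennreal (\<Prod>i\<in>I. std_normal_density (\<sigma> m * z i)) = u m z) sequentially"
        using small[OF s0(1)]
      proof eventually_elim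
        fix m assume "\<sigma> m < s0"
        then have "z \<in> Z m" using s0(2)[OF \<sigma>(1)] z(2) by (auto simp: Z_def)
        then show "ennreal (\<Prod>i\<in>I. std_normal_density (\<sigma> m * z i)) = u m z" by (simp add: u)
      qed
      moreover have "(\<lambda>m. ennreal (\<Prod>i\<in>I. std_normal_density (\<sigma> m * z i))) \<longlonglongrightarrow> ennreal (\<Prod>i\<in>I. ?\<phi>)"
        by (intro tendsto_ennrealI tendsto_prod tendsto_std_normal_density tendsto_mult_left_zero \<sigma>(3))
      ultimately have "(\<lambda>m. u m z) \<longlonglongrightarrow> ennreal (\<Prod>i\<in>I. ?\<phi>)" by (rule Lim_transform_eventually[rotated])
      then show ?thesis using True by (simp add: u'_def)
    qed
  qed
  have "(\<lambda>m. \<integral>\<^sup>+z. u m z \<partial>leb I) \<longlonglongrightarrow> (\<integral>\<^sup>+z. u' z \<partial>leb I)"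
  proof (rule nn_integral_dominated_convergence[where w=w])
    show "u' \<in> borel_measurable (leb I)" unfolding u'_def using im by (intro borel_measurable_times_ennreal borel_measurable_indicator) auto
    show "(\<integral>\<^sup>+z. w z \<partial>leb I) < \<infinity>"
      unfolding w_def using box emeasure_leb_bounded_finite[of I "PiE I (\<lambda>_. {-b..b})" b]
      by (simp add: nn_integral_cmult ennreal_mult_less_top)
  qed (use um wm uw conv in auto)
  also have "(\<integral>\<^sup>+z. u' z \<partial>leb I) = ennreal (?\<phi> ^ card I) * emeasure (leb I) (lin_image I V L C)"
    unfolding u'_def using im by (simp add: nn_integral_cmult)
  finally show "(\<lambda>m. \<integral>\<^sup>+z. u m z \<partial>leb I) \<longlonglongrightarrow> ennreal (?\<phi> ^ card I) * emeasure (leb I) (lin_image I V L C)" .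
qed

section \<open>The system in the affine chart around a point\<close>

context multihom
begin

text \<open>Coordinates of the affine chart in which \<open>x (j, 0) = 1\<close> for every
  block.\<close>

definition V :: "(nat \<times> nat) set" where
  "V = (SIGMA j:{1..k}. {1..ns j})"

text \<open>The neighbourhood of \<open>north\<close> in chart coordinates after division by
  \<open>s\<close>, hence the same set for all scales.\<close>

definition balls :: "(nat \<times> nat \<Rightarrow> real) set" where
  "balls = {\<tau> \<in> PiE V (\<lambda>_. UNIV). \<forall>j\<in>{1..k}. (\<Sum>h\<in>{1..ns j}. (\<tau> (j, h))\<^sup>2) \<le> 1}"

definition open_balls :: "(nat \<times> nat \<Rightarrow> real) set" where
  "open_balls = {\<tau> \<in> PiE V (\<lambda>_. UNIV). \<forall>j\<in>{1..k}. (\<Sum>h\<in>{1..ns j}. (\<tau> (j, h))\<^sup>2) < 1}"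

definition chart :: "real \<Rightarrow> (nat \<times> nat \<Rightarrow> real) \<Rightarrow> nat \<times> nat \<Rightarrow> real" where
  "chart s \<tau> = (\<lambda>(j, h). if h = 0 then 1 else s * \<tau> (j, h))"

section \<open>The product of unit balls as domain of the chart\<close>

lemma finite_V [simp]: "finite V"
  by (simp add: V_def)

lemma card_V: "card V = (\<Sum>j\<in>{1..k}. ns j)"
  by (simp add: V_def)

lemma ns_le_card_V: "j \<in> {1..k} \<Longrightarrow> real (ns j) \<le> real (card V)"
  unfolding card_V by (intro of_nat_mono member_le_sum) auto

lemma in_V [simp]: "(j, h) \<in> V \<longleftrightarrow> 1 \<le> j \<and> j \<le> k \<and> 1 \<le> h \<and> h \<le> ns j"
  by (auto simp: V_def)

lemma balls_bounded: "balls \<subseteq> PiE V (\<lambda>_. {-1..1})"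
proof (intro subsetI PiE_I)
  fix \<tau> v assume \<tau>: "\<tau> \<in> balls" and v: "v \<in> V"
  obtain j h where jh: "v = (j, h)" by (cases v)
  have "(\<tau> (j, h))\<^sup>2 \<le> (\<Sum>h\<in>{1..ns j}. (\<tau> (j, h))\<^sup>2)" using v jh by (intro member_le_sum) auto
  also have "\<dots> \<le> 1" using \<tau> v jh by (auto simp: balls_def)
  finally have "\<bar>\<tau> v\<bar> \<le> 1" by (simp add: abs_square_le_1 jh)
  then show "\<tau> v \<in> {-1..1}" by (auto simp: abs_le_iff)
qed (auto simp: balls_def PiE_iff extensional_def)

lemma compact_balls: "compact balls"
proof -
  have "closed {\<tau> :: nat \<times> nat \<Rightarrow> real. (\<Sum>h\<in>{1..ns j}. (\<tau> (j, h))\<^sup>2) \<le> 1}" for j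
    by (intro closed_Collect_le continuous_on_sum continuous_on_power continuous_on_coord continuous_on_const)
  then have "closed (\<Inter>j\<in>{1..k}. {\<tau> :: nat \<times> nat \<Rightarrow> real. (\<Sum>h\<in>{1..ns j}. (\<tau> (j, h))\<^sup>2) \<le> 1})"
    by (intro closed_INT) auto
  moreover have "compact (PiE V (\<lambda>_. {-1..1::real}))" by (intro compact_PiE_fun) simp
  ultimately have "compact (PiE V (\<lambda>_. {-1..1::real}) \<inter> (\<Inter>j\<in>{1..k}. {\<tau> :: nat \<times> nat \<Rightarrow> real. (\<Sum>h\<in>{1..ns j}. (\<tau> (j, h))\<^sup>2) \<le> 1}))"
    by (rule compact_Int_closed[rotated])
  moreover have "PiE V (\<lambda>_. {-1..1::real}) \<inter> (\<Inter>j\<in>{1..k}. {\<tau> :: nat \<times> nat \<Rightarrow> real. (\<Sum>h\<in>{1..ns j}. (\<tau> (j, h))\<^sup>2) \<le> 1}) = balls"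
    using balls_bounded by (auto simp: balls_def PiE_iff)
  ultimately show ?thesis by simp
qed

lemma block_square_measurable:
  assumes "j \<in> {1..k}"
  shows "(\<lambda>\<tau>. \<Sum>h\<in>{1..ns j}. (\<tau> (j, h))\<^sup>2) \<in> borel_measurable (leb V)"
  using assms by (intro borel_measurable_sum borel_measurable_power measurable_leb_coord) auto

lemma balls_sets: "balls \<in> sets (leb V)" "open_balls \<in> sets (leb V)"
proof -
  have "{\<tau> \<in> space (leb V). \<forall>j\<in>{1..k}. (\<Sum>h\<in>{1..ns j}. (\<tau> (j, h))\<^sup>2) \<le> 1} \<in> sets (leb V)"
    by (intro sets.sets_Collect_finite_All borel_measurable_le block_square_measurable borel_measurable_const) auto
  then show "balls \<in> sets (leb V)" by (simp add: balls_def space_leb)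
  have "{\<tau> \<in> space (leb V). \<forall>j\<in>{1..k}. (\<Sum>h\<in>{1..ns j}. (\<tau> (j, h))\<^sup>2) < 1} \<in> sets (leb V)"
    by (intro sets.sets_Collect_finite_All borel_measurable_less block_square_measurable borel_measurable_const) auto
  then show "open_balls \<in> sets (leb V)" by (simp add: open_balls_def space_leb)
qed

lemma open_balls_subset: "open_balls \<subseteq> balls"
  by (auto simp: balls_def open_balls_def intro: less_imp_le)

lemma balls_finite: "emeasure (leb V) balls < \<infinity>"
  by (rule emeasure_leb_bounded_finite[OF finite_V balls_bounded])

lemma balls_pos: "0 < emeasure (leb V) balls"
proof -
  define r where "r = 1 / (real (card V) + 1)"
  have r: "r > 0" "r \<le> 1" by (auto simp: r_def field_simps)
  have "PiE V (\<lambda>_. {0..r}) \<subseteq> balls"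
  proof
    fix \<tau> assume \<tau>: "\<tau> \<in> PiE V (\<lambda>_. {0..r})"
    have "(\<Sum>h\<in>{1..ns j}. (\<tau> (j, h))\<^sup>2) \<le> 1" if j: "j \<in> {1..k}" for j
    proof -
      have "(\<Sum>h\<in>{1..ns j}. (\<tau> (j, h))\<^sup>2) \<le> (\<Sum>h\<in>{1..ns j}. r * 1)"
        unfolding power2_eq_square using \<tau> r j by (intro sum_mono mult_mono) (auto simp: PiE_iff intro: order_trans)
      also have "\<dots> = real (ns j) * r" by simp
      also have "\<dots> \<le> real (card V) * r"
        using r ns_le_card_V[OF j] by (intro mult_right_mono) auto
      also have "\<dots> \<le> 1" by (simp add: r_def)
      finally show ?thesis .
    qed
    then show "\<tau> \<in> balls" using \<tau> by (auto simp: balls_def PiE_iff)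
  qed
  then have "emeasure (leb V) (PiE V (\<lambda>_. {0..r})) \<le> emeasure (leb V) balls"
    using balls_sets by (intro emeasure_mono)
  moreover have "0 < emeasure (leb V) (PiE V (\<lambda>_. {0..r}))"
    using r by (subst emeasure_leb_box) (auto simp: zero_less_iff_neq_zero)
  ultimately show ?thesis by order
qed

text \<open>Shrinking by \<open>r < 1\<close> maps \<open>balls\<close> into
  \<open>open_balls\<close> and multiplies volumes by \<open>r ^ card V\<close>. Letting
  \<open>r\<close> tend to 1 shows that the two volumes agree.\<close>

lemma balls_boundary_null: "emeasure (leb V) (balls - open_balls) = 0"
proof -
  define a where "a = measure (leb V) balls"
  define b where "b = measure (leb V) open_balls"
  have bfin: "emeasure (leb V) open_balls < \<infinity>"
    using emeasure_mono[OF open_balls_subset balls_sets(1)] balls_finite by order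
  have ea: "emeasure (leb V) balls = ennreal a" and eb: "emeasure (leb V) open_balls = ennreal b"
    using balls_finite bfin by (auto simp: a_def b_def emeasure_eq_ennreal_measure)
  have le: "r ^ card V * a \<le> b" if r: "0 < r" "r < 1" for r
  proof -
    have ind: "indicator open_balls \<in> borel_measurable (leb V)" using balls_sets by simp
    have "ennreal b = (\<integral>\<^sup>+x. indicator open_balls x \<partial>leb V)" using balls_sets eb by simp
    also have "\<dots> = ennreal (\<Prod>v\<in>V. \<bar>r\<bar>) * (\<integral>\<^sup>+x. indicator open_balls (\<lambda>v\<in>V. 0 + r * x v) \<partial>leb V)"
      using r by (intro nn_integral_leb_affine finite_V ind) auto
    also have "\<dots> \<ge> ennreal (\<Prod>v\<in>V. \<bar>r\<bar>) * (\<integral>\<^sup>+x. indicator balls x \<partial>leb V)"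
    proof (intro mult_left_mono nn_integral_mono)
      fix x
      show "indicator balls x \<le> (indicator open_balls (\<lambda>v\<in>V. 0 + r * x v) :: ennreal)"
      proof (cases "x \<in> balls")
        case True
        have "(\<Sum>h\<in>{1..ns j}. ((\<lambda>v\<in>V. 0 + r * x v) (j, h))\<^sup>2) < 1" if j: "j \<in> {1..k}" for j
        proof -
          have "(\<Sum>h\<in>{1..ns j}. ((\<lambda>v\<in>V. 0 + r * x v) (j, h))\<^sup>2) = r\<^sup>2 * (\<Sum>h\<in>{1..ns j}. (x (j, h))\<^sup>2)"
            using j by (auto simp: sum_distrib_left power_mult_distrib intro!: sum.cong)
          also have "\<dots> \<le> r\<^sup>2 * 1" using True j by (intro mult_left_mono) (auto simp: balls_def)
          also have "\<dots> < 1" using r by (simp add: power_less_one_iff)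
          finally show ?thesis .
        qed
        then have "(\<lambda>v\<in>V. 0 + r * x v) \<in> open_balls" by (simp add: open_balls_def)
        then show ?thesis by (simp add: indicator_def)
      qed simp
    qed simp
    finally have "ennreal (r ^ card V) * ennreal a \<le> ennreal b"
      using r balls_sets ea by simp
    then show ?thesis using r by (simp add: ennreal_mult[symmetric] a_def b_def)
  qed
  \<comment> \<open>The shift by 2 keeps the factors strictly between 0 and 1.\<close>
  have "(\<lambda>m. (1 - 1 / (real m + 2)) ^ card V * a) \<longlonglongrightarrow> (1 - 0) ^ card V * a"
    by (intro tendsto_intros) real_asymp
  moreover have "(1 - 1 / (real m + 2)) ^ card V * a \<le> b" for m by (rule le) auto
  ultimately have "a \<le> b" by (auto intro: LIMSEQ_le_const2)
  then have "emeasure (leb V) balls \<le> emeasure (leb V) open_balls" using ea eb by (simp add: ennreal_leI)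
  then show ?thesis
    using emeasure_Diff[of "leb V" open_balls balls] balls_sets bfin open_balls_subset
    by (simp add: diff_eq_0_ennreal balls_finite)
qed

lemma sum_square_neg:
  fixes \<tau> :: "nat \<times> nat \<Rightarrow> real"
  shows "j \<in> {1..k} \<Longrightarrow> (\<Sum>h\<in>{1..ns j}. ((\<lambda>v\<in>V. - \<tau> v) (j, h))\<^sup>2) = (\<Sum>h\<in>{1..ns j}. (\<tau> (j, h))\<^sup>2)"
  by (intro sum.cong) auto

lemma balls_sym: "\<tau> \<in> balls \<Longrightarrow> (\<lambda>v\<in>V. - \<tau> v) \<in> balls" "\<tau> \<in> open_balls \<Longrightarrow> (\<lambda>v\<in>V. - \<tau> v) \<in> open_balls"
  using sum_square_neg by (auto simp: balls_def open_balls_def)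

text \<open>The strict inequalities leave a margin \<open>\<epsilon>\<close>. Coordinates are
  bounded by 1, so a change of at most \<open>\<rho> \<le> 1\<close> alters a square by at most
  \<open>2 * \<rho> + \<rho>\<^sup>2 \<le> 3 * \<rho>\<close>, which explains the 3 in
  \<open>\<rho>\<close>.\<close>

lemma open_balls_inner:
  assumes "\<tau>0 \<in> open_balls"
  shows "\<exists>\<rho>>0. {\<tau> \<in> PiE V (\<lambda>_. UNIV). \<forall>v\<in>V. \<bar>\<tau> v - \<tau>0 v\<bar> \<le> \<rho>} \<subseteq> balls"
proof -
  have \<tau>0: "\<bar>\<tau>0 v\<bar> \<le> 1" if "v \<in> V" for v
    using assms open_balls_subset balls_bounded that by (fastforce simp: abs_le_iff)
  define q where "q j = (\<Sum>h\<in>{1..ns j}. (\<tau>0 (j, h))\<^sup>2)" for j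
  define \<epsilon> where "\<epsilon> = Min (insert 1 ((\<lambda>j. 1 - q j) ` {1..k}))"
  have \<epsilon>: "\<epsilon> > 0" "\<epsilon> \<le> 1" "\<And>j. j \<in> {1..k} \<Longrightarrow> \<epsilon> \<le> 1 - q j"
  proof -
    show "\<epsilon> > 0" using assms unfolding \<epsilon>_def by (auto simp: open_balls_def q_def Min_gr_iff)
    show "\<epsilon> \<le> 1" unfolding \<epsilon>_def by (intro Min_le) auto
    show "\<epsilon> \<le> 1 - q j" if "j \<in> {1..k}" for j unfolding \<epsilon>_def using that by (intro Min_le) auto
  qed
  define \<rho> where "\<rho> = \<epsilon> / (3 * (real (card V) + 1))"
  have \<rho>: "\<rho> > 0" "\<rho> \<le> 1" "3 * real (card V) * \<rho> \<le> \<epsilon>" using \<epsilon> by (auto simp: \<rho>_def field_simps)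
  have "(\<Sum>h\<in>{1..ns j}. (\<tau> (j, h))\<^sup>2) \<le> 1" if \<tau>: "\<forall>v\<in>V. \<bar>\<tau> v - \<tau>0 v\<bar> \<le> \<rho>" and j: "j \<in> {1..k}" for \<tau> j
  proof -
    have "(\<Sum>h\<in>{1..ns j}. (\<tau> (j, h))\<^sup>2) \<le> (\<Sum>h\<in>{1..ns j}. (\<tau>0 (j, h))\<^sup>2 + 3 * \<rho>)"
    proof (intro sum_mono)
      fix h assume "h \<in> {1..ns j}"
      then have v: "(j, h) \<in> V" using j by simp
      define d where "d = \<tau> (j, h) - \<tau>0 (j, h)"
      have d: "\<bar>d\<bar> \<le> \<rho>" using \<tau> v by (auto simp: d_def)
      have "(\<tau> (j, h))\<^sup>2 = (\<tau>0 (j, h))\<^sup>2 + (2 * (\<tau>0 (j, h) * d) + d * d)"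
        by (simp add: d_def power2_eq_square algebra_simps)
      moreover have "\<bar>\<tau>0 (j, h) * d\<bar> \<le> 1 * \<rho>" unfolding abs_mult using \<tau>0[OF v] d by (intro mult_mono) auto
      moreover have "\<bar>d * d\<bar> \<le> \<rho> * 1" unfolding abs_mult using d \<rho> by (intro mult_mono) auto
      ultimately show "(\<tau> (j, h))\<^sup>2 \<le> (\<tau>0 (j, h))\<^sup>2 + 3 * \<rho>" by linarith
    qed
    also have "\<dots> = q j + 3 * real (ns j) * \<rho>" by (simp add: q_def sum.distrib)
    also have "\<dots> \<le> q j + 3 * real (card V) * \<rho>"
      using \<rho> ns_le_card_V[OF j] by (intro add_left_mono mult_right_mono) auto
    also have "\<dots> \<le> 1" using \<rho>(3) \<epsilon>(3)[OF j] by linarith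
    finally show ?thesis .
  qed
  then show ?thesis using \<rho>(1) by (intro exI[of _ \<rho>]) (auto simp: balls_def)
qed

section \<open>Roots near the distinguished point in chart coordinates\<close>

lemma sum_split_zero: "(\<Sum>h\<le>m. f h) = f 0 + (\<Sum>h\<in>{1..m}. f h)" for f :: "nat \<Rightarrow> real" and m :: nat
  by (simp add: sum.atLeast_Suc_atMost atMost_atLeast0)

lemma fld_scale:
  assumes "\<And>j h. j \<in> {1..k} \<Longrightarrow> h \<le> ns j \<Longrightarrow> y (j, h) = c j * x (j, h)"
  shows "fld \<xi> i y = (\<Prod>j\<in>{1..k}. c j ^ \<delta> i j) * fld \<xi> i x"
  unfolding pev_collapse[symmetric] pev_def using assms by (rule mpoly_eval_scale)

text \<open>A unit vector lies within angle arctan \<open>s\<close> of \<open>north\<close> exactly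
  if, after division by the leading coordinate of each block, the other coordinates have length at
  most \<open>s\<close>. Multihomogeneity carries zeros from one normalisation to the other.\<close>

lemma hit_north_iff:
  assumes s: "s > 0"
  shows "hit s (fld \<xi>) north \<longleftrightarrow> (\<exists>\<tau>\<in>balls. \<forall>i\<in>{1..n}. fld \<xi> i (chart s \<tau>) = 0)"
proof
  have north: "ip {..ns j} (\<lambda>h. x (j, h)) (\<lambda>h. north (j, h)) = x (j, 0)" if "j \<in> {1..k}" for x j
  proof -
    have "ip {..ns j} (\<lambda>h. x (j, h)) (\<lambda>h. north (j, h)) = (\<Sum>h\<le>ns j. if h = 0 then x (j, h) else 0)"
      unfolding ip_def using that by (intro sum.cong) (auto simp: north_def)
    then show ?thesis by simp
  qed
  have north1: "north (j, 0) = 1" if "j \<in> {1..k}" for j using that by (simp add: north_def)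
  have ipq: "ip {..ns j} (\<lambda>h. g (j, h)) (\<lambda>h. g (j, h)) = (g (j, 0))\<^sup>2 + (\<Sum>h\<in>{1..ns j}. (g (j, h))\<^sup>2)"
    for g :: "nat \<times> nat \<Rightarrow> real" and j
    by (simp add: ip_def sum_split_zero power2_eq_square)
  {
    assume "hit s (fld \<xi>) north"
    then obtain x where x: "x \<in> sphere_prod" "\<forall>i\<in>{1..n}. fld \<xi> i x = 0" "near s x north" by (auto simp: hit_def)
    have le: "1 \<le> (1 + s\<^sup>2) * (x (j, 0))\<^sup>2" and one: "(x (j, 0))\<^sup>2 + (\<Sum>h\<in>{1..ns j}. (x (j, h))\<^sup>2) = 1" if "j \<in> {1..k}" for j
    proof -
      have j1: "ip {..ns j} (\<lambda>h. x (j, h)) (\<lambda>h. x (j, h)) = 1" using x(1) that by (simp add: sphere_prod_def)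
      then show "(x (j, 0))\<^sup>2 + (\<Sum>h\<in>{1..ns j}. (x (j, h))\<^sup>2) = 1" by (simp only: ipq)
      have "near_lines s {..ns j} (\<lambda>h. x (j, h)) (\<lambda>h. north (j, h))" using x(3) that by (simp add: near_def)
      then show "1 \<le> (1 + s\<^sup>2) * (x (j, 0))\<^sup>2"
        unfolding near_lines_def north[OF that] north1[OF that] j1 by simp
    qed
    have nz: "x (j, 0) \<noteq> 0" if "j \<in> {1..k}" for j using le[OF that] by auto
    define \<tau> where "\<tau> = (\<lambda>(j, h)\<in>V. x (j, h) / (s * x (j, 0)))"
    have "(\<Sum>h\<in>{1..ns j}. (\<tau> (j, h))\<^sup>2) \<le> 1" if j: "j \<in> {1..k}" for j
    proof -
      have "(\<Sum>h\<in>{1..ns j}. (\<tau> (j, h))\<^sup>2) = (\<Sum>h\<in>{1..ns j}. (x (j, h))\<^sup>2) / (s * x (j, 0))\<^sup>2"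
        using j by (auto simp: \<tau>_def sum_divide_distrib power_divide intro!: sum.cong)
      also have "(\<Sum>h\<in>{1..ns j}. (x (j, h))\<^sup>2) = 1 - (x (j, 0))\<^sup>2"
        using one[OF j] by linarith
      also have "(1 - (x (j, 0))\<^sup>2) / (s * x (j, 0))\<^sup>2 \<le> 1"
      proof -
        have "1 - (x (j, 0))\<^sup>2 \<le> (s * x (j, 0))\<^sup>2" using le[OF j] by (simp add: power_mult_distrib algebra_simps)
        moreover have "(s * x (j, 0))\<^sup>2 > 0" using nz[OF j] s by simp
        ultimately show ?thesis by (simp only: divide_le_eq_1_pos)
      qed
      finally show ?thesis .
    qed
    then have "\<tau> \<in> balls" by (auto simp: balls_def \<tau>_def)
    moreover have "fld \<xi> i (chart s \<tau>) = 0" if "i \<in> {1..n}" for i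
    proof -
      have "fld \<xi> i x = (\<Prod>j\<in>{1..k}. (x (j, 0)) ^ \<delta> i j) * fld \<xi> i (chart s \<tau>)"
        using nz s by (intro fld_scale) (auto simp: chart_def \<tau>_def)
      then show ?thesis using x(2) that nz by auto
    qed
    ultimately show "\<exists>\<tau>\<in>balls. \<forall>i\<in>{1..n}. fld \<xi> i (chart s \<tau>) = 0" by blast
  }
  {
    assume "\<exists>\<tau>\<in>balls. \<forall>i\<in>{1..n}. fld \<xi> i (chart s \<tau>) = 0"
    then obtain \<tau> where \<tau>: "\<tau> \<in> balls" "\<forall>i\<in>{1..n}. fld \<xi> i (chart s \<tau>) = 0" by blast
    \<comment> \<open>The squared length of block \<open>j\<close> of \<open>chart s \<tau>\<close>,
      by which the point is returned to the spheres.\<close>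
    define q where "q j = 1 + s\<^sup>2 * (\<Sum>h\<in>{1..ns j}. (\<tau> (j, h))\<^sup>2)" for j
    have q: "q j \<ge> 1" for j by (simp add: q_def sum_nonneg)
    define x where "x = (\<lambda>(j, h)\<in>X. inverse (sqrt (q j)) * chart s \<tau> (j, h))"
    have x0: "(x (j, 0))\<^sup>2 = 1 / q j" if "j \<in> {1..k}" for j
      using that order_trans[OF zero_le_one q[of j]] by (simp add: x_def chart_def power_divide inverse_eq_divide)
    have "ip {..ns j} (\<lambda>h. x (j, h)) (\<lambda>h. x (j, h)) = 1" if j: "j \<in> {1..k}" for j
    proof -
      have "(\<Sum>h\<in>{1..ns j}. (x (j, h))\<^sup>2) = (\<Sum>h\<in>{1..ns j}. s\<^sup>2 * (\<tau> (j, h))\<^sup>2 / q j)"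
        using j order_trans[OF zero_le_one q[of j]]
        by (intro sum.cong) (auto simp: x_def chart_def power_mult_distrib power_inverse field_simps)
      also have "\<dots> = (q j - 1) / q j" by (simp add: q_def sum_distrib_left sum_divide_distrib)
      finally have "ip {..ns j} (\<lambda>h. x (j, h)) (\<lambda>h. x (j, h)) = 1 / q j + (q j - 1) / q j"
        by (simp add: ipq x0[OF j])
      then show ?thesis using q[of j] by (simp add: field_simps)
    qed
    then have "x \<in> sphere_prod" by (auto simp: sphere_prod_def x_def)
    moreover have "near s x north"
      unfolding near_def near_lines_def
    proof
      fix j assume j: "j \<in> {1..k}"
      have "q j \<le> 1 + s\<^sup>2" using \<tau>(1) j by (auto simp: q_def balls_def intro: mult_left_le)
      then have "1 \<le> (1 + s\<^sup>2) * (x (j, 0))\<^sup>2" 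
      proof -
        have "q j * (x (j, 0))\<^sup>2 = 1" using x0[OF j] q[of j] by simp
        moreover have "q j * (x (j, 0))\<^sup>2 \<le> (1 + s\<^sup>2) * (x (j, 0))\<^sup>2"
          using \<open>q j \<le> 1 + s\<^sup>2\<close> by (intro mult_right_mono) auto
        ultimately show ?thesis by linarith
      qed
      then show "ip {..ns j} (\<lambda>h. x (j, h)) (\<lambda>h. x (j, h)) * ip {..ns j} (\<lambda>h. north (j, h)) (\<lambda>h. north (j, h))
        \<le> (1 + s\<^sup>2) * (ip {..ns j} (\<lambda>h. x (j, h)) (\<lambda>h. north (j, h)))\<^sup>2"
        using \<open>x \<in> sphere_prod\<close> j by (simp add: north north1 sphere_prod_def)
    qed
    moreover have "fld \<xi> i x = 0" if "i \<in> {1..n}" for i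
    proof -
      have "fld \<xi> i x = (\<Prod>j\<in>{1..k}. (inverse (sqrt (q j))) ^ \<delta> i j) * fld \<xi> i (chart s \<tau>)"
        by (intro fld_scale) (auto simp: x_def)
      then show ?thesis using \<tau>(2) that by simp
    qed
    ultimately show "hit s (fld \<xi>) north" unfolding hit_def by blast
  }
qed

section \<open>Expansion around the distinguished point in powers of the scale\<close>

definition zero_word :: "nat \<Rightarrow> nat \<Rightarrow> nat \<Rightarrow> nat" where
  "zero_word i = (\<lambda>j\<in>{1..k}. \<lambda>p\<in>{1..\<delta> i j}. 0)"

definition positions :: "nat \<Rightarrow> (nat \<times> nat) set" where
  "positions i = (SIGMA j:{1..k}. {1..\<delta> i j})"

text \<open>Every position with a nonzero letter contributes one factor \<open>s\<close> in the
  chart, so the size of the support is the order of the word in \<open>s\<close>.\<close>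

definition support :: "nat \<Rightarrow> (nat \<Rightarrow> nat \<Rightarrow> nat) \<Rightarrow> (nat \<times> nat) set" where
  "support i \<omega> = {q \<in> positions i. \<omega> (fst q) (snd q) \<noteq> 0}"

definition letter :: "(nat \<Rightarrow> nat \<Rightarrow> nat) \<Rightarrow> nat \<times> nat \<Rightarrow> nat \<times> nat" where
  "letter \<omega> q = (fst q, \<omega> (fst q) (snd q))"

text \<open>Indices of the words of order 0, one for each equation. Their coefficients are the
  values of the polynomials at \<open>north\<close>.\<close>

definition const_index :: "(nat \<times> (nat \<Rightarrow> nat \<Rightarrow> nat)) set" where
  "const_index = (\<lambda>i. (i, zero_word i)) ` {1..n}"

definition rest_index :: "(nat \<times> (nat \<Rightarrow> nat \<Rightarrow> nat)) set" where
  "rest_index = (SIGMA i:{1..n}. words i - {zero_word i})"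

text \<open>The polynomial in the chart without its constant term, divided by \<open>s\<close>; for
  \<open>s\<close> tending to 0 it converges to its linear part. The index \<open>a\<close> comes
  from \<open>const_index\<close>, and its first component is the number of the equation.\<close>

definition rest_part :: "(nat \<times> (nat \<Rightarrow> nat \<Rightarrow> nat) \<Rightarrow> real) \<Rightarrow> real \<Rightarrow> nat \<times> (nat \<Rightarrow> nat \<Rightarrow> nat) \<Rightarrow> (nat \<times> nat \<Rightarrow> real) \<Rightarrow> real" where
  "rest_part w s a \<tau> = (\<Sum>\<omega>\<in>words (fst a) - {zero_word (fst a)}.
     w (fst a, \<omega>) * (s ^ (card (support (fst a) \<omega>) - 1) * (\<Prod>q\<in>support (fst a) \<omega>. \<tau> (letter \<omega> q))))"

definition first_words :: "nat \<Rightarrow> nat \<times> nat \<Rightarrow> (nat \<Rightarrow> nat \<Rightarrow> nat) set" where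
  "first_words i v = {\<omega> \<in> words i. \<exists>q. support i \<omega> = {q} \<and> letter \<omega> q = v}"

text \<open>The partial derivative at \<open>north\<close> in the direction of the chart coordinate
  \<open>v\<close>, as a sum of word coefficients.\<close>

definition lin_part :: "(nat \<times> (nat \<Rightarrow> nat \<Rightarrow> nat) \<Rightarrow> real) \<Rightarrow> nat \<times> (nat \<Rightarrow> nat \<Rightarrow> nat) \<Rightarrow> nat \<times> nat \<Rightarrow> real" where
  "lin_part w a v = (\<Sum>\<omega>\<in>first_words (fst a) v. w (fst a, \<omega>))"

lemma zero_word_in [simp]: "zero_word i \<in> words i"
  by (auto simp: zero_word_def words_def)

lemma finite_positions [simp]: "finite (positions i)" and finite_support [simp]: "finite (support i \<omega>)"
  by (auto simp: positions_def support_def)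

lemma support_zero_word: "support i (zero_word i) = {}"
  by (auto simp: support_def positions_def zero_word_def)

lemma support_empty:
  assumes "\<omega> \<in> words i" "support i \<omega> = {}"
  shows "\<omega> = zero_word i"
  unfolding words_eq_iff[OF assms(1) zero_word_in]
  using assms(2) by (auto simp: support_def positions_def zero_word_def)

lemma letter_in: "\<omega> \<in> words i \<Longrightarrow> q \<in> support i \<omega> \<Longrightarrow> letter \<omega> q \<in> V"
  using words_letter[of \<omega> i "fst q" "snd q"] by (cases q) (auto simp: letter_def support_def positions_def)

lemma fld_chart:
  "fld \<xi> i (chart s \<tau>) = \<xi> (i, zero_word i) + s * rest_part \<xi> s (i, zero_word i) \<tau>"
proof -
  have mono: "(\<Prod>j\<in>{1..k}. \<Prod>p\<in>{1..\<delta> i j}. chart s \<tau> (j, \<omega> j p)) = s ^ card (support i \<omega>) * (\<Prod>q\<in>support i \<omega>. \<tau> (letter \<omega> q))" for \<omega>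
  proof -
    have "(\<Prod>j\<in>{1..k}. \<Prod>p\<in>{1..\<delta> i j}. chart s \<tau> (j, \<omega> j p)) = (\<Prod>q\<in>positions i. chart s \<tau> (letter \<omega> q))"
      unfolding positions_def by (subst prod.Sigma) (auto simp: letter_def case_prod_unfold)
    also have "\<dots> = (\<Prod>q\<in>support i \<omega>. chart s \<tau> (letter \<omega> q))"
      by (intro prod.mono_neutral_right) (auto simp: support_def letter_def chart_def)
    also have "\<dots> = (\<Prod>q\<in>support i \<omega>. s * \<tau> (letter \<omega> q))"
      by (intro prod.cong) (auto simp: support_def letter_def chart_def)
    finally show ?thesis by (simp add: prod.distrib)
  qed
  have "fld \<xi> i (chart s \<tau>) = (\<Sum>\<omega>\<in>words i. \<xi> (i, \<omega>) * (s ^ card (support i \<omega>) * (\<Prod>q\<in>support i \<omega>. \<tau> (letter \<omega> q))))"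
    unfolding fld_def mono ..
  also have "\<dots> = \<xi> (i, zero_word i) + (\<Sum>\<omega>\<in>words i - {zero_word i}. \<xi> (i, \<omega>) * (s ^ card (support i \<omega>) * (\<Prod>q\<in>support i \<omega>. \<tau> (letter \<omega> q))))"
    by (subst sum.remove[of _ "zero_word i"]) (auto simp: support_zero_word)
  also have "(\<Sum>\<omega>\<in>words i - {zero_word i}. \<xi> (i, \<omega>) * (s ^ card (support i \<omega>) * (\<Prod>q\<in>support i \<omega>. \<tau> (letter \<omega> q))))
     = s * rest_part \<xi> s (i, zero_word i) \<tau>"
    unfolding rest_part_def sum_distrib_left
  proof (intro sum.cong)
    fix \<omega> assume "\<omega> \<in> words (fst (i, zero_word i)) - {zero_word (fst (i, zero_word i))}"
    \<comment> \<open>Words other than \<open>zero_word i\<close> have nonempty support, so the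
      subtraction in the exponent is exact.\<close>
    then have "card (support i \<omega>) \<noteq> 0" using support_empty[of \<omega> i] by auto
    then have "s ^ card (support i \<omega>) = s * s ^ (card (support i \<omega>) - 1)"
      by (metis Suc_diff_1 bot_nat_0.not_eq_extremum power_Suc)
    then show "\<xi> (i, \<omega>) * (s ^ card (support i \<omega>) * (\<Prod>q\<in>support i \<omega>. \<tau> (letter \<omega> q))) =
       s * (\<xi> (fst (i, zero_word i), \<omega>) * (s ^ (card (support (fst (i, zero_word i)) \<omega>) - 1) * (\<Prod>q\<in>support (fst (i, zero_word i)) \<omega>. \<tau> (letter \<omega> q))))"
      by simp
  qed simp
  finally show ?thesis .
qed

lemma Om_split: "Om = const_index \<union> rest_index" "const_index \<inter> rest_index = {}"
  by (auto simp: Om_def const_index_def rest_index_def)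

lemma finite_const_index [simp]: "finite const_index" and finite_rest_index [simp]: "finite rest_index"
  by (auto simp: const_index_def rest_index_def)

lemma card_const_index: "card const_index = n"
  unfolding const_index_def by (subst card_image) (auto simp: inj_on_def)

definition rest_norm :: "(nat \<times> (nat \<Rightarrow> nat \<Rightarrow> nat) \<Rightarrow> real) \<Rightarrow> real" where
  "rest_norm w = (\<Sum>p\<in>rest_index. \<bar>w p\<bar>)"

text \<open>Words with support of size one carry \<open>s ^ 0\<close>, and grouping them by their
  letter gives the linear part. The words that remain have at least two nonzero letters.\<close>

lemma rest_part_minus_lin_part:
  assumes a: "a \<in> const_index"
  shows "rest_part w s a \<tau> - (\<Sum>v\<in>V. lin_part w a v * \<tau> v) =
    (\<Sum>\<omega>\<in>{\<omega> \<in> words (fst a) - {zero_word (fst a)}. card (support (fst a) \<omega>) \<noteq> 1}.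
       w (fst a, \<omega>) * (s ^ (card (support (fst a) \<omega>) - 1) * (\<Prod>q\<in>support (fst a) \<omega>. \<tau> (letter \<omega> q))))"
proof -
  define i where "i = fst a"
  define A where "A = words i - {zero_word i}"
  define A1 where "A1 = {\<omega> \<in> A. card (support i \<omega>) = 1}"
  define T where "T \<omega> = w (i, \<omega>) * (s ^ (card (support i \<omega>) - 1) * (\<Prod>q\<in>support i \<omega>. \<tau> (letter \<omega> q)))" for \<omega>
  have fw: "first_words i v = {\<omega> \<in> A1. letter \<omega> (the_elem (support i \<omega>)) = v}" for v
  proof -
    have "\<omega> \<noteq> zero_word i" if "support i \<omega> = {q}" for \<omega> q using that support_zero_word[of i] by auto
    then show ?thesis by (auto simp: first_words_def A1_def A_def card_1_singleton_iff)
  qed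
  have "(\<Sum>v\<in>V. lin_part w a v * \<tau> v) = (\<Sum>v\<in>V. \<Sum>\<omega>\<in>{\<omega>. \<omega> \<in> A1 \<and> letter \<omega> (the_elem (support i \<omega>)) = v}. T \<omega>)"
    unfolding lin_part_def sum_distrib_right i_def[symmetric] fw
  proof (intro sum.cong refl)
    fix v \<omega> assume "\<omega> \<in> {\<omega> \<in> A1. letter \<omega> (the_elem (support i \<omega>)) = v}"
    then obtain q where "support i \<omega> = {q}" "letter \<omega> q = v" by (auto simp: A1_def card_1_singleton_iff)
    then show "w (i, \<omega>) * \<tau> v = T \<omega>" by (simp add: T_def)
  qed
  also have "\<dots> = (\<Sum>\<omega>\<in>A1. T \<omega>)"
  proof (rule sum.group)
    show "(\<lambda>\<omega>. letter \<omega> (the_elem (support i \<omega>))) ` A1 \<subseteq> V"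
    proof
      fix v assume "v \<in> (\<lambda>\<omega>. letter \<omega> (the_elem (support i \<omega>))) ` A1"
      then obtain \<omega> where \<omega>: "\<omega> \<in> A1" "v = letter \<omega> (the_elem (support i \<omega>))" by blast
      then obtain q where q: "support i \<omega> = {q}" by (auto simp: A1_def card_1_singleton_iff)
      have "letter \<omega> q \<in> V" by (rule letter_in[of \<omega> i]) (use \<omega> q in \<open>auto simp: A1_def A_def\<close>)
      then show "v \<in> V" using \<omega> q by simp
    qed
  qed (auto simp: A1_def A_def)
  finally have L: "(\<Sum>v\<in>V. lin_part w a v * \<tau> v) = (\<Sum>\<omega>\<in>A1. T \<omega>)" .
  have "rest_part w s a \<tau> = (\<Sum>\<omega>\<in>A. T \<omega>)" by (simp add: rest_part_def A_def T_def i_def)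
  also have "\<dots> = (\<Sum>\<omega>\<in>A - A1. T \<omega>) + (\<Sum>\<omega>\<in>A1. T \<omega>)"
    by (rule sum.subset_diff) (auto simp: A1_def A_def)
  finally have "rest_part w s a \<tau> - (\<Sum>v\<in>V. lin_part w a v * \<tau> v) = (\<Sum>\<omega>\<in>A - A1. T \<omega>)"
    by (simp add: L)
  also have "A - A1 = {\<omega> \<in> words i - {zero_word i}. card (support i \<omega>) \<noteq> 1}" by (auto simp: A1_def A_def)
  finally show ?thesis by (simp add: T_def i_def)
qed

end

section \<open>Asymptotics of the probability of a root near a point\<close>

text \<open>The volume is the measure of a section of one measurable set of pairs, so it depends
  measurably on the parameter.\<close>

lemma measurable_lin_volume:
  fixes L :: "'a \<Rightarrow> 'i \<Rightarrow> 'v::countable \<Rightarrow> real"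
  assumes [simp]: "finite I" "finite V" and C: "compact C"
    and L: "\<And>i v. i \<in> I \<Longrightarrow> v \<in> V \<Longrightarrow> (\<lambda>w. L w i v) \<in> borel_measurable M"
  shows "(\<lambda>w. emeasure (leb I) (lin_image I V (L w) C)) \<in> borel_measurable M"
proof -
  interpret sigma_finite_measure "leb I" by (simp add: sigma_finite_leb)
  let ?Q = "{p \<in> space (M \<Otimes>\<^sub>M leb I). \<exists>t\<in>C. (\<Sum>i\<in>I. \<bar>snd p i - (\<Sum>v\<in>V. L (fst p) i v * t v)\<bar>) = 0}"
  have Q: "?Q \<in> sets (M \<Otimes>\<^sub>M leb I)"
  proof (rule measurable_ex_compact[OF C])
    show "continuous_on C (\<lambda>t. \<Sum>i\<in>I. \<bar>snd p i - (\<Sum>v\<in>V. L (fst p) i v * t v)\<bar>)" for p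
      by (intro continuous_on_sum continuous_on_rabs continuous_on_diff continuous_on_const continuous_on_mult continuous_on_coord)
    show "(\<lambda>p. \<Sum>i\<in>I. \<bar>snd p i - (\<Sum>v\<in>V. L (fst p) i v * t v)\<bar>) \<in> borel_measurable (M \<Otimes>\<^sub>M leb I)" for t
    proof (intro borel_measurable_sum borel_measurable_abs borel_measurable_diff borel_measurable_times borel_measurable_const)
      fix i assume i: "i \<in> I"
      show "(\<lambda>p. snd p i) \<in> borel_measurable (M \<Otimes>\<^sub>M leb I)"
        by (rule measurable_compose[OF measurable_snd measurable_leb_coord[OF i]])
      fix v assume v: "v \<in> V"
      show "(\<lambda>p. L (fst p) i v) \<in> borel_measurable (M \<Otimes>\<^sub>M leb I)"
        by (rule measurable_compose[OF measurable_fst L[OF i v]])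
    qed
  qed
  have "(\<lambda>w. emeasure (leb I) (Pair w -` ?Q)) \<in> borel_measurable M" by (rule measurable_emeasure_Pair[OF Q])
  moreover have "lin_image I V (L w) C = Pair w -` ?Q" if "w \<in> space M" for w
    using that by (auto simp: lin_image_def space_pair_measure sum_nonneg_eq_0_iff)
  ultimately show ?thesis by (simp cong: measurable_cong)
qed

text \<open>Replaces a sum of absolute values by a product, whose powers can be integrated
  coordinate by coordinate against the Gaussian measure.\<close>

lemma sum_le_prod_one_plus:
  fixes f :: "'a \<Rightarrow> real"
  assumes "finite A" "\<And>a. a \<in> A \<Longrightarrow> f a \<ge> 0"
  shows "1 + (\<Sum>a\<in>A. f a) \<le> (\<Prod>a\<in>A. 1 + f a)"
  using assms
proof (induction A rule: finite_induct)
  case (insert x A)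
  have "1 + (\<Sum>a\<in>insert x A. f a) = f x + (1 + (\<Sum>a\<in>A. f a))" using insert by simp
  also have "\<dots> \<le> f x * (1 + (\<Sum>a\<in>A. f a)) + (1 + (\<Sum>a\<in>A. f a))"
    using insert by (intro add_right_mono) (simp add: distrib_left sum_nonneg)
  also have "\<dots> = (1 + f x) * (1 + (\<Sum>a\<in>A. f a))" by (simp add: algebra_simps)
  also have "\<dots> \<le> (1 + f x) * (\<Prod>a\<in>A. 1 + f a)" using insert by (intro mult_left_mono) auto
  finally show ?case using insert by simp
qed simp

lemma nn_integral_std_normal_moment_finite: "(\<integral>\<^sup>+x. ennreal ((1 + \<bar>x\<bar>) ^ n) \<partial>std_normal) < \<infinity>"
proof -
  have "(\<integral>\<^sup>+x. ennreal ((1 + \<bar>x\<bar>) ^ n) \<partial>std_normal) = (\<integral>\<^sup>+x. ennreal (std_normal_density x * (1 + \<bar>x\<bar>) ^ n) \<partial>lborel)"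
    by (subst nn_integral_density) (auto simp: ennreal_mult)
  also have "\<dots> \<le> (\<integral>\<^sup>+x. ennreal (2 ^ n * (std_normal_density x * \<bar>x\<bar> ^ 0 + std_normal_density x * \<bar>x\<bar> ^ n)) \<partial>lborel)"
  proof (intro nn_integral_mono ennreal_leI)
    fix x :: real
    have "(1 + \<bar>x\<bar>) ^ n \<le> (2 * max 1 \<bar>x\<bar>) ^ n" by (intro power_mono) auto
    also have "\<dots> = 2 ^ n * (max 1 \<bar>x\<bar>) ^ n" by (simp add: power_mult_distrib)
    also have "(max 1 \<bar>x\<bar>) ^ n \<le> 1 + \<bar>x\<bar> ^ n" by (simp add: max_def)
    finally have "(1 + \<bar>x\<bar>) ^ n \<le> 2 ^ n * (1 + \<bar>x\<bar> ^ n)" by simp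
    then have "std_normal_density x * (1 + \<bar>x\<bar>) ^ n \<le> std_normal_density x * (2 ^ n * (1 + \<bar>x\<bar> ^ n))"
      by (intro mult_left_mono) auto
    then show "std_normal_density x * (1 + \<bar>x\<bar>) ^ n \<le> 2 ^ n * (std_normal_density x * \<bar>x\<bar> ^ 0 + std_normal_density x * \<bar>x\<bar> ^ n)"
      by (simp add: algebra_simps)
  qed
  also have "\<dots> < \<infinity>"
  proof -
    have "integrable lborel (\<lambda>x. 2 ^ n * (std_normal_density x * \<bar>x\<bar> ^ 0 + std_normal_density x * \<bar>x\<bar> ^ n))"
      by (rule integrable_mult_right[OF Bochner_Integration.integrable_add[OF integrable_std_normal_moment_abs integrable_std_normal_moment_abs]])
    then show ?thesis
      by (subst (asm) integrable_iff_bounded) (auto simp: abs_mult)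
  qed
  finally show ?thesis .
qed

text \<open>A fixed null sequence of scales in the interval from 0 to 1, since the convergence
  theorems for integrals are applied along sequences.\<close>

definition radius :: "nat \<Rightarrow> real" where
  "radius m = 1 / (real m + 1)"

lemma radius: "0 < radius m" "radius m \<le> 1" "radius \<longlonglongrightarrow> 0"
  unfolding radius_def by (auto simp: field_simps) real_asymp

context multihom
begin

text \<open>A bound for the degrees of all equations at once; the summand 1 ensures that it is at
  least 1.\<close>

definition word_bound :: real where
  "word_bound = (\<Sum>i\<in>{1..n}. real (card (positions i))) + 1"

lemma card_support_le: "i \<in> {1..n} \<Longrightarrow> real (card (support i \<omega>)) \<le> word_bound"
proof -
  assume i: "i \<in> {1..n}"
  have "card (support i \<omega>) \<le> card (positions i)" by (intro card_mono) (auto simp: support_def)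
  also have "real (card (positions i)) \<le> (\<Sum>i\<in>{1..n}. real (card (positions i)))" using i by (intro member_le_sum) auto
  finally show ?thesis by (simp add: word_bound_def)
qed

lemma word_bound_ge_1: "word_bound \<ge> 1"
  by (simp add: word_bound_def sum_nonneg)

section \<open>Uniform estimates for the remainder\<close>

lemma rest_norm_nonneg: "rest_norm w \<ge> 0"
  by (simp add: rest_norm_def sum_nonneg)

lemma rest_norm_ge:
  assumes "i \<in> {1..n}" "A \<subseteq> words i - {zero_word i}"
  shows "(\<Sum>\<omega>\<in>A. \<bar>w (i, \<omega>)\<bar>) \<le> rest_norm w"
proof -
  have "(\<Sum>\<omega>\<in>A. \<bar>w (i, \<omega>)\<bar>) = (\<Sum>p\<in>Pair i ` A. \<bar>w p\<bar>)" by (simp add: sum.reindex inj_on_def)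
  also have "\<dots> \<le> rest_norm w" unfolding rest_norm_def
    using assms by (intro sum_mono2) (auto simp: rest_index_def)
  finally show ?thesis .
qed

lemma monomial_abs_le:
  assumes "\<omega> \<in> words i" "\<tau> \<in> balls"
  shows "\<bar>\<Prod>q\<in>support i \<omega>. \<tau> (letter \<omega> q)\<bar> \<le> 1"
proof -
  have "\<bar>\<tau> (letter \<omega> q)\<bar> \<le> 1" if "q \<in> support i \<omega>" for q
    using letter_in[OF assms(1) that] assms(2) balls_bounded by (fastforce simp: abs_le_iff)
  then show ?thesis unfolding abs_prod by (intro prod_le_1) auto
qed

text \<open>A product of factors bounded by 1 changes by at most the sum of the changes of its
  factors, and each factor is a coordinate.\<close>

lemma monomial_diff_le:
  assumes \<omega>: "\<omega> \<in> words i" and \<tau>: "\<tau> \<in> balls" and \<tau>': "\<tau>' \<in> balls" and i: "i \<in> {1..n}"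
  shows "\<bar>(\<Prod>q\<in>support i \<omega>. \<tau> (letter \<omega> q)) - (\<Prod>q\<in>support i \<omega>. \<tau>' (letter \<omega> q))\<bar> \<le> word_bound * (\<Sum>v\<in>V. \<bar>\<tau> v - \<tau>' v\<bar>)"
proof -
  have le: "\<bar>\<tau> (letter \<omega> q)\<bar> \<le> 1" "\<bar>\<tau>' (letter \<omega> q)\<bar> \<le> 1" if "q \<in> support i \<omega>" for q
    using letter_in[OF \<omega> that] \<tau> \<tau>' balls_bounded by (fastforce simp: abs_le_iff)+
  have "norm ((\<Prod>q\<in>support i \<omega>. \<tau> (letter \<omega> q)) - (\<Prod>q\<in>support i \<omega>. \<tau>' (letter \<omega> q))) \<le>
     (\<Sum>q\<in>support i \<omega>. norm (\<tau> (letter \<omega> q) - \<tau>' (letter \<omega> q)))"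
    using le by (intro norm_prod_diff) auto
  also have "\<dots> \<le> (\<Sum>q\<in>support i \<omega>. \<Sum>v\<in>V. \<bar>\<tau> v - \<tau>' v\<bar>)"
  proof (intro sum_mono)
    fix q assume "q \<in> support i \<omega>"
    then have "letter \<omega> q \<in> V" by (rule letter_in[OF \<omega>])
    then show "norm (\<tau> (letter \<omega> q) - \<tau>' (letter \<omega> q)) \<le> (\<Sum>v\<in>V. \<bar>\<tau> v - \<tau>' v\<bar>)"
      using member_le_sum[of "letter \<omega> q" V "\<lambda>v. \<bar>\<tau> v - \<tau>' v\<bar>"] by simp
  qed
  also have "\<dots> \<le> word_bound * (\<Sum>v\<in>V. \<bar>\<tau> v - \<tau>' v\<bar>)"
    using card_support_le[OF i, of \<omega>] by (simp add: mult_right_mono sum_nonneg)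
  finally show ?thesis by simp
qed

lemma weighted_sum_le:
  assumes i: "i \<in> {1..n}" and A: "A \<subseteq> words i - {zero_word i}"
    and c: "\<And>\<omega>. \<omega> \<in> A \<Longrightarrow> \<bar>g \<omega>\<bar> \<le> c" and c0: "c \<ge> 0"
  shows "\<bar>\<Sum>\<omega>\<in>A. w (i, \<omega>) * g \<omega>\<bar> \<le> rest_norm w * c"
proof -
  have "\<bar>\<Sum>\<omega>\<in>A. w (i, \<omega>) * g \<omega>\<bar> \<le> (\<Sum>\<omega>\<in>A. \<bar>w (i, \<omega>)\<bar> * c)"
    using c by (intro order_trans[OF sum_abs] sum_mono) (auto simp: abs_mult intro!: mult_left_mono)
  also have "\<dots> = (\<Sum>\<omega>\<in>A. \<bar>w (i, \<omega>)\<bar>) * c" by (simp add: sum_distrib_right)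
  also have "\<dots> \<le> rest_norm w * c" using rest_norm_ge[OF i A] c0 by (intro mult_right_mono)
  finally show ?thesis .
qed

lemma rest_part_bound:
  assumes a: "a \<in> const_index" and s: "0 < s" "s \<le> 1" and \<tau>: "\<tau> \<in> balls"
  shows "\<bar>rest_part w s a \<tau>\<bar> \<le> rest_norm w"
proof -
  have i: "fst a \<in> {1..n}" using a by (auto simp: const_index_def)
  have "\<bar>rest_part w s a \<tau>\<bar> \<le> rest_norm w * 1"
    unfolding rest_part_def
  proof (rule weighted_sum_le[OF i])
    fix \<omega> assume "\<omega> \<in> words (fst a) - {zero_word (fst a)}"
    then have "\<bar>\<Prod>q\<in>support (fst a) \<omega>. \<tau> (letter \<omega> q)\<bar> \<le> 1" using monomial_abs_le \<tau> by blast
    moreover have "\<bar>s ^ (card (support (fst a) \<omega>) - 1)\<bar> \<le> 1" using s by (simp add: power_le_one power_abs)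
    ultimately show "\<bar>s ^ (card (support (fst a) \<omega>) - 1) * (\<Prod>q\<in>support (fst a) \<omega>. \<tau> (letter \<omega> q))\<bar> \<le> 1"
      unfolding abs_mult by (intro mult_le_one) auto
  qed auto
  then show ?thesis by simp
qed

text \<open>The source of the factor \<open>s\<close> in both remainder estimates: two nonzero
  letters leave an exponent of at least 1.\<close>

lemma power_support_le:
  fixes s :: real
  assumes "0 < s" "s \<le> 1" "\<omega> \<in> words i - {zero_word i}" "card (support i \<omega>) \<noteq> 1"
  shows "s ^ (card (support i \<omega>) - 1) \<le> s"
proof -
  have "card (support i \<omega>) \<noteq> 0" using support_empty[of \<omega> i] assms by auto
  then have "card (support i \<omega>) - 1 \<ge> 1" using assms(4) by linarith
  then show ?thesis using power_decreasing[of 1 "card (support i \<omega>) - 1" s] assms by simp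
qed

lemma rest_part_linear_bound:
  assumes a: "a \<in> const_index" and s: "0 < s" "s \<le> 1" and \<tau>: "\<tau> \<in> balls"
  shows "\<bar>rest_part w s a \<tau> - (\<Sum>v\<in>V. lin_part w a v * \<tau> v)\<bar> \<le> s * (rest_norm w * word_bound)"
proof -
  have i: "fst a \<in> {1..n}" using a by (auto simp: const_index_def)
  have "\<bar>rest_part w s a \<tau> - (\<Sum>v\<in>V. lin_part w a v * \<tau> v)\<bar> \<le> rest_norm w * s"
    unfolding rest_part_minus_lin_part[OF a]
  proof (rule weighted_sum_le[OF i])
    fix \<omega> assume \<omega>: "\<omega> \<in> {\<omega> \<in> words (fst a) - {zero_word (fst a)}. card (support (fst a) \<omega>) \<noteq> 1}"
    then have "\<bar>\<Prod>q\<in>support (fst a) \<omega>. \<tau> (letter \<omega> q)\<bar> \<le> 1" using monomial_abs_le \<tau> by blast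
    moreover have "s ^ (card (support (fst a) \<omega>) - 1) \<le> s" using power_support_le[OF s] \<omega> by blast
    ultimately have "s ^ (card (support (fst a) \<omega>) - 1) * \<bar>\<Prod>q\<in>support (fst a) \<omega>. \<tau> (letter \<omega> q)\<bar> \<le> s * 1"
      using s by (intro mult_mono) auto
    then show "\<bar>s ^ (card (support (fst a) \<omega>) - 1) * (\<Prod>q\<in>support (fst a) \<omega>. \<tau> (letter \<omega> q))\<bar> \<le> s"
      using s by (simp add: abs_mult)
  qed (use s in auto)
  also have "\<dots> = s * (rest_norm w * 1)" by simp
  also have "\<dots> \<le> s * (rest_norm w * word_bound)"
    using s word_bound_ge_1 rest_norm_nonneg by (intro mult_left_mono) auto
  finally show ?thesis .
qed

lemma rest_part_lipschitz:
  assumes a: "a \<in> const_index" and s: "0 < s" "s \<le> 1" and \<tau>: "\<tau> \<in> balls" and \<tau>': "\<tau>' \<in> balls"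
  shows "\<bar>(rest_part w s a \<tau> - (\<Sum>v\<in>V. lin_part w a v * \<tau> v)) - (rest_part w s a \<tau>' - (\<Sum>v\<in>V. lin_part w a v * \<tau>' v))\<bar>
    \<le> s * (rest_norm w * word_bound) * (\<Sum>v\<in>V. \<bar>\<tau> v - \<tau>' v\<bar>)"
proof -
  have i: "fst a \<in> {1..n}" using a by (auto simp: const_index_def)
  define A where "A = {\<omega> \<in> words (fst a) - {zero_word (fst a)}. card (support (fst a) \<omega>) \<noteq> 1}"
  define P where "P \<omega> t = (\<Prod>q\<in>support (fst a) \<omega>. t (letter \<omega> q))" for \<omega> and t :: "nat \<times> nat \<Rightarrow> real"
  define S where "S = (\<Sum>v\<in>V. \<bar>\<tau> v - \<tau>' v\<bar>)"
  have S: "S \<ge> 0" by (simp add: S_def sum_nonneg)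
  have "(rest_part w s a \<tau> - (\<Sum>v\<in>V. lin_part w a v * \<tau> v)) - (rest_part w s a \<tau>' - (\<Sum>v\<in>V. lin_part w a v * \<tau>' v))
     = (\<Sum>\<omega>\<in>A. w (fst a, \<omega>) * (s ^ (card (support (fst a) \<omega>) - 1) * (P \<omega> \<tau> - P \<omega> \<tau>')))"
    unfolding rest_part_minus_lin_part[OF a] A_def P_def by (simp add: sum_subtractf[symmetric] right_diff_distrib)
  also have "\<bar>\<dots>\<bar> \<le> rest_norm w * (s * (word_bound * S))"
  proof (rule weighted_sum_le[OF i])
    fix \<omega> assume \<omega>: "\<omega> \<in> A"
    have "\<bar>P \<omega> \<tau> - P \<omega> \<tau>'\<bar> \<le> word_bound * S"
      unfolding P_def S_def using \<omega> by (intro monomial_diff_le[OF _ \<tau> \<tau>' i]) (auto simp: A_def)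
    moreover have "s ^ (card (support (fst a) \<omega>) - 1) \<le> s" using power_support_le[OF s] \<omega> by (auto simp: A_def)
    ultimately have "s ^ (card (support (fst a) \<omega>) - 1) * \<bar>P \<omega> \<tau> - P \<omega> \<tau>'\<bar> \<le> s * (word_bound * S)"
      using s by (intro mult_mono) auto
    then show "\<bar>s ^ (card (support (fst a) \<omega>) - 1) * (P \<omega> \<tau> - P \<omega> \<tau>')\<bar> \<le> s * (word_bound * S)"
      using s by (simp add: abs_mult)
  qed (use s S word_bound_ge_1 in \<open>auto simp: A_def\<close>)
  finally show ?thesis by (simp add: S_def mult_ac)
qed

lemma continuous_on_rest_part: "continuous_on S (rest_part w s a)"
  unfolding rest_part_def
  by (intro continuous_on_sum continuous_on_mult continuous_on_prod continuous_on_const continuous_on_coord)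

lemma measurable_rest_part:
  assumes "a \<in> const_index"
  shows "(\<lambda>w. rest_part w s a \<tau>) \<in> borel_measurable (leb rest_index)"
  unfolding rest_part_def using assms
  by (intro borel_measurable_sum borel_measurable_times borel_measurable_const measurable_leb_coord)
    (auto simp: rest_index_def const_index_def)

lemma first_words_subset: "first_words i v \<subseteq> words i - {zero_word i}"
  using support_zero_word[of i] by (auto simp: first_words_def)

lemma finite_first_words [simp]: "finite (first_words i v)"
  by (rule finite_subset[OF first_words_subset]) simp

lemma measurable_lin_part:
  assumes "a \<in> const_index"
  shows "(\<lambda>w. lin_part w a v) \<in> borel_measurable (leb rest_index)"
  unfolding lin_part_def
proof (intro borel_measurable_sum measurable_leb_coord)
  fix \<omega> assume "\<omega> \<in> first_words (fst a) v"
  then show "(fst a, \<omega>) \<in> rest_index"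
    using assms first_words_subset[of "fst a" v] by (auto simp: rest_index_def const_index_def)
qed

section \<open>Conditioning on the coefficients of positive order\<close>

definition local_hit :: "(nat \<times> (nat \<Rightarrow> nat \<Rightarrow> nat) \<Rightarrow> real) \<Rightarrow> real \<Rightarrow> (nat \<times> (nat \<Rightarrow> nat \<Rightarrow> nat) \<Rightarrow> real) \<Rightarrow> ennreal" where
  "local_hit w s z = ennreal (\<Prod>a\<in>const_index. std_normal_density (s * z a)) *
     indicator {z \<in> space (leb const_index). \<exists>\<tau>\<in>balls. \<forall>a\<in>const_index. z a + rest_part w s a \<tau> = 0} z"

lemma local_hit_pair_measurable:
  "{p \<in> space (leb rest_index \<Otimes>\<^sub>M leb const_index). \<exists>\<tau>\<in>balls. \<forall>a\<in>const_index. snd p a + rest_part (fst p) s a \<tau> = 0}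
    \<in> sets (leb rest_index \<Otimes>\<^sub>M leb const_index)" (is "?A \<in> _")
proof -
  have "?A = {p \<in> space (leb rest_index \<Otimes>\<^sub>M leb const_index). \<exists>\<tau>\<in>balls. (\<Sum>a\<in>const_index. \<bar>snd p a + rest_part (fst p) s a \<tau>\<bar>) = 0}"
    by (simp add: sum_nonneg_eq_0_iff)
  also have "\<dots> \<in> sets (leb rest_index \<Otimes>\<^sub>M leb const_index)"
  proof (rule measurable_ex_compact[OF compact_balls])
    show "continuous_on balls (\<lambda>\<tau>. \<Sum>a\<in>const_index. \<bar>snd p a + rest_part (fst p) s a \<tau>\<bar>)" for p
      by (intro continuous_on_sum continuous_on_rabs continuous_on_add continuous_on_const continuous_on_rest_part)
    show "(\<lambda>p. \<Sum>a\<in>const_index. \<bar>snd p a + rest_part (fst p) s a \<tau>\<bar>) \<in> borel_measurable (leb rest_index \<Otimes>\<^sub>M leb const_index)" for \<tau>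
      by (intro borel_measurable_sum borel_measurable_abs borel_measurable_add
          measurable_compose[OF measurable_snd measurable_leb_coord] measurable_compose[OF measurable_fst measurable_rest_part])
  qed
  finally show ?thesis .
qed

lemma measurable_local_hit_integral:
  "(\<lambda>w. \<integral>\<^sup>+z. local_hit w s z \<partial>leb const_index) \<in> borel_measurable (leb rest_index)"
proof -
  interpret sigma_finite_measure "leb const_index" by (simp add: sigma_finite_leb)
  have "(\<lambda>p. ennreal (\<Prod>a\<in>const_index. std_normal_density (s * snd p a)) *
     indicator {p \<in> space (leb rest_index \<Otimes>\<^sub>M leb const_index). \<exists>\<tau>\<in>balls. \<forall>a\<in>const_index. snd p a + rest_part (fst p) s a \<tau> = 0} p)
    \<in> borel_measurable (leb rest_index \<Otimes>\<^sub>M leb const_index)"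
  proof (intro borel_measurable_times_ennreal borel_measurable_indicator local_hit_pair_measurable measurable_compose[OF _ measurable_ennreal] borel_measurable_prod)
    fix a assume "a \<in> const_index"
    then have "(\<lambda>p. snd p a) \<in> borel_measurable (leb rest_index \<Otimes>\<^sub>M leb const_index)"
      by (intro measurable_compose[OF measurable_snd measurable_leb_coord])
    then have "(\<lambda>p. s * snd p a) \<in> borel_measurable (leb rest_index \<Otimes>\<^sub>M leb const_index)" by measurable
    then show "(\<lambda>p. std_normal_density (s * snd p a)) \<in> borel_measurable (leb rest_index \<Otimes>\<^sub>M leb const_index)" by measurable
  qed
  from borel_measurable_nn_integral_fst[OF this]
  show ?thesis
    by (rule measurable_cong[THEN iffD1, rotated])
      (auto simp: local_hit_def indicator_def space_pair_measure intro!: nn_integral_cong)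
qed

text \<open>The constant terms are standard normals independent of all other coefficients. The
  substitution \<open>c = s * z\<close> in them brings the hit condition to unit scale, with
  Jacobian \<open>s ^ n\<close> and the density evaluated at \<open>s * z\<close>.\<close>

lemma hit_prob_local:
  assumes s: "0 < s"
  shows "hit_prob s = ennreal (s ^ n) * (\<integral>\<^sup>+w. \<integral>\<^sup>+z. local_hit w s z \<partial>leb const_index \<partial>gauss rest_index)"
proof -
  let ?E = "{\<xi> \<in> space (leb Om). hit s (fld \<xi>) north}"
  have E: "?E \<in> sets (leb Om)" by (rule hit_fld_measurable)
  have Om: "Om = rest_index \<union> const_index" "rest_index \<inter> const_index = {}" using Om_split by auto
  have "hit_prob s = (\<integral>\<^sup>+\<xi>. indicator ?E \<xi> \<partial>PiM (rest_index \<union> const_index) (\<lambda>_. std_normal))"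
    unfolding hit_prob_def using E by (simp add: sets_gauss Om(1)[symmetric] gauss_def[symmetric])
  also have "\<dots> = (\<integral>\<^sup>+w. \<integral>\<^sup>+c. indicator ?E (merge rest_index const_index (w, c)) \<partial>gauss const_index \<partial>gauss rest_index)"
    unfolding gauss_def using E Om(2)
    by (intro gauss_prod.product_nn_integral_fold) (auto simp: Om(1)[symmetric] sets_gauss gauss_def[symmetric] intro!: borel_measurable_indicator)
  also have "\<dots> = (\<integral>\<^sup>+w. ennreal (s ^ n) * (\<integral>\<^sup>+z. local_hit w s z \<partial>leb const_index) \<partial>gauss rest_index)"
  proof (rule nn_integral_cong)
    fix w assume w: "w \<in> space (gauss rest_index)"
    define Z where "Z = {c \<in> space (leb const_index). \<exists>\<tau>\<in>balls. \<forall>a\<in>const_index. c a + s * rest_part w s a \<tau> = 0}"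
    have Z: "Z \<in> sets (leb const_index)"
    proof -
      have "Z = {c \<in> space (leb const_index). \<exists>\<tau>\<in>balls. (\<Sum>a\<in>const_index. \<bar>c a + s * rest_part w s a \<tau>\<bar>) = 0}"
        by (simp add: Z_def sum_nonneg_eq_0_iff)
      also have "\<dots> \<in> sets (leb const_index)"
        by (rule measurable_ex_compact[OF compact_balls];
            intro continuous_on_sum continuous_on_rabs continuous_on_add continuous_on_mult continuous_on_const continuous_on_rest_part
              borel_measurable_sum borel_measurable_abs borel_measurable_add borel_measurable_const measurable_leb_coord)
      finally show ?thesis .
    qed
    have "indicator ?E (merge rest_index const_index (w, c)) = (indicator Z c :: ennreal)" if c: "c \<in> space (gauss const_index)" for c
    proof -
      let ?\<xi> = "merge rest_index const_index (w, c)"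
      have "?\<xi> \<in> space (leb Om)" unfolding Om(1) by (auto simp: space_leb PiE_iff)
      moreover have "fld ?\<xi> i (chart s \<tau>) = c (i, zero_word i) + s * rest_part w s (i, zero_word i) \<tau>" if i: "i \<in> {1..n}" for i \<tau>
      proof -
        have "?\<xi> (i, zero_word i) = c (i, zero_word i)"
          using i by (simp add: merge_def rest_index_def const_index_def)
        moreover have "rest_part ?\<xi> s (i, zero_word i) \<tau> = rest_part w s (i, zero_word i) \<tau>"
          unfolding rest_part_def using i by (intro sum.cong refl) (simp add: merge_def rest_index_def)
        ultimately show ?thesis by (simp add: fld_chart)
      qed
      ultimately have "?\<xi> \<in> ?E \<longleftrightarrow> c \<in> Z"
        using c by (simp add: hit_north_iff[OF s] Z_def const_index_def space_gauss)
      then show ?thesis by (simp add: indicator_def)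
    qed
    then have "(\<integral>\<^sup>+c. indicator ?E (merge rest_index const_index (w, c)) \<partial>gauss const_index) = (\<integral>\<^sup>+c. indicator Z c \<partial>gauss const_index)"
      by (intro nn_integral_cong) auto
    also have "\<dots> = (\<integral>\<^sup>+c. ennreal (\<Prod>a\<in>const_index. std_normal_density (c a)) * indicator Z c \<partial>leb const_index)"
      using Z by (intro nn_integral_gauss) auto
    also have "\<dots> = ennreal (\<Prod>a\<in>const_index. \<bar>s\<bar>) * (\<integral>\<^sup>+z. ennreal (\<Prod>a\<in>const_index. std_normal_density ((\<lambda>a\<in>const_index. 0 + s * z a) a)) *
        indicator Z (\<lambda>a\<in>const_index. 0 + s * z a) \<partial>leb const_index)"
    proof (rule nn_integral_leb_affine)
      have "(\<lambda>c. \<Prod>a\<in>const_index. std_normal_density (c a)) \<in> borel_measurable (leb const_index)"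
      proof (rule borel_measurable_prod)
        fix a assume "a \<in> const_index"
        from measurable_leb_coord[OF this] show "(\<lambda>c. std_normal_density (c a)) \<in> borel_measurable (leb const_index)" by measurable
      qed
      then show "(\<lambda>c. ennreal (\<Prod>a\<in>const_index. std_normal_density (c a)) * indicator Z c) \<in> borel_measurable (leb const_index)"
        using Z by (intro borel_measurable_times_ennreal borel_measurable_indicator measurable_compose[OF _ measurable_ennreal])
    qed (use s in auto)
    also have "\<dots> = ennreal (s ^ n) * (\<integral>\<^sup>+z. local_hit w s z \<partial>leb const_index)"
    proof -
      have "(\<lambda>a\<in>const_index. 0 + s * z a) \<in> Z \<longleftrightarrow> (\<exists>\<tau>\<in>balls. \<forall>a\<in>const_index. z a + rest_part w s a \<tau> = 0)" for z
      proof -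
        have "s * z a + s * rest_part w s a \<tau> = 0 \<longleftrightarrow> z a + rest_part w s a \<tau> = 0" for a \<tau>
          using s by (simp add: distrib_left[symmetric])
        then show ?thesis by (simp add: Z_def space_leb)
      qed
      then have "(\<integral>\<^sup>+z. ennreal (\<Prod>a\<in>const_index. std_normal_density ((\<lambda>a\<in>const_index. 0 + s * z a) a)) *
          indicator Z (\<lambda>a\<in>const_index. 0 + s * z a) \<partial>leb const_index) = (\<integral>\<^sup>+z. local_hit w s z \<partial>leb const_index)"
        by (intro nn_integral_cong) (simp add: local_hit_def indicator_def)
      then show ?thesis using s by (simp add: card_const_index)
    qed
    finally show "(\<integral>\<^sup>+c. indicator ?E (merge rest_index const_index (w, c)) \<partial>gauss const_index)
      = ennreal (s ^ n) * (\<integral>\<^sup>+z. local_hit w s z \<partial>leb const_index)" .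
  qed
  also have "\<dots> = ennreal (s ^ n) * (\<integral>\<^sup>+w. \<integral>\<^sup>+z. local_hit w s z \<partial>leb const_index \<partial>gauss rest_index)"
    using measurable_local_hit_integral by (intro nn_integral_cmult) (simp cong: measurable_cong_sets add: sets_gauss)
  finally show ?thesis .
qed

text \<open>For as many equations as chart coordinates, the mean absolute determinant of the
  Jacobian matrix at \<open>north\<close>.\<close>

definition lin_volume :: ennreal where
  "lin_volume = (\<integral>\<^sup>+w. emeasure (leb const_index) (lin_image const_index V (lin_part w) (unit_cube V)) \<partial>gauss rest_index)"

text \<open>Dominated convergence over the remaining coefficients, the limit of the inner integral
  being known for each of them. The majorant is a product of powers of single coordinates and is
  integrable by the finiteness of normal moments. The limit inherits its bound, and dividing by
  positive factors shows that \<open>lin_volume\<close> is finite.\<close>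

lemma hit_prob_limit:
  assumes n: "n = (\<Sum>j\<in>{1..k}. ns j)"
  shows "(\<lambda>m. hit_prob (radius m) / ennreal (radius m ^ n)) \<longlonglongrightarrow>
      ennreal (std_normal_density 0 ^ n) * emeasure (leb V) balls * lin_volume"
    and "lin_volume < \<infinity>"
proof -
  have card: "card const_index = card V" unfolding card_const_index card_V by (rule n)
  note lim = perturbed_zero_set_limit[where I=const_index and V=V and C=balls and ?C0.0=open_balls and L="lin_part w"
      and H="rest_part w" and K="rest_norm w * word_bound" and b="rest_norm w" and \<sigma>=radius for w,
      OF finite_const_index finite_V card compact_balls balls_sets open_balls_subset balls_boundary_null balls_sym open_balls_inner
         rest_part_linear_bound rest_part_lipschitz continuous_on_rest_part rest_part_bound radius, folded local_hit_def, unfolded card_const_index]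
  define g where "g m w = (\<integral>\<^sup>+z. local_hit w (radius m) z \<partial>leb const_index)" for m w
  define g' where "g' w = ennreal (std_normal_density 0 ^ n) * emeasure (leb const_index) (lin_image const_index V (lin_part w) balls)" for w
  define B where "B w = ennreal (\<Prod>p\<in>rest_index. (1 + \<bar>w p\<bar>) ^ n)" for w :: "nat \<times> (nat \<Rightarrow> nat \<Rightarrow> nat) \<Rightarrow> real"
  have gm: "g m \<in> borel_measurable (gauss rest_index)" for m
    unfolding g_def using measurable_local_hit_integral by (simp cong: measurable_cong_sets add: sets_gauss)
  have g'm: "g' \<in> borel_measurable (gauss rest_index)"
    unfolding g'_def
    by (intro borel_measurable_times_ennreal borel_measurable_const measurable_lin_volume compact_balls)
      (auto simp: measurable_lin_part cong: measurable_cong_sets simp: sets_gauss)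
  have Bint: "(\<integral>\<^sup>+w. B w \<partial>gauss rest_index) < \<infinity>"
  proof -
    have "(\<integral>\<^sup>+w. B w \<partial>gauss rest_index) = (\<integral>\<^sup>+w. (\<Prod>p\<in>rest_index. ennreal ((1 + \<bar>w p\<bar>) ^ n)) \<partial>gauss rest_index)"
      by (simp add: B_def prod_ennreal)
    also have "\<dots> = (\<Prod>p\<in>rest_index. \<integral>\<^sup>+x. ennreal ((1 + \<bar>x\<bar>) ^ n) \<partial>std_normal)"
      unfolding gauss_def by (intro gauss_prod.product_nn_integral_prod) auto
    also have "\<dots> < \<infinity>"
      using nn_integral_std_normal_moment_finite[of n] by (simp add: power_less_top_ennreal)
    finally show ?thesis .
  qed
  have gB: "g m w \<le> ennreal (std_normal_density 0 ^ n * 2 ^ n) * B w" for m w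
  proof -
    have "g m w \<le> ennreal (std_normal_density 0 ^ n * (2 * rest_norm w) ^ n)" unfolding g_def by (rule lim(2))
    also have "\<dots> \<le> ennreal (std_normal_density 0 ^ n * (2 ^ n * (\<Prod>p\<in>rest_index. (1 + \<bar>w p\<bar>) ^ n)))"
    proof (intro ennreal_leI mult_left_mono)
      have "rest_norm w \<le> (\<Prod>p\<in>rest_index. 1 + \<bar>w p\<bar>)"
        using sum_le_prod_one_plus[of rest_index "\<lambda>p. \<bar>w p\<bar>"] by (simp add: rest_norm_def)
      then have "rest_norm w ^ n \<le> (\<Prod>p\<in>rest_index. 1 + \<bar>w p\<bar>) ^ n" by (intro power_mono rest_norm_nonneg)
      then show "(2 * rest_norm w) ^ n \<le> 2 ^ n * (\<Prod>p\<in>rest_index. (1 + \<bar>w p\<bar>) ^ n)"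
        by (simp add: power_mult_distrib prod_power_distrib)
    qed simp
    finally show ?thesis by (simp add: B_def ennreal_mult[symmetric] prod_nonneg mult.assoc)
  qed
  have Bm: "B \<in> borel_measurable (gauss rest_index)"
  proof -
    have "(\<lambda>w. \<Prod>p\<in>rest_index. (1 + \<bar>w p\<bar>) ^ n) \<in> borel_measurable (leb rest_index)"
      by (intro borel_measurable_prod borel_measurable_power borel_measurable_add borel_measurable_abs borel_measurable_const measurable_leb_coord)
    then have "B \<in> borel_measurable (leb rest_index)" unfolding B_def by (rule measurable_compose[OF _ measurable_ennreal])
    then show ?thesis by (simp cong: measurable_cong_sets add: sets_gauss)
  qed
  have bound_fin: "(\<integral>\<^sup>+w. ennreal (std_normal_density 0 ^ n * 2 ^ n) * B w \<partial>gauss rest_index) < \<infinity>"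
    using Bint by (simp add: nn_integral_cmult[OF Bm] ennreal_mult_less_top)
  have conv: "(\<lambda>m. \<integral>\<^sup>+w. g m w \<partial>gauss rest_index) \<longlonglongrightarrow> (\<integral>\<^sup>+w. g' w \<partial>gauss rest_index)"
  proof (rule nn_integral_dominated_convergence[where w="\<lambda>w. ennreal (std_normal_density 0 ^ n * 2 ^ n) * B w"])
    show "AE w in gauss rest_index. (\<lambda>m. g m w) \<longlonglongrightarrow> g' w"
      unfolding g_def g'_def using lim(3) by (intro always_eventually allI)
  qed (use gm g'm Bm gB bound_fin in auto)
  have bq: "emeasure (leb const_index) (lin_image const_index V (lin_part w) balls)
     = emeasure (leb V) balls * emeasure (leb const_index) (lin_image const_index V (lin_part w) (unit_cube V))" for w
    by (rule emeasure_lin_image[OF finite_const_index finite_V card balls_sets(1)])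
  have cube: "compact (unit_cube V)" unfolding unit_cube_def by (intro compact_PiE_fun) simp
  have g'int: "(\<integral>\<^sup>+w. g' w \<partial>gauss rest_index) = ennreal (std_normal_density 0 ^ n) * emeasure (leb V) balls * lin_volume"
    unfolding g'_def bq lin_volume_def mult.assoc[symmetric]
    by (intro nn_integral_cmult measurable_lin_volume cube)
      (auto simp: measurable_lin_part cong: measurable_cong_sets simp: sets_gauss)
  have "hit_prob (radius m) / ennreal (radius m ^ n) = (\<integral>\<^sup>+w. g m w \<partial>gauss rest_index)" for m
    unfolding hit_prob_local[OF radius(1)] g_def
    using radius(1)[of m] by (subst mult.commute) (rule mult_divide_eq_ennreal, auto)
  then show "(\<lambda>m. hit_prob (radius m) / ennreal (radius m ^ n)) \<longlonglongrightarrow> ennreal (std_normal_density 0 ^ n) * emeasure (leb V) balls * lin_volume"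
    using conv g'int by simp
  have "ennreal (std_normal_density 0 ^ n) * emeasure (leb V) balls * lin_volume \<le> (\<integral>\<^sup>+w. ennreal (std_normal_density 0 ^ n * 2 ^ n) * B w \<partial>gauss rest_index)"
    unfolding g'int[symmetric] using conv gB
    by (intro LIMSEQ_le_const2[OF conv]) (auto intro!: nn_integral_mono exI[of _ 0])
  then have "ennreal (std_normal_density 0 ^ n) * emeasure (leb V) balls * lin_volume < \<infinity>" using bound_fin by order
  moreover have "ennreal (std_normal_density 0 ^ n) * emeasure (leb V) balls \<noteq> 0" using balls_pos by (simp add: std_normal_density_0)
  ultimately show "lin_volume < \<infinity>" by (auto simp: ennreal_mult_less_top)
qed

end

section \<open>The expected number of roots in terms of random volumes\<close>

definition abs_moment :: "nat \<Rightarrow> ennreal" where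
  "abs_moment m = (\<integral>\<^sup>+x. ennreal (\<bar>x\<bar> ^ m) \<partial>std_normal)"

lemma abs_moment_finite: "abs_moment m < \<infinity>"
proof -
  have "abs_moment m \<le> (\<integral>\<^sup>+x. ennreal ((1 + \<bar>x\<bar>) ^ m) \<partial>std_normal)"
    unfolding abs_moment_def by (intro nn_integral_mono ennreal_leI power_mono) auto
  also have "\<dots> < \<infinity>" by (rule nn_integral_std_normal_moment_finite)
  finally show ?thesis .
qed

lemma prod_abs_moment_finite: "(\<Prod>j\<in>A. abs_moment (f j)) < \<infinity>"
proof (induction A rule: infinite_finite_induct)
  case (insert x A)
  then show ?case using abs_moment_finite[of "f x"] by (simp add: ennreal_mult_less_top)
qed auto

text \<open>The density is positive everywhere and the integrand vanishes at most at 0, which is a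
  null set.\<close>

lemma abs_moment_nonzero [simp]: "abs_moment m \<noteq> 0"
proof
  assume "abs_moment m = 0"
  then have "AE x in std_normal. ennreal (\<bar>x\<bar> ^ m) = 0"
      unfolding abs_moment_def by (subst (asm) nn_integral_0_iff_AE) auto
  then have "AE x in lborel. ennreal (\<bar>x\<bar> ^ m) = 0"
      by (subst (asm) AE_density) (auto simp: normal_density_pos elim!: eventually_mono)
  then have "AE x in lborel. x = (0::real)"
      by eventually_elim (auto simp: ennreal_eq_0_iff power_le_zero_eq split: if_splits)
  moreover have "AE x in lborel. x \<noteq> (0::real)" by (rule AE_lborel_singleton)
  ultimately have "AE x in (lborel :: real measure). False" by eventually_elim auto
  then show False by (simp add: AE_iff_null null_sets_def)
qed

context multihom
begin

section \<open>Gaussian measure of a small neighbourhood\<close>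

definition north_index :: "(nat \<times> nat) set" where
  "north_index = (\<lambda>j. (j, 0)) ` {1..k}"

lemma finite_north_index [simp]: "finite north_index"
  by (simp add: north_index_def)

lemma X_split: "X = north_index \<union> V" "north_index \<inter> V = {}"
  by (auto simp: X_def V_def north_index_def)

lemma near_north_iff:
  assumes s: "s > 0"
  shows "near s north y \<longleftrightarrow> (\<forall>j\<in>{1..k}. (\<Sum>h\<in>{1..ns j}. (y (j, h))\<^sup>2) \<le> s\<^sup>2 * (y (j, 0))\<^sup>2)"
  unfolding near_def
proof (intro ball_cong refl)
  fix j assume j: "j \<in> {1..k}"
  have *: "ip {..ns j} (\<lambda>h. north (j, h)) (\<lambda>h. g (j, h)) = g (j, 0)" for g :: "nat \<times> nat \<Rightarrow> real"
  proof -
    have "ip {..ns j} (\<lambda>h. north (j, h)) (\<lambda>h. g (j, h)) = (\<Sum>h\<le>ns j. if h = 0 then g (j, h) else 0)"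
      unfolding ip_def using j by (intro sum.cong) (auto simp: north_def)
    then show ?thesis by simp
  qed
  have "north (j, 0) = 1" using j by (simp add: north_def)
  moreover have "ip {..ns j} (\<lambda>h. y (j, h)) (\<lambda>h. y (j, h)) = (y (j, 0))\<^sup>2 + (\<Sum>h\<in>{1..ns j}. (y (j, h))\<^sup>2)"
    by (simp add: ip_def sum_split_zero power2_eq_square)
  ultimately show "near_lines s {..ns j} (\<lambda>h. north (j, h)) (\<lambda>h. y (j, h)) \<longleftrightarrow>
      (\<Sum>h\<in>{1..ns j}. (y (j, h))\<^sup>2) \<le> s\<^sup>2 * (y (j, 0))\<^sup>2"
    unfolding near_lines_def * by (simp add: algebra_simps)
qed

lemma prod_V: "(\<Prod>v\<in>V. f (fst v)) = (\<Prod>j\<in>{1..k}. f j ^ ns j)" for f :: "nat \<Rightarrow> real"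
proof -
  have "(\<Prod>v\<in>V. f (fst v)) = (\<Prod>j\<in>{1..k}. \<Prod>h\<in>{1..ns j}. f j)"
    unfolding V_def by (subst prod.Sigma) (auto simp: case_prod_unfold)
  then show ?thesis by simp
qed

definition local_cap :: "real \<Rightarrow> (nat \<times> nat \<Rightarrow> real) \<Rightarrow> ennreal" where
  "local_cap s y = (\<integral>\<^sup>+\<tau>. ennreal (\<Prod>v\<in>V. std_normal_density (s * \<bar>y (fst v, 0)\<bar> * \<tau> v)) * indicator balls \<tau> \<partial>leb V)"

text \<open>The Jacobian that remains, apart from powers of \<open>s\<close>, when the chart
  coordinates of block \<open>j\<close> are measured in units of
  \<open>s * \<bar>y (j, 0)\<bar>\<close>. Its mean is the product of absolute moments in the final
  denominator.\<close>

definition weight :: "(nat \<times> nat \<Rightarrow> real) \<Rightarrow> real" where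
  "weight y = (\<Prod>j\<in>{1..k}. \<bar>y (j, 0)\<bar> ^ ns j)"

lemma weight_measurable: "(\<lambda>y. ennreal (weight y)) \<in> borel_measurable (leb north_index)"
  unfolding weight_def
  by (intro measurable_compose[OF _ measurable_ennreal] borel_measurable_prod borel_measurable_power borel_measurable_abs measurable_leb_coord)
    (auto simp: north_index_def)

lemma nn_integral_weight: "(\<integral>\<^sup>+y. ennreal (weight y) \<partial>gauss north_index) = (\<Prod>j\<in>{1..k}. abs_moment (ns j))"
proof -
  have "(\<integral>\<^sup>+y. ennreal (weight y) \<partial>gauss north_index) = (\<integral>\<^sup>+y. (\<Prod>v\<in>north_index. ennreal (\<bar>y v\<bar> ^ ns (fst v))) \<partial>gauss north_index)"
    unfolding weight_def north_index_def by (simp add: prod_ennreal prod.reindex inj_on_def)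
  also have "\<dots> = (\<Prod>v\<in>north_index. abs_moment (ns (fst v)))"
    unfolding gauss_def abs_moment_def by (intro gauss_prod.product_nn_integral_prod) auto
  also have "\<dots> = (\<Prod>j\<in>{1..k}. abs_moment (ns j))"
    unfolding north_index_def by (simp add: prod.reindex inj_on_def)
  finally show ?thesis .
qed

lemma local_cap_measurable: "local_cap s \<in> borel_measurable (leb north_index)"
proof -
  interpret sigma_finite_measure "leb V" by (simp add: sigma_finite_leb)
  have "(\<lambda>p. ennreal (\<Prod>v\<in>V. std_normal_density (s * \<bar>fst p (fst v, 0)\<bar> * snd p v)) * indicator balls (snd p))
    \<in> borel_measurable (leb north_index \<Otimes>\<^sub>M leb V)"
  proof (intro borel_measurable_times_ennreal measurable_compose[OF measurable_snd borel_measurable_indicator]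
      balls_sets measurable_compose[OF _ measurable_ennreal] borel_measurable_prod)
    fix v assume v: "v \<in> V"
    then have "(\<lambda>p. snd p v) \<in> borel_measurable (leb north_index \<Otimes>\<^sub>M leb V)"
      by (intro measurable_compose[OF measurable_snd measurable_leb_coord])
    moreover have "(\<lambda>p. fst p (fst v, 0)) \<in> borel_measurable (leb north_index \<Otimes>\<^sub>M leb V)"
      using v by (intro measurable_compose[OF measurable_fst measurable_leb_coord]) (auto simp: V_def north_index_def)
    ultimately have "(\<lambda>p. s * \<bar>fst p (fst v, 0)\<bar> * snd p v) \<in> borel_measurable (leb north_index \<Otimes>\<^sub>M leb V)"
      by (intro borel_measurable_times borel_measurable_abs borel_measurable_const)
    then show "(\<lambda>p. std_normal_density (s * \<bar>fst p (fst v, 0)\<bar> * snd p v)) \<in> borel_measurable (leb north_index \<Otimes>\<^sub>M leb V)"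
      by measurable
  qed
  from borel_measurable_nn_integral_fst[OF this] show ?thesis by (simp add: local_cap_def[abs_def])
qed

text \<open>For given leading coordinates \<open>y (j, 0)\<close> the neighbourhood of
  \<open>north\<close> is a product of balls of radius \<open>s * \<bar>y (j, 0)\<bar>\<close>, and
  rescaling maps it to \<open>balls\<close>. Vanishing leading coordinates form a null set and are
  left out.\<close>

lemma cap_measure_local:
  assumes s: "s > 0"
  shows "cap_measure s = ennreal (s ^ card V) * (\<integral>\<^sup>+y. ennreal (weight y) * local_cap s y \<partial>gauss north_index)"
proof -
  let ?E = "{y \<in> space (leb X). near s north y}"
  have E: "?E \<in> sets (leb X)" by (rule near_measurable)
  have "cap_measure s = (\<integral>\<^sup>+y. indicator ?E y \<partial>PiM (north_index \<union> V) (\<lambda>_. std_normal))"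
    unfolding cap_measure_def using E by (simp add: sets_gauss X_split(1)[symmetric] gauss_def[symmetric])
  also have "\<dots> = (\<integral>\<^sup>+y. \<integral>\<^sup>+t. indicator ?E (merge north_index V (y, t)) \<partial>gauss V \<partial>gauss north_index)"
    unfolding gauss_def using E X_split(2)
    by (intro gauss_prod.product_nn_integral_fold) (auto simp: X_split(1)[symmetric] sets_gauss gauss_def[symmetric] intro!: borel_measurable_indicator)
  also have "\<dots> = (\<integral>\<^sup>+y. ennreal (s ^ card V) * (ennreal (weight y) * local_cap s y) \<partial>gauss north_index)"
  proof (rule nn_integral_cong_AE)
    have "AE y in gauss north_index. \<forall>j\<in>{1..k}. y (j, 0) \<noteq> 0"
      by (intro AE_finite_allI AE_gauss_nonzero) (auto simp: north_index_def)
    then show "AE y in gauss north_index. (\<integral>\<^sup>+t. indicator ?E (merge north_index V (y, t)) \<partial>gauss V)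
       = ennreal (s ^ card V) * (ennreal (weight y) * local_cap s y)"
      using AE_space
    proof eventually_elim
      fix y assume y: "\<forall>j\<in>{1..k}. y (j, 0) \<noteq> 0" "y \<in> space (gauss north_index)"
      define Z where "Z = {t \<in> space (leb V). \<forall>j\<in>{1..k}. (\<Sum>h\<in>{1..ns j}. (t (j, h))\<^sup>2) \<le> s\<^sup>2 * (y (j, 0))\<^sup>2}"
      have Z: "Z \<in> sets (leb V)" unfolding Z_def
        by (intro sets.sets_Collect_finite_All borel_measurable_le block_square_measurable borel_measurable_const) auto
      have "indicator ?E (merge north_index V (y, t)) = (indicator Z t :: ennreal)" if t: "t \<in> space (gauss V)" for t
      proof -
        let ?y = "merge north_index V (y, t)"
        have "?y \<in> space (leb X)" unfolding X_split(1) by (auto simp: space_leb PiE_iff)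
        moreover have "?y (j, 0) = y (j, 0)" if "j \<in> {1..k}" for j using that by (simp add: merge_def north_index_def)
        moreover have "(\<Sum>h\<in>{1..ns j}. (?y (j, h))\<^sup>2) = (\<Sum>h\<in>{1..ns j}. (t (j, h))\<^sup>2)" if "j \<in> {1..k}" for j
          using that by (intro sum.cong refl) (auto simp: merge_def north_index_def)
        ultimately have "?y \<in> ?E \<longleftrightarrow> t \<in> Z" using t by (simp add: near_north_iff[OF s] Z_def space_gauss)
        then show ?thesis by (simp add: indicator_def)
      qed
      then have "(\<integral>\<^sup>+t. indicator ?E (merge north_index V (y, t)) \<partial>gauss V) = (\<integral>\<^sup>+t. indicator Z t \<partial>gauss V)"
        by (intro nn_integral_cong) auto
      also have "\<dots> = (\<integral>\<^sup>+t. ennreal (\<Prod>v\<in>V. std_normal_density (t v)) * indicator Z t \<partial>leb V)"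
        using Z by (intro nn_integral_gauss) auto
      also have "\<dots> = ennreal (\<Prod>v\<in>V. \<bar>s * \<bar>y (fst v, 0)\<bar>\<bar>) *
         (\<integral>\<^sup>+\<tau>. ennreal (\<Prod>v\<in>V. std_normal_density ((\<lambda>v\<in>V. 0 + s * \<bar>y (fst v, 0)\<bar> * \<tau> v) v)) *
           indicator Z (\<lambda>v\<in>V. 0 + s * \<bar>y (fst v, 0)\<bar> * \<tau> v) \<partial>leb V)"
      proof (rule nn_integral_leb_affine)
        have "(\<lambda>t. \<Prod>v\<in>V. std_normal_density (t v)) \<in> borel_measurable (leb V)"
        proof (rule borel_measurable_prod)
          fix v assume "v \<in> V"
          from measurable_leb_coord[OF this] show "(\<lambda>t. std_normal_density (t v)) \<in> borel_measurable (leb V)" by measurable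
        qed
        then show "(\<lambda>t. ennreal (\<Prod>v\<in>V. std_normal_density (t v)) * indicator Z t) \<in> borel_measurable (leb V)"
          using Z by (intro borel_measurable_times_ennreal borel_measurable_indicator measurable_compose[OF _ measurable_ennreal])
        show "s * \<bar>y (fst v, 0)\<bar> \<noteq> 0" if "v \<in> V" for v using that y s by (auto simp: V_def)
      qed simp
      also have "(\<Prod>v\<in>V. \<bar>s * \<bar>y (fst v, 0)\<bar>\<bar>) = s ^ card V * weight y"
        using s prod_V[of "\<lambda>j. \<bar>y (j, 0)\<bar>"] by (simp add: abs_mult prod.distrib weight_def)
      also have "(\<integral>\<^sup>+\<tau>. ennreal (\<Prod>v\<in>V. std_normal_density ((\<lambda>v\<in>V. 0 + s * \<bar>y (fst v, 0)\<bar> * \<tau> v) v)) *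
           indicator Z (\<lambda>v\<in>V. 0 + s * \<bar>y (fst v, 0)\<bar> * \<tau> v) \<partial>leb V) = local_cap s y"
        unfolding local_cap_def
      proof (rule nn_integral_cong)
        fix \<tau> assume \<tau>: "\<tau> \<in> space (leb V)"
        have "(\<lambda>v\<in>V. 0 + s * \<bar>y (fst v, 0)\<bar> * \<tau> v) \<in> Z \<longleftrightarrow> \<tau> \<in> balls"
        proof -
          have "(\<Sum>h\<in>{1..ns j}. ((\<lambda>v\<in>V. 0 + s * \<bar>y (fst v, 0)\<bar> * \<tau> v) (j, h))\<^sup>2) \<le> s\<^sup>2 * (y (j, 0))\<^sup>2 \<longleftrightarrow> (\<Sum>h\<in>{1..ns j}. (\<tau> (j, h))\<^sup>2) \<le> 1"
            if j: "j \<in> {1..k}" for j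
          proof -
            have "(\<Sum>h\<in>{1..ns j}. ((\<lambda>v\<in>V. 0 + s * \<bar>y (fst v, 0)\<bar> * \<tau> v) (j, h))\<^sup>2) = (s\<^sup>2 * (y (j, 0))\<^sup>2) * (\<Sum>h\<in>{1..ns j}. (\<tau> (j, h))\<^sup>2)"
              using j by (auto simp: sum_distrib_left power_mult_distrib intro!: sum.cong)
            moreover have "s\<^sup>2 * (y (j, 0))\<^sup>2 > 0" using y(1) j s by auto
            ultimately show ?thesis
              using mult_le_cancel_left_pos[of "s\<^sup>2 * (y (j, 0))\<^sup>2" "\<Sum>h\<in>{1..ns j}. (\<tau> (j, h))\<^sup>2" 1] by simp
          qed
          then show ?thesis using \<tau> by (simp add: Z_def balls_def space_leb)
        qed
        then show "ennreal (\<Prod>v\<in>V. std_normal_density ((\<lambda>v\<in>V. 0 + s * \<bar>y (fst v, 0)\<bar> * \<tau> v) v)) *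
           indicator Z (\<lambda>v\<in>V. 0 + s * \<bar>y (fst v, 0)\<bar> * \<tau> v) =
           ennreal (\<Prod>v\<in>V. std_normal_density (s * \<bar>y (fst v, 0)\<bar> * \<tau> v)) * indicator balls \<tau>"
          by (simp add: indicator_def)
      qed
      finally show "(\<integral>\<^sup>+t. indicator ?E (merge north_index V (y, t)) \<partial>gauss V)
         = ennreal (s ^ card V) * (ennreal (weight y) * local_cap s y)"
        using s by (simp add: ennreal_mult weight_def prod_nonneg mult.assoc)
    qed
  qed
  also have "\<dots> = ennreal (s ^ card V) * (\<integral>\<^sup>+y. ennreal (weight y) * local_cap s y \<partial>gauss north_index)"
    using weight_measurable local_cap_measurable
    by (intro nn_integral_cmult borel_measurable_times_ennreal) (simp_all cong: measurable_cong_sets add: sets_gauss)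
  finally show ?thesis .
qed

lemma prod_density_le: "(\<Prod>v\<in>A. std_normal_density (f v)) \<le> std_normal_density 0 ^ card A"
  using prod_mono[of A "\<lambda>v. std_normal_density (f v)" "\<lambda>_. std_normal_density 0"] std_normal_density_le by simp

lemma local_cap_le: "local_cap s y \<le> ennreal (std_normal_density 0 ^ card V) * emeasure (leb V) balls"
proof -
  have "local_cap s y \<le> (\<integral>\<^sup>+\<tau>. ennreal (std_normal_density 0 ^ card V) * indicator balls \<tau> \<partial>leb V)"
    unfolding local_cap_def by (intro nn_integral_mono mult_right_mono ennreal_leI prod_density_le) auto
  also have "\<dots> = ennreal (std_normal_density 0 ^ card V) * emeasure (leb V) balls"
    using balls_sets by (simp add: nn_integral_cmult)
  finally show ?thesis .
qed

lemma local_cap_limit: "(\<lambda>m. local_cap (radius m) y) \<longlonglongrightarrow> ennreal (std_normal_density 0 ^ card V) * emeasure (leb V) balls"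
proof -
  have "(\<lambda>m. local_cap (radius m) y) \<longlonglongrightarrow> (\<integral>\<^sup>+\<tau>. ennreal (std_normal_density 0 ^ card V) * indicator balls \<tau> \<partial>leb V)"
    unfolding local_cap_def
  proof (rule nn_integral_dominated_convergence[where w="\<lambda>\<tau>. ennreal (std_normal_density 0 ^ card V) * indicator balls \<tau>"])
    show "(\<integral>\<^sup>+\<tau>. ennreal (std_normal_density 0 ^ card V) * indicator balls \<tau> \<partial>leb V) < \<infinity>"
      using balls_sets balls_finite by (simp add: nn_integral_cmult ennreal_mult_less_top)
    show "AE \<tau> in leb V. ennreal (\<Prod>v\<in>V. std_normal_density (radius m * \<bar>y (fst v, 0)\<bar> * \<tau> v)) * indicator balls \<tau>
       \<le> ennreal (std_normal_density 0 ^ card V) * indicator balls \<tau>" for m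
      by (intro always_eventually allI mult_right_mono ennreal_leI prod_density_le) auto
    show "AE \<tau> in leb V. (\<lambda>m. ennreal (\<Prod>v\<in>V. std_normal_density (radius m * \<bar>y (fst v, 0)\<bar> * \<tau> v)) * indicator balls \<tau>)
       \<longlonglongrightarrow> ennreal (std_normal_density 0 ^ card V) * indicator balls \<tau>"
    proof (intro always_eventually allI)
      fix \<tau>
      have "(\<lambda>m. ennreal (\<Prod>v\<in>V. std_normal_density (radius m * \<bar>y (fst v, 0)\<bar> * \<tau> v))) \<longlonglongrightarrow> ennreal (\<Prod>v\<in>V. std_normal_density 0)"
        by (intro tendsto_ennrealI tendsto_prod tendsto_std_normal_density tendsto_mult_left_zero radius(3))
      then show "(\<lambda>m. ennreal (\<Prod>v\<in>V. std_normal_density (radius m * \<bar>y (fst v, 0)\<bar> * \<tau> v)) * indicator balls \<tau>)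
       \<longlonglongrightarrow> ennreal (std_normal_density 0 ^ card V) * indicator balls \<tau>"
        by (cases "\<tau> \<in> balls") simp_all
    qed
    show "(\<lambda>\<tau>. ennreal (\<Prod>v\<in>V. std_normal_density (radius m * \<bar>y (fst v, 0)\<bar> * \<tau> v)) * indicator balls \<tau>) \<in> borel_measurable (leb V)" for m
    proof (intro borel_measurable_times_ennreal borel_measurable_indicator balls_sets measurable_compose[OF _ measurable_ennreal] borel_measurable_prod)
      fix v assume "v \<in> V"
      from measurable_leb_coord[OF this] show "(\<lambda>\<tau>. std_normal_density (radius m * \<bar>y (fst v, 0)\<bar> * \<tau> v)) \<in> borel_measurable (leb V)"
        by measurable
    qed
  qed (use balls_sets in auto)
  also have "(\<integral>\<^sup>+\<tau>. ennreal (std_normal_density 0 ^ card V) * indicator balls \<tau> \<partial>leb V) = ennreal (std_normal_density 0 ^ card V) * emeasure (leb V) balls"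
    using balls_sets by (simp add: nn_integral_cmult)
  finally show ?thesis .
qed

text \<open>The normal density is largest at 0, so the limit of the local integral is also its upper
  bound, and the integrable weight times this constant is a majorant.\<close>

lemma cap_measure_limit:
  "(\<lambda>m. cap_measure (radius m) / ennreal (radius m ^ card V)) \<longlonglongrightarrow>
     ennreal (std_normal_density 0 ^ card V) * emeasure (leb V) balls * (\<Prod>j\<in>{1..k}. abs_moment (ns j))"
proof -
  define c where "c = ennreal (std_normal_density 0 ^ card V) * emeasure (leb V) balls"
  have c: "c < \<infinity>" using balls_finite by (simp add: c_def ennreal_mult_less_top)
  have wm: "(\<lambda>y. ennreal (weight y)) \<in> borel_measurable (gauss north_index)"
    using weight_measurable by (simp cong: measurable_cong_sets add: sets_gauss)
  have cm: "local_cap s \<in> borel_measurable (gauss north_index)" for s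
    using local_cap_measurable by (simp cong: measurable_cong_sets add: sets_gauss)
  have fin: "(\<Prod>j\<in>{1..k}. abs_moment (ns j)) < \<infinity>"
    by (rule prod_abs_moment_finite)
  have "(\<lambda>m. \<integral>\<^sup>+y. ennreal (weight y) * local_cap (radius m) y \<partial>gauss north_index) \<longlonglongrightarrow> (\<integral>\<^sup>+y. ennreal (weight y) * c \<partial>gauss north_index)"
  proof (rule nn_integral_dominated_convergence[where w="\<lambda>y. ennreal (weight y) * c"])
    show "(\<integral>\<^sup>+y. ennreal (weight y) * c \<partial>gauss north_index) < \<infinity>"
      using c fin by (simp add: nn_integral_multc[OF wm] nn_integral_weight ennreal_mult_less_top)
    show "AE y in gauss north_index. ennreal (weight y) * local_cap (radius m) y \<le> ennreal (weight y) * c" for m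
      unfolding c_def by (intro always_eventually allI mult_left_mono local_cap_le) auto
    show "AE y in gauss north_index. (\<lambda>m. ennreal (weight y) * local_cap (radius m) y) \<longlonglongrightarrow> ennreal (weight y) * c"
      unfolding c_def by (intro always_eventually allI ennreal_tendsto_cmult local_cap_limit) auto
  qed (use wm cm in \<open>auto intro!: borel_measurable_times_ennreal\<close>)
  moreover have "cap_measure (radius m) / ennreal (radius m ^ card V) = (\<integral>\<^sup>+y. ennreal (weight y) * local_cap (radius m) y \<partial>gauss north_index)" for m
    unfolding cap_measure_local[OF radius(1)]
    using radius(1)[of m] by (subst mult.commute) (rule mult_divide_eq_ennreal, auto)
  moreover have "(\<integral>\<^sup>+y. ennreal (weight y) * c \<partial>gauss north_index) = c * (\<Prod>j\<in>{1..k}. abs_moment (ns j))"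
    by (subst nn_integral_multc[OF wm]) (simp add: nn_integral_weight mult.commute)
  ultimately show ?thesis by (simp add: c_def)
qed

section \<open>The limit of the quotient and the expectation\<close>

lemma prod_abs_moment_pos: "(\<Prod>j\<in>A. abs_moment (f j)) \<noteq> 0"
  by (cases "finite A") auto

lemma tendsto_divide_ennreal:
  fixes a b :: ennreal
  assumes "(f \<longlongrightarrow> a) F" "(g \<longlongrightarrow> b) F" "a < \<infinity>" "0 < b"
  shows "((\<lambda>x. f x / g x) \<longlongrightarrow> a / b) F"
proof -
  have "((\<lambda>x. inverse (g x)) \<longlongrightarrow> inverse b) F"
  proof -
    have "continuous_on UNIV (inverse :: ennreal \<Rightarrow> ennreal)"
      by (rule continuous_on_inverse_ennreal[OF continuous_on_id])
    from continuous_on_tendsto_compose[OF this assms(2)] show ?thesis by simp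
  qed
  moreover have "inverse b \<noteq> \<infinity>" using assms(4) by auto
  ultimately show ?thesis
    unfolding divide_ennreal_def using assms by (intro tendsto_mult_ennreal) auto
qed

lemma cap_measure_eventually_pos: "eventually (\<lambda>m. cap_measure (radius m) > 0) sequentially"
proof -
  have "ennreal (std_normal_density 0 ^ card V) * emeasure (leb V) balls * (\<Prod>j\<in>{1..k}. abs_moment (ns j)) \<noteq> 0"
    using balls_pos by (simp add: std_normal_density_0)
  then have "0 < ennreal (std_normal_density 0 ^ card V) * emeasure (leb V) balls * (\<Prod>j\<in>{1..k}. abs_moment (ns j))"
    by (simp add: zero_less_iff_neq_zero)
  from order_tendstoD(1)[OF cap_measure_limit this]
  have "eventually (\<lambda>m. 0 < cap_measure (radius m) / ennreal (radius m ^ card V)) sequentially" .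
  then show ?thesis by eventually_elim (auto simp: zero_less_iff_neq_zero)
qed

lemma cap_measure_finite: "cap_measure s \<noteq> \<infinity>"
proof -
  interpret prob_space "gauss X" by (rule prob_space_gauss)
  show ?thesis unfolding cap_measure_def using emeasure_finite by simp
qed

text \<open>The density at the origin and the volume of \<open>balls\<close> occur in both limits
  and cancel, so the volume of a ball is never computed.\<close>

lemma hit_cap_ratio_limit:
  assumes n: "n = (\<Sum>j\<in>{1..k}. ns j)"
  shows "(\<lambda>m. hit_prob (radius m) / cap_measure (radius m)) \<longlonglongrightarrow> lin_volume / (\<Prod>j\<in>{1..k}. abs_moment (ns j))"
proof -
  define c where "c = ennreal (std_normal_density 0 ^ n) * emeasure (leb V) balls"
  define A where "A = (\<Prod>j\<in>{1..k}. abs_moment (ns j))"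
  have nV: "card V = n" by (simp add: card_V n)
  have c: "c \<noteq> 0" "c < \<infinity>" using balls_pos balls_finite by (auto simp: c_def std_normal_density_0 ennreal_mult_less_top)
  have A: "A \<noteq> 0" "A < \<infinity>" using prod_abs_moment_pos prod_abs_moment_finite by (auto simp: A_def)
  have lv: "lin_volume < \<infinity>" by (rule hit_prob_limit(2)[OF n])
  have "(\<lambda>m. (hit_prob (radius m) / ennreal (radius m ^ n)) / (cap_measure (radius m) / ennreal (radius m ^ n))) \<longlonglongrightarrow> (c * lin_volume) / (c * A)"
    using hit_prob_limit(1)[OF n] cap_measure_limit c A lv unfolding nV c_def[symmetric] A_def[symmetric]
    by (intro tendsto_divide_ennreal) (auto simp: ennreal_mult_less_top zero_less_iff_neq_zero)
  moreover have "(hit_prob (radius m) / ennreal (radius m ^ n)) / (cap_measure (radius m) / ennreal (radius m ^ n)) = hit_prob (radius m) / cap_measure (radius m)" for m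
  proof -
    define a where "a = radius m ^ n"
    have a: "a > 0" "ennreal (radius m ^ n) = ennreal a" using radius(1)[of m] by (auto simp: a_def)
    interpret prob_space "gauss Om" by (rule prob_space_gauss)
    have "hit_prob (radius m) \<noteq> \<infinity>" unfolding hit_prob_def using emeasure_finite by simp
    then obtain p where p: "p \<ge> 0" "hit_prob (radius m) = ennreal p" by (cases "hit_prob (radius m)") auto
    obtain q where q: "q \<ge> 0" "cap_measure (radius m) = ennreal q" using cap_measure_finite[of "radius m"] by (cases "cap_measure (radius m)") auto
    show ?thesis
    \<comment> \<open>A vanishing denominator is separate, as division by zero gives infinity or 0
      according to the numerator.\<close>
    proof (cases "q = 0")
      case True
      then show ?thesis unfolding a p q using a p by (cases "p = 0") (auto simp: divide_ennreal ennreal_divide_self)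
    next
      case False
      then show ?thesis unfolding a p q using a p q by (simp add: divide_ennreal)
    qed
  qed
  moreover have "(c * lin_volume) / (c * A) = lin_volume / A"
  proof -
    obtain c' A' l where "c = ennreal c'" "c' > 0" "A = ennreal A'" "A' > 0" "lin_volume = ennreal l" "l \<ge> 0"
      using c A lv by (cases c; cases A; cases lin_volume) (auto simp: ennreal_eq_0_iff less_le)
    then show ?thesis by (simp add: divide_ennreal ennreal_mult[symmetric])
  qed
  ultimately show ?thesis by (simp add: A_def)
qed

text \<open>Finite subsets of the root set bound the lower limit from below, the union bound holds
  from above, and infinite root sets are included. The formula also makes the count
  measurable.\<close>

lemma root_count_liminf:
  "emeasure (count_space UNIV) (root_set k ns n \<delta> f) = liminf (\<lambda>m. hit_measure (radius m) f / cap_measure (radius m))"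
proof (rule antisym)
  let ?Z = "root_set k ns n \<delta> f" and ?N = "\<lambda>m. hit_measure (radius m) f / cap_measure (radius m)"
  have fin: "of_nat (card T) \<le> liminf ?N" if T: "finite T" "T \<subseteq> ?Z" for T
  proof (rule Liminf_bounded)
    obtain r where r: "r > 0" "\<And>s. 0 < s \<Longrightarrow> s < r \<Longrightarrow> of_nat (card T) * cap_measure s \<le> hit_measure s f"
      using hit_measure_ge[OF T] by blast
    have "eventually (\<lambda>m. radius m < r) sequentially" using order_tendstoD(2)[OF radius(3) r(1)] .
    then show "eventually (\<lambda>m. of_nat (card T) \<le> ?N m) sequentially"
      using cap_measure_eventually_pos
    proof eventually_elim
      fix m assume m: "radius m < r" "0 < cap_measure (radius m)"
      have "of_nat (card T) = of_nat (card T) * cap_measure (radius m) / cap_measure (radius m)"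
        using m(2) cap_measure_finite by (intro mult_divide_eq_ennreal[symmetric]) auto
      also have "\<dots> \<le> ?N m" using r(2)[OF radius(1) m(1)] by (rule divide_right_mono_ennreal)
      finally show "of_nat (card T) \<le> ?N m" .
    qed
  qed
  show "emeasure (count_space UNIV) ?Z \<le> liminf ?N"
  proof (cases "finite ?Z")
    case True
    then show ?thesis using fin[of ?Z] by simp
  next
    case False
    have "of_nat m \<le> liminf ?N" for m
      using infinite_arbitrarily_large[OF False, of m] fin by metis
    then have "liminf ?N = \<infinity>"
      by (metis ennreal_Ex_less_of_nat infinity_ennreal_def linorder_not_le top.not_eq_extremum)
    then show ?thesis by simp
  qed
  show "liminf ?N \<le> emeasure (count_space UNIV) ?Z"
  proof -
    have "eventually (\<lambda>m. ?N m \<le> emeasure (count_space UNIV) ?Z) sequentially"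
      using cap_measure_eventually_pos
    proof eventually_elim
      fix m assume pos: "0 < cap_measure (radius m)"
      have "?N m \<le> cap_measure (radius m) * emeasure (count_space UNIV) ?Z / cap_measure (radius m)"
        by (rule divide_right_mono_ennreal) (rule hit_measure_le[OF pos])
      also have "\<dots> = emeasure (count_space UNIV) ?Z"
        using pos cap_measure_finite by (subst mult.commute) (intro mult_divide_eq_ennreal, auto)
      finally show "?N m \<le> emeasure (count_space UNIV) ?Z" .
    qed
    then have "liminf ?N \<le> liminf (\<lambda>_. emeasure (count_space UNIV) ?Z)" by (rule Liminf_mono)
    then show ?thesis by (simp add: Liminf_const)
  qed
qed

text \<open>The upper bound is Fatou's lemma. For the lower bound every approximation with positive
  \<open>cap_measure\<close> is at most the count, so each of the means
  \<open>hit_prob / cap_measure\<close> bounds the expectation from below, and so does their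
  limit.\<close>

lemma expected_roots_eq:
  assumes n: "n = (\<Sum>j\<in>{1..k}. ns j)" "n \<ge> 1" and F: "random_system M k ns n \<delta> F"
  shows "expected_roots M k ns n \<delta> F = lin_volume / (\<Prod>j\<in>{1..k}. abs_moment (ns j))"
    and "(\<lambda>w. emeasure (count_space UNIV) (root_set k ns n \<delta> (\<lambda>i a. F i a w))) \<in> borel_measurable M"
proof -
  define N where "N m w = hit_measure (radius m) (\<lambda>i a. F i a w) / cap_measure (radius m)" for m w
  have Nm: "N m \<in> borel_measurable M" for m
    unfolding N_def using hit_measure_random_measurable[OF n(2) F] by (intro borel_measurable_divide_ennreal) auto
  have count: "emeasure (count_space UNIV) (root_set k ns n \<delta> (\<lambda>i a. F i a w)) = liminf (\<lambda>m. N m w)" for w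
    unfolding N_def by (rule root_count_liminf)
  show "(\<lambda>w. emeasure (count_space UNIV) (root_set k ns n \<delta> (\<lambda>i a. F i a w))) \<in> borel_measurable M"
    unfolding count using Nm by (rule borel_measurable_liminf)
  have int: "(\<integral>\<^sup>+w. N m w \<partial>M) = hit_prob (radius m) / cap_measure (radius m)" for m
    unfolding N_def using nn_integral_hit_measure[OF n(2) F] hit_measure_random_measurable[OF n(2) F]
    by (simp add: nn_integral_divide)
  note lim = hit_cap_ratio_limit[OF n(1)]
  show "expected_roots M k ns n \<delta> F = lin_volume / (\<Prod>j\<in>{1..k}. abs_moment (ns j))"
  proof (rule antisym)
    have "expected_roots M k ns n \<delta> F = (\<integral>\<^sup>+w. liminf (\<lambda>m. N m w) \<partial>M)"
      unfolding expected_roots_def count ..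
    also have "\<dots> \<le> liminf (\<lambda>m. \<integral>\<^sup>+w. N m w \<partial>M)" by (rule nn_integral_liminf[OF Nm])
    also have "\<dots> = lin_volume / (\<Prod>j\<in>{1..k}. abs_moment (ns j))"
      unfolding int by (rule lim_imp_Liminf[OF _ lim]) simp
    finally show "expected_roots M k ns n \<delta> F \<le> lin_volume / (\<Prod>j\<in>{1..k}. abs_moment (ns j))" .
    show "lin_volume / (\<Prod>j\<in>{1..k}. abs_moment (ns j)) \<le> expected_roots M k ns n \<delta> F"
    proof (rule tendsto_upperbound[OF lim])
      show "eventually (\<lambda>m. hit_prob (radius m) / cap_measure (radius m) \<le> expected_roots M k ns n \<delta> F) sequentially"
        using cap_measure_eventually_pos
      proof eventually_elim
        fix m assume pos: "0 < cap_measure (radius m)"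
        show "hit_prob (radius m) / cap_measure (radius m) \<le> expected_roots M k ns n \<delta> F"
          unfolding int[symmetric] expected_roots_def
        proof (rule nn_integral_mono)
          fix w
          have "N m w \<le> cap_measure (radius m) * emeasure (count_space UNIV) (root_set k ns n \<delta> (\<lambda>i a. F i a w)) / cap_measure (radius m)"
            unfolding N_def by (rule divide_right_mono_ennreal) (rule hit_measure_le[OF pos])
          also have "\<dots> = emeasure (count_space UNIV) (root_set k ns n \<delta> (\<lambda>i a. F i a w))"
            using pos cap_measure_finite by (subst mult.commute) (intro mult_divide_eq_ennreal, auto)
          finally show "N m w \<le> emeasure (count_space UNIV) (root_set k ns n \<delta> (\<lambda>i a. F i a w))" .
        qed
      qed
    qed simp
  qed
qed

end

section \<open>The mean volume of the image of the cube under a Gaussian matrix\<close>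

text \<open>For index sets of equal size, the mean absolute determinant of a standard Gaussian
  matrix.\<close>

definition gauss_volume :: "'i set \<Rightarrow> 'j set \<Rightarrow> ennreal" where
  "gauss_volume I J = (\<integral>\<^sup>+G. emeasure (leb I) (lin_image I J (\<lambda>i j. G (i, j)) (unit_cube J)) \<partial>gauss (I \<times> J))"

lemma compact_unit_cube: "compact (unit_cube J)"
  unfolding unit_cube_def by (intro compact_PiE_fun) simp

lemma measurable_gauss_volume:
  fixes J :: "'j::countable set"
  assumes "finite I" "finite J"
  shows "(\<lambda>G. emeasure (leb I) (lin_image I J (\<lambda>i j. G (i, j)) (unit_cube J))) \<in> borel_measurable (leb (I \<times> J))"
  using assms by (intro measurable_lin_volume compact_unit_cube measurable_leb_coord) auto

lemma leb_reindex:
  assumes [simp]: "finite I'" and \<alpha>: "bij_betw \<alpha> I' I"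
  shows "distr (leb I) (leb I') (\<lambda>z. \<lambda>i\<in>I'. z (\<alpha> i)) = leb I'"
  unfolding leb_def
proof (rule lborel_prod.PiM_eqI)
  have fin[simp]: "finite I" using \<alpha> by (metis assms(1) bij_betw_finite)
  have m: "(\<lambda>z. \<lambda>i\<in>I'. z (\<alpha> i)) \<in> measurable (PiM I (\<lambda>_. lborel)) (PiM I' (\<lambda>_. lborel))"
    using measurable_lebI[of I' "\<lambda>i z. z (\<alpha> i)" "leb I"] measurable_leb_coord[of _ I] \<alpha>
    unfolding leb_def by (auto simp: bij_betw_def)
  fix A :: "'a \<Rightarrow> real set" assume A: "\<And>i. i \<in> I' \<Longrightarrow> A i \<in> sets lborel"
  define \<beta> where "\<beta> = the_inv_into I' \<alpha>"
  have \<beta>\<alpha>: "\<beta> (\<alpha> i) = i" if "i \<in> I'" for i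
    using \<alpha> that by (simp add: \<beta>_def the_inv_into_f_f bij_betw_def)
  have im: "I = \<alpha> ` I'" and inj: "inj_on \<alpha> I'" using \<alpha> by (auto simp: bij_betw_def)
  have "emeasure (distr (PiM I (\<lambda>_. lborel)) (PiM I' (\<lambda>_. lborel)) (\<lambda>z. \<lambda>i\<in>I'. z (\<alpha> i))) (PiE I' A)
    = emeasure (PiM I (\<lambda>_. lborel)) ((\<lambda>z. \<lambda>i\<in>I'. z (\<alpha> i)) -` PiE I' A \<inter> space (PiM I (\<lambda>_. lborel)))"
    using A by (intro emeasure_distr m sets_PiM_I_finite) auto
  also have "(\<lambda>z. \<lambda>i\<in>I'. z (\<alpha> i)) -` PiE I' A \<inter> space (PiM I (\<lambda>_. lborel)) = PiE I (\<lambda>i. A (\<beta> i))"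
    using \<beta>\<alpha> im by (auto simp: space_PiM PiE_iff extensional_def)
  also have "emeasure (PiM I (\<lambda>_. lborel)) (PiE I (\<lambda>i. A (\<beta> i))) = (\<Prod>i\<in>I. emeasure lborel (A (\<beta> i)))"
    using A \<beta>\<alpha> im by (intro lborel_prod.emeasure_PiM) auto
  also have "\<dots> = (\<Prod>i\<in>I'. emeasure lborel (A i))"
    unfolding im by (subst prod.reindex[OF inj]) (auto simp: \<beta>\<alpha> intro!: prod.cong)
  finally show "emeasure (distr (PiM I (\<lambda>_. lborel)) (PiM I' (\<lambda>_. lborel)) (\<lambda>z. \<lambda>i\<in>I'. z (\<alpha> i))) (PiE I' A)
    = (\<Prod>i\<in>I'. emeasure lborel (A i))" .
qed simp_all

text \<open>Renaming rows and columns preserves all measures involved. The value thus depends on the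
  sizes alone and can be carried from the linear system to any other.\<close>

lemma gauss_volume_reindex:
  fixes J :: "'j::countable set" and J' :: "'k::countable set"
  assumes fin[simp]: "finite I" "finite J" "finite I'" "finite J'" and \<alpha>: "bij_betw \<alpha> I' I" and \<beta>: "bij_betw \<beta> J' J"
  shows "gauss_volume I J = gauss_volume I' J'"
proof -
  define t where "t = map_prod \<alpha> \<beta>"
  have t: "inj_on t (I' \<times> J')" "t \<in> I' \<times> J' \<rightarrow> I \<times> J"
    using \<alpha> \<beta> by (auto simp: t_def bij_betw_def intro!: map_prod_inj_on)
  have "distr (PiM (I \<times> J) (\<lambda>_. std_normal)) (PiM (I' \<times> J') (\<lambda>_. std_normal)) (\<lambda>\<omega>. \<lambda>n\<in>I' \<times> J'. \<omega> (t n)) = PiM (I' \<times> J') (\<lambda>_. std_normal)"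
    using distr_PiM_reindex[of "I \<times> J" "\<lambda>_. std_normal" t "I' \<times> J'"] t prob_space_std_normal by simp
  then have dg: "distr (gauss (I \<times> J)) (gauss (I' \<times> J')) (\<lambda>\<omega>. \<lambda>n\<in>I' \<times> J'. \<omega> (t n)) = gauss (I' \<times> J')"
    by (simp add: gauss_def)
  have mt: "(\<lambda>\<omega>. \<lambda>n\<in>I' \<times> J'. \<omega> (t n)) \<in> measurable (gauss (I \<times> J)) (gauss (I' \<times> J'))"
    using measurable_lebI[of "I' \<times> J'" "\<lambda>n \<omega>. \<omega> (t n)" "leb (I \<times> J)"] measurable_leb_coord[of _ "I \<times> J"] t(2)
    by (subst measurable_cong_sets[OF sets_gauss sets_gauss]) blast
  have vol: "emeasure (leb I') (lin_image I' J' (\<lambda>i j. (\<lambda>n\<in>I' \<times> J'. G (t n)) (i, j)) (unit_cube J'))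
     = emeasure (leb I) (lin_image I J (\<lambda>i j. G (i, j)) (unit_cube J))" for G
  proof -
    let ?S' = "lin_image I' J' (\<lambda>i j. (\<lambda>n\<in>I' \<times> J'. G (t n)) (i, j)) (unit_cube J')"
    have S': "?S' \<in> sets (leb I')" by (intro lin_image_compact_measurable compact_unit_cube fin)
    have mr: "(\<lambda>z. \<lambda>i\<in>I'. z (\<alpha> i)) \<in> measurable (leb I) (leb I')"
      using \<alpha> by (intro measurable_lebI measurable_leb_coord) (auto simp: bij_betw_def)
    have "emeasure (leb I') ?S' = emeasure (distr (leb I) (leb I') (\<lambda>z. \<lambda>i\<in>I'. z (\<alpha> i))) ?S'"
      by (simp add: leb_reindex[OF _ \<alpha>])
    also have "\<dots> = emeasure (leb I) ((\<lambda>z. \<lambda>i\<in>I'. z (\<alpha> i)) -` ?S' \<inter> space (leb I))"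
      by (rule emeasure_distr[OF mr S'])
    also have "(\<lambda>z. \<lambda>i\<in>I'. z (\<alpha> i)) -` ?S' \<inter> space (leb I) = lin_image I J (\<lambda>i j. G (i, j)) (unit_cube J)"
    proof (intro set_eqI iffI)
      fix z assume z: "z \<in> (\<lambda>z. \<lambda>i\<in>I'. z (\<alpha> i)) -` ?S' \<inter> space (leb I)"
      then obtain t' where t': "t' \<in> unit_cube J'" "\<And>i. i \<in> I' \<Longrightarrow> z (\<alpha> i) = (\<Sum>j\<in>J'. G (\<alpha> i, \<beta> j) * t' j)"
        by (auto simp: lin_image_def t_def)
      define u where "u = (\<lambda>j\<in>J. t' (the_inv_into J' \<beta> j))"
      have u\<beta>: "u (\<beta> j) = t' j" if "j \<in> J'" for j
      proof -
        have "\<beta> j \<in> J" using that \<beta> by (auto simp: bij_betw_def)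
        then show ?thesis using that \<beta> by (simp add: u_def the_inv_into_f_f bij_betw_def)
      qed
      have "u \<in> unit_cube J"
        using t'(1) u\<beta> \<beta> by (auto simp: unit_cube_def PiE_iff bij_betw_def u_def the_inv_into_f_f)
      moreover have "z i = (\<Sum>j\<in>J. G (i, j) * u j)" if i: "i \<in> I" for i
      proof -
        obtain i' where i': "i' \<in> I'" "i = \<alpha> i'" using i \<alpha> by (auto simp: bij_betw_def)
        have "(\<Sum>j\<in>J. G (i, j) * u j) = (\<Sum>j\<in>J'. G (i, \<beta> j) * u (\<beta> j))"
          using sum.reindex_bij_betw[OF \<beta>, of "\<lambda>j. G (i, j) * u j"] by simp
        also have "\<dots> = z i" using t'(2)[OF i'(1)] i' u\<beta> by simp
        finally show ?thesis by simp
      qed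
      ultimately show "z \<in> lin_image I J (\<lambda>i j. G (i, j)) (unit_cube J)" using z by (auto simp: lin_image_def)
    next
      fix z assume "z \<in> lin_image I J (\<lambda>i j. G (i, j)) (unit_cube J)"
      then obtain u where z: "z \<in> space (leb I)" and u: "u \<in> unit_cube J" "\<And>i. i \<in> I \<Longrightarrow> z i = (\<Sum>j\<in>J. G (i, j) * u j)"
        by (auto simp: lin_image_def)
      define t' where "t' = (\<lambda>j\<in>J'. u (\<beta> j))"
      have "t' \<in> unit_cube J'" using u(1) \<beta> by (auto simp: unit_cube_def PiE_iff bij_betw_def t'_def)
      moreover have "z (\<alpha> i) = (\<Sum>j\<in>J'. G (\<alpha> i, \<beta> j) * t' j)" if i: "i \<in> I'" for i
      proof -
        have "z (\<alpha> i) = (\<Sum>j\<in>J. G (\<alpha> i, j) * u j)" using i \<alpha> by (intro u(2)) (auto simp: bij_betw_def)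
        also have "\<dots> = (\<Sum>j\<in>J'. G (\<alpha> i, \<beta> j) * u (\<beta> j))"
          using sum.reindex_bij_betw[OF \<beta>, of "\<lambda>j. G (\<alpha> i, j) * u j"] by simp
        finally show ?thesis by (simp add: t'_def)
      qed
      ultimately show "z \<in> (\<lambda>z. \<lambda>i\<in>I'. z (\<alpha> i)) -` ?S' \<inter> space (leb I)"
        using z by (auto simp: lin_image_def t_def space_leb intro!: bexI[of _ t'])
    qed
    finally show ?thesis .
  qed
  have "gauss_volume I' J' = (\<integral>\<^sup>+G. emeasure (leb I') (lin_image I' J' (\<lambda>i j. G (i, j)) (unit_cube J'))
      \<partial>distr (gauss (I \<times> J)) (gauss (I' \<times> J')) (\<lambda>\<omega>. \<lambda>n\<in>I' \<times> J'. \<omega> (t n)))"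
    unfolding gauss_volume_def dg ..
  also have "\<dots> = (\<integral>\<^sup>+G. emeasure (leb I') (lin_image I' J' (\<lambda>i j. (\<lambda>n\<in>I' \<times> J'. G (t n)) (i, j)) (unit_cube J')) \<partial>gauss (I \<times> J))"
    using measurable_gauss_volume[of I' J']
    by (intro nn_integral_distr[OF mt]) (simp cong: measurable_cong_sets add: sets_gauss)
  also have "\<dots> = gauss_volume I J" unfolding vol gauss_volume_def ..
  finally show ?thesis ..
qed

text \<open>Scaling columns turns the cube into a box, and scaling rows is an affine substitution in
  the target. Together they give the effect on the determinant of diagonal factors on both
  sides.\<close>

lemma emeasure_lin_image_scaled:
  fixes J :: "'j::countable set"
  assumes fin[simp]: "finite I" "finite J" and card: "card I = card J"
    and r: "\<And>i. i \<in> I \<Longrightarrow> r i > 0" and c: "\<And>j. j \<in> J \<Longrightarrow> c j > 0"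
  shows "emeasure (leb I) (lin_image I J (\<lambda>i j. r i * G i j * c j) (unit_cube J)) =
    ennreal ((\<Prod>i\<in>I. r i) * (\<Prod>j\<in>J. c j)) * emeasure (leb I) (lin_image I J G (unit_cube J))"
proof -
  define box where "box = PiE J (\<lambda>j. {0..c j})"
  have box: "box \<in> sets (leb J)" unfolding box_def by (intro box_in_sets_leb) auto
  have bc: "compact box" unfolding box_def by (intro compact_PiE_fun) simp
  have "emeasure (leb J) box = (\<Prod>j\<in>J. ennreal (c j))"
  proof -
    have "emeasure lborel {0..c j} = ennreal (c j)" if "j \<in> J" for j using c[OF that] by simp
    then show ?thesis unfolding box_def by (subst emeasure_leb_box) auto
  qed
  then have ebox: "emeasure (leb J) box = ennreal (\<Prod>j\<in>J. c j)"
    using c by (simp add: prod_ennreal less_imp_le)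
  have meas: "lin_image I J G box \<in> sets (leb I)" by (intro lin_image_compact_measurable fin bc)
  let ?A = "lin_image I J (\<lambda>i j. r i * G i j * c j) (unit_cube J)"
  have A: "?A \<in> sets (leb I)" by (intro lin_image_compact_measurable fin compact_unit_cube)
  have iff: "(\<lambda>i\<in>I. 0 + r i * z i) \<in> ?A \<longleftrightarrow> z \<in> lin_image I J G box" if z: "z \<in> space (leb I)" for z
  proof
    assume "(\<lambda>i\<in>I. 0 + r i * z i) \<in> ?A"
    then obtain t where t: "t \<in> unit_cube J" "\<And>i. i \<in> I \<Longrightarrow> r i * z i = (\<Sum>j\<in>J. r i * G i j * c j * t j)"
      by (auto simp: lin_image_def)
    have "(\<lambda>j\<in>J. c j * t j) \<in> box"
      using t(1) c by (auto simp: box_def unit_cube_def PiE_iff less_imp_le intro!: mult_left_le)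
    moreover have "z i = (\<Sum>j\<in>J. G i j * (\<lambda>j\<in>J. c j * t j) j)" if i: "i \<in> I" for i
    proof -
      have "r i * z i = r i * (\<Sum>j\<in>J. G i j * (c j * t j))" using t(2)[OF i] by (simp add: sum_distrib_left mult_ac)
      then show ?thesis using r[OF i] by simp
    qed
    ultimately show "z \<in> lin_image I J G box" using z unfolding lin_image_def by blast
  next
    assume "z \<in> lin_image I J G box"
    then obtain t where t: "t \<in> box" "\<And>i. i \<in> I \<Longrightarrow> z i = (\<Sum>j\<in>J. G i j * t j)" by (auto simp: lin_image_def)
    have "(\<lambda>j\<in>J. t j / c j) \<in> unit_cube J"
      using t(1) c by (auto simp: box_def unit_cube_def PiE_iff less_imp_le)
    moreover have "(\<lambda>i\<in>I. 0 + r i * z i) i = (\<Sum>j\<in>J. r i * G i j * c j * (\<lambda>j\<in>J. t j / c j) j)" if i: "i \<in> I" for i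
    proof -
      have "(\<Sum>j\<in>J. r i * G i j * c j * (\<lambda>j\<in>J. t j / c j) j) = (\<Sum>j\<in>J. r i * (G i j * t j))"
        by (intro sum.cong refl) (use c in force)
      then show ?thesis using t(2)[OF i] i by (simp add: sum_distrib_left)
    qed
    moreover have "(\<lambda>i\<in>I. 0 + r i * z i) \<in> space (leb I)" by (auto simp: space_leb)
    ultimately show "(\<lambda>i\<in>I. 0 + r i * z i) \<in> ?A" unfolding lin_image_def by blast
  qed
  have "emeasure (leb I) ?A = (\<integral>\<^sup>+z. indicator ?A z \<partial>leb I)" using A by simp
  also have "\<dots> = ennreal (\<Prod>i\<in>I. \<bar>r i\<bar>) * (\<integral>\<^sup>+z. indicator ?A (\<lambda>i\<in>I. 0 + r i * z i) \<partial>leb I)"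
    by (rule nn_integral_leb_affine) (use A r in \<open>auto simp: less_imp_neq[symmetric]\<close>)
  also have "(\<integral>\<^sup>+z. indicator ?A (\<lambda>i\<in>I. 0 + r i * z i) \<partial>leb I) = (\<integral>\<^sup>+z. indicator (lin_image I J G box) z \<partial>leb I)"
    using iff by (intro nn_integral_cong) (simp add: indicator_def)
  also have "\<dots> = emeasure (leb I) (lin_image I J G box)" using meas by simp
  also have "\<dots> = ennreal (\<Prod>j\<in>J. c j) * emeasure (leb I) (lin_image I J G (unit_cube J))"
    using emeasure_lin_image[OF fin card box, of G] by (simp add: ebox)
  also have "(\<Prod>i\<in>I. \<bar>r i\<bar>) = (\<Prod>i\<in>I. r i)"
    by (intro prod.cong refl abs_of_pos r)
  finally show ?thesis
    using r c by (simp add: ennreal_mult prod_nonneg less_imp_le mult.assoc)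
qed

section \<open>The law of the linear part\<close>

context multihom
begin

definition single_word :: "nat \<Rightarrow> nat \<times> nat \<Rightarrow> nat \<Rightarrow> nat \<Rightarrow> nat \<Rightarrow> nat" where
  "single_word i v p = (\<lambda>j\<in>{1..k}. \<lambda>q\<in>{1..\<delta> i j}. if j = fst v \<and> q = p then snd v else 0)"

text \<open>A word of order one is determined by the position of its only nonzero letter. The number
  of positions is the variance of the corresponding entry of the linear part.\<close>

lemma card_first_words:
  assumes v: "v \<in> V"
  shows "card (first_words i v) = \<delta> i (fst v)"
proof -
  obtain j h where jh: "v = (j, h)" "j \<in> {1..k}" "h \<in> {1..ns j}" using v by (auto simp: V_def)
  have sw: "single_word i v p \<in> words i" for p
    using jh by (auto simp: single_word_def words_def)
  have supp: "support i (single_word i v p) = {(j, p)}" if "p \<in> {1..\<delta> i j}" for p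
    using that jh by (auto simp: support_def positions_def single_word_def)
  have "first_words i v = single_word i v ` {1..\<delta> i j}"
  proof (intro set_eqI iffI)
    fix \<omega> assume "\<omega> \<in> first_words i v"
    then obtain q where \<omega>: "\<omega> \<in> words i" and q: "support i \<omega> = {q}" "letter \<omega> q = v" by (auto simp: first_words_def)
    obtain p where p: "q = (j, p)" "\<omega> j p = h" using q(2) jh by (cases q) (auto simp: letter_def)
    have "q \<in> support i \<omega>" using q by simp
    then have p1: "p \<in> {1..\<delta> i j}" by (auto simp: p support_def positions_def)
    have "\<omega> = single_word i v p"
      unfolding words_eq_iff[OF \<omega> sw]
    proof (intro ballI)
      fix j' p' assume jp: "j' \<in> {1..k}" "p' \<in> {1..\<delta> i j'}"
      show "\<omega> j' p' = single_word i v p j' p'"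
      proof (cases "(j', p') = (j, p)")
        case True
        then show ?thesis using jp p jh by (simp add: single_word_def)
      next
        case False
        then have "(j', p') \<notin> support i \<omega>" using q p by auto
        then have "\<omega> j' p' = 0" using jp by (simp add: support_def positions_def)
        then show ?thesis using False jp jh by (auto simp: single_word_def)
      qed
    qed
    then show "\<omega> \<in> single_word i v ` {1..\<delta> i j}" using p1 by blast
  next
    fix \<omega> assume "\<omega> \<in> single_word i v ` {1..\<delta> i j}"
    then obtain p where p: "p \<in> {1..\<delta> i j}" "\<omega> = single_word i v p" by blast
    have "letter \<omega> (j, p) = v" using p jh by (simp add: letter_def single_word_def)
    then show "\<omega> \<in> first_words i v" using supp[OF p(1)] p sw by (auto simp: first_words_def)
  qed
  moreover have "inj_on (single_word i v) {1..\<delta> i j}"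
  proof (rule inj_onI)
    fix p p' assume "p \<in> {1..\<delta> i j}" "p' \<in> {1..\<delta> i j}" "single_word i v p = single_word i v p'"
    then have "{(j, p)} = {(j, p')}" using supp by metis
    then show "p = p'" by simp
  qed
  ultimately show ?thesis by (simp add: card_image jh)
qed

lemma lin_part_zero:
  assumes "v \<in> V" "\<delta> (fst a) (fst v) = 0"
  shows "lin_part w a v = 0"
proof -
  have "first_words (fst a) v = {}" using card_first_words[OF assms(1), of "fst a"] assms(2) by simp
  then show ?thesis by (simp add: lin_part_def)
qed

text \<open>The entries are sums over disjoint groups of coefficients, so they are independent
  centred normals whose variances are the degrees; dividing by standard deviations leaves a standard
  Gaussian matrix. A vanishing degree would give an empty group.\<close>

lemma distr_lin_part:
  assumes ne: "n \<ge> 1" "V \<noteq> {}" and pos: "\<And>i v. i \<in> {1..n} \<Longrightarrow> v \<in> V \<Longrightarrow> \<delta> i (fst v) > 0"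
  defines "S \<equiv> \<lambda>w. \<lambda>p\<in>const_index \<times> V. lin_part w (fst p) (snd p) / sqrt (real (\<delta> (fst (fst p)) (fst (snd p))))"
  shows "S \<in> measurable (gauss rest_index) (gauss (const_index \<times> V))"
    and "distr (gauss rest_index) (gauss (const_index \<times> V)) S = gauss (const_index \<times> V)"
proof -
  interpret prob_space "gauss rest_index" by (rule prob_space_gauss)
  let ?T = "const_index \<times> V"
  define K where "K p = Pair (fst (fst p)) ` first_words (fst (fst p)) (snd p)"
    for p :: "(nat \<times> (nat \<Rightarrow> nat \<Rightarrow> nat)) \<times> (nat \<times> nat)"
  have i: "fst (fst p) \<in> {1..n}" "snd p \<in> V" if "p \<in> ?T" for p
    using that by (auto simp: const_index_def)
  have sumK: "(\<Sum>q\<in>K p. w q) = lin_part w (fst p) (snd p)" for p w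
    by (simp add: K_def lin_part_def sum.reindex inj_on_def)
  have cardK: "card (K p) = \<delta> (fst (fst p)) (fst (snd p))" if "p \<in> ?T" for p
    using card_first_words[OF i(2)[OF that]] by (simp add: K_def card_image inj_on_def)
  have K1: "K p \<subseteq> rest_index" if "p \<in> ?T" for p
    using i[OF that] first_words_subset[of "fst (fst p)" "snd p"] by (auto simp: K_def rest_index_def)
  have K2: "K p \<noteq> {}" if "p \<in> ?T" for p
    using cardK[OF that] pos[OF i[OF that]] by auto
  have disj: "disjoint_family_on K ?T"
    unfolding disjoint_family_on_def
  proof (intro ballI impI)
    fix p q assume pq: "p \<in> ?T" "q \<in> ?T" "p \<noteq> q"
    show "K p \<inter> K q = {}"
    proof (rule ccontr)
      assume "K p \<inter> K q \<noteq> {}"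
      then obtain \<omega> where \<omega>: "\<omega> \<in> first_words (fst (fst p)) (snd p)" "\<omega> \<in> first_words (fst (fst q)) (snd q)"
        and eq: "fst (fst p) = fst (fst q)" by (auto simp: K_def)
      then have "snd p = snd q" by (auto simp: first_words_def)
      moreover have "fst p = fst q" using pq eq by (auto simp: const_index_def)
      ultimately show False using pq(3) by (simp add: prod_eq_iff)
    qed
  qed
  have sums1: "indep_vars (\<lambda>_. borel) (\<lambda>p w. lin_part w (fst p) (snd p)) ?T"
    using gauss_group_sums(1)[OF finite_rest_index _ _ disj] K1 K2 by (simp add: sumK)
  have sums2: "distributed (gauss rest_index) lborel (\<lambda>w. lin_part w (fst p) (snd p)) (normal_density 0 (sqrt (card (K p))))"
    if "p \<in> ?T" for p
    using gauss_group_sums(2)[OF finite_rest_index _ _ disj that] K1 K2 by (simp add: sumK)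
  define Y where "Y p w = lin_part w (fst p) (snd p) / sqrt (real (\<delta> (fst (fst p)) (fst (snd p))))" for p w
  have ind: "indep_vars (\<lambda>_. borel) Y ?T"
    unfolding Y_def using indep_vars_compose2[OF sums1, of "\<lambda>p x. x / sqrt (real (\<delta> (fst (fst p)) (fst (snd p))))" "\<lambda>_. borel"] by simp
  have Y: "distributed (gauss rest_index) lborel (Y p) std_normal_density" if p: "p \<in> ?T" for p
  proof -
    have "0 < sqrt (real (card (K p)))" using cardK[OF p] pos[OF i[OF p]] by simp
    from normal_standard_normal_convert[OF this, of "\<lambda>w. lin_part w (fst p) (snd p)" 0] sums2[OF p]
    show ?thesis by (simp add: Y_def[abs_def] cardK[OF p])
  qed
  have Ym: "Y p \<in> borel_measurable (gauss rest_index)" if "p \<in> ?T" for p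
    using distributed_measurable[OF Y[OF that]] by simp
  have S: "S = (\<lambda>w. \<lambda>p\<in>?T. Y p w)" by (simp add: S_def Y_def)
  show "S \<in> measurable (gauss rest_index) (gauss ?T)"
    unfolding S using measurable_lebI[OF Ym] by (simp cong: measurable_cong_sets add: sets_gauss)
  have ne': "?T \<noteq> {}" using ne by (auto simp: const_index_def)
  have "distr (gauss rest_index) (gauss ?T) S = distr (gauss rest_index) (PiM ?T (\<lambda>_. borel)) (\<lambda>w. \<lambda>p\<in>?T. Y p w)"
    by (intro distr_cong) (auto simp: S sets_gauss sets_leb)
  also have "\<dots> = PiM ?T (\<lambda>p. distr (gauss rest_index) borel (Y p))"
    using indep_vars_iff_distr_eq_PiM'[OF ne', where M'="\<lambda>_. borel" and X=Y] ind Ym by auto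
  also have "\<dots> = PiM ?T (\<lambda>_. std_normal)"
  proof (intro PiM_cong refl)
    fix p assume "p \<in> ?T"
    have "distr (gauss rest_index) borel (Y p) = distr (gauss rest_index) lborel (Y p)" by (intro distr_cong) auto
    then show "distr (gauss rest_index) borel (Y p) = std_normal"
      using distributed_distr_eq_density[OF Y[OF \<open>p \<in> ?T\<close>]] by simp
  qed
  finally show "distr (gauss rest_index) (gauss ?T) S = gauss ?T" by (simp add: gauss_def)
qed

lemma sqrt_prod: "sqrt (\<Prod>a\<in>A. f a) = (\<Prod>a\<in>A. sqrt (f a))"
  by (induction A rule: infinite_finite_induct) (auto simp: real_sqrt_mult)

lemma prod_V_nat: "(\<Prod>v\<in>V. sqrt (real (e (fst v)))) = sqrt (\<Prod>j\<in>{1..k}. real (e j) ^ ns j)"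
  using prod_V[of "\<lambda>j. sqrt (real (e j))"] by (simp add: sqrt_prod real_sqrt_power)

text \<open>The standard deviations \<open>sqrt (d i) * sqrt (e j)\<close> are scalings of rows and
  columns. If some \<open>d i\<close> is 0 a row vanishes, and if \<open>e j\<close> is 0 for a
  block with \<open>ns j > 0\<close> a column does; both sides are then 0. A block with
  \<open>ns j = 0\<close> has no columns and contributes \<open>e j ^ 0 = 1\<close> to the product,
  even for \<open>e j = 0\<close>.\<close>

lemma lin_volume_eq:
  assumes n: "n = (\<Sum>j\<in>{1..k}. ns j)" "n \<ge> 1" and \<delta>: "\<And>i j. i \<in> {1..n} \<Longrightarrow> j \<in> {1..k} \<Longrightarrow> \<delta> i j = d i * e j"
  shows "lin_volume = ennreal (sqrt (\<Prod>i\<in>{1..n}. real (d i)) * sqrt (\<Prod>j\<in>{1..k}. real (e j) ^ ns j)) * gauss_volume const_index V"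
proof -
  have card: "card const_index = card V" unfolding card_const_index card_V by (rule n(1))
  have \<delta>V: "\<delta> i (fst v) = d i * e (fst v)" if "i \<in> {1..n}" "v \<in> V" for i v
    using \<delta>[of i "fst v"] that by (auto simp: V_def)
  have fa: "fst a \<in> {1..n}" if "a \<in> const_index" for a using that by (auto simp: const_index_def)
  consider (row) i where "i \<in> {1..n}" "d i = 0" | (col) v where "v \<in> V" "e (fst v) = 0"
    | (pos) "\<forall>i\<in>{1..n}. d i > 0" "\<forall>v\<in>V. e (fst v) > 0" by blast
  then show ?thesis
  proof cases
    case row
    have "emeasure (leb const_index) (lin_image const_index V (lin_part w) (unit_cube V)) = 0" for w
    \<comment> \<open>The functional that reads off the vanishing row.\<close>
    proof (rule emeasure_lin_image_singular[where u="\<lambda>a. of_bool (fst a = i)"])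
      show "\<exists>a\<in>const_index. of_bool (fst a = i) \<noteq> (0::real)" using row by (auto simp: const_index_def)
      show "(\<Sum>a\<in>const_index. of_bool (fst a = i) * (\<Sum>v\<in>V. lin_part w a v * t v)) = 0" for t
      proof (rule sum.neutral, rule ballI)
        fix a assume "a \<in> const_index"
        have "lin_part w a v = 0" if "v \<in> V" "fst a = i" for v
          using lin_part_zero[OF that(1), of a w] \<delta>V[OF row(1) that(1)] row(2) that(2) by simp
        then show "of_bool (fst a = i) * (\<Sum>v\<in>V. lin_part w a v * t v) = 0" by simp
      qed
    qed simp
    moreover have "(\<Prod>i\<in>{1..n}. real (d i)) = 0" using row by (intro prod_zero) auto
    ultimately show ?thesis
      unfolding lin_volume_def by (simp only: nn_integral_const mult_zero_left real_sqrt_zero ennreal_0)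
  next
    case col
    have "emeasure (leb const_index) (lin_image const_index V (lin_part w) (unit_cube V)) = 0" for w
    proof -
      have "lin_part w a v = 0" if "a \<in> const_index" for a
        using lin_part_zero[OF col(1), of a w] \<delta>V[OF fa[OF that] col(1)] col(2) by simp
      then have "\<not> injective_system const_index V (lin_part w)"
        unfolding injective_system_def not_all
        by (intro exI[of _ "\<lambda>v'. of_bool (v' = v)"]) (use col(1) in \<open>auto simp: sum.delta\<close>)
      from singular_system_left_kernel[OF finite_const_index finite_V card this] obtain u where
        "\<exists>i\<in>const_index. u i \<noteq> 0" "\<And>t. (\<Sum>i\<in>const_index. u i * (\<Sum>j\<in>V. lin_part w i j * t j)) = 0" by blast
      then show ?thesis by (rule emeasure_lin_image_singular[OF finite_const_index])
    qed
    moreover have "(\<Prod>j\<in>{1..k}. real (e j) ^ ns j) = 0" using col by (intro prod_zero) (auto simp: V_def)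
    ultimately show ?thesis
      unfolding lin_volume_def by (simp only: nn_integral_const mult_zero_left mult_zero_right real_sqrt_zero ennreal_0)
  next
    case pos
    define S where "S w = (\<lambda>p\<in>const_index \<times> V. lin_part w (fst p) (snd p) / sqrt (real (\<delta> (fst (fst p)) (fst (snd p)))))" for w
    define vol where "vol G = emeasure (leb const_index) (lin_image const_index V (\<lambda>i j. G (i, j)) (unit_cube V))" for G
    have \<delta>pos: "\<delta> i (fst v) > 0" if "i \<in> {1..n}" "v \<in> V" for i v using \<delta>V[OF that] pos that by simp
    have V: "V \<noteq> {}"
    proof
      assume "V = {}"
      then have "card const_index = 0" using card by simp
      then show False using n(2) card_const_index by linarith
    qed
    have law: "S \<in> measurable (gauss rest_index) (gauss (const_index \<times> V))"
      "distr (gauss rest_index) (gauss (const_index \<times> V)) S = gauss (const_index \<times> V)"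
      unfolding S_def[abs_def] by (rule distr_lin_part[OF n(2) V]; use \<delta>pos in blast)+
    have volm: "vol \<in> borel_measurable (gauss (const_index \<times> V))"
      unfolding vol_def using measurable_gauss_volume[OF finite_const_index finite_V] by (simp cong: measurable_cong_sets add: sets_gauss)
    define c where "c = (\<Prod>a\<in>const_index. sqrt (real (d (fst a)))) * (\<Prod>v\<in>V. sqrt (real (e (fst v))))"
    have "emeasure (leb const_index) (lin_image const_index V (lin_part w) (unit_cube V)) = ennreal c * vol (S w)" for w
    proof -
      have "lin_image const_index V (lin_part w) (unit_cube V) =
        lin_image const_index V (\<lambda>a v. sqrt (real (d (fst a))) * S w (a, v) * sqrt (real (e (fst v)))) (unit_cube V)"
      proof -
        have "lin_part w a v = sqrt (real (d (fst a))) * S w (a, v) * sqrt (real (e (fst v)))" if "a \<in> const_index" "v \<in> V" for a v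
          using that \<delta>V[OF fa[OF that(1)] that(2)] bspec[OF pos(1) fa[OF that(1)]] bspec[OF pos(2) that(2)]
          by (simp add: S_def real_sqrt_mult)
        then show ?thesis unfolding lin_image_def by (intro Collect_cong conj_cong refl bex_cong ball_cong arg_cong2[where f="(=)"] sum.cong) auto
      qed
      also have "emeasure (leb const_index) \<dots> = ennreal c * vol (S w)"
        unfolding c_def vol_def using pos fa by (intro emeasure_lin_image_scaled finite_const_index finite_V card) auto
      finally show ?thesis .
    qed
    then have "lin_volume = (\<integral>\<^sup>+w. ennreal c * vol (S w) \<partial>gauss rest_index)" by (simp add: lin_volume_def)
    also have "\<dots> = ennreal c * (\<integral>\<^sup>+w. vol (S w) \<partial>gauss rest_index)"
      by (intro nn_integral_cmult measurable_compose[OF law(1) volm])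
    also have "(\<integral>\<^sup>+w. vol (S w) \<partial>gauss rest_index) = (\<integral>\<^sup>+G. vol G \<partial>distr (gauss rest_index) (gauss (const_index \<times> V)) S)"
      using volm by (intro nn_integral_distr[symmetric] law(1)) simp
    also have "\<dots> = gauss_volume const_index V" unfolding law(2) by (simp add: gauss_volume_def vol_def)
    also have "c = sqrt (\<Prod>i\<in>{1..n}. real (d i)) * sqrt (\<Prod>j\<in>{1..k}. real (e j) ^ ns j)"
      unfolding c_def prod_V_nat const_index_def by (simp add: prod.reindex inj_on_def sqrt_prod)
    finally show ?thesis .
  qed
qed

end

section \<open>Calibration by linear systems\<close>

text \<open>A linear system with finitely many projective roots has exactly one. Since the expected number of
  roots of the random linear system is finite, it is 1, which determines the mean volume without
  computing the expectation of a determinant.\<close>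

lemma linear_root_count:
  fixes f :: "nat \<Rightarrow> (nat \<Rightarrow> nat \<Rightarrow> nat) \<Rightarrow> real"
  assumes n: "n \<ge> 1"
    and lin: "\<And>i x. i \<in> {1..n} \<Longrightarrow> multihom.pev (Suc 0) (\<lambda>_. n) (\<lambda>_ _. Suc 0) f i x = (\<Sum>h\<le>n. a i h * x (Suc 0, h))"
    and fin: "finite (root_set (Suc 0) (\<lambda>_. n) n (\<lambda>_ _. Suc 0) f)"
  shows "card (root_set (Suc 0) (\<lambda>_. n) n (\<lambda>_ _. Suc 0) f) = 1"
proof -
  interpret multihom "Suc 0" n "\<lambda>_. n" "\<lambda>_ _. Suc 0" .
  let ?Z = "root_set (Suc 0) (\<lambda>_. n) n (\<lambda>_ _. Suc 0) f"
  define ip1 where "ip1 x y = (\<Sum>h\<le>n. x (Suc 0, h) * y (Suc 0, h))" for x y :: "nat \<times> nat \<Rightarrow> real"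
  define lf where "lf i x = (\<Sum>h\<le>n. a i h * x (Suc 0, h))" for i and x :: "nat \<times> nat \<Rightarrow> real"
  have sphere: "x \<in> sphere_prod \<longleftrightarrow> x \<in> PiE X (\<lambda>_. UNIV) \<and> ip1 x x = 1" for x
    by (auto simp: sphere_prod_def ip_def ip1_def)
  define nrm where "nrm y = (\<lambda>v\<in>X. y v / sqrt (ip1 y y))" for y
  have pos: "ip1 y y > 0" if ex: "\<exists>h\<le>n. y (Suc 0, h) \<noteq> 0" for y
  proof -
    obtain h where h: "h \<le> n" "y (Suc 0, h) \<noteq> 0" using ex by blast
    have "0 < y (Suc 0, h) * y (Suc 0, h)" using h(2) not_real_square_gt_zero by blast
    also have "\<dots> \<le> ip1 y y" unfolding ip1_def using h by (intro member_le_sum) auto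
    finally show ?thesis .
  qed
  have nrm_v: "nrm y (Suc 0, h) = y (Suc 0, h) / sqrt (ip1 y y)" if "h \<le> n" for y h
    using that by (simp add: nrm_def)
  have nrm: "nrm y \<in> sphere_prod" if "ip1 y y > 0" for y
  proof -
    have "ip1 (nrm y) (nrm y) = (\<Sum>h\<le>n. y (Suc 0, h) * y (Suc 0, h) / ip1 y y)"
      unfolding ip1_def[of "nrm y"] using that by (intro sum.cong) (auto simp: nrm_v)
    also have "\<dots> = 1" using that by (simp add: ip1_def flip: sum_divide_distrib)
    finally show ?thesis by (simp add: sphere nrm_def)
  qed
  have root: "point (nrm y) \<in> ?Z" if yp: "ip1 y y > 0" and yz: "\<And>i. i \<in> {1..n} \<Longrightarrow> lf i y = 0" for y
  proof -
    have "pev f i (nrm y) = 0" if i: "i \<in> {1..n}" for i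
    proof -
      have "pev f i (nrm y) = lf i y / sqrt (ip1 y y)"
        unfolding lin[OF i] lf_def by (simp add: nrm_v sum_divide_distrib)
      then show ?thesis using yz[OF i] by simp
    qed
    then show ?thesis using point_root_iff[OF nrm[OF yp]] by blast
  qed
  have "?Z \<noteq> {}"
  proof -
    have "card {1..n} < card {..n}" by simp
    then obtain x where "\<exists>h\<in>{..n}. x h \<noteq> 0" "\<forall>i\<in>{1..n}. (\<Sum>h\<in>{..n}. a i h * x h) = 0"
      using homogeneous_system_nontrivial[of "{1..n}" "{..n}" a] by auto
    then have "point (nrm (\<lambda>v. x (snd v))) \<in> ?Z" by (intro root pos) (auto simp: lf_def)
    then show ?thesis by blast
  qed
  moreover have "\<zeta> = \<zeta>'" if \<zeta>: "\<zeta> \<in> ?Z" "\<zeta>' \<in> ?Z" for \<zeta> \<zeta>'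
  proof (rule ccontr)
    assume neq: "\<zeta> \<noteq> \<zeta>'"
    have rs: "\<zeta> \<in> root_space (Suc 0) (\<lambda>_. n)" "\<zeta>' \<in> root_space (Suc 0) (\<lambda>_. n)" using \<zeta> by (auto simp: root_set_def)
    define x where "x = rep \<zeta>"
    define x' where "x' = rep \<zeta>'"
    have x: "x \<in> sphere_prod" "point x = \<zeta>" and x': "x' \<in> sphere_prod" "point x' = \<zeta>'"
      using rep[OF rs(1)] rep[OF rs(2)] by (auto simp: x_def x'_def)
    have nprop: "\<not> (\<exists>c. c \<noteq> 0 \<and> (\<forall>h\<le>n. x' (Suc 0, h) = c * x (Suc 0, h)))"
      using point_eq_iff[OF x(1) x'(1)] neq x(2) x'(2) by auto
    have zx: "lf i x = 0" "lf i x' = 0" if "i \<in> {1..n}" for i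
    proof -
      have "pev f i x = 0" "pev f i x' = 0"
        using \<zeta> point_root_iff[OF x(1), of f] point_root_iff[OF x'(1), of f] x(2) x'(2) that by auto
      then show "lf i x = 0" "lf i x' = 0" by (simp_all only: lin[OF that] lf_def)
    qed
    have nzx: "\<exists>h\<le>n. x (Suc 0, h) \<noteq> 0" "\<exists>h\<le>n. x' (Suc 0, h) \<noteq> 0"
    proof -
      have nz: "\<exists>h\<le>n. z (Suc 0, h) \<noteq> 0" if "ip1 z z = 1" for z
      proof (rule ccontr)
        assume "\<not> (\<exists>h\<le>n. z (Suc 0, h) \<noteq> 0)"
        then have "ip1 z z = 0" by (simp add: ip1_def)
        with that show False by simp
      qed
      have "ip1 x x = 1" "ip1 x' x' = 1" using x x' sphere by auto
      then show "\<exists>h\<le>n. x (Suc 0, h) \<noteq> 0" "\<exists>h\<le>n. x' (Suc 0, h) \<noteq> 0" by (simp_all add: nz)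
    qed
    \<comment> \<open>A family of roots on the line through two distinct ones. Different parameters
      give different points, which contradicts finiteness.\<close>
    define y where "y c = (\<lambda>v. x v + c * x' v)" for c
    have ypos: "ip1 (y c) (y c) > 0" for c
    proof (rule pos, rule ccontr)
      assume "\<not> (\<exists>h\<le>n. y c (Suc 0, h) \<noteq> 0)"
      then have z: "x (Suc 0, h) = - c * x' (Suc 0, h)" if "h \<le> n" for h
        using that by (auto simp: y_def add_eq_0_iff)
      have "c \<noteq> 0" using nzx(1) z by auto
      then have "\<forall>h\<le>n. x' (Suc 0, h) = (- 1 / c) * x (Suc 0, h)" using z by simp
      then show False using nprop \<open>c \<noteq> 0\<close> by (metis divide_eq_0_iff neg_equal_0_iff_equal zero_neq_one)
    qed
    have "lf i (y c) = lf i x + c * lf i x'" for i c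
      by (simp add: lf_def y_def distrib_left sum.distrib sum_distrib_left mult_ac)
    then have "point (nrm (y c)) \<in> ?Z" for c using zx ypos by (intro root) auto
    moreover have "inj (\<lambda>c. point (nrm (y c)))"
    proof (rule injI)
      fix c c' assume "point (nrm (y c)) = point (nrm (y c'))"
      then obtain l where l: "l \<noteq> 0" "\<And>h. h \<le> n \<Longrightarrow> nrm (y c') (Suc 0, h) = l * nrm (y c) (Suc 0, h)"
        using point_eq_iff[OF nrm[OF ypos] nrm[OF ypos], of c c'] by auto
      define m where "m = l * sqrt (ip1 (y c') (y c')) / sqrt (ip1 (y c) (y c))"
      have m: "x (Suc 0, h) + c' * x' (Suc 0, h) = m * (x (Suc 0, h) + c * x' (Suc 0, h))" if "h \<le> n" for h
        using l(2)[OF that] nrm_v[OF that] ypos[of c] ypos[of c'] by (simp add: y_def m_def field_simps)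
      \<comment> \<open>Otherwise \<open>x'\<close> would be proportional to
        \<open>x\<close>.\<close>
      have "m = 1"
      proof (rule ccontr)
        assume m1: "m \<noteq> 1"
        have z: "x (Suc 0, h) * (1 - m) = (m * c - c') * x' (Suc 0, h)" if "h \<le> n" for h
          using m[OF that] by (simp add: algebra_simps)
        have "m * c - c' \<noteq> 0" using nzx(1) z m1 by fastforce
        moreover from this have "\<forall>h\<le>n. x' (Suc 0, h) = ((1 - m) / (m * c - c')) * x (Suc 0, h)"
          using z by (simp add: field_simps)
        ultimately show False using nprop m1 by (metis divide_eq_0_iff eq_iff_diff_eq_0)
      qed
      then show "c = c'" using m nzx(2) by auto
    qed
    ultimately have "infinite ?Z"
      using finite_subset[of "range (\<lambda>c. point (nrm (y c)))" ?Z] finite_imageD[of "\<lambda>c. point (nrm (y c))" UNIV]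
        infinite_UNIV_char_0[where 'a=real] by blast
    then show False using fin by simp
  qed
  ultimately show ?thesis using fin by (metis card_1_singleton_iff is_singletonI' is_singleton_def One_nat_def)
qed

text \<open>For one block and all degrees equal to 1 the mean count is the quotient of
  \<open>gauss_volume\<close> and \<open>abs_moment n\<close>. As the mean is 1, the two
  agree.\<close>

lemma gauss_volume_eq_abs_moment:
  fixes J :: "'j::countable set"
  assumes fin: "finite I" "finite J" and card: "card I = n" "card J = n" and n: "n \<ge> 1"
  shows "gauss_volume I J = abs_moment n"
proof -
  interpret multihom "Suc 0" n "\<lambda>_. n" "\<lambda>_ _. Suc 0" .
  have sum_n: "n = (\<Sum>j\<in>{1..Suc 0}. n)" by simp
  note er = expected_roots_eq[OF sum_n n random_system_collapse]
  let ?N = "\<lambda>\<xi>. emeasure (count_space UNIV) (root_set (Suc 0) (\<lambda>_. n) n (\<lambda>_ _. Suc 0) (\<lambda>i a. collapse \<xi> i a))"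
  \<comment> \<open>Words of degree 1 consist of one letter, and grouping by this letter gives the
    coefficients of a linear form.\<close>
  have lin: "pev (\<lambda>i a. collapse \<xi> i a) i x = (\<Sum>h\<le>n. (\<Sum>\<omega>\<in>{\<omega>. \<omega> \<in> words i \<and> \<omega> (Suc 0) (Suc 0) = h}. \<xi> (i, \<omega>)) * x (Suc 0, h))" for \<xi> i x
  proof -
    have "pev (\<lambda>i a. collapse \<xi> i a) i x = (\<Sum>\<omega>\<in>words i. \<xi> (i, \<omega>) * x (1, \<omega> (Suc 0) (Suc 0)))"
      using pev_collapse[of \<xi> i x] by (simp add: fld_def)
    also have "\<dots> = (\<Sum>h\<le>n. \<Sum>\<omega>\<in>{\<omega>. \<omega> \<in> words i \<and> \<omega> (Suc 0) (Suc 0) = h}. \<xi> (i, \<omega>) * x (1, \<omega> (Suc 0) (Suc 0)))"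
      using words_letter[of _ i "Suc 0" "Suc 0"] by (intro sum.group[symmetric]) auto
    also have "\<dots> = (\<Sum>h\<le>n. (\<Sum>\<omega>\<in>{\<omega>. \<omega> \<in> words i \<and> \<omega> (Suc 0) (Suc 0) = h}. \<xi> (i, \<omega>)) * x (Suc 0, h))"
      unfolding sum_distrib_right by (intro sum.cong refl) auto
    finally show ?thesis .
  qed
  have "expected_roots (gauss Om) (Suc 0) (\<lambda>_. n) n (\<lambda>_ _. Suc 0) (\<lambda>i a \<xi>. collapse \<xi> i a) = lin_volume / abs_moment n"
    using er(1) by simp
  then have int: "(\<integral>\<^sup>+\<xi>. ?N \<xi> \<partial>gauss Om) = lin_volume / abs_moment n" by (simp add: expected_roots_def)
  \<comment> \<open>Finiteness of the mean excludes infinitely many roots almost surely, which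
    stands in for an argument on the rank of a random matrix.\<close>
  have "lin_volume / abs_moment n < \<infinity>"
    using hit_prob_limit(2)[OF sum_n] by (auto simp: ennreal_divide_eq_top_iff less_top[symmetric])
  then have "AE \<xi> in gauss Om. ?N \<xi> \<noteq> \<infinity>"
    using er(2) int by (intro nn_integral_PInf_AE) auto
  then have "AE \<xi> in gauss Om. ?N \<xi> = 1"
  proof eventually_elim
    fix \<xi> assume "?N \<xi> \<noteq> \<infinity>"
    then have "finite (root_set (Suc 0) (\<lambda>_. n) n (\<lambda>_ _. Suc 0) (\<lambda>i a. collapse \<xi> i a))"
      by (metis emeasure_count_space_infinite subset_UNIV infinity_ennreal_def)
    moreover from linear_root_count[OF n lin this] have "card (root_set (Suc 0) (\<lambda>_. n) n (\<lambda>_ _. Suc 0) (\<lambda>i a. collapse \<xi> i a)) = 1" .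
    ultimately show "?N \<xi> = 1" by (subst emeasure_count_space_finite) auto
  qed
  then have "(\<integral>\<^sup>+\<xi>. ?N \<xi> \<partial>gauss Om) = (\<integral>\<^sup>+\<xi>. 1 \<partial>gauss Om)" by (rule nn_integral_cong_AE)
  also have "\<dots> = 1" using prob_space.emeasure_space_1[OF prob_space_gauss] by simp
  finally have "lin_volume / abs_moment n = 1" using int by simp
  then have lv: "lin_volume = abs_moment n"
    using abs_moment_finite[of n] ennreal_divide_times[of lin_volume "abs_moment n" "abs_moment n"]
    by (metis abs_moment_nonzero ennreal_mult_divide_eq infinity_ennreal_def less_irrefl mult.commute mult_1 ennreal_times_divide)
  have "lin_volume = gauss_volume const_index V"
    using lin_volume_eq[of "\<lambda>_. 1" "\<lambda>_. 1", OF sum_n n] by simp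
  moreover obtain \<alpha> where "bij_betw \<alpha> const_index I"
    using finite_same_card_bij[OF finite_const_index fin(1)] card by (auto simp: card_const_index)
  moreover obtain \<beta> where "bij_betw \<beta> V J"
    using finite_same_card_bij[OF finite_V fin(2)] card by (auto simp: card_V)
  ultimately show ?thesis
    using gauss_volume_reindex[OF fin finite_const_index finite_V] lv by metis
qed

section \<open>Absolute moments of the standard normal distribution\<close>

lemma abs_moment_lebesgue: "abs_moment m = (\<integral>\<^sup>+x. ennreal (std_normal_density x * \<bar>x\<bar> ^ m) \<partial>lborel)"
  unfolding abs_moment_def by (subst nn_integral_density) (auto simp: ennreal_mult)

text \<open>The functional equation of the Gamma function is a recursion of step 2, which brings the
  right-hand side into the closed forms of the even moments and of the odd absolute moments.\<close>

lemma abs_moment_eq: "abs_moment m = ennreal (sqrt 2 ^ m * (Gamma ((real m + 1) / 2) / Gamma (1 / 2)))"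
proof -
  have G: "Gamma (1 / 2 :: real) = sqrt pi" by (rule Gamma_one_half_real)
  define g where "g m = sqrt 2 ^ m * (Gamma ((real m + 1) / 2) / Gamma (1 / 2))" for m
  have step: "g (m + 2) = (real m + 1) * g m" for m
  proof -
    have "Gamma ((real (m + 2) + 1) / 2) = Gamma ((real m + 1) / 2 + 1)" by (simp add: field_simps)
    also have "\<dots> = (real m + 1) / 2 * Gamma ((real m + 1) / 2)"
      by (intro Gamma_plus1) (auto simp: nonpos_Ints_def dest!: arg_cong[where f="\<lambda>x. x > 0"])
    finally have "Gamma ((real (m + 2) + 1) / 2) = (real m + 1) / 2 * Gamma ((real m + 1) / 2)" .
    moreover have "sqrt 2 ^ (m + 2) = 2 * sqrt 2 ^ m" by (simp add: power_add)
    ultimately have "g (m + 2) = (2 * sqrt 2 ^ m) * ((real m + 1) / 2 * Gamma ((real m + 1) / 2) / Gamma (1 / 2))"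
      by (simp only: g_def)
    then show ?thesis by (simp add: g_def)
  qed
  have even: "g (2 * j) = fact (2 * j) / (2 ^ j * fact j)" for j
  proof (induction j)
    case 0
    then show ?case by (simp add: g_def G)
  next
    case (Suc j)
    have "g (2 * Suc j) = (2 * real j + 1) * g (2 * j)" using step[of "2 * j"] by simp
    also have "\<dots> = ((2 * real j + 1) * fact (2 * j)) / (2 ^ j * fact j)" by (simp add: Suc)
    also have "\<dots> = ((2 * (real j + 1)) * ((2 * real j + 1) * fact (2 * j))) / ((2 * (real j + 1)) * (2 ^ j * fact j))"
      by (rule mult_divide_mult_cancel_left[symmetric]) simp
    also have "(2 * (real j + 1)) * ((2 * real j + 1) * fact (2 * j)) = fact (2 * Suc j)" by (simp add: algebra_simps)
    also have "(2 * (real j + 1)) * (2 ^ j * fact j) = 2 ^ Suc j * fact (Suc j)" by (simp add: algebra_simps)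
    finally show ?case .
  qed
  have odd: "g (2 * j + 1) = sqrt (2 / pi) * 2 ^ j * fact j" for j
  proof (induction j)
    case 0
    then show ?case by (simp add: g_def G real_sqrt_divide)
  next
    case (Suc j)
    have "g (2 * Suc j + 1) = (2 * real j + 2) * g (2 * j + 1)" using step[of "2 * j + 1"] by simp
    then show ?case using Suc by (simp add: algebra_simps)
  qed
  have "has_bochner_integral lborel (\<lambda>x. std_normal_density x * \<bar>x\<bar> ^ m) (g m)"
  proof (cases "even m")
    case True
    then obtain j where j: "m = 2 * j" by (rule evenE)
    show ?thesis using std_normal_moment_even[of j] by (simp add: j even power_even_abs)
  next
    case False
    then obtain j where j: "m = 2 * j + 1" by (rule oddE)
    show ?thesis using std_normal_moment_abs_odd[of j] unfolding j odd .
  qed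
  then have "(\<integral>\<^sup>+x. ennreal (std_normal_density x * \<bar>x\<bar> ^ m) \<partial>lborel) = ennreal (g m)"
    by (subst nn_integral_eq_integral) (auto simp: has_bochner_integral_iff)
  then show ?thesis by (simp add: abs_moment_lebesgue g_def)
qed

theorem theorem2:
  fixes k n :: nat and ns d e :: "nat \<Rightarrow> nat" and \<delta> :: "nat \<Rightarrow> nat \<Rightarrow> nat"
    and M :: "'w measure" and F :: "nat \<Rightarrow> (nat \<Rightarrow> nat \<Rightarrow> nat) \<Rightarrow> 'w \<Rightarrow> real"
  assumes "k \<ge> 1"
    and "n = (\<Sum>j\<in>{1..k}. ns j)"
    and "n \<ge> 1"
    and "\<And>i j. i \<in> {1..n} \<Longrightarrow> j \<in> {1..k} \<Longrightarrow> \<delta> i j = d i * e j"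
    and "random_system M k ns n \<delta> F"
  shows "expected_roots M k ns n \<delta> F =
    ennreal (Gamma ((real n + 1) / 2) / Gamma (1 / 2)
      * (\<Prod>j\<in>{1..k}. Gamma (1 / 2) / Gamma ((real (ns j) + 1) / 2))
      * sqrt (\<Prod>i\<in>{1..n}. real (d i))
      * sqrt (\<Prod>j\<in>{1..k}. real (e j) ^ ns j))"
proof -
  interpret multihom k n ns \<delta> .
  \<comment> \<open>The absolute moment of order \<open>m\<close> without its factor
    \<open>sqrt 2 ^ m\<close>.\<close>
  define g where "g m = Gamma ((real m + 1) / 2) / Gamma (1 / 2)" for m
  define s where "s = sqrt (\<Prod>i\<in>{1..n}. real (d i)) * sqrt (\<Prod>j\<in>{1..k}. real (e j) ^ ns j)"
  have g: "g m > 0" for m by (simp add: g_def Gamma_real_pos)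
  have s: "s \<ge> 0" by (simp add: s_def prod_nonneg)
  have mom: "abs_moment m = ennreal (sqrt 2 ^ m * g m)" for m by (simp add: abs_moment_eq g_def)
  have "card V = n" unfolding card_V by (rule assms(2)[symmetric])
  then have gv: "gauss_volume const_index V = abs_moment n"
    using assms(3) card_const_index by (intro gauss_volume_eq_abs_moment) auto
  have lv: "lin_volume = ennreal (s * (sqrt 2 ^ n * g n))"
    using lin_volume_eq[OF assms(2,3,4)] s g[of n] unfolding gv mom s_def[symmetric]
    by (simp add: ennreal_mult less_imp_le)
  have "(\<Prod>j\<in>{1..k}. abs_moment (ns j)) = ennreal (\<Prod>j\<in>{1..k}. sqrt 2 ^ ns j * g (ns j))"
    unfolding mom using g by (intro prod_ennreal) (auto simp: less_imp_le)
  \<comment> \<open>The powers of \<open>sqrt 2\<close> collect to the exponent \<open>n\<close>,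
    the sum of the dimensions, and cancel against the power in \<open>lin_volume\<close>.\<close>
  also have "(\<Prod>j\<in>{1..k}. sqrt 2 ^ ns j * g (ns j)) = sqrt 2 ^ n * (\<Prod>j\<in>{1..k}. g (ns j))"
    by (simp add: prod.distrib assms(2) power_sum)
  finally have A: "(\<Prod>j\<in>{1..k}. abs_moment (ns j)) = ennreal (sqrt 2 ^ n * (\<Prod>j\<in>{1..k}. g (ns j)))" .
  have P: "(\<Prod>j\<in>{1..k}. g (ns j)) > 0" using g by (intro prod_pos) auto
  have "expected_roots M k ns n \<delta> F = ennreal (s * (sqrt 2 ^ n * g n)) / ennreal (sqrt 2 ^ n * (\<Prod>j\<in>{1..k}. g (ns j)))"
    unfolding expected_roots_eq(1)[OF assms(2,3,5)] lv A ..
  also have "\<dots> = ennreal (s * g n / (\<Prod>j\<in>{1..k}. g (ns j)))"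
    using s g[of n] P by (subst divide_ennreal) auto
  also have "s * g n / (\<Prod>j\<in>{1..k}. g (ns j)) = g n * (\<Prod>j\<in>{1..k}. 1 / g (ns j)) * s"
    by (simp add: prod_dividef)
  finally show ?thesis by (simp add: g_def s_def mult.assoc)
qed

end
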